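(* Let $P\in\mathbb{C}[\xi_1,\ldots,\xi_d]$ be a polynomial which acts along a subspace $W$ of $\mathbb{R}^d$ and is elliptic on $W$. Let $X,Y\subseteq\mathbb{R}^d$ be open with $Y\subseteq X$ such that $X$ is $P$-convex for supports. Suppose that there is no $x\in\mathbb{R}^d$ such that $X$ contains a compact connected component of $(\mathbb{R}^d\setminus Y)\cap(x+W)$. Then $Y$ is $P$-convex for supports and both restriction maps $r_{\mathscr{E}}^P:\mathscr{E}_P(X)\to\mathscr{E}_P(Y)$, $f\mapsto f_{|Y}$, and $r_{\mathscr{D}'}^P:\mathscr{D}'_P(X)\to\mathscr{D}'_P(Y)$, $f\mapsto f_{|Y}$, have dense range.
   Context: For a polynomial $P\in\mathbb{C}[\xi_1,\ldots,\xi_d]$ of degree $m$ with principal part $P_m$, $P(D)=P(-i\frac{\partial}{\partial x_1},\ldots,-i\frac{\partial}{\partial x_d})$ and $\check{P}(\xi)=P(-\xi)$. $P$ acts along a subspace $W\subseteq\mathbb{R}^d$ if $P(\xi)=P(\pi_W\xi)$ for all $\xi\in\mathbb{R}^d$, where $\pi_W$ is the orthogonal projection onto $W$; such a $P$ is elliptic on $W$ if $P_m(\xi)\neq0$ for every $\xi\in W\setminus\{0\}$. An open set $X\subseteq\mathbb{R}^d$ is $P$-convex for supports if for every compact $K\subseteq X$ there is a compact $L\subseteq X$ such that for all $f\in\mathscr{E}'(X)$ (distributions with compact support in $X$): $\operatorname{supp}\check{P}(D)f\subseteq K$ implies $\operatorname{supp}f\subseteq L$. $\mathscr{E}(X)$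 is the space of smooth functions on $X$ with its Fréchet topology given by the seminorms $\|f\|_{K,r}=\sup_{x\in K,|\alpha|\leq r}|\partial^\alpha f(x)|$ ($K\subseteq X$ compact, $r\in\mathbb{N}_0$); $\mathscr{D}'(X)$ is the space of distributions on $X$ with its strong dual topology. $\mathscr{E}_P(X)=\{f\in\mathscr{E}(X):P(D)f=0\}$ and $\mathscr{D}'_P(X)=\{f\in\mathscr{D}'(X):P(D)f=0\}$ carry the subspace topologies. *)

theory Defs
  imports "HOL-Analysis.Analysis" "HOL-Library.Poly_Mapping"
begin

section \<open>Polynomials in the coordinates of $\mathbb{R}^d$\<close>

text \<open>
  Multi-indices are elements of \<^typ>\<open>nat ^ 'd\<close>, and a polynomial is the finitely supported
  family of its coefficients.
\<close>

type_synonym 'd mpoly = "(nat ^ 'd) \<Rightarrow>\<^sub>0 complex"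

definition mi_size :: "nat ^ 'd::finite \<Rightarrow> nat"
  where "mi_size \<alpha> = (\<Sum>j\<in>UNIV. \<alpha> $ j)"

definition mpoly_eval :: "'d::finite mpoly \<Rightarrow> real ^ 'd \<Rightarrow> complex" where
  "mpoly_eval P \<xi> =
     (\<Sum>\<alpha>\<in>Poly_Mapping.keys P. Poly_Mapping.lookup P \<alpha> * (\<Prod>j\<in>UNIV. complex_of_real (\<xi> $ j) ^ (\<alpha> $ j)))"

text \<open>The zero polynomial gets degree 0 here and has principal part 0.\<close>

definition mpoly_degree :: "'d::finite mpoly \<Rightarrow> nat"
  where "mpoly_degree P = Max (insert 0 (mi_size ` Poly_Mapping.keys P))"

definition principal_part :: "'d::finite mpoly \<Rightarrow> 'd mpoly" where
  "principal_part P = Poly_Mapping.mapp (\<lambda>\<alpha> c. c when mi_size \<alpha> = mpoly_degree P) P"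

text \<open>The polynomial $\check P(\xi) = P(-\xi)$; see \<open>mpoly_eval_reflect\<close> below.\<close>

definition mpoly_reflect :: "'d::finite mpoly \<Rightarrow> 'd mpoly" where
  "mpoly_reflect P = Poly_Mapping.mapp (\<lambda>\<alpha> c. (-1) ^ mi_size \<alpha> * c) P"

lemma keys_mpoly_reflect: "Poly_Mapping.keys (mpoly_reflect P) = Poly_Mapping.keys P"
  by (auto simp: mpoly_reflect_def lookup_mapp in_keys_iff)

lemma mpoly_eval_reflect: "mpoly_eval (mpoly_reflect P) \<xi> = mpoly_eval P (- \<xi>)"
proof -
  have "(\<Prod>j\<in>UNIV. complex_of_real ((- \<xi>) $ j) ^ (\<alpha> $ j)) =
        (-1) ^ mi_size \<alpha> * (\<Prod>j\<in>UNIV. complex_of_real (\<xi> $ j) ^ (\<alpha> $ j))" for \<alpha>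
    by (simp add: mi_size_def power_minus[of "complex_of_real _"] prod.distrib power_sum)
  then show ?thesis
    unfolding mpoly_eval_def keys_mpoly_reflect
    by (intro sum.cong refl) (simp add: mpoly_reflect_def lookup_mapp in_keys_iff)
qed

definition orth_proj :: "(real ^ 'd::finite) set \<Rightarrow> real ^ 'd \<Rightarrow> real ^ 'd" where
  "orth_proj W \<xi> = (THE \<eta>. \<eta> \<in> W \<and> (\<forall>w\<in>W. orthogonal (\<xi> - \<eta>) w))"

lemma orth_proj:
  assumes "subspace W"
  shows "orth_proj W \<xi> \<in> W \<and> (\<forall>w\<in>W. orthogonal (\<xi> - orth_proj W \<xi>) w)"
  unfolding orth_proj_def
proof (rule theI')
  obtain y z where "y \<in> span W" "\<And>w. w \<in> span W \<Longrightarrow> orthogonal z w" "\<xi> = y + z"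
    using orthogonal_subspace_decomp_exists[of W \<xi>] by metis
  then have "y \<in> W \<and> (\<forall>w\<in>W. orthogonal (\<xi> - y) w)"
    using assms by (auto simp: span_base span_eq_iff[THEN iffD2])
  moreover have "v = y"
    if v: "v \<in> W \<and> (\<forall>w\<in>W. orthogonal (\<xi> - v) w)"
      and y: "y \<in> W \<and> (\<forall>w\<in>W. orthogonal (\<xi> - y) w)" for v y
  proof -
    have "v - y \<in> W" using v y assms by (simp add: subspace_diff)
    then have "(\<xi> - y) \<bullet> (v - y) - (\<xi> - v) \<bullet> (v - y) = 0"
      using v y by (simp add: orthogonal_def)
    then show ?thesis by (simp flip: inner_diff_left)
  qed
  ultimately show "\<exists>!y. y \<in> W \<and> (\<forall>w\<in>W. orthogonal (\<xi> - y) w)" by blast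
qed

definition acts_along :: "'d::finite mpoly \<Rightarrow> (real ^ 'd) set \<Rightarrow> bool" where
  "acts_along P W \<longleftrightarrow> (\<forall>\<xi>. mpoly_eval P \<xi> = mpoly_eval P (orth_proj W \<xi>))"

definition elliptic_on :: "'d::finite mpoly \<Rightarrow> (real ^ 'd) set \<Rightarrow> bool" where
  "elliptic_on P W \<longleftrightarrow> (\<forall>\<xi>\<in>W - {0}. mpoly_eval (principal_part P) \<xi> \<noteq> 0)"


section \<open>Derivatives and the space of smooth functions\<close>

definition partial_deriv :: "'d::finite \<Rightarrow> (real ^ 'd \<Rightarrow> complex) \<Rightarrow> real ^ 'd \<Rightarrow> complex" where
  "partial_deriv j f x = vector_derivative (\<lambda>t. f (x + t *\<^sub>R axis j 1)) (at 0)"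

text \<open>
  The type \<^typ>\<open>'d\<close> carries no order, so the order of differentiation in $\partial^\alpha$ is
  fixed by an arbitrary enumeration of the coordinates. It is irrelevant for smooth functions.
\<close>

definition coords :: "'d::finite list"
  where "coords = (SOME js. distinct js \<and> set js = UNIV)"

definition multi_deriv ::
    "nat ^ 'd::finite \<Rightarrow> (real ^ 'd \<Rightarrow> complex) \<Rightarrow> real ^ 'd \<Rightarrow> complex" where
  "multi_deriv \<alpha> f = foldr (\<lambda>j. partial_deriv j ^^ (\<alpha> $ j)) coords f"

primrec C_on :: "nat \<Rightarrow> (real ^ 'd::finite) set \<Rightarrow> (real ^ 'd \<Rightarrow> complex) \<Rightarrow> bool" where
  "C_on 0 X f \<longleftrightarrow> continuous_on X f"
| "C_on (Suc k) X f \<longleftrightarrow> continuous_on X f \<and>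
     (\<forall>j. (\<forall>x\<in>X. (\<lambda>t. f (x + t *\<^sub>R axis j 1)) differentiable at 0) \<and>
          C_on k X (partial_deriv j f))"

text \<open>
  The space $\mathscr{E}(X)$ for open \<open>X\<close>. Functions on \<open>X\<close> are total functions that are
  \<^const>\<open>undefined\<close> off \<open>X\<close>. On an open set all derivatives are determined by the values on
  that set.
\<close>

definition smooth_funs :: "(real ^ 'd::finite) set \<Rightarrow> (real ^ 'd \<Rightarrow> complex) set"
  where "smooth_funs X = {f \<in> extensional X. \<forall>k. C_on k X f}"

text \<open>Inserting 0 only matters for empty \<open>K\<close>: the supremum of the empty set of reals is unspecified.\<close>

definition smooth_seminorm ::
    "(real ^ 'd::finite) set \<Rightarrow> nat \<Rightarrow> (real ^ 'd \<Rightarrow> complex) \<Rightarrow> real" where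
  "smooth_seminorm K r f =
     Sup (insert 0 {cmod (multi_deriv \<alpha> f x) |\<alpha> x. x \<in> K \<and> mi_size \<alpha> \<le> r})"

definition smooth_topology :: "(real ^ 'd::finite) set \<Rightarrow> (real ^ 'd \<Rightarrow> complex) topology" where
  "smooth_topology X = topology_generated_by
     {{g \<in> smooth_funs X. smooth_seminorm K r (\<lambda>x. g x - f x) < e} |f K r e.
        f \<in> smooth_funs X \<and> compact K \<and> K \<subseteq> X \<and> e > 0}"

definition diff_op :: "'d::finite mpoly \<Rightarrow> (real ^ 'd \<Rightarrow> complex) \<Rightarrow> real ^ 'd \<Rightarrow> complex" where
  "diff_op P f x =
     (\<Sum>\<alpha>\<in>Poly_Mapping.keys P. Poly_Mapping.lookup P \<alpha> * (- \<i>) ^ mi_size \<alpha> * multi_deriv \<alpha> f x)"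

definition smooth_kernel :: "'d::finite mpoly \<Rightarrow> (real ^ 'd) set \<Rightarrow> (real ^ 'd \<Rightarrow> complex) set"
  where "smooth_kernel P X = {f \<in> smooth_funs X. \<forall>x\<in>X. diff_op P f x = 0}"


section \<open>Distributions\<close>

definition fun_support :: "(real ^ 'd::finite \<Rightarrow> complex) \<Rightarrow> (real ^ 'd) set"
  where "fun_support \<phi> = closure {x. \<phi> x \<noteq> 0}"

text \<open>Test functions on \<open>X\<close> are extended by 0, so that $\mathscr{D}(Y) \subseteq \mathscr{D}(X)$ for $Y \subseteq X$.\<close>

definition test_funs :: "(real ^ 'd::finite) set \<Rightarrow> (real ^ 'd \<Rightarrow> complex) set" where
  "test_funs X = {\<phi>. (\<forall>k. C_on k UNIV \<phi>) \<and> compact (fun_support \<phi>) \<and> fun_support \<phi> \<subseteq> X}"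

text \<open>
  The continuous seminorms of the usual inductive limit topology on $\mathscr{D}(X)$, the finest
  locally convex topology for which the inclusions of the Fr\'echet spaces $\mathscr{D}_K$,
  \<open>K\<close> compact in \<open>X\<close>, are continuous.
\<close>

definition continuous_test_seminorm ::
    "(real ^ 'd::finite) set \<Rightarrow> ((real ^ 'd \<Rightarrow> complex) \<Rightarrow> real) \<Rightarrow> bool" where
  "continuous_test_seminorm X p \<longleftrightarrow>
     (\<forall>\<phi>\<in>test_funs X. \<forall>\<psi>\<in>test_funs X. p (\<lambda>x. \<phi> x + \<psi> x) \<le> p \<phi> + p \<psi>) \<and>
     (\<forall>\<phi>\<in>test_funs X. \<forall>c. p (\<lambda>x. c * \<phi> x) = cmod c * p \<phi>) \<and>
     (\<forall>K. compact K \<and> K \<subseteq> X \<longrightarrow>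
        (\<exists>C r. \<forall>\<phi>\<in>test_funs X. fun_support \<phi> \<subseteq> K \<longrightarrow> p \<phi> \<le> C * smooth_seminorm K r \<phi>))"

definition bounded_test_set ::
    "(real ^ 'd::finite) set \<Rightarrow> (real ^ 'd \<Rightarrow> complex) set \<Rightarrow> bool" where
  "bounded_test_set X B \<longleftrightarrow>
     B \<subseteq> test_funs X \<and> (\<forall>p. continuous_test_seminorm X p \<longrightarrow> (\<exists>M. \<forall>\<phi>\<in>B. p \<phi> \<le> M))"

definition distributions ::
    "(real ^ 'd::finite) set \<Rightarrow> ((real ^ 'd \<Rightarrow> complex) \<Rightarrow> complex) set" where
  "distributions X = {u \<in> extensional (test_funs X).
     (\<forall>\<phi>\<in>test_funs X. \<forall>\<psi>\<in>test_funs X. u (\<lambda>x. \<phi> x + \<psi> x) = u \<phi> + u \<psi>) \<and>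
     (\<forall>\<phi>\<in>test_funs X. \<forall>c. u (\<lambda>x. c * \<phi> x) = c * u \<phi>) \<and>
     (\<forall>K. compact K \<and> K \<subseteq> X \<longrightarrow>
        (\<exists>C r. \<forall>\<phi>\<in>test_funs X. fun_support \<phi> \<subseteq> K \<longrightarrow> cmod (u \<phi>) \<le> C * smooth_seminorm K r \<phi>))}"

definition strong_seminorm ::
    "(real ^ 'd::finite \<Rightarrow> complex) set \<Rightarrow> ((real ^ 'd \<Rightarrow> complex) \<Rightarrow> complex) \<Rightarrow> real" where
  "strong_seminorm B u = Sup (insert 0 {cmod (u \<phi>) |\<phi>. \<phi> \<in> B})"

definition strong_topology ::
    "(real ^ 'd::finite) set \<Rightarrow> ((real ^ 'd \<Rightarrow> complex) \<Rightarrow> complex) topology" where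
  "strong_topology X = topology_generated_by
     {{v \<in> distributions X. strong_seminorm B (\<lambda>\<phi>. v \<phi> - u \<phi>) < e} |u B e.
        u \<in> distributions X \<and> bounded_test_set X B \<and> e > 0}"

definition dist_multi_deriv ::
    "(real ^ 'd::finite) set \<Rightarrow> nat ^ 'd \<Rightarrow>
     ((real ^ 'd \<Rightarrow> complex) \<Rightarrow> complex) \<Rightarrow> (real ^ 'd \<Rightarrow> complex) \<Rightarrow> complex" where
  "dist_multi_deriv X \<alpha> u = (\<lambda>\<phi>\<in>test_funs X. (-1) ^ mi_size \<alpha> * u (multi_deriv \<alpha> \<phi>))"

definition dist_diff_op ::
    "(real ^ 'd::finite) set \<Rightarrow> 'd mpoly \<Rightarrow>
     ((real ^ 'd \<Rightarrow> complex) \<Rightarrow> complex) \<Rightarrow> (real ^ 'd \<Rightarrow> complex) \<Rightarrow> complex" where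
  "dist_diff_op X P u = (\<lambda>\<phi>\<in>test_funs X.
     \<Sum>\<alpha>\<in>Poly_Mapping.keys P. Poly_Mapping.lookup P \<alpha> * (- \<i>) ^ mi_size \<alpha> * dist_multi_deriv X \<alpha> u \<phi>)"

definition dist_kernel ::
    "'d::finite mpoly \<Rightarrow> (real ^ 'd) set \<Rightarrow> ((real ^ 'd \<Rightarrow> complex) \<Rightarrow> complex) set" where
  "dist_kernel P X = {u \<in> distributions X. \<forall>\<phi>\<in>test_funs X. dist_diff_op X P u \<phi> = 0}"

definition dist_support ::
    "(real ^ 'd::finite) set \<Rightarrow> ((real ^ 'd \<Rightarrow> complex) \<Rightarrow> complex) \<Rightarrow> (real ^ 'd) set" where
  "dist_support X u = X - \<Union>{U. open U \<and> U \<subseteq> X \<and> (\<forall>\<phi>\<in>test_funs U. u \<phi> = 0)}"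

definition compact_distributions ::
    "(real ^ 'd::finite) set \<Rightarrow> ((real ^ 'd \<Rightarrow> complex) \<Rightarrow> complex) set" where
  "compact_distributions X = {u \<in> distributions X. compact (dist_support X u)}"

definition P_convex_for_supports :: "'d::finite mpoly \<Rightarrow> (real ^ 'd) set \<Rightarrow> bool" where
  "P_convex_for_supports P X \<longleftrightarrow>
     (\<forall>K. compact K \<and> K \<subseteq> X \<longrightarrow>
        (\<exists>L. compact L \<and> L \<subseteq> X \<and>
           (\<forall>f\<in>compact_distributions X.
              dist_support X (dist_diff_op X (mpoly_reflect P) f) \<subseteq> K \<longrightarrow> dist_support X f \<subseteq> L)))"


section \<open>Dense range\<close>

definition dense_range :: "'a topology \<Rightarrow> 'b topology \<Rightarrow> ('a \<Rightarrow> 'b) \<Rightarrow> bool" where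
  "dense_range S T r \<longleftrightarrow>
     r ` topspace S \<subseteq> topspace T \<and> T closure_of (r ` topspace S) = topspace T"

definition smooth_kernel_topology ::
    "'d::finite mpoly \<Rightarrow> (real ^ 'd) set \<Rightarrow> (real ^ 'd \<Rightarrow> complex) topology"
  where "smooth_kernel_topology P X = subtopology (smooth_topology X) (smooth_kernel P X)"

definition dist_kernel_topology ::
    "'d::finite mpoly \<Rightarrow> (real ^ 'd) set \<Rightarrow> ((real ^ 'd \<Rightarrow> complex) \<Rightarrow> complex) topology"
  where "dist_kernel_topology P X = subtopology (strong_topology X) (dist_kernel P X)"

lemma multi_deriv_zero [simp]: "multi_deriv \<alpha> (\<lambda>x. 0) = (\<lambda>x. 0)"
proof -
  have "(partial_deriv j ^^ k) (\<lambda>x. 0) = (\<lambda>x. 0)" for j :: 'a and k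
    by (induction k) (auto simp: partial_deriv_def fun_eq_iff)
  then have "foldr (\<lambda>j. partial_deriv j ^^ (\<alpha> $ j)) js (\<lambda>x. 0) = (\<lambda>x. 0)" for js
    by (induction js) auto
  then show ?thesis by (simp add: multi_deriv_def)
qed

lemma smooth_seminorm_zero [simp]: "smooth_seminorm K r (\<lambda>x. 0) = 0"
proof -
  have "insert 0 {cmod (multi_deriv \<alpha> (\<lambda>x. 0) x) |\<alpha> x. x \<in> K \<and> mi_size \<alpha> \<le> r} = {0}"
    by auto
  then show ?thesis unfolding smooth_seminorm_def by (metis cSup_singleton)
qed

lemma topspace_smooth_kernel_topology: "topspace (smooth_kernel_topology P X) = smooth_kernel P X"
proof -
  have "topspace (smooth_topology X) = smooth_funs X"
  proof
    show "smooth_funs X \<subseteq> topspace (smooth_topology X)"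
    proof
      fix f assume f: "f \<in> smooth_funs X"
      have "{g \<in> smooth_funs X. smooth_seminorm {} 0 (\<lambda>x. g x - f x) < 1} \<in>
          {{g \<in> smooth_funs X. smooth_seminorm K r (\<lambda>x. g x - f x) < e} |f K r e.
             f \<in> smooth_funs X \<and> compact K \<and> K \<subseteq> X \<and> e > 0}"
        using f zero_less_one compact_empty empty_subsetI[of X] by blast
      moreover have "f \<in> {g \<in> smooth_funs X. smooth_seminorm {} 0 (\<lambda>x. g x - f x) < 1}"
        using f by simp
      ultimately show "f \<in> topspace (smooth_topology X)"
        unfolding smooth_topology_def topology_generated_by_topspace by (rule UnionI)
    qed
  qed (auto simp: smooth_topology_def)
  then show ?thesis
    by (auto simp: smooth_kernel_topology_def smooth_kernel_def)
qed

lemma topspace_dist_kernel_topology: "topspace (dist_kernel_topology P X) = dist_kernel P X"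
proof -
  have "topspace (strong_topology X) = distributions X"
  proof
    show "distributions X \<subseteq> topspace (strong_topology X)"
    proof
      fix u assume u: "u \<in> distributions X"
      have "bounded_test_set X {}" by (simp add: bounded_test_set_def)
      then have "{v \<in> distributions X. strong_seminorm {} (\<lambda>\<phi>. v \<phi> - u \<phi>) < 1} \<in>
          {{v \<in> distributions X. strong_seminorm B (\<lambda>\<phi>. v \<phi> - u \<phi>) < e} |u B e.
             u \<in> distributions X \<and> bounded_test_set X B \<and> e > 0}"
        using u zero_less_one by blast
      moreover have "u \<in> {v \<in> distributions X. strong_seminorm {} (\<lambda>\<phi>. v \<phi> - u \<phi>) < 1}"
        using u by (simp add: strong_seminorm_def)
      ultimately show "u \<in> topspace (strong_topology X)"
        unfolding strong_topology_def topology_generated_by_topspace by (rule UnionI)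
    qed
  qed (auto simp: strong_topology_def)
  then show ?thesis
    by (auto simp: dist_kernel_topology_def dist_kernel_def)
qed

end

theory Submission
  imports Defs "HOL-Probability.Characteristic_Functions"
begin

text \<open>
 Write \<open>Q\<close> for the reflected polynomial. If \<open>f\<close> is a distribution with compact support and \<open>Q(D)f\<close>
 is supported in \<open>K\<close>, then mollifications of \<open>f\<close> are analytic along \<open>W\<close> off a neighbourhood of
 \<open>K\<close>, so zeros propagate along paths in \<open>x + W\<close> that avoid \<open>K\<close>. Together with the absence of compact
 components of \<open>(UNIV - Y) \<inter> (x + W)\<close> inside \<open>X\<close>, this keeps the support of \<open>f\<close> in a compact
 subset \<open>L\<close> of \<open>Y\<close> that depends only on \<open>K\<close>, and gives convexity of \<open>Y\<close>. For density, a solution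
 near \<open>L\<close> is approximated in the mean square on \<open>K\<close> by solutions on larger and larger compact
 subsets of \<open>X\<close>: by duality and a coercivity estimate for \<open>Q(D)\<close> the only obstruction would be a
 distribution \<open>f\<close> as above whose support is not in \<open>L\<close>. A Mittag-Leffler argument yields solutions
 on \<open>X\<close>, and mollification reduces the case of distributions to that of smooth functions.
\<close>

text \<open>Estimates are therefore made for mollified functions, with constants that do not depend
  on the function: the radius in \<open>zero_propagation\<close> serves all mollifications of
  \<open>f\<close> at once. Analyticity comes from L2 estimates on cylinders that are infinite
  across \<open>W\<close>; locality is restored afterwards by cutoffs that are constant along
  \<open>W\<close>, since multiplication by these commutes with \<open>P(D)\<close>. Coercivity, in
  contrast, uses no ellipticity: one point where the principal part does not vanish is enough. The
  duality takes place in a Hilbert space, where orthogonal projection replaces the Hahn-Banach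
  theorem. The hull \<open>L\<close> is formed for distributions on \<open>X\<close>, although
  \<open>K\<close> and \<open>L\<close> lie in \<open>Y\<close>: the functionals that could obstruct
  density may a priori have their support anywhere in \<open>X\<close>, while for the convexity of
  \<open>Y\<close> distributions on \<open>Y\<close> are simply extended by zero.\<close>

abbreviation (input) "cr == complex_of_real"
abbreviation (input) "supp == fun_support"
abbreviation (input) "sn == smooth_seminorm"
abbreviation (input) "tf == test_funs"
abbreviation (input) "rfl == mpoly_reflect"
abbreviation (input) "dsupp == dist_support"
abbreviation (input) "coef == Poly_Mapping.lookup"
abbreviation (input) "keys == Poly_Mapping.keys"
abbreviation (input) "deg == mpoly_degree"
abbreviation (input) "cdist == compact_distributions"
abbreviation (input) "ddo == dist_diff_op"
abbreviation (input) lint :: "('a::euclidean_space => 'b::{banach, second_countable_topology}) => 'b" (binder "LI " 10)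
 where "lint f == integral\<^sup>L lborel f"
abbreviation (input) "pd == partial_deriv"
abbreviation (input) "ax j == axis j (1::real)"
lemmas lint_mono = Bochner_Integration.integral_mono
lemmas cont_bm = borel_measurable_continuous_onI

section \<open>Smooth functions\<close>

definition smooth_on :: "(real ^ 'd::finite) set => (real ^ 'd => complex) => bool"
 where "smooth_on X f \<longleftrightarrow> (\<forall>k. C_on k X f)"

text \<open>A combination of partial derivatives, hence linear in \<open>v\<close> without any
  condition on \<open>f\<close>. Arbitrary directions occur because the coordinate axes need not be
  adapted to \<open>W\<close>.\<close>

definition dd :: "real ^ 'd::finite => (real ^ 'd => complex) => real ^ 'd => complex"
 where "dd v f x = (\<Sum>j\<in>UNIV. cr (v $ j) * pd j f x)"

text \<open>Lists of vectors take the place of multi-indices, so that derivatives along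
  \<open>W\<close> and along the axes share one calculus; for smooth functions the order of the list
  is immaterial by \<open>DL_perm\<close>.\<close>

definition DL :: "(real ^ 'd::finite) list => (real ^ 'd => complex) => real ^ 'd => complex"
 where "DL vs f = foldr dd vs f"

lemma DL_Nil [simp]: "DL [] f = f" and DL_Cons [simp]: "DL (v # vs) f = dd v (DL vs f)"
 and DL_append: "DL (vs @ ws) f = DL vs (DL ws f)"
 by (simp_all add: DL_def)

section \<open>Partial derivatives and functions of class C^k\<close>

lemma pd_cong:
 assumes "open X" "x \<in> X" "!!y. y \<in> X ==> f y = g y"
 shows "pd j f x = pd j g x"
proof -
 have "\<forall>\<^sub>F t in nhds 0. x + t *\<^sub>R ax j \<in> X"
 proof -
  have "((%t. x + t *\<^sub>R ax j) \<longlongrightarrow> x + 0 *\<^sub>R ax j) (nhds (0::real))"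
   by (intro tendsto_intros filterlim_ident)
  thus ?thesis
   using topological_tendstoD[OF _ assms(1)] assms(2) by auto
 qed
 thus ?thesis
  unfolding partial_deriv_def
  by (intro vector_derivative_cong_eq) (auto elim!: eventually_mono simp: assms(3))
qed

lemma C_on_imp_continuous: "C_on k X f ==> continuous_on X f"
 by (cases k) auto

lemma C_on_mono: "C_on (Suc k) X f ==> C_on k X f"
 by (induction k arbitrary: f) auto

lemma C_on_subset: "C_on k X f ==> Y <= X ==> C_on k Y f"
 by (induction k arbitrary: f) (auto intro: continuous_on_subset)

lemma C_on_cong:
 assumes "open X" "!!x. x \<in> X ==> f x = g x"
 shows "C_on k X f \<longleftrightarrow> C_on k X g"
proof -
 have *: "C_on k X g" if "C_on k X f" "!!x. x \<in> X ==> f x = g x" for f g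
  using that
 proof (induction k arbitrary: f g)
  case 0
  thus ?case using continuous_on_cong[of X X f g] by simp
 next
  case (Suc k)
  have "(%t. g (x + t *\<^sub>R ax j)) differentiable at 0" if x: "x \<in> X" for x j
  proof -
   have "((%t. x + t *\<^sub>R ax j) \<longlongrightarrow> x + 0 *\<^sub>R ax j) (nhds (0::real))"
    by (intro tendsto_intros filterlim_ident)
   hence "\<forall>\<^sub>F t in nhds 0. x + t *\<^sub>R ax j \<in> X"
    using topological_tendstoD[OF _ assms(1)] x by auto
   hence ev: "\<forall>\<^sub>F t in nhds 0. f (x + t *\<^sub>R ax j) = g (x + t *\<^sub>R ax j)"
    by (rule eventually_mono) (auto simp: Suc.prems)
   have "((%t. f (x + t *\<^sub>R ax j)) has_vector_derivative pd j f x) (at 0)"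
    unfolding partial_deriv_def using Suc.prems(1) x by (auto simp: vector_derivative_works[symmetric])
   hence "((%t. g (x + t *\<^sub>R ax j)) has_vector_derivative pd j f x) (at 0)"
    using has_vector_derivative_cong_ev[of UNIV "%t. f (x + t *\<^sub>R ax j)" "%t. g (x + t *\<^sub>R ax j)" 0]
     ev Suc.prems(2)[OF x] by simp
   thus ?thesis by (rule differentiableI_vector)
  qed
  moreover have "C_on k X (pd j g)" for j
  proof (rule Suc.IH[of "pd j f"])
   show "C_on k X (pd j f)" using Suc.prems(1) by simp
   show "pd j f x = pd j g x" if "x \<in> X" for x
    using pd_cong[OF assms(1) that Suc.prems(2)] by simp
  qed
  moreover have "continuous_on X g"
   using Suc.prems continuous_on_cong[of X X f g] by simp
  ultimately show ?case by simp
 qed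
 show ?thesis using *[of f g] *[of g f] assms(2) by auto
qed

lemma C_on_SucI:
 assumes "open X" "continuous_on X f"
  and "!!j x. x \<in> X ==> ((%t. f (x + t *\<^sub>R ax j)) has_vector_derivative g j x) (at 0)"
  and "!!j. C_on k X (g j)"
 shows "C_on (Suc k) X f"
proof -
 have "pd j f x = g j x" if "x \<in> X" for j x
  unfolding partial_deriv_def using assms(3)[OF that] by (rule vector_derivative_at)
 hence "C_on k X (pd j f)" for j
  using C_on_cong[OF assms(1), of "pd j f" "g j"] assms(4) by auto
 thus ?thesis using assms(2,3) by (auto intro: differentiableI_vector)
qed

lemma pd_eqI:
 "((%t. f (x + t *\<^sub>R ax j)) has_vector_derivative d) (at 0) ==> pd j f x = d"
 unfolding partial_deriv_def by (rule vector_derivative_at)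

lemma C_on_has_vector_derivative:
 assumes "C_on (Suc k) X f" "x + t *\<^sub>R ax j \<in> X"
 shows "((%s. f (x + s *\<^sub>R ax j)) has_vector_derivative pd j f (x + t *\<^sub>R ax j)) (at t within S)"
proof -
 define y where "y = x + t *\<^sub>R ax j"
 have eq: "y + (s - t) *\<^sub>R ax j = x + s *\<^sub>R ax j" for s
  by (simp add: y_def algebra_simps)
 have "((%s. f (y + s *\<^sub>R ax j)) has_vector_derivative pd j f y) (at (t - t))"
  unfolding partial_deriv_def using assms unfolding y_def by (auto simp: vector_derivative_works[symmetric])
 moreover have "((%s. s - t) has_vector_derivative 1) (at t)"
  by (auto intro!: derivative_eq_intros)
 ultimately have "((%s. f (y + s *\<^sub>R ax j)) \<circ> (%s. s - t) has_vector_derivative 1 *\<^sub>R pd j f y) (at t)"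
  by (intro vector_diff_chain_at) auto
 hence "((%s. f (x + s *\<^sub>R ax j)) has_vector_derivative pd j f y) (at t)"
  unfolding o_def eq by simp
 thus ?thesis
  unfolding y_def by (rule has_vector_derivative_at_within)
qed

lemma onorm_scaleR_left_le: "norm v <= e ==> onorm (%h::real. h *\<^sub>R v) <= e"
proof (rule onorm_bound)
 assume v: "norm v <= e"
 show "0 <= e" using norm_ge_zero v by (rule order_trans)
 show "norm (h *\<^sub>R v) <= e * norm h" for h :: real
  using mult_left_mono[OF v, of "\<bar>h\<bar>"] by (simp add: mult.commute)
qed

text \<open>The mean value inequality for \<open>g\<close> minus a linear function of slope
  \<open>c\<close>: the error of the linear approximation is bounded by the oscillation of the
  partial derivative.\<close>

lemma pd_mean_value:
 assumes "C_on (Suc k) X g" "!!n. n \<in> closed_segment 0 s ==> y + n *\<^sub>R ax i \<in> X"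
  and "!!n. n \<in> closed_segment 0 s ==> cmod (pd i g (y + n *\<^sub>R ax i) - c) <= e"
 shows "cmod (g (y + s *\<^sub>R ax i) - g y - cr s * c) <= e * \<bar>s\<bar>"
proof -
 let ?S = "closed_segment 0 s"
 have "norm ((g (y + s *\<^sub>R ax i) - s *\<^sub>R c) - (g (y + 0 *\<^sub>R ax i) - 0 *\<^sub>R c)) <= e * norm (s - 0)"
 proof (rule differentiable_bound[where S = ?S])
  fix n assume s: "n \<in> ?S"
  show "((%n. g (y + n *\<^sub>R ax i) - n *\<^sub>R c) has_derivative
    (%h. h *\<^sub>R (pd i g (y + n *\<^sub>R ax i) - c))) (at n within ?S)"
   using C_on_has_vector_derivative[OF assms(1) assms(2)[OF s], of ?S]
   unfolding has_vector_derivative_def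
   by (auto intro!: derivative_eq_intros simp: scaleR_diff_right)
  show "onorm (%h. h *\<^sub>R (pd i g (y + n *\<^sub>R ax i) - c)) <= e"
   by (rule onorm_scaleR_left_le[OF assms(3)[OF s]])
 qed auto
 thus ?thesis by (simp add: scaleR_conv_of_real algebra_simps)
qed

text \<open>The increment is walked one coordinate at a time, each leg being controlled by
  \<open>pd_mean_value\<close> and the continuity of the partial derivatives.\<close>

lemma has_deriv_pd:
 assumes "open X" "C_on (Suc 0) X f" "x \<in> X"
 shows "(f has_derivative (%h. dd h f x)) (at x)"
 unfolding has_derivative_at_alt
proof (intro conjI allI impI)
 show "bounded_linear (%h. dd h f x)"
  unfolding linear_conv_bounded_linear[symmetric] dd_def
  by (intro linearI) (simp_all add: distrib_right sum.distrib scaleR_sum_right scaleR_conv_of_real[where 'a=complex] sum_distrib_left mult.assoc)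
 fix e :: real assume e: "e > 0"
 define N where "N = real CARD('a)"
 define c where "c = (%j. pd j f x)"
 have N: "N > 0" by (simp add: N_def)
 have "\<exists>d>0. \<forall>y\<in>ball x d. y \<in> X & cmod (pd j f y - c j) <= e / N" for j
 proof -
  have "continuous_on X (pd j f)" using assms(2) by simp
  hence "isCont (pd j f) x"
   using assms(1,3) continuous_on_eq_continuous_at by blast
  then obtain d1 where d1: "d1 > 0" "!!y. dist y x < d1 ==> dist (pd j f y) (c j) < e / N"
   unfolding continuous_at_eps_delta c_def using e N by (meson divide_pos_pos)
  obtain d2 where d2: "d2 > 0" "ball x d2 <= X"
   using assms(1,3) openE by blast
  show ?thesis
  proof (rule exI[of _ "min d1 d2"], intro conjI ballI)
   fix y assume y: "y \<in> ball x (min d1 d2)"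
   thus "y \<in> X" using d2 by auto
   have "dist y x < d1" using y by (simp add: dist_commute)
   thus "cmod (pd j f y - c j) <= e / N" using d1(2)[of y] by (simp add: dist_norm)
  qed (use d1 d2 in auto)
 qed
 then obtain d where d: "!!j. d j > 0" "!!j y. y \<in> ball x (d j) ==> y \<in> X & cmod (pd j f y - c j) <= e / N"
  by metis
 define de where "de = Min (range d)"
 have de: "de > 0" "!!y j. y \<in> ball x de ==> y \<in> X" "!!y j. y \<in> ball x de ==> cmod (pd j f y - c j) <= e / N"
 proof -
  show "de > 0" unfolding de_def using d(1) by auto
  have le: "de <= d j" for j unfolding de_def by simp
  show "y \<in> X" if "y \<in> ball x de" for y
   using that le[of undefined] d(2)[of y undefined] by auto
  show "cmod (pd j f y - c j) <= e / N" if "y \<in> ball x de" for y j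
   using that le[of j] d(2)[of y j] by auto
 qed
 \<comment> \<open>Induction on the set \<open>S\<close> of coordinates in which the increment may
   be nonzero; every added coordinate contributes one error \<open>e / N\<close>, and there are
   \<open>N\<close> of them.\<close>
 have claim: "cmod (f (x + h) - f x - (\<Sum>j\<in>S. cr (h $ j) * c j)) <= real (card S) * (e / N) * norm h"
  if "norm h < de" "!!j. j \<notin> S ==> h $ j = 0" for S h
  using finite[of S] that
 proof (induction S arbitrary: h rule: finite_induct)
  case empty
  hence "h = 0" by (simp add: vec_eq_iff)
  thus ?case by simp
 next
  case (insert i S)
  define h' where "h' = h - (h $ i) *\<^sub>R ax i"
  have h'_nth: "h' $ j = (if j = i then 0 else h $ j)" for j
   by (auto simp: h'_def axis_def)
  have seg: "norm (h' + s *\<^sub>R ax i) <= norm h" if "s \<in> closed_segment 0 (h $ i)" for s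
  proof (rule norm_le_componentwise_cart)
   fix j show "norm ((h' + s *\<^sub>R ax i) $ j) <= norm (h $ j)"
    using that by (auto simp: h'_nth axis_def closed_segment_eq_real_ivl split: if_splits)
  qed
  have nh': "norm h' <= norm h" using seg[of 0] by simp
  have eqh: "h' + (h $ i) *\<^sub>R ax i = h" by (simp add: h'_def)
  have "cmod (f (x + h') - f x - (\<Sum>j\<in>S. cr (h' $ j) * c j)) <= real (card S) * (e / N) * norm h'"
   using insert.prems nh' h'_nth by (intro insert.IH) auto
  also have "... <= real (card S) * (e / N) * norm h"
   using nh' e N by (intro mult_left_mono) auto
  also have "(\<Sum>j\<in>S. cr (h' $ j) * c j) = (\<Sum>j\<in>S. cr (h $ j) * c j)"
   using insert.hyps by (intro sum.cong) (auto simp: h'_nth)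
  finally have 1: "cmod (f (x + h') - f x - (\<Sum>j\<in>S. cr (h $ j) * c j)) <= real (card S) * (e / N) * norm h" .
  have inb: "x + h' + s *\<^sub>R ax i \<in> ball x de" if "s \<in> closed_segment 0 (h $ i)" for s
  proof -
   have "norm (h' + s *\<^sub>R ax i) < de" using seg[OF that] insert.prems(1) by simp
   thus ?thesis
    by (simp add: dist_norm add.assoc) (metis norm_minus_commute minus_add_distrib add.commute uminus_add_conv_diff norm_minus_cancel)
  qed
  have "cmod (f ((x + h') + (h $ i) *\<^sub>R ax i) - f (x + h') - cr (h $ i) * c i) <= e / N * \<bar>h $ i\<bar>"
   using inb by (intro pd_mean_value[OF assms(2)] de(2,3))
  also have "... <= e / N * norm h"
   using e N component_le_norm_cart[of h i] by (intro mult_left_mono) auto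
  finally have 2: "cmod (f (x + h) - f (x + h') - cr (h $ i) * c i) <= e / N * norm h"
   by (simp add: eqh add.assoc)
  have "cmod (f (x + h) - f x - (\<Sum>j\<in>insert i S. cr (h $ j) * c j)) <=
    cmod (f (x + h') - f x - (\<Sum>j\<in>S. cr (h $ j) * c j)) + cmod (f (x + h) - f (x + h') - cr (h $ i) * c i)"
   using insert.hyps by (intro order_trans[OF _ norm_triangle_ineq]) (simp add: algebra_simps)
  also have "... <= real (card S) * (e / N) * norm h + e / N * norm h" using 1 2 by linarith
  also have "... = real (card (insert i S)) * (e / N) * norm h"
   using insert.hyps by (simp add: algebra_simps)
  finally show ?case .
 qed
 show "\<exists>da>0. \<forall>y. norm (y - x) < da --> norm (f y - f x - dd (y - x) f x) <= e * norm (y - x)"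
 proof (intro exI[of _ de] conjI allI impI de)
  fix y assume "norm (y - x) < de"
  hence "cmod (f (x + (y - x)) - f x - (\<Sum>j\<in>UNIV. cr ((y - x) $ j) * c j)) <= real (card (UNIV::'a set)) * (e / N) * norm (y - x)"
   by (intro claim) auto
  thus "norm (f y - f x - dd (y - x) f x) <= e * norm (y - x)"
   using N by (simp add: dd_def c_def N_def)
 qed
qed

lemma has_derivative_imp_dd:
 assumes "(f has_derivative f') (at x)"
 shows "pd j f x = f' (ax j)" "dd v f x = f' v"
proof -
 show *: "pd j f x = f' (ax j)" for j
 proof (rule pd_eqI)
  have g: "((%t. x + t *\<^sub>R ax j) has_derivative (%t. t *\<^sub>R ax j)) (at (0::real))"
   by (auto intro!: derivative_eq_intros)
  have f: "(f has_derivative f') (at ((%t. x + t *\<^sub>R ax j) 0))" using assms by simp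
  have "((%t. f (x + t *\<^sub>R ax j)) has_derivative (%t. f' (t *\<^sub>R ax j))) (at 0)"
   by (rule has_derivative_compose[OF g f])
  thus "((%t. f (x + t *\<^sub>R ax j)) has_vector_derivative f' (ax j)) (at 0)"
   unfolding has_vector_derivative_def
   using linear_scale[OF has_derivative_linear[OF assms]] by simp
 qed
 have "f' v = f' (\<Sum>j\<in>UNIV. v $ j *\<^sub>R ax j)"
  by (simp add: basis_expansion scalar_mult_eq_scaleR[symmetric])
 also have "... = (\<Sum>j\<in>UNIV. v $ j *\<^sub>R f' (ax j))"
  by (simp add: linear_sum[OF has_derivative_linear[OF assms]] linear_scale[OF has_derivative_linear[OF assms]])
 finally show "dd v f x = f' v"
  by (simp add: dd_def * scaleR_conv_of_real)
qed

text \<open>Schwarz's theorem: the second difference of \<open>f\<close> over a square of side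
  \<open>s\<close>, divided by \<open>s * s\<close>, tends to the mixed derivative, and it is
  symmetric in \<open>i\<close> and \<open>j\<close>.\<close>

lemma pd_commute:
 assumes "open X" "C_on (Suc (Suc 0)) X f" "x \<in> X"
 shows "pd i (pd j f) x = pd j (pd i f) x"
proof -
 let ?c = "%i j. pd i (pd j f) x"
 have *: "\<exists>d>0. \<forall>s. 0 < s & s < d --> cmod (f (x + s *\<^sub>R ax i + s *\<^sub>R ax j) - f (x + s *\<^sub>R ax i) - f (x + s *\<^sub>R ax j) + f x
   - cr (s * s) * ?c i j) <= e * (s * s)" if e: "e > 0" for e i j
 proof -
  have "continuous_on X (pd i (pd j f))" using assms(2) by simp
  hence "isCont (pd i (pd j f)) x"
   using assms(1,3) continuous_on_eq_continuous_at by blast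
  then obtain d1 where d1: "d1 > 0" "!!y. dist y x < d1 ==> dist (pd i (pd j f) y) (?c i j) < e"
   unfolding continuous_at_eps_delta using e by meson
  obtain d2 where d2: "d2 > 0" "ball x d2 <= X"
   using assms(1,3) openE by blast
  define d where "d = min d1 d2 / 2"
  have d: "d > 0" using d1 d2 by (simp add: d_def)
  have nb: "x + a *\<^sub>R ax i + b *\<^sub>R ax j \<in> X"
       "cmod (pd i (pd j f) (x + a *\<^sub>R ax i + b *\<^sub>R ax j) - ?c i j) <= e"
   if "0 <= a" "0 <= b" "a < d" "b < d" for a b
  proof -
   have "norm (a *\<^sub>R ax i + b *\<^sub>R ax j :: real^'a) <= norm (a *\<^sub>R ax i :: real^'a) + norm (b *\<^sub>R ax j :: real^'a)"
    by (rule norm_triangle_ineq)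
   also have "... < min d1 d2" using that by (simp add: d_def)
   finally have n: "norm (a *\<^sub>R ax i + b *\<^sub>R ax j :: real^'a) < min d1 d2" .
   have ds: "dist (x + a *\<^sub>R ax i + b *\<^sub>R ax j) x < min d1 d2"
    using n by (simp add: dist_norm add.assoc)
   hence "x + a *\<^sub>R ax i + b *\<^sub>R ax j \<in> ball x d2" by (simp add: dist_commute)
   thus "x + a *\<^sub>R ax i + b *\<^sub>R ax j \<in> X" using d2(2) by blast
   have "dist (x + a *\<^sub>R ax i + b *\<^sub>R ax j) x < d1" using ds by simp
   from d1(2)[OF this] show "cmod (pd i (pd j f) (x + a *\<^sub>R ax i + b *\<^sub>R ax j) - ?c i j) <= e"
    by (simp add: dist_norm)
  qed
  show ?thesis
  proof (intro exI[of _ d] conjI d allI impI)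
   fix s :: real assume s: "0 < s & s < d"
   define g where "g = (%z. f (z + s *\<^sub>R ax i) - f z)"
   have Cj: "C_on (Suc 0) X (pd j f)" and C1: "C_on (Suc 0) X f"
    using assms(2) C_on_mono by auto
   \<comment> \<open>The first difference in direction \<open>i\<close>, taken of
     \<open>pd j f\<close>; a second mean value argument, in direction \<open>j\<close>, turns this
     into a bound for the second difference of \<open>f\<close>.\<close>
   have inner: "cmod (pd j f (x + b *\<^sub>R ax j + s *\<^sub>R ax i) - pd j f (x + b *\<^sub>R ax j) - cr s * ?c i j) <= e * s"
    if b: "0 <= b" "b < d" for b
   proof -
    have eq: "x + b *\<^sub>R ax j + s' *\<^sub>R ax i = x + s' *\<^sub>R ax i + b *\<^sub>R ax j" for s'
     by simp
    have "cmod (pd j f (x + b *\<^sub>R ax j + s *\<^sub>R ax i) - pd j f (x + b *\<^sub>R ax j) - cr s * ?c i j) <= e * \<bar>s\<bar>"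
    proof (rule pd_mean_value[OF Cj])
     fix s' assume "s' \<in> closed_segment 0 s"
     hence s': "0 <= s'" "s' < d" using s by (auto simp: closed_segment_eq_real_ivl)
     show "x + b *\<^sub>R ax j + s' *\<^sub>R ax i \<in> X"
      unfolding eq by (rule nb(1)[OF s'(1) b(1) s'(2) b(2)])
     show "cmod (pd i (pd j f) (x + b *\<^sub>R ax j + s' *\<^sub>R ax i) - ?c i j) <= e"
      unfolding eq by (rule nb(2)[OF s'(1) b(1) s'(2) b(2)])
    qed
    thus ?thesis using s by simp
   qed
   have "norm ((f (x + s *\<^sub>R ax i + s *\<^sub>R ax j) - f (x + s *\<^sub>R ax j) - s *\<^sub>R (cr s * ?c i j))
     - (f (x + s *\<^sub>R ax i + 0 *\<^sub>R ax j) - f (x + 0 *\<^sub>R ax j) - 0 *\<^sub>R (cr s * ?c i j))) <= (e * s) * norm (s - 0)"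
   proof (rule differentiable_bound[where S = "{0..s}" and f' = "%t h. h *\<^sub>R
     (pd j f (x + s *\<^sub>R ax i + t *\<^sub>R ax j) - pd j f (x + t *\<^sub>R ax j) - cr s * ?c i j)"])
    fix t assume t: "t \<in> {0..s}"
    have 1: "((%t. f (x + s *\<^sub>R ax i + t *\<^sub>R ax j)) has_vector_derivative pd j f (x + s *\<^sub>R ax i + t *\<^sub>R ax j)) (at t within {0..s})"
     using t s nb(1)[of s t] by (intro C_on_has_vector_derivative[OF C1, of "x + s *\<^sub>R ax i"]) simp
    have 2: "((%t. f (x + t *\<^sub>R ax j)) has_vector_derivative pd j f (x + t *\<^sub>R ax j)) (at t within {0..s})"
     using t s nb(1)[of 0 t] by (intro C_on_has_vector_derivative[OF C1, of x]) simp
    have 3: "((%t. t *\<^sub>R w) has_vector_derivative w) (at t within {0..s})" for w :: complex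
     by (auto intro!: derivative_eq_intros simp: has_vector_derivative_def)
    show "((%t. f (x + s *\<^sub>R ax i + t *\<^sub>R ax j) - f (x + t *\<^sub>R ax j) - t *\<^sub>R (cr s * ?c i j)) has_derivative
      (%h. h *\<^sub>R (pd j f (x + s *\<^sub>R ax i + t *\<^sub>R ax j) - pd j f (x + t *\<^sub>R ax j) - cr s * ?c i j)))
      (at t within {0..s})"
     using has_vector_derivative_diff[OF has_vector_derivative_diff[OF 1 2] 3]
     unfolding has_vector_derivative_def .
    show "onorm (%h. h *\<^sub>R (pd j f (x + s *\<^sub>R ax i + t *\<^sub>R ax j) - pd j f (x + t *\<^sub>R ax j) - cr s * ?c i j)) <= e * s"
    proof (rule onorm_scaleR_left_le)
     have eq: "x + s *\<^sub>R ax i + t *\<^sub>R ax j = x + t *\<^sub>R ax j + s *\<^sub>R ax i"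
      by (simp only: add_ac)
     show "cmod (pd j f (x + s *\<^sub>R ax i + t *\<^sub>R ax j) - pd j f (x + t *\<^sub>R ax j) - cr s * ?c i j) <= e * s"
      unfolding eq using t s by (intro inner) auto
    qed
   qed (use s in auto)
   moreover have "a - b - s *\<^sub>R (cr s * k) - (p - q - 0 *\<^sub>R (cr s * k)) = a - p - b + q - cr (s * s) * k"
    for a b p q k :: complex by (simp add: scaleR_conv_of_real)
   ultimately show "cmod (f (x + s *\<^sub>R ax i + s *\<^sub>R ax j) - f (x + s *\<^sub>R ax i) - f (x + s *\<^sub>R ax j) + f x
     - cr (s * s) * ?c i j) <= e * (s * s)"
    using s by (simp only: abs_of_pos real_norm_def diff_0_right scaleR_zero_left add_0_right mult.assoc)
  qed
 qed
 have "cmod (?c i j - ?c j i) <= 2 * e" if e: "e > 0" for e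
 proof -
  obtain d1 where d1: "d1 > 0" "!!s. 0 < s & s < d1 ==> cmod (f (x + s *\<^sub>R ax i + s *\<^sub>R ax j) - f (x + s *\<^sub>R ax i) - f (x + s *\<^sub>R ax j) + f x
   - cr (s * s) * ?c i j) <= e * (s * s)" using *[OF e, of i j] by blast
  obtain d2 where d2: "d2 > 0" "!!s. 0 < s & s < d2 ==> cmod (f (x + s *\<^sub>R ax j + s *\<^sub>R ax i) - f (x + s *\<^sub>R ax j) - f (x + s *\<^sub>R ax i) + f x
   - cr (s * s) * ?c j i) <= e * (s * s)" using *[OF e, of j i] by blast
  define s where "s = min d1 d2 / 2"
  have s: "0 < s" "0 < s & s < d1" "0 < s & s < d2" using d1(1) d2(1) by (auto simp: s_def)
  have comm: "x + s *\<^sub>R ax j + s *\<^sub>R ax i = x + s *\<^sub>R ax i + s *\<^sub>R ax j"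
   by (simp only: add_ac)
  have "cmod (a - b) <= 2 * e" if "cmod (p - q - r + t - cr (s * s) * a) <= e * (s * s)"
   "cmod (p - r - q + t - cr (s * s) * b) <= e * (s * s)" for a b p q r t
  proof -
   have "cr (s * s) * (a - b) = (p - r - q + t - cr (s * s) * b) - (p - q - r + t - cr (s * s) * a)"
    by (simp add: algebra_simps)
   hence "cmod (cr (s * s) * (a - b)) <= e * (s * s) + e * (s * s)"
    using order_trans[OF norm_triangle_ineq4 add_mono[OF that(2) that(1)]] by simp
   moreover have "cmod (cr (s * s) * (a - b)) = (s * s) * cmod (a - b)"
    unfolding norm_mult norm_of_real by simp
   ultimately have "(s * s) * cmod (a - b) <= (s * s) * (2 * e)" by (simp add: algebra_simps)
   thus ?thesis using mult_pos_pos[OF s(1) s(1)] by (simp only: mult_le_cancel_left_pos)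
  qed
  thus ?thesis using d1(2)[OF s(2)] d2(2)[OF s(3)] unfolding comm by blast
 qed
 hence "cmod (?c i j - ?c j i) <= 0 + e" if "e > 0" for e
  using that by (metis add.left_neutral field_sum_of_halves half_gt_zero mult_2)
 hence "cmod (?c i j - ?c j i) <= 0"
  by (rule field_le_epsilon)
 thus ?thesis by simp
qed

lemma C_on_add:
 assumes "open X"
 shows "C_on k X f ==> C_on k X g ==> C_on k X (%x. f x + g x)"
proof (induction k arbitrary: f g)
 case (Suc k)
 have "((%t. f (x + t *\<^sub>R ax j) + g (x + t *\<^sub>R ax j)) has_vector_derivative
   pd j f x + pd j g x) (at 0)" if "x \<in> X" for j x
  using C_on_has_vector_derivative[OF Suc.prems(1), of x 0 j] C_on_has_vector_derivative[OF Suc.prems(2), of x 0 j] that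
  by (intro has_vector_derivative_add) simp_all
 thus ?case
  using Suc.prems by (intro C_on_SucI[OF assms, where g = "%j x. pd j f x + pd j g x"])
   (auto intro!: continuous_intros Suc.IH)
qed (auto intro: continuous_intros)

lemma C_on_mult:
 assumes "open X"
 shows "C_on k X f ==> C_on k X g ==> C_on k X (%x. f x * g x)"
proof (induction k arbitrary: f g)
 case (Suc k)
 have "((%t. f (x + t *\<^sub>R ax j) * g (x + t *\<^sub>R ax j)) has_vector_derivative
   f x * pd j g x + pd j f x * g x) (at 0)" if "x \<in> X" for j x
  using has_vector_derivative_mult[OF C_on_has_vector_derivative[OF Suc.prems(1), of x 0 j]
   C_on_has_vector_derivative[OF Suc.prems(2), of x 0 j]] that by simp
 thus ?case
  using Suc.prems C_on_mono[OF Suc.prems(1)] C_on_mono[OF Suc.prems(2)]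
  by (intro C_on_SucI[OF assms, where g = "%j x. f x * pd j g x + pd j f x * g x"])
   (auto intro!: continuous_intros Suc.IH C_on_add[OF assms])
qed (auto intro: continuous_intros)

lemma C_on_const: "C_on k X (%x. c)"
proof (induction k arbitrary: c)
 case (Suc k)
 have "pd j (%x. c) = (%x. 0)" for j :: 'a
  by (simp add: partial_deriv_def fun_eq_iff)
 with Suc show ?case by auto
qed auto

lemma C_on_sum:
 assumes "open X"
 shows "(!!i. i \<in> I ==> C_on k X (f i)) ==> C_on k X (%x. \<Sum>i\<in>I. f i x)"
 by (induction I rule: infinite_finite_induct) (auto intro!: C_on_const C_on_add assms)

lemma C_on_cmult: "open X ==> C_on k X f ==> C_on k X (%x. c * f x)"
 by (intro C_on_mult C_on_const)

lemma C_on_cnj: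
 assumes "open X"
 shows "C_on k X f ==> C_on k X (%x. cnj (f x))"
proof (induction k arbitrary: f)
 case (Suc k)
 have "((%t. cnj (f (x + t *\<^sub>R ax j))) has_vector_derivative cnj (pd j f x)) (at 0)" if "x \<in> X" for j x
  using has_vector_derivative_cnj[OF C_on_has_vector_derivative[OF Suc.prems, of x 0 j]] that by simp
 thus ?case
  using Suc.prems by (intro C_on_SucI[OF assms, where g = "%j x. cnj (pd j f x)"])
   (auto intro!: continuous_intros Suc.IH)
qed (auto intro: continuous_intros)

lemma C_on_affine: "C_on k X (%x. cr (w \<bullet> x + c))"
proof (rule C_on_subset)
 show "C_on k UNIV (%x. cr (w \<bullet> x + c))"
 proof (cases k)
  case (Suc n)
  show ?thesis unfolding Suc
  proof (rule C_on_SucI[where g = "%j x. cr (w \<bullet> ax j)"])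
   show "((%t. cr (w \<bullet> (x + t *\<^sub>R ax j) + c)) has_vector_derivative cr (w \<bullet> ax j)) (at 0)" for x j
    by (intro has_vector_derivative_of_real) (auto intro!: derivative_eq_intros simp: inner_add_right has_field_derivative_def mult.commute)
  qed (auto intro!: continuous_intros C_on_const)
 qed (auto intro!: continuous_intros)
qed auto

lemma C_on_compose_affine:
 assumes "open X"
 shows "C_on k X f ==> C_on k {x. a + c *\<^sub>R x \<in> X} (%x. f (a + c *\<^sub>R x))"
proof (induction k arbitrary: f)
 case 0
 thus ?case
  by (auto intro!: continuous_on_compose2[OF _ continuous_on_add[OF continuous_on_const continuous_on_scaleR[OF continuous_on_const continuous_on_id]]])
next
 case (Suc k)
 have op: "open {x. a + c *\<^sub>R x \<in> X}"
 proof -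
  have "continuous_on UNIV (%x. a + c *\<^sub>R x)" by (intro continuous_intros)
  thus ?thesis using open_vimage[OF assms] by (auto simp: vimage_def)
 qed
 show ?case
 proof (rule C_on_SucI[OF op, where g = "%j x. cr c * pd j f (a + c *\<^sub>R x)"])
  show "continuous_on {x. a + c *\<^sub>R x \<in> X} (%x. f (a + c *\<^sub>R x))"
   using Suc.prems by (auto intro!: continuous_on_compose2[of X f] continuous_intros)
  fix j x assume x: "x \<in> {x. a + c *\<^sub>R x \<in> X}"
  have "((%t. f (a + c *\<^sub>R x + t *\<^sub>R ax j)) has_vector_derivative pd j f (a + c *\<^sub>R x)) (at (c * 0))"
   using C_on_has_vector_derivative[OF Suc.prems, of "a + c *\<^sub>R x" 0 j] x by simp
  moreover have "((%t. c * t) has_vector_derivative c) (at 0)"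
   by (auto intro!: derivative_eq_intros)
  ultimately have "((%t. f (a + c *\<^sub>R x + t *\<^sub>R ax j)) \<circ> (%t. c * t) has_vector_derivative c *\<^sub>R pd j f (a + c *\<^sub>R x)) (at 0)"
   by (intro vector_diff_chain_at) auto
  thus "((%t. f (a + c *\<^sub>R (x + t *\<^sub>R ax j))) has_vector_derivative cr c * pd j f (a + c *\<^sub>R x)) (at 0)"
   by (simp add: o_def scaleR_add_right add.assoc scaleR_conv_of_real[where 'a=complex])
 next
  show "C_on k {x. a + c *\<^sub>R x \<in> X} (%x. cr c * pd j f (a + c *\<^sub>R x))" for j
   using Suc by (intro C_on_cmult[OF op]) auto
 qed
qed

lemma smooth_on_add: "open X ==> smooth_on X f ==> smooth_on X g ==> smooth_on X (%x. f x + g x)"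
 and smooth_on_mult: "open X ==> smooth_on X f ==> smooth_on X g ==> smooth_on X (%x. f x * g x)"
 and smooth_on_cmult: "open X ==> smooth_on X f ==> smooth_on X (%x. c * f x)"
 and smooth_on_const: "smooth_on X (%x. c)"
 and smooth_on_cnj: "open X ==> smooth_on X f ==> smooth_on X (%x. cnj (f x))"
 and smooth_on_affine: "smooth_on X (%x. cr (w \<bullet> x + r))"
 and smooth_on_compose_affine: "open X ==> smooth_on X f ==> smooth_on {x. a + s *\<^sub>R x \<in> X} (%x. f (a + s *\<^sub>R x))"
 and smooth_on_subset: "smooth_on X f ==> Y <= X ==> smooth_on Y f"
 unfolding smooth_on_def by (blast intro: C_on_add C_on_mult C_on_cmult C_on_const C_on_cnj C_on_affine C_on_subset
   C_on_compose_affine)+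

lemma smooth_on_sum: "open X ==> (!!i. i \<in> I ==> smooth_on X (f i)) ==> smooth_on X (%x. \<Sum>i\<in>I. f i x)"
 unfolding smooth_on_def using C_on_sum[of X I _ f] by blast

lemma smooth_on_diff: "open X ==> smooth_on X f ==> smooth_on X g ==> smooth_on X (%x. f x - g x)"
 using smooth_on_add[of X f "%x. (-1) * g x"] smooth_on_cmult[of X g "-1"] by simp

lemma smooth_on_cong: "open X ==> (!!x. x \<in> X ==> f x = g x) ==> smooth_on X f \<longleftrightarrow> smooth_on X g"
 unfolding smooth_on_def using C_on_cong[of X f g] by simp

lemma smooth_on_imp_continuous: "smooth_on X f ==> continuous_on X f"
 unfolding smooth_on_def using C_on_imp_continuous by blast

lemma smooth_on_partial_deriv: "smooth_on X f ==> smooth_on X (pd j f)"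
 unfolding smooth_on_def using C_on.simps(2)[of _ X f] by blast

lemma smooth_on_dd: "open X ==> smooth_on X f ==> smooth_on X (dd v f)"
 unfolding dd_def[abs_def] by (intro smooth_on_sum smooth_on_cmult smooth_on_partial_deriv)

lemma smooth_on_DL: "open X ==> smooth_on X f ==> smooth_on X (DL vs f)"
 by (induction vs) (auto intro: smooth_on_dd)

lemma smooth_on_has_derivative:
 "open X ==> smooth_on X f ==> x \<in> X ==> (f has_derivative (%h. dd h f x)) (at x)"
 unfolding smooth_on_def by (intro has_deriv_pd) auto

lemma smooth_on_local:
 assumes "!!x. x \<in> X ==> \<exists>U. open U & x \<in> U & smooth_on U f"
 shows "smooth_on X f"
proof -
 have "C_on k X f" if "!!x. x \<in> X ==> \<exists>U. open U & x \<in> U & smooth_on U f" for k f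
  using that
 proof (induction k arbitrary: f)
  case 0
  have "isCont f x" if "x \<in> X" for x
   using 0[OF that] smooth_on_imp_continuous continuous_on_eq_continuous_at by blast
  thus ?case by (simp add: continuous_at_imp_continuous_on)
 next
  case (Suc k)
  have 1: "isCont f x" if "x \<in> X" for x
   using Suc.prems[OF that] smooth_on_imp_continuous continuous_on_eq_continuous_at by blast
  have 2: "(%t. f (x + t *\<^sub>R ax j)) differentiable at 0" if x: "x \<in> X" for x j
  proof -
   obtain U where "x \<in> U" "smooth_on U f" using Suc.prems[OF x] by blast
   hence "C_on (Suc 0) U f" unfolding smooth_on_def by blast
   thus ?thesis using \<open>x \<in> U\<close> by simp
  qed
  have 3: "C_on k X (pd j f)" for j
   using Suc.prems smooth_on_partial_deriv by (intro Suc.IH) blast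
  show ?case using 1 2 3 by (simp add: continuous_at_imp_continuous_on)
 qed
 with assms show ?thesis unfolding smooth_on_def by blast
qed

lemma smooth_on_UN: "(!!U. U \<in> \<U> ==> open U & smooth_on U f) ==> smooth_on (\<Union>\<U>) f"
 by (intro smooth_on_local) blast

section \<open>Calculus of iterated directional derivatives\<close>

lemma dd_axis [simp]: "dd (ax j) f = pd j f"
proof
 fix x
 have "(\<Sum>k\<in>UNIV. cr ((ax j :: real^'a) $ k) * pd k f x) =
    (\<Sum>k\<in>UNIV. if k = j then pd k f x else 0)"
  by (intro sum.cong) (auto simp: axis_def)
 thus "dd (ax j) f x = pd j f x"
  by (simp add: dd_def)
qed

lemma dd_cong:
 assumes "open X" "x \<in> X" "!!y. y \<in> X ==> f y = g y"
 shows "dd v f x = dd v g x"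
 unfolding dd_def using pd_cong[OF assms] by simp

lemma DL_cong:
 assumes "open X" "x \<in> X" "!!y. y \<in> X ==> f y = g y"
 shows "DL vs f x = DL vs g x"
 using assms(2) by (induction vs arbitrary: x) (auto simp: assms intro: dd_cong[OF assms(1)])

lemma dd_vscale: "dd (c *\<^sub>R v) f x = cr c * dd v f x"
 by (simp add: dd_def sum_distrib_left mult.assoc)

lemma dd_vzero [simp]: "dd 0 f x = 0"
 by (simp add: dd_def)

context
 fixes X :: "(real ^ 'd::finite) set"
 assumes X: "open X"
begin

lemma dd_add: "smooth_on X f ==> smooth_on X g ==> x \<in> X ==> dd v (%x. f x + g x) x = dd v f x + dd v g x"
 by (rule has_derivative_imp_dd(2)[OF has_derivative_add[OF smooth_on_has_derivative[OF X] smooth_on_has_derivative[OF X]]])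

lemma dd_mult: "smooth_on X f ==> smooth_on X g ==> x \<in> X ==> dd v (%x. f x * g x) x = dd v f x * g x + f x * dd v g x"
 using has_derivative_imp_dd(2)[OF has_derivative_mult[OF smooth_on_has_derivative[OF X] smooth_on_has_derivative[OF X]], of f x g v]
 by (simp add: add.commute)

lemma dd_const [simp]: "dd v (%x. c) x = 0"
 by (rule has_derivative_imp_dd(2)[OF has_derivative_const])

lemma dd_cmult: "smooth_on X f ==> x \<in> X ==> dd v (%x. c * f x) x = c * dd v f x"
 using dd_mult[of "%x. c" f] by (simp add: smooth_on_const)

lemma dd_sum: "(!!i. i \<in> I ==> smooth_on X (f i)) ==> x \<in> X ==> dd v (%x. \<Sum>i\<in>I. f i x) x = (\<Sum>i\<in>I. dd v (f i) x)"
 by (induction I rule: infinite_finite_induct) (auto simp: dd_add smooth_on_sum[OF X])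

lemma dd_cnj: "smooth_on X f ==> x \<in> X ==> dd v (%x. cnj (f x)) x = cnj (dd v f x)"
 by (rule has_derivative_imp_dd(2)[OF has_derivative_cnj[OF smooth_on_has_derivative[OF X]]])

lemma dd_affine: "dd v (%x. cr (w \<bullet> x + r)) x = cr (w \<bullet> v)"
proof (rule has_derivative_imp_dd(2))
 show "((%x. cr (w \<bullet> x + r)) has_derivative (%v. cr (w \<bullet> v))) (at x)"
  by (auto intro!: derivative_eq_intros)
qed

lemma dd_compose_affine:
 assumes "smooth_on X f" "a + c *\<^sub>R x \<in> X"
 shows "dd v (%x. f (a + c *\<^sub>R x)) x = cr c * dd v f (a + c *\<^sub>R x)"
proof -
 have "((%x. a + c *\<^sub>R x) has_derivative (%h. c *\<^sub>R h)) (at x)"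
  by (auto intro!: derivative_eq_intros)
 from has_derivative_compose[OF this smooth_on_has_derivative[OF X assms]]
 show ?thesis by (simp add: has_derivative_imp_dd(2) dd_vscale)
qed

lemma dd_commute:
 assumes f: "smooth_on X f" and x: "x \<in> X"
 shows "dd v (dd w f) x = dd w (dd v f) x"
proof -
 have *: "dd v (dd w f) x = (\<Sum>j\<in>UNIV. \<Sum>i\<in>UNIV. cr (w $ j) * (cr (v $ i) * pd i (pd j f) x))" for v w
 proof -
  have "dd v (%x. \<Sum>j\<in>UNIV. cr (w $ j) * pd j f x) x
    = (\<Sum>j\<in>UNIV. dd v (%x. cr (w $ j) * pd j f x) x)"
   by (intro dd_sum smooth_on_cmult X smooth_on_partial_deriv f x)
  also have "... = (\<Sum>j\<in>UNIV. cr (w $ j) * dd v (pd j f) x)"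
   by (intro sum.cong refl dd_cmult smooth_on_partial_deriv f x)
  finally show ?thesis
   by (simp add: dd_def[abs_def] sum_distrib_left)
 qed
 have "C_on (Suc (Suc 0)) X f" using f unfolding smooth_on_def by blast
 hence c: "pd i (pd j f) x = pd j (pd i f) x" for i j
  using pd_commute[OF X _ x] by blast
 show ?thesis
  unfolding * by (subst sum.swap) (simp add: c mult.left_commute)
qed

lemma DL_add: "smooth_on X f ==> smooth_on X g ==> x \<in> X ==> DL vs (%x. f x + g x) x = DL vs f x + DL vs g x"
proof (induction vs arbitrary: x)
 case (Cons v vs)
 have "dd v (DL vs (%x. f x + g x)) x = dd v (%x. DL vs f x + DL vs g x) x"
  using Cons by (intro dd_cong[OF X]) auto
 thus ?case using Cons.prems by (simp add: dd_add smooth_on_DL[OF X])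
qed auto

lemma DL_cmult: "smooth_on X f ==> x \<in> X ==> DL vs (%x. c * f x) x = c * DL vs f x"
proof (induction vs arbitrary: x)
 case (Cons v vs)
 have "dd v (DL vs (%x. c * f x)) x = dd v (%x. c * DL vs f x) x"
  using Cons by (intro dd_cong[OF X]) auto
 thus ?case using Cons.prems by (simp add: dd_cmult smooth_on_DL[OF X])
qed auto

lemma DL_diff: "smooth_on X f ==> smooth_on X g ==> x \<in> X ==> DL vs (%x. f x - g x) x = DL vs f x - DL vs g x"
 using DL_add[of f "%x. (-1) * g x" x vs] DL_cmult[of g x vs "-1"] smooth_on_cmult[OF X, of g "-1"] by simp

lemma DL_0 [simp]: "DL vs (%x. 0) x = 0"
 using DL_cong[of UNIV x "%x. 0" "%x. 0 * 0"] by (induction vs arbitrary: x) (simp_all add: dd_cong[of UNIV _ _ "%x. 0"])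

lemma DL_sum: "(!!i. i \<in> I ==> smooth_on X (f i)) ==> x \<in> X ==> DL vs (%x. \<Sum>i\<in>I. f i x) x = (\<Sum>i\<in>I. DL vs (f i) x)"
 by (induction I rule: infinite_finite_induct) (auto simp: DL_add smooth_on_sum[OF X])

lemma DL_cnj: "smooth_on X f ==> x \<in> X ==> DL vs (%x. cnj (f x)) x = cnj (DL vs f x)"
proof (induction vs arbitrary: x)
 case (Cons v vs)
 have "dd v (DL vs (%x. cnj (f x))) x = dd v (%x. cnj (DL vs f x)) x"
  using Cons by (intro dd_cong[OF X]) auto
 thus ?case using Cons.prems by (simp add: dd_cnj smooth_on_DL[OF X])
qed auto

lemma DL_compose_affine:
 assumes "smooth_on X f"
 shows "a + c *\<^sub>R x \<in> X ==> DL vs (%x. f (a + c *\<^sub>R x)) x = cr c ^ length vs * DL vs f (a + c *\<^sub>R x)"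
proof (induction vs arbitrary: x)
 case (Cons v vs)
 let ?Y = "{x. a + c *\<^sub>R x \<in> X}"
 have op: "open ?Y"
 proof -
  have "continuous_on UNIV (%x. a + c *\<^sub>R x)" by (intro continuous_intros)
  thus ?thesis using open_vimage[OF X] by (auto simp: vimage_def)
 qed
 have sm: "smooth_on ?Y (%x. DL vs f (a + c *\<^sub>R x))"
  by (intro smooth_on_compose_affine smooth_on_DL X assms)
 have "DL (v # vs) (%x. f (a + c *\<^sub>R x)) x = dd v (%x. cr c ^ length vs * DL vs f (a + c *\<^sub>R x)) x"
  unfolding DL_Cons using Cons by (intro dd_cong[OF op]) auto
 also have "... = cr c ^ length vs * dd v (%x. DL vs f (a + c *\<^sub>R x)) x"
 proof -
  have "((%x. DL vs f (a + c *\<^sub>R x)) has_derivative (%h. dd h (%x. DL vs f (a + c *\<^sub>R x)) x)) (at x)"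
   using smooth_on_has_derivative[OF op sm] Cons.prems by auto
  from has_derivative_imp_dd(2)[OF has_derivative_mult_right[OF this, of "cr c ^ length vs"]]
  show ?thesis by simp
 qed
 also have "dd v (%x. DL vs f (a + c *\<^sub>R x)) x = cr c * DL (v # vs) f (a + c *\<^sub>R x)"
  using Cons.prems by (simp add: dd_compose_affine smooth_on_DL[OF X assms])
 finally show ?case by simp
qed auto

lemma DL_dd_commute: "smooth_on X f ==> x \<in> X ==> DL vs (dd v f) x = dd v (DL vs f) x"
proof (induction vs arbitrary: x)
 case (Cons w vs)
 have "DL (w # vs) (dd v f) x = dd w (dd v (DL vs f)) x"
  unfolding DL_Cons using Cons by (intro dd_cong[OF X]) auto
 thus ?case using Cons.prems by (simp add: dd_commute[OF smooth_on_DL[OF X]])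
qed auto

lemma DL_perm: "mset vs = mset ws ==> smooth_on X f ==> x \<in> X ==> DL vs f x = DL ws f x"
proof (induction vs arbitrary: ws x)
 case (Cons v vs)
 then obtain as bs where ws: "ws = as @ v # bs" by (metis in_set_conv_decomp list.set_intros(1) mset_eq_setD)
 have m: "mset vs = mset (as @ bs)" using Cons.prems(1) by (simp add: ws)
 have "DL (v # vs) f x = dd v (DL (as @ bs) f) x"
  unfolding DL_Cons using Cons m by (intro dd_cong[OF X]) auto
 also have "... = DL as (dd v (DL bs f)) x"
  using Cons.prems by (simp add: DL_append DL_dd_commute smooth_on_DL[OF X])
 finally show ?case by (simp add: ws DL_append)
qed auto

end

section \<open>The Leibniz rule, multi-indices and the seminorms of smooth functions\<close>

fun splits :: "'a list => ('a list \<times> 'a list) list" where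
 "splits [] = [([], [])]"
| "splits (v # vs) = map (%(a, b). (v # a, b)) (splits vs) @ map (%(a, b). (a, v # b)) (splits vs)"

lemma splitsD: "(a, b) \<in> set (splits vs) ==> length a + length b = length vs & set a <= set vs & set b <= set vs"
 by (induction vs arbitrary: a b) fastforce+

lemma length_splits: "length (splits vs) = 2 ^ length vs"
 by (induction vs) auto

text \<open>\<open>splits\<close> assigns every position of \<open>vs\<close> to one of the two
  factors, so repeated directions are counted with multiplicity and no binomial coefficients
  appear.\<close>

lemma DL_mult:
 assumes X: "open X" and f: "smooth_on X f" and g: "smooth_on X g"
 shows "x \<in> X ==> DL vs (%x. f x * g x) x = (\<Sum>(a, b)\<leftarrow>splits vs. DL a f x * DL b g x)"
proof (induction vs arbitrary: x)
 case (Cons v vs)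
 note xX = Cons.prems
 have dd_sl: "dd v (%x. \<Sum>p\<leftarrow>ps. DL (fst p) f x * DL (snd p) g x) x =
   (\<Sum>p\<leftarrow>ps. dd v (%x. DL (fst p) f x * DL (snd p) g x) x)" and "smooth_on X (%x. \<Sum>p\<leftarrow>ps. DL (fst p) f x * DL (snd p) g x)" for ps
 proof (induction ps)
  case (Cons p ps)
  have 1: "smooth_on X (%x. DL (fst p) f x * DL (snd p) g x)"
   by (intro smooth_on_mult smooth_on_DL X f g)
  {
   case 1
   show ?case using dd_add[OF X \<open>smooth_on X (%x. DL (fst p) f x * DL (snd p) g x)\<close> Cons.IH(2) xX] Cons.IH(1) by simp
  next
   case 2
   show ?case using smooth_on_add[OF X 1 Cons.IH(2)] by simp
  }
 qed (simp_all add: smooth_on_const dd_const[OF X])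
 have "DL (v # vs) (%x. f x * g x) x = dd v (%x. \<Sum>(a, b)\<leftarrow>splits vs. DL a f x * DL b g x) x"
  unfolding DL_Cons using Cons by (intro dd_cong[OF X]) auto
 also have "... = (\<Sum>(a, b)\<leftarrow>splits vs. dd v (%x. DL a f x * DL b g x) x)"
  using dd_sl[of "splits vs"] by (simp add: case_prod_unfold)
 also have "... = (\<Sum>(a, b)\<leftarrow>splits vs. DL (v # a) f x * DL b g x + DL a f x * DL (v # b) g x)"
  by (intro arg_cong[where f = sum_list] map_cong)
   (auto simp: dd_mult[OF X smooth_on_DL[OF X f] smooth_on_DL[OF X g] Cons.prems])
 also have "... = (\<Sum>(a, b)\<leftarrow>splits (v # vs). DL a f x * DL b g x)"
  by (simp add: sum_list_addf case_prod_unfold comp_def)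
 finally show ?case .
qed auto

lemma norm_sum_list_le: "norm (\<Sum>x\<leftarrow>xs. f x) <= (\<Sum>x\<leftarrow>xs. norm (f x))" for f :: "'a => 'b::real_normed_vector"
 by (induction xs) (auto intro: norm_triangle_le)

text \<open>The axes come in the order of \<open>coords\<close>, the enumeration used by
  \<open>multi_deriv\<close>; this makes \<open>multi_deriv_DL\<close> hold for arbitrary functions,
  without interchanging derivatives.\<close>

definition mvecs :: "nat ^ 'd => (real ^ 'd::finite) list"
 where "mvecs a = concat (map (%j. replicate (a $ j) (ax j)) coords)"

lemma coords: "distinct (coords :: 'd::finite list)" "set (coords :: 'd list) = UNIV"
proof -
 obtain js where "set js = (UNIV::'d set)" "distinct js"
  using finite_distinct_list[of "UNIV::'d set"] by auto
 hence "distinct (coords :: 'd list) & set (coords :: 'd list) = UNIV"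
  unfolding coords_def by (intro someI[of "%js. distinct js & set js = (UNIV::'d set)"]) auto
 thus "distinct (coords :: 'd::finite list)" "set (coords :: 'd list) = UNIV" by auto
qed

lemma multi_deriv_DL: "multi_deriv al f = DL (mvecs al) f"
proof -
 have *: "(pd j ^^ n) g = DL (replicate n (ax j)) g" for j :: 'a and n g
  by (induction n) auto
 have "foldr (%j. pd j ^^ (al $ j)) js f = DL (concat (map (%j. replicate (al $ j) (ax j)) js)) f" for js
  by (induction js) (auto simp: * DL_append)
 thus ?thesis by (simp add: multi_deriv_def mvecs_def)
qed

lemma length_mvecs: "length (mvecs a) = mi_size a"
proof -
 have "length (mvecs a) = (\<Sum>j\<leftarrow>coords. a $ j)"
  by (simp add: mvecs_def length_concat comp_def)
 also have "... = mi_size a"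
  unfolding mi_size_def coords(2)[symmetric] by (rule sum_list_distinct_conv_sum_set[OF coords(1)])
 finally show ?thesis .
qed

lemma norm_mvecs: "v \<in> set (mvecs a) ==> norm v = 1"
 by (auto simp: mvecs_def)

abbreviation axes :: "'d list => (real ^ 'd::finite) list" where "axes js \<equiv> map (%j. ax j) js"

lemma DL_axes:
 assumes "open X" "smooth_on X f" "x \<in> X"
 shows "DL (axes js) f x = multi_deriv (\<chi> j. count (mset js) j) f x"
  and "mi_size (\<chi> j. count (mset js) j) = length js"
proof -
 have 1: "count (mset (concat (map (%j. replicate (n j) j) cs))) i = (if i \<in> set cs then n i else 0)"
  if "distinct cs" for cs :: "'a list" and n i
  using that by (induction cs) (auto simp: count_eq_zero_iff)
 have 2: "mset js = mset (concat (map (%j. replicate (count (mset js) j) j) coords))"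
  by (rule multiset_eqI) (simp add: 1 coords)
 have "mvecs (\<chi> j. count (mset js) j) = axes (concat (map (%j. replicate (count (mset js) j) j) coords))"
  by (simp add: mvecs_def map_concat comp_def)
 hence "mset (axes js) = mset (mvecs (\<chi> j. count (mset js) j))"
  using 2 by (metis mset_map)
 thus "DL (axes js) f x = multi_deriv (\<chi> j. count (mset js) j) f x"
  unfolding multi_deriv_DL by (rule DL_perm[OF assms(1) _ assms(2,3)])
 have "length (mvecs (\<chi> j. count (mset js) j)) = length js"
  by (metis \<open>mset (axes js) = mset (mvecs (\<chi> j. count (mset js) j))\<close> length_map size_mset)
 thus "mi_size (\<chi> j. count (mset js) j) = length js"
  by (simp add: length_mvecs)
qed

lemma finite_mi_size_le: "finite {a :: nat ^ 'd::finite. mi_size a <= r}"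
proof -
 have "vec_nth a \<in> PiE UNIV (%_. {..r})" if "mi_size a <= r" for a :: "nat ^ 'd"
  using that member_le_sum[of _ "UNIV::'d set" "%j. a $ j"] by (fastforce simp: mi_size_def intro: order_trans)
 hence "vec_nth ` {a :: nat ^ 'd. mi_size a <= r} <= PiE UNIV (%_. {..r})" by auto
 hence "finite (vec_nth ` {a :: nat ^ 'd. mi_size a <= r})"
  by (rule finite_subset) (simp add: finite_PiE)
 thus ?thesis by (rule finite_imageD) (auto simp: inj_on_def vec_eq_iff)
qed

text \<open>The seminorm is a supremum of reals and is informative only for bounded sets;
  boundedness comes from compactness of \<open>K\<close> and the finite number of multi-indices of
  size at most \<open>r\<close>.\<close>

lemma sn_bdd:
 assumes "open X" "smooth_on X f" "compact K" "K <= X"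
 shows "bdd_above (insert 0 {cmod (multi_deriv a f x) |a x. x \<in> K & mi_size a <= r})"
proof -
 have "compact ((%x. cmod (multi_deriv a f x)) ` K)" for a
  unfolding multi_deriv_DL using smooth_on_imp_continuous[OF smooth_on_DL[OF assms(1,2)]] assms(3,4)
  by (intro compact_continuous_image continuous_on_norm) (auto intro: continuous_on_subset)
 hence "bdd_above ((%x. cmod (multi_deriv a f x)) ` K)" for a
  by (intro bounded_imp_bdd_above compact_imp_bounded)
 hence "bdd_above (\<Union>a\<in>{a. mi_size a <= r}. (%x. cmod (multi_deriv a f x)) ` K)"
  by (simp add: finite_mi_size_le)
 moreover have "{cmod (multi_deriv a f x) |a x. x \<in> K & mi_size a <= r} = (\<Union>a\<in>{a. mi_size a <= r}. (%x. cmod (multi_deriv a f x)) ` K)"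
  by auto
 ultimately show ?thesis by simp
qed

lemma sn_le:
 assumes "0 <= c" "!!a x. x \<in> K ==> mi_size a <= r ==> cmod (multi_deriv a f x) <= c"
 shows "sn K r f <= c"
 unfolding smooth_seminorm_def using assms by (intro cSup_least) auto

lemma sn_cong:
 assumes "open X" "K <= X" "!!x. x \<in> X ==> f x = g x"
 shows "sn K r f = sn K r g"
proof -
 have "multi_deriv a f x = multi_deriv a g x" if "x \<in> K" for a x
  unfolding multi_deriv_DL using assms that by (intro DL_cong[OF assms(1)]) auto
 hence "{cmod (multi_deriv a f x) |a x. x \<in> K & mi_size a <= r} = {cmod (multi_deriv a g x) |a x. x \<in> K & mi_size a <= r}"
  by (metis (no_types, lifting))
 thus ?thesis unfolding smooth_seminorm_def by simp
qed

context
 fixes X K :: "(real ^ 'd::finite) set"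
 assumes X: "open X" and K: "compact K" "K <= X"
begin

lemma multi_deriv_le_seminorm:
 "smooth_on X f ==> x \<in> K ==> mi_size a <= r ==> cmod (multi_deriv a f x) <= sn K r f"
 unfolding smooth_seminorm_def by (rule cSup_upper[OF _ sn_bdd[OF X _ K]]) auto

lemma sn_nonneg: "smooth_on X f ==> 0 <= sn K r f"
 unfolding smooth_seminorm_def by (rule cSup_upper[OF _ sn_bdd[OF X _ K]]) auto

lemma DL_axes_le_seminorm:
 assumes "smooth_on X f" "x \<in> K" "length js <= r"
 shows "cmod (DL (axes js) f x) <= sn K r f"
proof -
 have "x \<in> X" using assms K by auto
 thus ?thesis
  using multi_deriv_le_seminorm[OF assms(1,2), of "\<chi> j. count (mset js) j" r] DL_axes[OF X assms(1), of x js] assms(3) by simp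
qed

text \<open>Every direction is expanded in the axes: \<open>CARD('d)\<close> terms with coefficients
  of modulus at most 1, once for each vector of the list.\<close>

lemma DL_le_seminorm:
 assumes f: "smooth_on X f" and x: "x \<in> K" and "length vs <= r" "!!v. v \<in> set vs ==> norm v <= 1"
 shows "cmod (DL vs f x) <= real CARD('d) ^ length vs * sn K r f"
proof -
 \<comment> \<open>Generalised so that axes already split off can accumulate next to
   \<open>f\<close>; the induction consumes \<open>vs\<close> from the right, where the innermost
   derivative sits.\<close>
 have "cmod (DL vs (DL (axes js) f) x) <= real CARD('d) ^ length vs * sn K r f"
  if "length vs + length js <= r" "!!v. v \<in> set vs ==> norm v <= 1" for js
  using that
 proof (induction vs arbitrary: js rule: rev_induct)
  case Nil
  thus ?case using DL_axes_le_seminorm[OF f x] by simp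
 next
  case (snoc v vs)
  have xX: "x \<in> X" using x K by auto
  have "DL (vs @ [v]) (DL (axes js) f) x = DL vs (%x. \<Sum>j\<in>UNIV. cr (v $ j) * DL (axes (j # js)) f x) x"
   by (simp add: DL_append) (simp add: dd_def[abs_def])
  also have "... = (\<Sum>j\<in>UNIV. cr (v $ j) * DL vs (DL (axes (j # js)) f) x)"
   by (subst DL_sum[OF X _ xX]) (auto intro!: smooth_on_cmult X smooth_on_DL smooth_on_partial_deriv f sum.cong DL_cmult[OF X _ xX])
  also have "cmod ... <= (\<Sum>j::'d\<in>UNIV. real CARD('d) ^ length vs * sn K r f)"
  proof (rule sum_norm_le)
   fix j
   have "\<bar>v $ j\<bar> <= 1" using component_le_norm_cart[of v j] snoc.prems(2)[of v] by simp
   moreover have "cmod (DL vs (DL (axes (j # js)) f) x) <= real CARD('d) ^ length vs * sn K r f"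
    using snoc.prems by (intro snoc.IH) auto
   ultimately show "cmod (cr (v $ j) * DL vs (DL (axes (j # js)) f) x) <= real CARD('d) ^ length vs * sn K r f"
    using mult_mono[of "\<bar>v $ j\<bar>" 1 "cmod (DL vs (DL (axes (j # js)) f) x)"] by (simp add: norm_mult)
  qed
  finally show ?case by (simp add: mult.assoc)
 qed
 from this[of "[]"] assms show ?thesis by simp
qed

lemma sn_triangle:
 assumes "smooth_on X f" "smooth_on X g"
 shows "sn K r (%x. f x + g x) <= sn K r f + sn K r g"
proof (rule sn_le)
 show "0 <= sn K r f + sn K r g" using sn_nonneg assms by simp
 fix a :: "nat ^ 'd" and x assume x: "x \<in> K" "mi_size a <= r"
 hence "x \<in> X" using K by auto
 hence "multi_deriv a (%x. f x + g x) x = multi_deriv a f x + multi_deriv a g x"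
  unfolding multi_deriv_DL by (intro DL_add[OF X] assms)
 thus "cmod (multi_deriv a (%x. f x + g x) x) <= sn K r f + sn K r g"
  using norm_triangle_ineq multi_deriv_le_seminorm[OF assms(1) x] multi_deriv_le_seminorm[OF assms(2) x] by (smt (verit))
qed

text \<open>A derivative of order \<open>n\<close> produces \<open>2 ^ n\<close> Leibniz terms, each
  estimated by \<open>DL_le_seminorm\<close>; the constant is a common upper bound for all orders up
  to \<open>r\<close>.\<close>

lemma sn_mult:
 assumes "smooth_on X f" "smooth_on X g"
 shows "sn K r (%x. f x * g x) <= (2 * real CARD('d) ^ 2) ^ r * sn K r f * sn K r g"
proof (rule sn_le)
 have nn: "0 <= sn K r f" "0 <= sn K r g" using sn_nonneg assms by auto
 thus "0 <= (2 * real CARD('d) ^ 2) ^ r * sn K r f * sn K r g" by simp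
 have N: "1 <= real CARD('d)" by (simp add: Suc_leI)
 fix al :: "nat ^ 'd" and x assume x: "x \<in> K" "mi_size al <= r"
 hence xX: "x \<in> X" using K by auto
 let ?n = "mi_size al" and ?A = "sn K r f" and ?B = "sn K r g"
 have "cmod (multi_deriv al (%x. f x * g x) x) = cmod (\<Sum>(a, b)\<leftarrow>splits (mvecs al). DL a f x * DL b g x)"
  unfolding multi_deriv_DL by (simp add: DL_mult[OF X assms xX])
 also have "... <= (\<Sum>p\<leftarrow>splits (mvecs al). cmod (DL (fst p) f x * DL (snd p) g x))"
  using norm_sum_list_le[of "%p. DL (fst p) f x * DL (snd p) g x"] by (simp add: case_prod_unfold)
 also have "... <= (\<Sum>p\<leftarrow>splits (mvecs al). real CARD('d) ^ ?n * ?A * ?B)"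
 proof (rule sum_list_mono)
  fix p assume p: "p \<in> set (splits (mvecs al))"
  obtain a b where ab: "p = (a, b)" by fastforce
  have len: "length a + length b = ?n" and sub: "set a <= set (mvecs al)" "set b <= set (mvecs al)"
   using p splitsD[of a b "mvecs al"] by (auto simp: ab length_mvecs)
  have 1: "cmod (DL a f x) <= real CARD('d) ^ length a * ?A"
   using len x sub norm_mvecs by (intro DL_le_seminorm assms) (fastforce+)
  have 2: "cmod (DL b g x) <= real CARD('d) ^ length b * ?B"
   using len x sub norm_mvecs by (intro DL_le_seminorm assms) (fastforce+)
  have "cmod (DL a f x * DL b g x) <= (real CARD('d) ^ length a * ?A) * (real CARD('d) ^ length b * ?B)"
   unfolding norm_mult using 1 2 nn by (intro mult_mono) auto
  also have "... = real CARD('d) ^ ?n * ?A * ?B"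
   by (simp add: len[symmetric] power_add)
  finally show "cmod (DL (fst p) f x * DL (snd p) g x) <= real CARD('d) ^ ?n * ?A * ?B" by (simp add: ab)
 qed
 also have "... = 2 ^ ?n * real CARD('d) ^ ?n * ?A * ?B"
  by (simp add: sum_list_triv length_splits length_mvecs)
 also have "... <= (2 * real CARD('d) ^ 2) ^ r * ?A * ?B"
 proof -
  have "(2 * real CARD('d)) ^ ?n <= (2 * real CARD('d) ^ 2) ^ ?n"
   using N by (intro power_mono) (auto simp: power2_eq_square)
  also have "... <= (2 * real CARD('d) ^ 2) ^ r"
   using N x(2) mult_mono[OF N N] by (intro power_increasing) (auto simp: power2_eq_square)
  finally show ?thesis using nn by (intro mult_right_mono) (auto simp: power_mult_distrib)
 qed
 finally show "cmod (multi_deriv al (%x. f x * g x) x) <= (2 * real CARD('d) ^ 2) ^ r * ?A * ?B" .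
qed

end

section \<open>Test functions, bump functions and mollifiers\<close>

lemma supp_subset: "closed K ==> (!!x. x \<notin> K ==> f x = 0) ==> supp f <= K"
 unfolding fun_support_def by (rule closure_minimal) auto

lemma not_supp: "x \<notin> supp f ==> f x = 0"
 using closure_subset[of "{x. f x ~= 0}"] by (auto simp: fun_support_def)

lemma closed_fun_support [simp]: "closed (supp f)"
 by (simp add: fun_support_def)

lemma tf_iff: "f \<in> tf X \<longleftrightarrow> smooth_on UNIV f & compact (supp f) & supp f <= X"
 by (auto simp: test_funs_def smooth_on_def)

lemma test_funsI:
 assumes "smooth_on UNIV f" "compact K" "K <= X" "!!x. x \<notin> K ==> f x = 0"
 shows "f \<in> tf X"
proof -
 have *: "supp f <= K" using assms by (intro supp_subset compact_imp_closed) auto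
 hence "compact (supp f)"
  using compact_Int_closed[OF assms(2) closed_fun_support, of f] by (simp add: Int_absorb1)
 with * assms show ?thesis by (auto simp: tf_iff)
qed

lemma tf_mono: "f \<in> tf X ==> X <= Y ==> f \<in> tf Y"
 by (auto simp: tf_iff)

lemma tf_UNIV: "f \<in> tf X ==> f \<in> tf UNIV"
 by (auto simp: tf_iff)

lemma tf_support: "f \<in> tf X \<longleftrightarrow> f \<in> tf UNIV & supp f <= X"
 by (auto simp: tf_iff)

lemma test_smooth: "f \<in> tf X ==> smooth_on UNIV f"
 by (auto simp: tf_iff)

lemma test_continuous: "f \<in> tf X ==> continuous_on S f"
 using smooth_on_imp_continuous[of UNIV f] test_smooth[of f X] continuous_on_subset by blast

lemma test_zero [simp]: "(%x. 0) \<in> tf X"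
 by (rule test_funsI[of _ "{}"]) (auto simp: smooth_on_const)

lemma test_add: "f \<in> tf X ==> g \<in> tf X ==> (%x. f x + g x) \<in> tf X"
 by (rule test_funsI[of _ "supp f \<union> supp g"])
  (auto simp: tf_iff not_supp intro: smooth_on_add)

lemma test_cmult: "f \<in> tf X ==> (%x. c * f x) \<in> tf X"
 by (rule test_funsI[of _ "supp f"])
  (auto simp: tf_iff not_supp intro: smooth_on_cmult)

lemma test_diff: "f \<in> tf X ==> g \<in> tf X ==> (%x. f x - g x) \<in> tf X"
 using test_add[of f X "%x. (-1) * g x"] test_cmult[of g X "-1"] by simp

lemma test_sum: "(!!i. i \<in> I ==> f i \<in> tf X) ==> (%x. \<Sum>i\<in>I. f i x) \<in> tf X"
 by (induction I rule: infinite_finite_induct) (auto intro: test_add)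

lemma test_cnj: "f \<in> tf X ==> (%x. cnj (f x)) \<in> tf X"
 by (rule test_funsI[of _ "supp f"])
  (auto simp: tf_iff not_supp intro: smooth_on_cnj)

lemma DL_eq_0_outside: "closed K ==> (!!y. y \<notin> K ==> f y = 0) ==> x \<notin> K ==> DL vs f x = 0"
 using DL_cong[of "- K" x f "%x. 0" vs] DL_0[OF open_UNIV] by auto

lemma DL_outside_support: "x \<notin> supp f ==> DL vs f x = 0"
 by (rule DL_eq_0_outside[OF closed_fun_support not_supp])

lemma supp_DL: "supp (DL vs f) <= supp f"
 by (rule supp_subset) (auto intro: DL_outside_support)

lemma test_DL: "f \<in> tf X ==> DL vs f \<in> tf X"
 by (rule test_funsI[of _ "supp f"])
  (auto simp: tf_iff DL_outside_support intro: smooth_on_DL)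

text \<open>Nothing is known of \<open>F\<close> outside \<open>X\<close>; the product is glued from
  its restrictions to \<open>X\<close> and to the complement of the support of \<open>f\<close>,
  where it is zero.\<close>

lemma test_mult:
 assumes "open X" "smooth_on X F" "f \<in> tf X"
 shows "(%x. F x * f x) \<in> tf X"
proof (rule test_funsI[of _ "supp f"])
 have "smooth_on (\<Union>{X, - supp f}) (%x. F x * f x)"
 proof (rule smooth_on_UN)
  fix U assume "U \<in> {X, - supp f}"
  moreover have "smooth_on X (%x. F x * f x)"
   using assms by (intro smooth_on_mult) (auto simp: tf_iff intro: smooth_on_subset)
  moreover have "smooth_on (- supp f) (%x. F x * f x)"
   using smooth_on_cong[of "- supp f" "%x. F x * f x" "%x. 0"] by (simp add: not_supp smooth_on_const open_Compl)
  ultimately show "open U & smooth_on U (%x. F x * f x)" using assms(1) by auto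
 qed
 moreover have "\<Union>{X, - supp f} = UNIV" using assms(3) by (auto simp: tf_iff)
 ultimately show "smooth_on UNIV (%x. F x * f x)" by simp
qed (use assms in \<open>auto simp: tf_iff not_supp\<close>)

lemma test_compose_affine:
 assumes "f \<in> tf UNIV" "c ~= 0"
 shows "(%x. f (a + c *\<^sub>R x)) \<in> tf UNIV"
  and "supp (%x. f (a + c *\<^sub>R x)) <= {x. a + c *\<^sub>R x \<in> supp f}"
proof -
 let ?g = "%y. (1 / c) *\<^sub>R (y - a)"
 have "compact (?g ` supp f)"
  using assms by (intro compact_continuous_image continuous_intros) (auto simp: tf_iff)
 moreover have "x \<in> ?g ` supp f" if "a + c *\<^sub>R x \<in> supp f" for x
  using assms(2) that by (intro image_eqI[of _ _ "a + c *\<^sub>R x"]) auto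
 ultimately show "(%x. f (a + c *\<^sub>R x)) \<in> tf UNIV"
  using smooth_on_compose_affine[OF open_UNIV test_smooth[OF assms(1)], of a c]
  by (intro test_funsI[of _ "?g ` supp f"]) (auto intro: not_supp)
 have "closed {x. a + c *\<^sub>R x \<in> supp f}"
  using continuous_closed_vimage[OF closed_fun_support, of "%x. a + c *\<^sub>R x" f]
  by (auto simp: vimage_def intro!: continuous_intros)
 thus "supp (%x. f (a + c *\<^sub>R x)) <= {x. a + c *\<^sub>R x \<in> supp f}"
  by (rule supp_subset) (auto intro: not_supp)
qed

lemma test_reflect_translate:
 assumes "f \<in> tf UNIV"
 shows "(%y. f (x - y)) \<in> tf UNIV" "supp (%y. f (x - y)) <= {y. x - y \<in> supp f}"
  "DL vs (%y. f (x - y)) y = (-1) ^ length vs * DL vs f (x - y)"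
 using test_compose_affine[OF assms, of "-1" x] DL_compose_affine[OF open_UNIV test_smooth[OF assms], of x "-1" y vs] by auto

lemma DL_bounded:
 assumes "f \<in> tf UNIV"
 obtains C where "C > 0" "!!y. cmod (DL vs f y) <= C"
proof -
 have "compact (DL vs f ` supp f)"
  using assms test_continuous[OF test_DL[OF assms]] by (intro compact_continuous_image) (auto simp: tf_iff)
 then obtain C where C: "C > 0" "!!z. z \<in> DL vs f ` supp f ==> norm z <= C"
  using compact_imp_bounded bounded_pos by metis
 have "cmod (DL vs f y) <= C" for y
  using C DL_outside_support[of y f vs] by (cases "y \<in> supp f") auto
 with C that show ?thesis by blast
qed

subsection \<open>Lines\<close>

lemma smooth_line_derivative:
 assumes "open X" "smooth_on X f" "x + t *\<^sub>R v \<in> X"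
 shows "((%t. f (x + t *\<^sub>R v)) has_vector_derivative dd v f (x + t *\<^sub>R v)) (at t within S)"
proof -
 have "((%t. x + t *\<^sub>R v) has_derivative (%h. h *\<^sub>R v)) (at t within S)"
  by (auto intro!: derivative_eq_intros)
 from has_derivative_compose[OF this smooth_on_has_derivative[OF assms]]
 show ?thesis by (simp add: has_vector_derivative_def dd_vscale scaleR_conv_of_real[where 'a=complex])
qed

lemma line_mean_value:
 assumes "smooth_on UNIV f" "!!s. s \<in> closed_segment 0 t ==> cmod (dd v f (x + s *\<^sub>R v) - c) <= C"
 shows "cmod (f (x + t *\<^sub>R v) - f x - cr t * c) <= C * \<bar>t\<bar>"
proof -
 have "norm ((f (x + t *\<^sub>R v) - t *\<^sub>R c) - (f (x + 0 *\<^sub>R v) - 0 *\<^sub>R c)) <= C * norm (t - 0)"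
 proof (rule differentiable_bound[where S = "closed_segment 0 t"])
  fix s assume s: "s \<in> closed_segment 0 t"
  have 3: "((%t. t *\<^sub>R c) has_vector_derivative c) (at s within closed_segment 0 t)"
   by (auto intro!: derivative_eq_intros simp: has_vector_derivative_def)
  show "((%t. f (x + t *\<^sub>R v) - t *\<^sub>R c) has_derivative (%h. h *\<^sub>R (dd v f (x + s *\<^sub>R v) - c))) (at s within closed_segment 0 t)"
   using has_vector_derivative_diff[OF smooth_line_derivative[OF open_UNIV assms(1)] 3]
   unfolding has_vector_derivative_def by auto
  show "onorm (%h. h *\<^sub>R (dd v f (x + s *\<^sub>R v) - c)) <= C"
   by (rule onorm_scaleR_left_le[OF assms(2)[OF s]])
 qed auto
 thus ?thesis by (simp add: scaleR_conv_of_real[where 'a=complex] algebra_simps)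
qed

lemma line_bound:
 assumes "smooth_on UNIV f" "!!y. cmod (dd v f y) <= C"
 shows "cmod (f (x + t *\<^sub>R v) - f x) <= C * \<bar>t\<bar>"
 using line_mean_value[OF assms(1), of t v x 0 C] assms(2) by simp

text \<open>The mean value inequality applied twice. The factor 1/2 of Taylor's formula is given
  away, as only the quadratic order matters.\<close>

lemma line_bound2:
 assumes "smooth_on UNIV f" "!!y. cmod (dd v (dd v f) y) <= C"
 shows "cmod (f (x + t *\<^sub>R v) - f x - cr t * dd v f x) <= C * t\<^sup>2"
proof -
 have "0 <= C" using assms(2)[of 0] norm_ge_zero order_trans by blast
 have "cmod (f (x + t *\<^sub>R v) - f x - cr t * dd v f x) <= (C * \<bar>t\<bar>) * \<bar>t\<bar>"
 proof (rule line_mean_value[OF assms(1)])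
  fix s assume "s \<in> closed_segment 0 t"
  hence s: "\<bar>s\<bar> <= \<bar>t\<bar>" by (auto simp: closed_segment_eq_real_ivl split: if_splits)
  have "cmod (dd v f (x + s *\<^sub>R v) - dd v f x) <= C * \<bar>s\<bar>"
   by (intro line_bound smooth_on_dd open_UNIV assms)
  also have "... <= C * \<bar>t\<bar>" using s \<open>0 <= C\<close> by (intro mult_left_mono)
  finally show "cmod (dd v f (x + s *\<^sub>R v) - dd v f x) <= C * \<bar>t\<bar>" .
 qed
 thus ?thesis by (simp add: power2_eq_square)
qed

subsection \<open>Integration\<close>

lemma integrable_compact_support:
 fixes f :: "'a::euclidean_space => 'b::{banach, second_countable_topology}"
 assumes "continuous_on UNIV f" "compact K" "!!x. x \<notin> K ==> f x = 0"
 shows "integrable lborel f"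
proof -
 have "integrable lborel (%x. indicator K x *\<^sub>R f x)"
  using assms by (intro borel_integrable_compact continuous_on_subset[OF assms(1)]) auto
 moreover have "(%x. indicator K x *\<^sub>R f x) = f"
  using assms(3) by (auto simp: fun_eq_iff indicator_def)
 ultimately show ?thesis by simp
qed

lemma test_integrable: "f \<in> tf X ==> integrable lborel f"
 using test_continuous[of f X UNIV] by (intro integrable_compact_support[of _ "supp f"]) (auto simp: tf_iff not_supp)

lemma lborel_integral_translate:
 fixes f :: "'a::euclidean_space => 'b::{banach, second_countable_topology}"
 assumes "f \<in> borel_measurable borel"
 shows "(LI x. f (a + x)) = (LI x. f x)"
proof -
 have "(LI x. f x) = (\<integral>x. f x \<partial>distr lborel borel ((+) a))"
  by (simp only: lborel_distr_plus)
 also have "... = (LI x. f (a + x))"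
  using assms by (subst integral_distr) auto
 finally show ?thesis by simp
qed

text \<open>Difference quotients have integral zero by translation invariance, and dominated
  convergence passes to the derivative.\<close>

lemma integral_dd_eq_0:
 assumes f: "f \<in> tf X"
 shows "(LI x. dd v f x) = 0"
proof -
 have f': "f \<in> tf UNIV" using f by (rule tf_UNIV)
 obtain C where C: "C > 0" "!!y. cmod (dd v f y) <= C" using DL_bounded[OF f', of "[v]"] by auto
 obtain C2 where C2: "C2 > 0" "!!y. cmod (dd v (dd v f) y) <= C2" using DL_bounded[OF f', of "[v, v]"] by auto
 have sm: "smooth_on UNIV f" using f by (rule test_smooth)
 have meas: "f \<in> borel_measurable borel"
  using test_continuous[OF f] by (rule cont_bm)
 obtain B where B: "B > 0" "supp f <= cball 0 B"
  using f compact_imp_bounded[of "supp f"] by (auto simp: tf_iff bounded_pos subset_iff)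
 \<comment> \<open>The difference quotients use steps of length at most \<open>norm v\<close>, so
   all of them vanish outside this ball.\<close>
 define K where "K = cball (0::real^'a) (B + norm v)"
 define s where "s = (%n x. cr (real (Suc n)) * (f (x + (1 / real (Suc n)) *\<^sub>R v) - f x))"
 have "(%n. LI x. s n x) \<longlonglongrightarrow> (LI x. dd v f x)"
 proof (rule integral_dominated_convergence[where w = "%x. indicator K x *\<^sub>R C"])
  show "integrable lborel (%x. indicator K x *\<^sub>R C)"
   by (intro borel_integrable_compact continuous_on_const) (simp add: K_def)
  show "dd v f \<in> borel_measurable lborel"
   using test_continuous[OF test_DL[OF f, of "[v]"]] by (auto intro: cont_bm)
  show "s n \<in> borel_measurable lborel" for n
   unfolding s_def using test_continuous[OF f, of UNIV]
   by (auto intro!: cont_bm continuous_intros continuous_on_compose2[of UNIV f])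
  show "AE x in lborel. (%n. s n x) \<longlonglongrightarrow> dd v f x"
  proof (rule AE_I2)
   fix x
   show "(%n. s n x) \<longlonglongrightarrow> dd v f x"
   proof (rule LIM_zero_cancel, rule Lim_null_comparison[OF always_eventually, rule_format])
    fix n
    let ?t = "1 / real (Suc n)"
    have "s n x - dd v f x = cr (real (Suc n)) * (f (x + ?t *\<^sub>R v) - f x - cr ?t * dd v f x)"
     by (simp add: s_def algebra_simps del: of_nat_Suc)
    hence "cmod (s n x - dd v f x) = real (Suc n) * cmod (f (x + ?t *\<^sub>R v) - f x - cr ?t * dd v f x)"
     by (simp only: norm_mult norm_of_real abs_of_nat)
    also have "... <= real (Suc n) * (C2 * ?t\<^sup>2)"
     by (intro mult_left_mono line_bound2 sm C2) auto
    finally show "cmod (s n x - dd v f x) <= C2 * ?t" by (simp add: power2_eq_square del: of_nat_Suc)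
   next
    show "(%n. C2 * (1 / real (Suc n))) \<longlonglongrightarrow> 0"
     by (rule tendsto_mult_right_zero[OF LIMSEQ_Suc[OF lim_1_over_n]])
   qed
  qed
  show "AE x in lborel. norm (s n x) <= indicator K x *\<^sub>R C" for n
  proof (rule AE_I2)
   fix x
   have "cmod (f (x + (1 / real (Suc n)) *\<^sub>R v) - f x) <= C * \<bar>1 / real (Suc n)\<bar>"
    by (intro line_bound sm C)
   hence "real (Suc n) * cmod (f (x + (1 / real (Suc n)) *\<^sub>R v) - f x) <= real (Suc n) * (C * \<bar>1 / real (Suc n)\<bar>)"
    by (intro mult_left_mono) auto
   also have "... = C" by simp
   finally have 1: "norm (s n x) <= C" by (simp only: s_def norm_mult norm_of_real abs_of_nat)
   have "s n x = 0" if "x \<notin> K"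
   proof -
    have n1: "norm x > B + norm v" using that by (simp add: K_def)
    have "norm ((1 / real (Suc n)) *\<^sub>R v) <= norm v" by (simp add: field_simps mult_left_le)
    hence "norm (x + (1 / real (Suc n)) *\<^sub>R v) > B"
     using n1 norm_triangle_ineq4[of "x + (1 / real (Suc n)) *\<^sub>R v" "(1 / real (Suc n)) *\<^sub>R v"] by simp
    hence "x + (1 / real (Suc n)) *\<^sub>R v \<notin> supp f" using B(2) by (meson mem_cball_0 not_le subsetD)
    moreover have "norm x > B" using n1 norm_ge_zero[of v] by linarith
    hence "x \<notin> supp f" using B(2) by (meson mem_cball_0 not_le subsetD)
    ultimately show ?thesis by (simp add: s_def not_supp)
   qed
   with 1 show "norm (s n x) <= indicator K x *\<^sub>R C" by (auto simp: indicator_def)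
  qed
 qed
 moreover have "(LI x. s n x) = 0" for n
 proof -
  let ?a = "(1 / real (Suc n)) *\<^sub>R v"
  have i1: "integrable lborel (%x. f (x + ?a))"
   using test_integrable[OF test_compose_affine(1)[OF f', of 1 ?a]] by (simp add: add.commute)
  have "(LI x. f (x + ?a)) = (LI x. f x)"
   using lborel_integral_translate[OF meas, of ?a] by (simp add: add.commute)
  thus ?thesis
   unfolding s_def using i1 test_integrable[OF f] by (simp del: of_nat_Suc)
 qed
 ultimately have "(%n::nat. 0) \<longlonglongrightarrow> (LI x. dd v f x)" by simp
 thus ?thesis by (simp add: LIMSEQ_const_iff)
qed

lemma integral_by_parts_dd:
 assumes X: "open X" and F: "smooth_on X F" and f: "f \<in> tf X"
 shows "(LI x. dd v F x * f x) = - (LI x. F x * dd v f x)"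
proof -
 have "dd v (%x. F x * f x) x = dd v F x * f x + F x * dd v f x" for x
 proof (cases "x \<in> X")
  case True
  thus ?thesis using dd_mult[OF X F] smooth_on_subset[OF test_smooth[OF f]] by auto
 next
  case False
  hence x: "x \<notin> supp f" using f by (auto simp: tf_iff)
  have "dd v (%x. F x * f x) x = dd v (%x. 0) x"
   by (rule dd_cong[of "- supp f"]) (auto simp: x not_supp)
  thus ?thesis using DL_outside_support[OF x, of "[v]"] by (simp add: not_supp[OF x] dd_const[OF open_UNIV])
 qed
 moreover have "integrable lborel (%x. dd v F x * f x)" "integrable lborel (%x. F x * dd v f x)"
  using test_integrable[OF test_mult[OF X smooth_on_dd[OF X F] f]] test_integrable[OF test_mult[OF X F test_DL[OF f, of "[v]"]]] by auto
 ultimately have "0 = (LI x. dd v F x * f x) + (LI x. F x * dd v f x)"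
  using integral_dd_eq_0[OF test_mult[OF X F f], of v] by simp
 thus ?thesis by (simp add: eq_neg_iff_add_eq_0)
qed

lemma integral_by_parts:
 assumes X: "open X" and F: "smooth_on X F" and f: "f \<in> tf X"
 shows "(LI x. DL vs F x * f x) = (-1) ^ length vs * (LI x. F x * DL vs f x)"
proof -
 \<comment> \<open>Moving the derivatives over one by one reverses the list; \<open>DL_perm\<close>
   undoes this at the end.\<close>
 have "(LI x. DL vs F x * f x) = (-1) ^ length vs * (LI x. F x * DL (rev vs) f x)"
  using f
 proof (induction vs arbitrary: f)
  case (Cons v vs)
  have "(LI x. DL (v # vs) F x * f x) = - (LI x. DL vs F x * dd v f x)"
   using integral_by_parts_dd[OF X smooth_on_DL[OF X F] Cons.prems] by simp
  also have "... = - ((-1) ^ length vs * (LI x. F x * DL (rev vs) (dd v f) x))"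
   using Cons.IH[of "dd v f"] test_DL[OF Cons.prems, of "[v]"] by simp
  finally show ?case by (simp add: DL_append)
 qed auto
 moreover have "DL (rev vs) f x = DL vs f x" for x
  by (rule DL_perm[OF open_UNIV]) (auto intro: test_smooth[OF f])
 ultimately show ?thesis by simp
qed

subsection \<open>Bump functions\<close>

text \<open>The functions \<open>exp (- 1 / t) / t ^ n\<close>, continued by zero. Derivatives are
  linear combinations of members of the family, which makes smoothness of \<open>bump\<close> an
  induction with \<open>n\<close> left free.\<close>

definition flat_fun :: "nat => real => real" where
 "flat_fun n t = (if t > 0 then exp (- (1 / t)) * (1 / t) ^ n else 0)"

lemma power_div_fact_le_exp: "0 <= x ==> x ^ n / fact n <= exp (x :: real)"
 using sum_le_suminf[of "%n. x ^ n /\<^sub>R fact n" "{n}"] exp_converges[of x]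
 by (simp add: sums_iff divide_inverse mult.commute)

lemma flat_fun_bound: "\<bar>flat_fun n t\<bar> <= fact (Suc n) * \<bar>t\<bar>"
proof (cases "t > 0")
 case True
 let ?u = "1 / t"
 have u: "?u > 0" using True by simp
 \<comment> \<open>A single term of the exponential series at \<open>1 / t\<close> dominates the
   pole of order \<open>n\<close> and leaves a factor \<open>t\<close> to spare.\<close>
 have "?u ^ Suc n <= fact (Suc n) * exp ?u"
  using power_div_fact_le_exp[of ?u "Suc n"] u
  by (metis fact_gt_zero less_imp_le mult.commute pos_divide_le_eq)
 hence "exp (- ?u) * ?u ^ Suc n <= exp (- ?u) * (fact (Suc n) * exp ?u)"
  by (intro mult_left_mono) auto
 also have "... = fact (Suc n)" by (simp add: exp_minus)
 finally have "t * (exp (- ?u) * ?u ^ Suc n) <= t * fact (Suc n)" using True by (intro mult_left_mono) auto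
 moreover have "t * (exp (- ?u) * ?u ^ Suc n) = flat_fun n t"
  using True by (simp add: flat_fun_def)
 moreover have "flat_fun n t \<ge> 0" by (simp add: flat_fun_def)
 ultimately show ?thesis using True by (simp add: mult.commute)
next
 case False
 hence "flat_fun n t = 0" by (simp add: flat_fun_def)
 thus ?thesis by (simp only: abs_zero) (intro mult_nonneg_nonneg, auto)
qed

lemma flat_fun_derivative:
 "(flat_fun n has_real_derivative flat_fun (n + 2) t - real n * flat_fun (n + 1) t) (at t)"
proof -
 consider "t > 0" | "t < 0" | "t = 0" by linarith
 thus ?thesis
 proof cases
  case 1
  have "((%t. exp (- (1 / t)) * (1 / t) ^ n) has_real_derivative
    exp (- (1 / t)) * (1 / t) ^ (n + 2) - real n * (exp (- (1 / t)) * (1 / t) ^ (n + 1))) (at t)"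
  proof -
   define u where "u = 1 / t"
   have d: "((%t. 1 / t) has_real_derivative - (u\<^sup>2)) (at t)"
    using 1 by (auto intro!: derivative_eq_intros simp: u_def power2_eq_square)
   have d1: "((%t. exp (- (1 / t))) has_real_derivative exp (- u) * u\<^sup>2) (at t)"
    using DERIV_chain2[OF DERIV_exp DERIV_minus[OF d]] by (simp add: u_def)
   have d2: "((%t. (1 / t) ^ n) has_real_derivative real n * u ^ (n - 1) * (- (u\<^sup>2))) (at t)"
    using DERIV_power[OF d, of n] by (simp add: u_def mult_ac)
   have "exp (- u) * u\<^sup>2 * u ^ n + real n * u ^ (n - 1) * (- (u\<^sup>2)) * exp (- u) = exp (- u) * u ^ (n + 2) - real n * (exp (- u) * u ^ (n + 1))"
    by (cases n) (simp_all add: power2_eq_square algebra_simps)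
   thus ?thesis using DERIV_mult[OF d1 d2] by (simp add: u_def)
  qed
  hence "(flat_fun n has_real_derivative
    exp (- (1 / t)) * (1 / t) ^ (n + 2) - real n * (exp (- (1 / t)) * (1 / t) ^ (n + 1))) (at t)"
   by (rule has_field_derivative_transform_within_open[of _ _ _ "{0<..}"]) (use 1 in \<open>auto simp: flat_fun_def\<close>)
  thus ?thesis using 1 by (simp add: flat_fun_def)
 next
  case 2
  have "((%t. 0) has_real_derivative 0) (at t)" by simp
  hence "(flat_fun n has_real_derivative 0) (at t)"
   by (rule has_field_derivative_transform_within_open[of _ _ _ "{..<0}"]) (use 2 in \<open>auto simp: flat_fun_def\<close>)
  thus ?thesis using 2 by (simp add: flat_fun_def)
 next
  case 3
  \<comment> \<open>At the corner the difference quotient is again a member of the family, with the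
    next index, and tends to zero by \<open>flat_fun_bound\<close>.\<close>
  have "((%h. (flat_fun n (0 + h) - flat_fun n 0) / h) \<longlongrightarrow> 0) (at 0)"
  proof (rule Lim_null_comparison[OF always_eventually, rule_format])
   fix h :: real
   have "(flat_fun n (0 + h) - flat_fun n 0) / h = flat_fun (Suc n) h"
    by (auto simp: flat_fun_def)
   thus "norm ((flat_fun n (0 + h) - flat_fun n 0) / h) <= fact (Suc (Suc n)) * \<bar>h\<bar>"
    using flat_fun_bound[of "Suc n" h] by (simp del: fact_Suc)
  next
   have "((%h. fact (Suc (Suc n)) * \<bar>h\<bar>) \<longlongrightarrow> fact (Suc (Suc n)) * \<bar>0::real\<bar>) (at 0)"
    by (intro tendsto_intros)
   thus "((%h. fact (Suc (Suc n)) * \<bar>h\<bar>) \<longlongrightarrow> (0::real)) (at 0)" by simp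
  qed
  thus ?thesis using 3 by (simp add: DERIV_def flat_fun_def)
 qed
qed

lemma open_null_sets_lborel:
 fixes U :: "'a::euclidean_space set"
 assumes "open U" "U \<in> null_sets lborel"
 shows "U = {}"
proof (rule ccontr)
 assume "U ~= {}"
 then obtain x r where r: "r > 0" "ball x r <= U" using assms(1) openE by blast
 have "ball x r \<in> null_sets lborel" using null_sets_subset[OF assms(2) _ r(2)] by simp
 hence "measure lborel (ball x r) = 0" by (rule measure_eq_0_null_sets)
 thus False using content_ball_pos[OF r(1), of x] by simp
qed

text \<open>The part of \<open>U\<close> where \<open>f\<close> does not vanish is open and null,
  hence empty. This converts L2 information back into pointwise statements.\<close>

lemma AE_zero_continuous:
 fixes f :: "'a::euclidean_space => 'b::real_normed_vector"
 assumes "open U" "continuous_on U f" "AE x in lborel. x \<in> U --> f x = 0" "x \<in> U"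
 shows "f x = 0"
proof -
 let ?V = "{x \<in> U. f x ~= 0}"
 have "?V = U \<inter> f -` (- {0})" by auto
 hence op: "open ?V"
  using continuous_open_preimage[OF assms(2,1), of "- {0}"] by (simp add: open_Compl)
 have eq: "{x \<in> space lborel. \<not> (x \<in> U --> f x = 0)} = ?V" by (auto simp: space_lborel)
 have "{x \<in> space lborel. \<not> (x \<in> U --> f x = 0)} \<in> sets lborel"
  unfolding eq sets_lborel by (rule borel_open[OF op])
 hence "?V \<in> null_sets lborel"
  using assms(3) AE_iff_null[of lborel "%x. x \<in> U --> f x = 0"] unfolding eq by blast
 hence "?V = {}" by (rule open_null_sets_lborel[OF op])
 thus ?thesis using assms(4) by auto
qed

definition bump :: "real ^ 'd::finite => complex"
 where "bump x = cr (flat_fun 0 (1 - x \<bullet> x))"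

lemma C_on_flat_fun: "C_on k UNIV (%x. cr (flat_fun n (1 - x \<bullet> x)))"
proof (induction k arbitrary: n)
 case 0
 have "isCont (flat_fun n) t" for t using DERIV_isCont flat_fun_derivative by blast
 hence "continuous_on UNIV (flat_fun n)" by (simp add: continuous_at_imp_continuous_on)
 thus ?case
  by (auto intro!: continuous_intros continuous_on_compose2[of UNIV "flat_fun n"])
next
 case (Suc k)
 have cont: "continuous_on UNIV (flat_fun n)"
  using DERIV_isCont flat_fun_derivative by (intro continuous_at_imp_continuous_on) blast
 let ?g = "%(j::'a) (x::real^'a). cr (ax j \<bullet> x + 0) * (cr (- 2) * (cr (flat_fun (n + 2) (1 - x \<bullet> x))
   + cr (- real n) * cr (flat_fun (n + 1) (1 - x \<bullet> x))))"
 show ?case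
 proof (rule C_on_SucI[where g = ?g])
  show "continuous_on UNIV (%x::real^'a. cr (flat_fun n (1 - x \<bullet> x)))"
   by (auto intro!: continuous_intros continuous_on_compose2[OF cont])
  show "C_on k UNIV (?g j)" for j
   by (intro C_on_mult C_on_add C_on_const C_on_affine open_UNIV Suc.IH)
  show "((%t. cr (flat_fun n (1 - (x + t *\<^sub>R ax j) \<bullet> (x + t *\<^sub>R ax j)))) has_vector_derivative ?g j x) (at 0)" for j x
  proof -
   have "((%t. 1 - (x + t *\<^sub>R ax j) \<bullet> (x + t *\<^sub>R ax j)) has_real_derivative (- 2 * (ax j \<bullet> x))) (at 0)"
    unfolding has_field_derivative_def
    by (auto intro!: derivative_eq_intros simp: inner_add_right inner_add_left inner_commute fun_eq_iff)
   from DERIV_chain2[OF _ this, of "flat_fun n"] flat_fun_derivative[of n "1 - x \<bullet> x"]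
   have "((%t. flat_fun n (1 - (x + t *\<^sub>R ax j) \<bullet> (x + t *\<^sub>R ax j))) has_real_derivative
     (flat_fun (n + 2) (1 - x \<bullet> x) - real n * flat_fun (n + 1) (1 - x \<bullet> x)) * (- 2 * (ax j \<bullet> x))) (at 0)"
    by simp
   from has_vector_derivative_of_real[OF this]
   show ?thesis by (rule back_subst[where P = "%d. (_ has_vector_derivative d) _"]) (simp add: algebra_simps)
  qed
 qed auto
qed

lemma bump_smooth: "smooth_on UNIV bump"
 unfolding smooth_on_def bump_def[abs_def] using C_on_flat_fun by blast

lemma bump_eq_0: "norm x \<ge> 1 ==> bump x = 0"
proof -
 assume "norm x \<ge> 1"
 hence "1 - x \<bullet> x <= 0" using one_le_power[of "norm x" 2] by (simp add: dot_square_norm)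
 thus ?thesis by (simp add: bump_def flat_fun_def)
qed

lemma bump_pos: "norm x < 1 ==> Re (bump x) > 0"
 by (simp add: bump_def flat_fun_def dot_square_norm abs_square_less_1)

lemma bump_real: "bump x = cr (Re (bump x))" and bump_nonneg: "0 <= Re (bump x)"
 and bump_even: "bump (- x) = bump x"
 by (auto simp: bump_def flat_fun_def)

lemma bump_test: "bump \<in> tf UNIV"
 by (rule test_funsI[of _ "cball 0 1"]) (auto intro: bump_smooth bump_eq_0)

lemma bump_integral_pos: "0 < integral\<^sup>L lborel (%x::real^'d::finite. Re (bump x))"
proof -
 have int: "integrable lborel (%x::real^'d. Re (bump x))"
  using test_integrable[OF bump_test] by (rule integrable_Re)
 have "integral\<^sup>L lborel (%x::real^'d. Re (bump x)) ~= 0"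
 proof
  assume "integral\<^sup>L lborel (%x::real^'d. Re (bump x)) = 0"
  hence "AE x in lborel. Re (bump (x::real^'d)) = 0"
   using integral_nonneg_eq_0_iff_AE[OF int] bump_nonneg by blast
  moreover have "continuous_on UNIV (%x::real^'d. Re (bump x))"
   by (intro continuous_intros test_continuous[OF bump_test])
  ultimately have "Re (bump (0::real^'d)) = 0"
   using AE_zero_continuous[OF open_UNIV, of "%x::real^'d. Re (bump x)" 0] by simp
  thus False using bump_pos[of "0::real^'d"] by simp
 qed
 moreover have "0 <= integral\<^sup>L lborel (%x::real^'d. Re (bump x))" by (intro Bochner_Integration.integral_nonneg bump_nonneg)
 ultimately show ?thesis by simp
qed

lemma lborel_integral_scale:
 fixes f :: "'a::euclidean_space => 'b::{banach, second_countable_topology}"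
 assumes "f \<in> borel_measurable borel" "c ~= 0"
 shows "(LI x. f x) = \<bar>c\<bar> ^ DIM('a) *\<^sub>R (LI x. f (t + c *\<^sub>R x))"
  and "integrable lborel f \<longleftrightarrow> integrable lborel (%x. f (t + c *\<^sub>R x))"
proof -
 have eq: "(lborel :: 'a measure) = density (distr lborel borel (%x. t + c *\<^sub>R x)) (%_. ennreal (\<bar>c\<bar> ^ DIM('a)))"
  using lborel_affine[OF assms(2), of t] by (simp add: ennreal_power)
 have m: "(%x. t + c *\<^sub>R x) \<in> measurable lborel (borel :: 'a measure)" by simp
 have "(LI x. f x) = (\<integral>x. f x \<partial>density (distr lborel borel (%x. t + c *\<^sub>R x)) (%_. ennreal (\<bar>c\<bar> ^ DIM('a))))"
  using eq by simp
 also have "... = (\<integral>x. \<bar>c\<bar> ^ DIM('a) *\<^sub>R f x \<partial>distr lborel borel (%x. t + c *\<^sub>R x))"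
  using assms by (subst integral_density) auto
 also have "... = (LI x. \<bar>c\<bar> ^ DIM('a) *\<^sub>R f (t + c *\<^sub>R x))"
  using assms by (subst integral_distr) auto
 finally show "(LI x. f x) = \<bar>c\<bar> ^ DIM('a) *\<^sub>R (LI x. f (t + c *\<^sub>R x))" by simp
 have "integrable lborel f \<longleftrightarrow> integrable (density (distr lborel borel (%x. t + c *\<^sub>R x)) (%_. ennreal (\<bar>c\<bar> ^ DIM('a)))) f"
  using eq by simp
 also have "... \<longleftrightarrow> integrable (distr lborel borel (%x. t + c *\<^sub>R x)) (%x. \<bar>c\<bar> ^ DIM('a) *\<^sub>R f x)"
  using assms by (subst integrable_density) auto
 also have "... \<longleftrightarrow> integrable lborel (%x. \<bar>c\<bar> ^ DIM('a) *\<^sub>R f (t + c *\<^sub>R x))"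
  using assms by (subst integrable_distr_eq) auto
 also have "... \<longleftrightarrow> integrable lborel (%x. f (t + c *\<^sub>R x))"
 proof
  assume "integrable lborel (%x. \<bar>c\<bar> ^ DIM('a) *\<^sub>R f (t + c *\<^sub>R x))"
  from integrable_scaleR_right[OF this, of "1 / \<bar>c\<bar> ^ DIM('a)"] show "integrable lborel (%x. f (t + c *\<^sub>R x))"
   using assms(2) by simp
 qed (rule integrable_scaleR_right)
 finally show "integrable lborel f \<longleftrightarrow> integrable lborel (%x. f (t + c *\<^sub>R x))" .
qed

section \<open>Mollifiers\<close>

definition moll_const :: "'d::finite itself => real => real"
 where "moll_const _ e = 1 / (e ^ CARD('d) * integral\<^sup>L lborel (%x::real^'d. Re (bump x)))"

definition moll :: "real => real ^ 'd::finite => complex"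
 where "moll e x = cr (moll_const TYPE('d) e) * bump ((1 / e) *\<^sub>R x)"

lemma moll_const_pos: "e > 0 ==> moll_const TYPE('d::finite) e > 0"
 using bump_integral_pos[where 'd = 'd] by (simp add: moll_const_def)

lemma moll_test: "e > 0 ==> moll e \<in> tf UNIV"
 unfolding moll_def[abs_def] using test_cmult[OF test_compose_affine(1)[OF bump_test, of "1 / e" 0]] by simp

lemma moll_eq_0: "e > 0 ==> norm x \<ge> e ==> moll e x = 0"
 by (simp add: moll_def bump_eq_0)

lemma moll_support: "e > 0 ==> supp (moll e) <= cball 0 e"
 by (rule supp_subset) (auto intro: moll_eq_0)

lemma moll_even: "moll e (- x) = moll e x"
 using bump_even[of "(1 / e) *\<^sub>R x"] by (simp add: moll_def)

lemma cmod_moll: "e > 0 ==> cr (cmod (moll e x)) = moll e x"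
proof -
 assume e: "e > 0"
 obtain r where r: "bump ((1 / e) *\<^sub>R x) = cr r" "r \<ge> 0"
  using bump_real bump_nonneg by blast
 have "cmod (moll e x) = moll_const TYPE('a) e * r"
  unfolding moll_def r(1) norm_mult norm_of_real using r(2) moll_const_pos[OF e, where 'd = 'a] by simp
 thus ?thesis unfolding moll_def r(1) by simp
qed

lemma integral_moll:
 assumes e: "e > 0"
 shows "integral\<^sup>L lborel (moll e :: real ^ 'd::finite => complex) = 1"
proof -
 have m: "(bump :: real ^ 'd => complex) \<in> borel_measurable borel"
  by (intro cont_bm test_continuous[OF bump_test])
 let ?I = "integral\<^sup>L lborel (%x::real^'d. Re (bump x))"
 have I: "?I > 0" by (rule bump_integral_pos)
 have "integral\<^sup>L lborel (bump :: real ^ 'd => complex) = integral\<^sup>L lborel (%x::real^'d. cr (Re (bump x)))"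
  using bump_real by metis
 also have "... = cr ?I" by (rule integral_complex_of_real)
 finally have 1: "integral\<^sup>L lborel (bump :: real ^ 'd => complex) = cr ?I" .
 have "integral\<^sup>L lborel (bump :: real ^ 'd => complex) = \<bar>1 / e\<bar> ^ DIM(real^'d) *\<^sub>R (LI x. bump (0 + (1 / e) *\<^sub>R (x::real^'d)))"
  using e m by (intro lborel_integral_scale(1)) auto
 with 1 have 2: "cr ?I = cr ((1 / e) ^ CARD('d)) * (LI x. bump ((1 / e) *\<^sub>R (x::real^'d)))"
  using e by (simp add: scaleR_conv_of_real[where 'a=complex])
 have "integral\<^sup>L lborel (moll e :: real ^ 'd => complex) = cr (moll_const TYPE('d) e) * (LI x. bump ((1 / e) *\<^sub>R (x::real^'d)))"
  unfolding moll_def by simp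
 also have "cr (moll_const TYPE('d) e) = cr ((1 / e) ^ CARD('d)) / cr ?I"
  by (simp add: moll_const_def power_divide)
 finally have "integral\<^sup>L lborel (moll e :: real ^ 'd => complex) = cr ?I / cr ?I"
  unfolding 2 by simp
 thus ?thesis using I by simp
qed

lemma integral_cmod_moll:
 assumes e: "e > 0"
 shows "integral\<^sup>L lborel (%x. cmod (moll e (x :: real ^ 'd::finite))) = 1"
proof -
 have "cr (integral\<^sup>L lborel (%x. cmod (moll e (x :: real ^ 'd)))) = integral\<^sup>L lborel (moll e :: real ^ 'd => complex)"
  unfolding integral_complex_of_real[symmetric] using cmod_moll[OF e] by metis
 thus ?thesis unfolding integral_moll[OF e] by (simp only: of_real_eq_1_iff)
qed

lemma DL_bounded_all:
 assumes "f \<in> tf UNIV"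
 obtains M where "M > 0" "!!vs y. length vs <= r ==> (!!v. v \<in> set vs ==> norm v <= 1) ==> cmod (DL vs f y) <= M"
proof -
 let ?S = "sn (supp f) r f" and ?N = "real CARD('a)"
 have sm: "smooth_on UNIV f" and cp: "compact (supp f)" using assms by (auto simp: tf_iff)
 have S: "0 <= ?S" using sn_nonneg[OF open_UNIV cp _ sm] by auto
 have N: "1 <= ?N" by (simp add: Suc_leI)
 have "cmod (DL vs f y) <= ?N ^ r * ?S + 1" if "length vs <= r" "!!v. v \<in> set vs ==> norm v <= 1" for vs y
 proof (cases "y \<in> supp f")
  case True
  have "cmod (DL vs f y) <= ?N ^ length vs * ?S"
   using DL_le_seminorm[OF open_UNIV cp _ sm True that] by auto
  also have "... <= ?N ^ r * ?S"
   using N S that by (intro mult_right_mono power_increasing)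
  finally show ?thesis by simp
 next
  case False
  thus ?thesis using S by (simp add: DL_outside_support)
 qed
 moreover have "?N ^ r * ?S + 1 > 0" using S by (simp add: add_nonneg_pos)
 ultimately show ?thesis using that by blast
qed

section \<open>Elementary properties of distributions and the smoothness of their
  mollifications\<close>

lemma distributions_bound:
 assumes "u \<in> distributions X" "compact K" "K <= X"
 obtains C r where "C \<ge> 0" "!!f. f \<in> tf X ==> supp f <= K ==> cmod (u f) <= C * sn K r f"
proof -
 obtain C r where C: "!!f. f \<in> tf X ==> supp f <= K ==> cmod (u f) <= C * sn K r f"
  using assms unfolding distributions_def mem_Collect_eq by metis
 have "cmod (u f) <= \<bar>C\<bar> * sn K r f" if "f \<in> tf X" "supp f <= K" for f
 proof -
  have "0 <= sn K r f"
   using sn_nonneg[OF open_UNIV assms(2) _ test_smooth[OF that(1)]] by auto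
  thus ?thesis using C[OF that] by (smt (verit) mult_right_mono)
 qed
 thus ?thesis using that[of "\<bar>C\<bar>" r] by auto
qed

lemma distributions_add: "u \<in> distributions X ==> f \<in> tf X ==> g \<in> tf X ==> u (%x. f x + g x) = u f + u g"
 and distributions_cmult: "u \<in> distributions X ==> f \<in> tf X ==> u (%x. c * f x) = c * u f"
 by (auto simp: distributions_def)

lemma distributions_0: "u \<in> distributions X ==> u (%x. 0) = 0"
 using distributions_cmult[OF _ test_zero, of u X 0] by simp

lemma distributions_diff: "u \<in> distributions X ==> f \<in> tf X ==> g \<in> tf X ==> u (%x. f x - g x) = u f - u g"
 using distributions_add[of u X f "%x. (-1) * g x"] distributions_cmult[of u X g "-1"] test_cmult[of g X "-1"] by simp

lemma distributions_sum: "u \<in> distributions X ==> (!!i. i \<in> I ==> f i \<in> tf X) ==> u (%x. \<Sum>i\<in>I. f i x) = (\<Sum>i\<in>I. u (f i))"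
proof (induction I rule: infinite_finite_induct)
 case (insert i I)
 thus ?case using distributions_add[OF insert.prems(1), of "f i" "%x. \<Sum>i\<in>I. f i x"] test_sum[of I f X] by simp
qed (auto simp: distributions_0)

lemma compact_difference_set: "compact A ==> compact B ==> compact {x - y |x y. x \<in> A & y \<in> B}" for A B :: "'a::real_normed_vector set"
proof -
 assume "compact A" "compact B"
 hence "compact ((%(x, y). x - y) ` (A \<times> B))"
  by (intro compact_continuous_image compact_Times) (auto simp: split_def intro!: continuous_intros)
 moreover have "(%(x, y). x - y) ` (A \<times> B) = {x - y |x y. x \<in> A & y \<in> B}" by auto
 ultimately show ?thesis by simp
qed

lemma has_vector_derivative_quadratic:
 assumes "de > 0" "!!t. \<bar>t\<bar> < de ==> norm (f t - f 0 - t *\<^sub>R d) <= C * t\<^sup>2"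
 shows "(f has_vector_derivative d) (at 0)"
 unfolding has_vector_derivative_def has_derivative_at_alt
proof (intro conjI allI impI)
 fix e :: real assume e: "e > 0"
 have C: "0 <= \<bar>C\<bar> + 1" "C <= \<bar>C\<bar> + 1" by auto
 show "\<exists>d'>0. \<forall>t. norm (t - 0) < d' --> norm (f t - f 0 - (t - 0) *\<^sub>R d) <= e * norm (t - 0)"
 proof (intro exI[of _ "min de (e / (\<bar>C\<bar> + 1))"] conjI allI impI)
  fix t :: real assume "norm (t - 0) < min de (e / (\<bar>C\<bar> + 1))"
  hence t: "\<bar>t\<bar> < de" "\<bar>t\<bar> * (\<bar>C\<bar> + 1) <= e" by (auto simp: pos_less_divide_eq)
  have "norm (f t - f 0 - t *\<^sub>R d) <= (\<bar>C\<bar> + 1) * t\<^sup>2"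
   using assms(2)[OF t(1)] mult_right_mono[OF C(2), of "t\<^sup>2"] by simp
  also have "... = (\<bar>t\<bar> * (\<bar>C\<bar> + 1)) * \<bar>t\<bar>" by (simp add: power2_eq_square abs_if)
  also have "... <= e * \<bar>t\<bar>" using t(2) by (intro mult_right_mono) auto
  finally show "norm (f t - f 0 - (t - 0) *\<^sub>R d) <= e * norm (t - 0)" by simp
 qed (use assms e in auto)
qed (rule bounded_linear_scaleR_left)

text \<open>Mollification: \<open>u \<^emph> \<rho>\<close> is the function \<open>x \<mapsto> u (\<rho> (x - \<cdot>))\<close>.\<close>

lemma trans_test:
 assumes "r \<in> tf UNIV" "!!y. y \<in> supp r ==> x - y \<in> X"
 shows "(%y. r (x - y)) \<in> tf X"
proof -
 have "y \<in> X" if "x - y \<in> supp r" for y using assms(2)[OF that] by simp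
 thus ?thesis
  using test_reflect_translate(1,2)[OF assms(1), of x] unfolding tf_support[of _ X] by auto
qed

context
 fixes u :: "(real ^ 'd::finite => complex) => complex" and X :: "(real ^ 'd) set"
 assumes u: "u \<in> distributions X"
begin

text \<open>Continuity of \<open>u\<close> on functions supported in \<open>K\<close> reduces the
  remainders of the mollification to seminorms of order \<open>r\<close> of the remainders of the
  kernel; first and second order remainders of such derivatives involve derivatives of
  \<open>r'\<close> up to order \<open>r + 2\<close>.\<close>

lemma mollify_estimates:
 assumes r': "r' \<in> tf UNIV" and K: "compact K" "K <= X"
 obtains M where "M \<ge> 0"
  "!!x x'. {x - y |y. y \<in> supp r'} <= K ==> {x' - y |y. y \<in> supp r'} <= K ==>
   cmod (u (%y. r' (x' - y)) - u (%y. r' (x - y))) <= M * norm (x' - x)"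
  "!!x t v. norm v <= 1 ==> {x - y |y. y \<in> supp r'} <= K ==> {x + t *\<^sub>R v - y |y. y \<in> supp r'} <= K ==>
   cmod (u (%y. r' (x + t *\<^sub>R v - y)) - u (%y. r' (x - y)) - cr t * u (%y. dd v r' (x - y))) <= M * t\<^sup>2"
proof -
 obtain C r where C: "C \<ge> 0" "!!f. f \<in> tf X ==> supp f <= K ==> cmod (u f) <= C * sn K r f"
  using distributions_bound[OF u K] by blast
 obtain M where M: "M > 0" "!!vs y. length vs <= r + 2 ==> (!!v. v \<in> set vs ==> norm v <= 1) ==> cmod (DL vs r' y) <= M"
  using DL_bounded_all[OF r', of "r + 2"] by blast
 have mv: "length (mvecs al) <= r" "!!v. v \<in> set (mvecs al) ==> norm v <= 1" if "mi_size al <= r" for al :: "nat ^ 'd"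
  using that norm_mvecs[of _ al] by (auto simp: length_mvecs)
 have T: "(%y. r'' (x - y)) \<in> tf X" "supp (%y. r'' (x - y)) <= K"
  if x: "{x - y |y. y \<in> supp r'} <= K" and r'': "r'' \<in> tf UNIV" "supp r'' <= supp r'" for x r''
 proof -
  have 1: "y \<in> K" if "x - y \<in> supp r''" for y
  proof -
   have "y = x - (x - y)" by simp
   thus ?thesis using x that r''(2) by blast
  qed
  thus "supp (%y. r'' (x - y)) <= K" using test_reflect_translate(2)[OF r''(1), of x] by auto
  thus "(%y. r'' (x - y)) \<in> tf X" using test_reflect_translate(1)[OF r''(1), of x] K(2) unfolding tf_support[of _ X] by auto
 qed
 have sm: "smooth_on UNIV r'" using r' by (rule test_smooth)
 have smt: "smooth_on UNIV (%y. r'' (x - y))" if "r'' \<in> tf UNIV" for r'' and x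
  using test_smooth[OF test_reflect_translate(1)[OF that]] .
 have DLt: "multi_deriv al (%y. r'' (x - y)) y = (-1) ^ mi_size al * DL (mvecs al) r'' (x - y)" if "r'' \<in> tf UNIV" for al r'' x y
  using test_reflect_translate(3)[OF that] by (simp add: multi_deriv_DL length_mvecs)
 show ?thesis
 proof (rule that[of "C * M"])
  show "C * M \<ge> 0" using C M by simp
  fix x x' assume x: "{x - y |y. y \<in> supp r'} <= K" "{x' - y |y. y \<in> supp r'} <= K"
  \<comment> \<open>The unit direction from \<open>x\<close> to \<open>x'\<close>, with 0 as a
    default when the points coincide.\<close>
  define v where "v = (if x' = x then 0 else (1 / norm (x' - x)) *\<^sub>R (x' - x))"
  have v: "norm v <= 1" "x' = x + norm (x' - x) *\<^sub>R v" by (auto simp: v_def)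
  have "sn K r (%y. r' (x' - y) - r' (x - y)) <= M * norm (x' - x)"
  proof (rule sn_le)
   fix al :: "nat ^ 'd" and y assume a: "mi_size al <= r"
   have "multi_deriv al (%y. r' (x' - y) - r' (x - y)) y = (-1) ^ mi_size al * (DL (mvecs al) r' (x' - y) - DL (mvecs al) r' (x - y))"
    unfolding multi_deriv_DL DL_diff[OF open_UNIV smt[OF r'] smt[OF r'] UNIV_I] using DLt[OF r']
    by (simp add: multi_deriv_DL right_diff_distrib)
   moreover have "x' - y = (x - y) + norm (x' - x) *\<^sub>R v" using v(2) by (simp add: algebra_simps)
   moreover have "cmod (DL (mvecs al) r' ((x - y) + norm (x' - x) *\<^sub>R v) - DL (mvecs al) r' (x - y)) <= M * \<bar>norm (x' - x)\<bar>"
   proof (rule line_bound)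
    show "cmod (dd v (DL (mvecs al) r') z) <= M" for z
     using M(2)[of "v # mvecs al" z] mv[OF a] v(1) by auto
   qed (intro smooth_on_DL open_UNIV sm)
   ultimately show "cmod (multi_deriv al (%y. r' (x' - y) - r' (x - y)) y) <= M * norm (x' - x)"
    by (simp add: norm_mult norm_power)
  qed (use M in simp)
  moreover have "(%y. r' (x' - y) - r' (x - y)) \<in> tf X" "supp (%y. r' (x' - y) - r' (x - y)) <= K"
  proof -
   show "(%y. r' (x' - y) - r' (x - y)) \<in> tf X" using T[OF x(1) r'] T[OF x(2) r'] by (intro test_diff) auto
   show "supp (%y. r' (x' - y) - r' (x - y)) <= K"
   proof (rule supp_subset)
    fix y assume "y \<notin> K"
    hence "y \<notin> supp (%y. r' (x' - y))" "y \<notin> supp (%y. r' (x - y))" using T(2)[OF x(1) r'] T(2)[OF x(2) r'] by auto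
    hence "(%y. r' (x' - y)) y = 0" "(%y. r' (x - y)) y = 0" using not_supp by metis+
    thus "r' (x' - y) - r' (x - y) = 0" by simp
   qed (rule compact_imp_closed[OF K(1)])
  qed
  ultimately have "cmod (u (%y. r' (x' - y) - r' (x - y))) <= C * (M * norm (x' - x))"
   using C(2) mult_left_mono[OF _ C(1)] order_trans by meson
  thus "cmod (u (%y. r' (x' - y)) - u (%y. r' (x - y))) <= C * M * norm (x' - x)"
   using distributions_diff[OF u T(1)[OF x(2) r'] T(1)[OF x(1) r']] by (simp add: mult.assoc)
 next
  fix x t v assume v: "norm v <= 1" and x: "{x - y |y. y \<in> supp r'} <= K" "{x + t *\<^sub>R v - y |y. y \<in> supp r'} <= K"
  have r'v: "dd v r' \<in> tf UNIV" "supp (dd v r') <= supp r'"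
   using test_DL[OF r', of "[v]"] supp_DL[of "[v]" r'] by auto
  let ?h = "%y. r' (x + t *\<^sub>R v - y) - r' (x - y) - cr t * dd v r' (x - y)"
  have "sn K r ?h <= M * t\<^sup>2"
  proof (rule sn_le)
   fix al :: "nat ^ 'd" and y assume a: "mi_size al <= r"
   let ?s = "DL (mvecs al) r'"
   have "DL (mvecs al) (dd v r') (x - y) = dd v ?s (x - y)"
    by (rule DL_dd_commute[OF open_UNIV sm UNIV_I])
   hence "multi_deriv al ?h y = (-1) ^ mi_size al * (?s (x + t *\<^sub>R v - y) - ?s (x - y) - cr t * dd v ?s (x - y))"
    unfolding multi_deriv_DL DL_diff[OF open_UNIV smooth_on_diff[OF open_UNIV smt[OF r'] smt[OF r']] smooth_on_cmult[OF open_UNIV smt[OF r'v(1)]] UNIV_I]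
     DL_diff[OF open_UNIV smt[OF r'] smt[OF r'] UNIV_I] DL_cmult[OF open_UNIV smt[OF r'v(1)] UNIV_I]
    using DLt[OF r'] DLt[OF r'v(1)] by (simp add: multi_deriv_DL right_diff_distrib)
   moreover have "x + t *\<^sub>R v - y = (x - y) + t *\<^sub>R v" by simp
   moreover have "cmod (?s ((x - y) + t *\<^sub>R v) - ?s (x - y) - cr t * dd v ?s (x - y)) <= M * t\<^sup>2"
   proof (rule line_bound2)
    show "cmod (dd v (dd v ?s) z) <= M" for z
     using M(2)[of "v # v # mvecs al" z] mv[OF a] v by auto
   qed (intro smooth_on_DL open_UNIV sm)
   ultimately show "cmod (multi_deriv al ?h y) <= M * t\<^sup>2"
    by (simp add: norm_mult norm_power)
  qed (use M in simp)
  moreover have h1: "(%y. r' (x + t *\<^sub>R v - y) - r' (x - y)) \<in> tf X" "(%y. cr t * dd v r' (x - y)) \<in> tf X"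
   using T[OF x(1) r'] T[OF x(2) r'] T[OF x(1) r'v] by (auto intro: test_diff test_cmult)
  moreover have "?h \<in> tf X" using h1 by (rule test_diff)
  moreover have "supp ?h <= K"
  proof (rule supp_subset)
   fix y assume "y \<notin> K"
   hence "y \<notin> supp (%y. r' (x + t *\<^sub>R v - y))" "y \<notin> supp (%y. r' (x - y))" "y \<notin> supp (%y. dd v r' (x - y))"
    using T(2)[OF x(1) r'] T(2)[OF x(2) r'] T(2)[OF x(1) r'v] by auto
   hence "(%y. r' (x + t *\<^sub>R v - y)) y = 0" "(%y. r' (x - y)) y = 0" "(%y. dd v r' (x - y)) y = 0" using not_supp by metis+
   thus "?h y = 0" by simp
  qed (rule compact_imp_closed[OF K(1)])
  ultimately have "cmod (u ?h) <= C * (M * t\<^sup>2)"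
   using C(2) mult_left_mono[OF _ C(1)] order_trans by meson
  moreover have "u ?h = u (%y. r' (x + t *\<^sub>R v - y)) - u (%y. r' (x - y)) - cr t * u (%y. dd v r' (x - y))"
   using distributions_diff[OF u h1] distributions_diff[OF u T(1)[OF x(2) r'] T(1)[OF x(1) r']] distributions_cmult[OF u T(1)[OF x(1) r'v]] by simp
  ultimately show "cmod (u (%y. r' (x + t *\<^sub>R v - y)) - u (%y. r' (x - y)) - cr t * u (%y. dd v r' (x - y))) <= C * M * t\<^sup>2"
   by (simp add: mult.assoc)
 qed
qed

lemma mollify_local:
 assumes r: "r \<in> tf UNIV" and G: "open G" "!!x y. x \<in> G ==> y \<in> supp r ==> x - y \<in> X" and x: "x \<in> G"
 shows "isCont (%x. u (%y. r (x - y))) x"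
  and "norm v <= 1 ==> ((%t. u (%y. r (x + t *\<^sub>R v - y))) has_vector_derivative u (%y. dd v r (x - y))) (at 0)"
proof -
 obtain de where de: "de > 0" "cball x de <= G" using G(1) x open_contains_cball by blast
 define K where "K = {a - b |a b. a \<in> cball x de & b \<in> supp r}"
 have K: "compact K" "K <= X"
  unfolding K_def using r de G(2) compact_difference_set[OF compact_cball[of x de], of "supp r"] by (auto simp: tf_iff)
 have KK: "{x' - y |y. y \<in> supp r} <= K" if "norm (x' - x) <= de" for x'
 proof -
  have "x' \<in> cball x de" using that by (simp add: dist_norm norm_minus_commute)
  thus ?thesis unfolding K_def by blast
 qed
 obtain M where M: "M \<ge> 0"
  "!!x x'. {x - y |y. y \<in> supp r} <= K ==> {x' - y |y. y \<in> supp r} <= K ==>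
   cmod (u (%y. r (x' - y)) - u (%y. r (x - y))) <= M * norm (x' - x)"
  "!!x t v. norm v <= 1 ==> {x - y |y. y \<in> supp r} <= K ==> {x + t *\<^sub>R v - y |y. y \<in> supp r} <= K ==>
   cmod (u (%y. r (x + t *\<^sub>R v - y)) - u (%y. r (x - y)) - cr t * u (%y. dd v r (x - y))) <= M * t\<^sup>2"
  by (rule mollify_estimates[OF r K], rule that)
 show "isCont (%x. u (%y. r (x - y))) x"
  unfolding isCont_def
 proof (rule LIM_zero_cancel, rule Lim_null_comparison)
  have "\<forall>\<^sub>F x' in at x. norm (x' - x) <= de"
   using de(1) eventually_at[of "%x'. norm (x' - x) <= de" x UNIV] by (auto simp: dist_norm intro!: exI[of _ de])
  thus "\<forall>\<^sub>F x' in at x. norm (u (%y. r (x' - y)) - u (%y. r (x - y))) <= M * norm (x' - x)"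
   by (rule eventually_mono) (use de in \<open>intro M KK, auto\<close>)
  have "((%x'. M * norm (x' - x)) \<longlongrightarrow> M * norm (x - x)) (at x)" by (intro tendsto_intros)
  thus "((%x'. M * norm (x' - x)) \<longlongrightarrow> 0) (at x)" by simp
 qed
 assume v: "norm v <= 1"
 show "((%t. u (%y. r (x + t *\<^sub>R v - y))) has_vector_derivative u (%y. dd v r (x - y))) (at 0)"
 proof (rule has_vector_derivative_quadratic[OF de(1)])
  fix t assume t: "\<bar>t\<bar> < de"
  have "norm (t *\<^sub>R v) <= de" using t v mult_mono[of "\<bar>t\<bar>" de "norm v" 1] de(1) by simp
  thus "norm (u (%y. r (x + t *\<^sub>R v - y)) - u (%y. r (x + 0 *\<^sub>R v - y)) - t *\<^sub>R u (%y. dd v r (x - y))) <= M * t\<^sup>2"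
   using M(3)[OF v KK[of x] KK[of "x + t *\<^sub>R v"]] de(1) by (simp add: scaleR_conv_of_real[where 'a=complex])
 qed
qed

text \<open>For points of \<open>G\<close> the translated kernel lies in \<open>X\<close>.
  Derivatives fall on the kernel, which stays a test function with no larger support, so the
  argument can be iterated.\<close>

lemma mollify_smooth:
 assumes r: "r \<in> tf UNIV" and G: "open G" "!!x y. x \<in> G ==> y \<in> supp r ==> x - y \<in> X"
 shows "smooth_on G (%x. u (%y. r (x - y)))"
  and "x \<in> G ==> DL vs (%x. u (%y. r (x - y))) x = u (%y. DL vs r (x - y))"
proof -
 have "C_on k G (%x. u (%y. r (x - y)))" if "r \<in> tf UNIV" "!!x y. x \<in> G ==> y \<in> supp r ==> x - y \<in> X" for k r
  using that
 proof (induction k arbitrary: r)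
  case 0
  thus ?case using mollify_local(1)[OF 0(1) G(1) 0(2)] by (simp add: continuous_at_imp_continuous_on)
 next
  case (Suc k)
  show ?case
  proof (rule C_on_SucI[OF G(1), where g = "%j x. u (%y. dd (ax j) r (x - y))"])
   show "continuous_on G (%x. u (%y. r (x - y)))"
    using mollify_local(1)[OF Suc.prems(1) G(1) Suc.prems(2)] by (simp add: continuous_at_imp_continuous_on)
   show "((%t. u (%y. r (x + t *\<^sub>R ax j - y))) has_vector_derivative u (%y. dd (ax j) r (x - y))) (at 0)" if "x \<in> G" for j x
    by (rule mollify_local(2)[OF Suc.prems(1) G(1) Suc.prems(2) that]) auto
   show "C_on k G (%x. u (%y. dd (ax j) r (x - y)))" for j
    using test_DL[OF Suc.prems(1), of "[ax j]"] supp_DL[of "[ax j]" r] Suc.prems(2)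
    by (intro Suc.IH) auto
  qed
 qed
 thus "smooth_on G (%x. u (%y. r (x - y)))"
  using assms unfolding smooth_on_def by blast
 have dd: "dd v (%x. u (%y. r (x - y))) x = u (%y. dd v r (x - y))" if r: "r \<in> tf UNIV" "!!x y. x \<in> G ==> y \<in> supp r ==> x - y \<in> X" and x: "x \<in> G" for r v x
 proof -
  have P: "pd j (%x. u (%y. r (x - y))) x = u (%y. pd j r (x - y))" for j
   using mollify_local(2)[OF r(1) G(1) r(2) x, of "ax j"] by (intro pd_eqI) simp
  have tj: "(%y. pd j r (x - y)) \<in> tf X" for j
   using test_DL[OF r(1), of "[ax j]"] supp_DL[of "[ax j]" r] r(2)[OF x] by (intro trans_test) auto
  have "u (%y. dd v r (x - y)) = (\<Sum>j\<in>UNIV. u (%y. cr (v $ j) * pd j r (x - y)))"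
   unfolding dd_def using tj by (intro distributions_sum[OF u] test_cmult)
  thus ?thesis
   unfolding dd_def P using distributions_cmult[OF u tj] by simp
 qed
 show "DL vs (%x. u (%y. r (x - y))) x = u (%y. DL vs r (x - y))" if "x \<in> G"
  using that
 proof (induction vs arbitrary: x)
  case (Cons v vs)
  have "DL (v # vs) (%x. u (%y. r (x - y))) x = dd v (%x. u (%y. DL vs r (x - y))) x"
   unfolding DL_Cons using Cons by (intro dd_cong[OF G(1)]) auto
  also have "... = u (%y. dd v (DL vs r) (x - y))"
   using test_DL[OF r] supp_DL[of vs r] G(2) Cons.prems by (intro dd) auto
  finally show ?case by simp
 qed auto
qed

end

section \<open>Convolution\<close>

lemma integrable_mult_bounded:
 fixes g h :: "'a => complex"
 assumes "integrable M g" "h \<in> borel_measurable M" "!!x. cmod (h x) <= B"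
 shows "integrable M (%x. g x * h x)" "cmod (\<integral>x. g x * h x \<partial>M) <= (\<integral>x. cmod (g x) \<partial>M) * B"
proof -
 have m: "(%x. g x * h x) \<in> borel_measurable M"
  by (rule borel_measurable_times[OF borel_measurable_integrable[OF assms(1)] assms(2)])
 have i: "integrable M (%x. cmod (g x) * B)" using assms(1) by simp
 have le: "cmod (g x * h x) <= cmod (g x) * B" for x
  unfolding norm_mult using assms(3)[of x] by (intro mult_left_mono) auto
 show *: "integrable M (%x. g x * h x)"
 proof (rule Bochner_Integration.integrable_bound[OF i m], rule AE_I2)
  fix x show "norm (g x * h x) <= norm (cmod (g x) * B)"
   using le[of x] by (simp only: real_norm_def)
 qed
 have "cmod (\<integral>x. g x * h x \<partial>M) <= (\<integral>x. cmod (g x * h x) \<partial>M)" by (rule integral_norm_bound)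
 also have "... <= (\<integral>x. cmod (g x) * B \<partial>M)"
  using * i le by (intro integral_mono integrable_norm)
 finally show "cmod (\<integral>x. g x * h x \<partial>M) <= (\<integral>x. cmod (g x) \<partial>M) * B" by simp
qed

definition loc_int :: "(real ^ 'd::finite) set => (real ^ 'd => complex) => bool"
 where "loc_int X f \<longleftrightarrow> (\<forall>K. compact K & K <= X --> integrable lborel (%x. indicator K x *\<^sub>R f x))"

definition reg :: "(real ^ 'd::finite) set => (real ^ 'd => complex) => (real ^ 'd => complex) => complex"
 where "reg X f = (\<lambda>g\<in>tf X. LI x. f x * g x)"

lemma loc_int_continuous: "continuous_on X f ==> loc_int X f"
 unfolding loc_int_def using borel_integrable_compact continuous_on_subset by blast

lemma loc_int_integrable: "integrable lborel f ==> loc_int X f"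
 unfolding loc_int_def by (auto intro!: integrable_mult_indicator simp: borel_compact)

lemma loc_int_test:
 assumes f: "loc_int X f" and g: "g \<in> tf X"
 shows "integrable lborel (%x. f x * g x)"
  and "compact K ==> K <= X ==> supp g <= K ==> (!!x. cmod (g x) <= B) ==>
   cmod (LI x. f x * g x) <= (LI x. cmod (indicator K x *\<^sub>R f x)) * B"
proof -
 have eq: "f x * g x = (indicator K x *\<^sub>R f x) * g x" if "supp g <= K" for K x
  using not_supp[of x g] that by (auto simp: indicator_def)
 have m: "g \<in> borel_measurable lborel"
  using test_continuous[OF g] by (simp add: cont_bm)
 {
  fix K B assume K: "compact K" "K <= X" "supp g <= K" "!!x. cmod (g x) <= B"
  have e: "(%x. f x * g x) = (%x. (indicator K x *\<^sub>R f x) * g x)" by (rule ext) (rule eq[OF K(3)])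
  have i: "integrable lborel (%x. indicator K x *\<^sub>R f x)" using f K(1,2) unfolding loc_int_def by blast
  have "integrable lborel (%x. f x * g x)"
    "cmod (LI x. f x * g x) <= (LI x. cmod (indicator K x *\<^sub>R f x)) * B"
   unfolding e by (rule integrable_mult_bounded[OF i m K(4)])+
 } note * = this
 obtain B0 where "!!x. cmod (g x) <= B0" using DL_bounded[OF tf_UNIV[OF g], of "[]"] by auto
 thus "integrable lborel (%x. f x * g x)"
  using g by (intro *(1)[of "supp g" B0]) (auto simp: tf_iff)
 show "compact K ==> K <= X ==> supp g <= K ==> (!!x. cmod (g x) <= B) ==>
   cmod (LI x. f x * g x) <= (LI x. cmod (indicator K x *\<^sub>R f x)) * B"
  by (rule *(2))
qed

lemma test_le_seminorm:
 assumes "f \<in> tf X" "compact K" "supp f <= K"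
 shows "cmod (f x) <= sn K r f"
proof (cases "x \<in> K")
 case True
 thus ?thesis
  using DL_axes_le_seminorm[OF open_UNIV assms(2) _ test_smooth[OF assms(1)], of x "[]" r] by simp
next
 case False
 hence "f x = 0" using assms(3) not_supp by blast
 thus ?thesis using sn_nonneg[OF open_UNIV assms(2) _ test_smooth[OF assms(1)]] by simp
qed

lemma reg_distribution:
 assumes f: "loc_int X f"
 shows "reg X f \<in> distributions X"
 unfolding distributions_def mem_Collect_eq
proof (intro conjI ballI allI impI)
 show "reg X f \<in> extensional (tf X)" by (simp add: reg_def)
 fix g assume g: "g \<in> tf X"
 show "reg X f (%x. g x + h x) = reg X f g + reg X f h" if "h \<in> tf X" for h
  using g that loc_int_test(1)[OF f] by (simp add: reg_def test_add distrib_left)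
 show "reg X f (%x. c * g x) = c * reg X f g" for c
  using g by (simp add: reg_def test_cmult mult.left_commute)
next
 fix K assume K: "compact K & K <= X"
 show "\<exists>C r. \<forall>g\<in>tf X. supp g <= K --> cmod (reg X f g) <= C * sn K r g"
 proof (intro exI ballI impI)
  fix g assume "g \<in> tf X" "supp g <= K"
  thus "cmod (reg X f g) <= (LI x. cmod (indicator K x *\<^sub>R f x)) * sn K 0 g"
   using K loc_int_test(2)[OF f, of g K "sn K 0 g"] test_le_seminorm[of g X K _ 0] by (simp add: reg_def)
 qed
qed

subsection \<open>Convolution\<close>

definition conv :: "(real ^ 'd::finite => complex) => (real ^ 'd => complex) => real ^ 'd => complex"
 where "conv f r x = (LI y. f y * r (x - y))"

text \<open>Convolution is the mollification of a regular distribution, so smoothness of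
  convolutions with locally integrable functions comes from \<open>mollify_smooth\<close>.\<close>

lemma reg_translate:
 "r \<in> tf UNIV ==> reg UNIV f (%y. r (x - y)) = conv f r x"
 using test_reflect_translate(1)[of r x] by (simp add: reg_def conv_def)

lemma conv_smooth:
 assumes "loc_int UNIV f" "r \<in> tf UNIV"
 shows "smooth_on UNIV (conv f r)" "DL vs (conv f r) x = conv f (DL vs r) x"
proof -
 have eq: "conv f r = (%x. reg UNIV f (%y. r (x - y)))"
  by (simp add: reg_translate[OF assms(2)] fun_eq_iff)
 show "smooth_on UNIV (conv f r)"
  unfolding eq by (rule mollify_smooth(1)[OF reg_distribution[OF assms(1)] assms(2) open_UNIV]) auto
 show "DL vs (conv f r) x = conv f (DL vs r) x"
  unfolding eq reg_translate[OF test_DL[OF assms(2)], symmetric]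
  by (rule mollify_smooth(2)[OF reg_distribution[OF assms(1)] assms(2) open_UNIV]) auto
qed

lemma conv_eq_0:
 assumes "!!y. y \<notin> A ==> f y = 0" "!!y. y \<notin> B ==> r y = 0" "!!a b. a \<in> A ==> b \<in> B ==> x ~= a + b"
 shows "conv f r x = 0"
proof -
 have "f y * r (x - y) = 0" for y
  using assms(1)[of y] assms(2)[of "x - y"] assms(3)[of y "x - y"] by auto
 hence "(%y. f y * r (x - y)) = (%y. 0)" by (rule ext)
 thus ?thesis unfolding conv_def by simp
qed

lemma conv_test:
 assumes "loc_int UNIV f" "r \<in> tf UNIV" "compact A" "!!y. y \<notin> A ==> f y = 0"
 shows "conv f r \<in> tf UNIV"
proof (rule test_funsI[of _ "{a + b |a b. a \<in> A & b \<in> supp r}"])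
 show "compact {a + b |a b. a \<in> A & b \<in> supp r}"
  using assms by (intro compact_sums) (auto simp: tf_iff)
 show "conv f r x = 0" if "x \<notin> {a + b |a b. a \<in> A & b \<in> supp r}" for x
  using that assms(4) by (intro conv_eq_0[of A _ "supp r"]) (auto intro: not_supp)
qed (use conv_smooth[OF assms(1,2)] in auto)

lemma conv_commute:
 assumes "f \<in> borel_measurable borel" "g \<in> borel_measurable borel"
 shows "conv f g x = conv g f x"
proof -
 have "conv f g x = \<bar>- 1\<bar> ^ DIM(real ^ 'a) *\<^sub>R (LI y. f (x + (- 1) *\<^sub>R y) * g (x - (x + (- 1) *\<^sub>R y)))"
  unfolding conv_def using assms by (intro lborel_integral_scale) auto
 thus ?thesis by (simp add: conv_def mult.commute)
qed

text \<open>The mollifier is nonnegative with integral 1, so the convolution is an average of the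
  values of \<open>f\<close> within distance \<open>e\<close> of \<open>x\<close>.\<close>

lemma conv_moll_approx:
 assumes e: "e > 0" and f: "continuous_on UNIV f" and w: "!!y. norm y <= e ==> cmod (f (x - y) - f x) <= om"
 shows "cmod (conv f (moll e) x - f x) <= om"
proof -
 have fm: "f \<in> borel_measurable borel" using f by (rule cont_bm)
 have mc: "continuous_on UNIV (moll e :: real ^ 'a => complex)" using test_continuous[OF moll_test[OF e]] .
 have mm: "(moll e :: real ^ 'a => complex) \<in> borel_measurable borel" using mc by (rule cont_bm)
 have mi: "integrable lborel (moll e :: real ^ 'a => complex)" by (rule test_integrable[OF moll_test[OF e]])
 have cont: "continuous_on UNIV (%y. f (x - y))"
  by (intro continuous_on_compose2[OF f] continuous_intros) auto
 have i1: "integrable lborel (%y. moll e y * f (x - y))"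
  by (rule integrable_compact_support[of _ "cball 0 e"]) (auto intro!: continuous_intros mc cont simp: moll_eq_0[OF e])
 have "conv f (moll e) x - f x = (LI y. moll e y * f (x - y)) - (LI y. moll e (y :: real ^ 'a) * f x)"
  using conv_commute[OF fm mm] integral_moll[OF e, where 'd = 'a] by (simp add: conv_def)
 also have "... = (LI y. moll e y * f (x - y) - moll e y * f x)"
  using i1 mi by simp
 also have "cmod ... <= (LI y. cmod (moll e y * f (x - y) - moll e y * f x))" by (rule integral_norm_bound)
 also have "... <= (LI y. cmod (moll e (y :: real ^ 'a)) * om)"
 proof (rule integral_mono)
  show "integrable lborel (%y. cmod (moll e y * f (x - y) - moll e y * f x))" using i1 mi by simp
  show "integrable lborel (%y. cmod (moll e (y :: real ^ 'a)) * om)" using mi by simp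
  fix y :: "real ^ 'a"
  have "cmod (moll e y * f (x - y) - moll e y * f x) = cmod (moll e y) * cmod (f (x - y) - f x)"
   by (simp add: norm_mult[symmetric] right_diff_distrib)
  also have "... <= cmod (moll e y) * om"
   using w[of y] moll_eq_0[OF e, of y] by (cases "norm y <= e") (auto intro: mult_left_mono)
  finally show "cmod (moll e y * f (x - y) - moll e y * f x) <= cmod (moll e y) * om" .
 qed
 also have "... = om" using integral_cmod_moll[OF e, where 'd = 'a] by simp
 finally show ?thesis .
qed

lemma test_lipschitz:
 assumes "f \<in> tf UNIV"
 obtains L where "L \<ge> 0" "!!x y. cmod (f x - f y) <= L * norm (x - y)"
proof -
 obtain M where M: "M > 0" "!!vs y. length vs <= 1 ==> (!!v. v \<in> set vs ==> norm v <= 1) ==> cmod (DL vs f y) <= M"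
  using DL_bounded_all[OF assms, of 1] by blast
 have "cmod (f x - f y) <= M * norm (x - y)" for x y
 proof (cases "x = y")
  case False
  define v where "v = (1 / norm (x - y)) *\<^sub>R (x - y)"
  have v: "norm v <= 1" "y + norm (x - y) *\<^sub>R v = x" using False by (auto simp: v_def)
  have "cmod (f (y + norm (x - y) *\<^sub>R v) - f y) <= M * \<bar>norm (x - y)\<bar>"
   using M(2)[of "[v]"] v by (intro line_bound test_smooth[OF assms]) auto
  thus ?thesis by (simp add: v)
 qed auto
 thus ?thesis using that M(1) less_imp_le by blast
qed

lemma conv_moll_DL_approx:
 assumes f: "f \<in> tf UNIV" and e: "e > 0" and vs: "length vs <= r" "!!v. v \<in> set vs ==> norm v <= 1"
  and M: "!!vs y. length vs <= r + 1 ==> (!!v. v \<in> set vs ==> norm v <= 1) ==> cmod (DL vs f y) <= M"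
 shows "cmod (DL vs (conv f (moll e)) x - DL vs f x) <= M * e"
proof -
 have M0: "0 <= M" by (rule order_trans[OF norm_ge_zero M[of "[]" undefined]]) auto
 have m: "f \<in> borel_measurable borel" "DL vs f \<in> borel_measurable borel" "(moll e :: real ^ 'a => complex) \<in> borel_measurable borel"
  by (intro cont_bm test_continuous[OF f] test_continuous[OF test_DL[OF f]] test_continuous[OF moll_test[OF e]])+
 have "DL vs (conv f (moll e)) x = DL vs (conv (moll e) f) x"
  by (rule DL_cong[OF open_UNIV]) (simp_all add: conv_commute[OF m(1,3)])
 also have "... = conv (DL vs f) (moll e) x"
  using conv_smooth(2)[OF loc_int_continuous[OF test_continuous[OF moll_test[OF e]]] f] conv_commute[OF m(2,3)] by simp
 finally have eq: "DL vs (conv f (moll e)) x = conv (DL vs f) (moll e) x" .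
 show ?thesis unfolding eq
 proof (rule conv_moll_approx[OF e])
  show "continuous_on UNIV (DL vs f)" using test_continuous[OF test_DL[OF f]] .
  fix y :: "real ^ 'a" assume y: "norm y <= e"
  define v where "v = (1 / norm y) *\<^sub>R (- y)"
  have v: "norm v <= 1" "x - y = x + norm y *\<^sub>R v" by (auto simp: v_def)
  have "cmod (DL vs f (x + norm y *\<^sub>R v) - DL vs f x) <= M * \<bar>norm y\<bar>"
   using M[of "v # vs"] vs v by (intro line_bound test_smooth[OF test_DL[OF f]]) auto
  also have "... <= M * e" using y M0 by (intro mult_left_mono) auto
  finally show "cmod (DL vs f (x - y) - DL vs f x) <= M * e" by (simp add: v(2))
 qed
qed

text \<open>In a cell contained in the ball of radius \<open>de\<close> around its tag a Lipschitz
  function differs from its value at the tag by at most \<open>L * de\<close>; the total error is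
  linear in the mesh.\<close>

lemma riemann_sum_error:
 fixes F :: "real ^ 'd::finite => complex"
 assumes F: "continuous_on UNIV F" "!!x. x \<notin> cbox a b ==> F x = 0"
  and L: "!!x y. cmod (F x - F y) <= L * norm (x - y)" "L \<ge> 0"
  and p: "p tagged_division_of cbox a b" "(%x. ball x de) fine p"
 shows "cmod ((LI x. F x) - (\<Sum>(x, k)\<in>p. measure lborel k *\<^sub>R F x)) <= L * de * measure lborel (cbox a b)"
proof -
 have io: "F integrable_on cbox a b" using F(1) by (intro integrable_continuous continuous_on_subset[OF F(1)]) auto
 have "integrable lborel F" using F by (intro integrable_compact_support[of _ "cbox a b"]) auto
 hence "(LI x. F x) = integral UNIV F" by (simp add: integral_lborel)
 also have "... = integral (cbox a b) F"
 proof -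
  have "(%x. if x \<in> cbox a b then F x else 0) = F" using F(2) by auto
  thus ?thesis using integral_restrict_UNIV[of "cbox a b" F] by simp
 qed
 also have "... = (\<Sum>(x, k)\<in>p. integral k F)"
  by (rule integral_combine_tagged_division_topdown[OF io p(1)])
 finally have "(LI x. F x) - (\<Sum>(x, k)\<in>p. measure lborel k *\<^sub>R F x) = (\<Sum>(x, k)\<in>p. integral k F - measure lborel k *\<^sub>R F x)"
  by (simp add: sum_subtractf case_prod_unfold)
 also have "cmod ... <= (\<Sum>(x, k)\<in>p. (L * de) * measure lborel k)"
 proof (rule sum_norm_le, clarify)
  fix x k assume xk: "(x, k) \<in> p"
  obtain c d where k: "k = cbox c d" "x \<in> k" using tagged_division_ofD(2,4)[OF p(1) xk] by auto
  have sub: "k <= ball x de" using p(2) xk by (auto simp: fine_def)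
  have de: "de > 0" using sub k(2) by (metis ball_eq_empty empty_iff not_le subset_empty)
  have iok: "F integrable_on k" unfolding k(1) by (intro integrable_continuous continuous_on_subset[OF F(1)]) auto
  have hk: "((%y. F y - F x) has_integral (integral k F - measure lborel k *\<^sub>R F x)) (cbox c d)"
   unfolding k(1)[symmetric] using has_integral_diff[OF integrable_integral[OF iok], of "%y. F x"] has_integral_const[of "F x" c d]
   unfolding k(1) by simp
  show "cmod (integral k F - measure lborel k *\<^sub>R F x) <= L * de * measure lborel k"
   unfolding k(1)
  proof (rule has_integral_bound[OF _ hk[unfolded k(1)]])
   show "0 <= L * de" using L(2) de by simp
   fix y assume "y \<in> cbox c d"
   hence "norm (y - x) <= de" using sub k(1) by (auto simp: dist_norm norm_minus_commute)
   thus "norm (F y - F x) <= L * de" using L(1)[of y x] mult_left_mono[OF _ L(2), of "norm (y - x)" de] by linarith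
  qed
 qed
 also have "... = L * de * measure lborel (cbox a b)"
  using additive_content_tagged_division[OF p(1)] unfolding case_prod_unfold sum_distrib_left[symmetric] by metis
 finally show ?thesis .
qed

text \<open>Riemann sums turn the integral into finite sums, to which linearity of \<open>u\<close> applies.\<close>

lemma mollify_pairing:
 assumes u: "u \<in> distributions X" and X: "open X" and m: "m \<in> tf UNIV" and s: "s \<in> tf UNIV" "!!x. m (- x) = s x"
  and f: "f \<in> tf UNIV" and sub: "!!x y. x \<in> supp f ==> y \<in> supp m ==> x - y \<in> X"
 shows "conv f s \<in> tf X" "u (conv f s) = (LI x. f x * u (%y. m (x - y)))"
  "supp (conv f s) <= {x - y |x y. x \<in> supp f & y \<in> supp m}"
proof -
 let ?g = "%x. u (%y. m (x - y))"
 define K where "K = {x - y |x y. x \<in> supp f & y \<in> supp m}"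
 have K: "compact K" "K <= X"
  unfolding K_def using m f sub by (auto simp: tf_iff intro!: compact_difference_set)
 have ev: "m (x - y) = s (y - x)" for x y using s(2)[of "y - x"] by simp
 have inK: "y \<in> K" if "x \<in> supp f" "s (y - x) ~= 0" for x y
 proof -
  have "x - y \<in> supp m" using that ev[of x y] not_supp[of "x - y" m] by auto
  moreover have "y = x - (x - y)" by simp
  ultimately show ?thesis unfolding K_def using that(1) by blast
 qed
 \<comment> \<open>The points whose translated kernel lies in \<open>X\<close>. The complement is
   the sum of a compact and a closed set, hence closed.\<close>
 define G where "G = - {a + b |a b. a \<in> supp m & b \<in> - X}"
 have G: "open G"
 proof -
  have "{a + b |a b. a \<in> supp m & b \<in> - X} = (\<Union>x\<in>supp m. \<Union>y\<in>- X. {x + y})" by auto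
  moreover have "closed (\<Union>x\<in>supp m. \<Union>y\<in>- X. {x + y})"
   using m X by (intro compact_closed_sums) (auto simp: tf_iff)
  ultimately have "closed {a + b |a b. a \<in> supp m & b \<in> - X}" by (simp only:)
  thus ?thesis unfolding G_def by (rule open_Compl)
 qed
 have GX: "x - y \<in> X" if "x \<in> G" "y \<in> supp m" for x y
 proof (rule ccontr)
  assume "x - y \<notin> X"
  hence "x = y + (x - y) & y \<in> supp m & x - y \<in> - X" using that by simp
  thus False using that(1) unfolding G_def by blast
 qed
 have fG: "f \<in> tf G"
  unfolding tf_support[of _ G]
 proof (intro conjI subsetI)
  fix x assume x: "x \<in> supp f"
  show "x \<in> G"
  proof (rule ccontr)
   assume "x \<notin> G"
   then obtain a b where "x = a + b" "a \<in> supp m" "b \<notin> X" unfolding G_def by auto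
   thus False using sub[OF x, of a] by simp
  qed
 qed (rule f)
 have sg: "smooth_on G ?g" by (rule mollify_smooth(1)[OF u m G GX])
 have fg: "(%x. f x * ?g x) \<in> tf UNIV"
  using tf_UNIV[OF test_mult[OF G sg fG]] by (simp add: mult.commute)
 have Kconv: "conv f s y = 0" if "y \<notin> K" for y
 proof (rule conv_eq_0[of "supp f" _ "supp s"])
  fix a b assume ab: "a \<in> supp f" "b \<in> supp s"
  show "y ~= a + b"
  proof
   assume y: "y = a + b"
   have "- b \<in> supp m"
    using ab(2) test_compose_affine(2)[OF m, of "-1" 0] s(2) by (auto simp: subset_iff)
   hence "y = a - (- b) & a \<in> supp f & - b \<in> supp m" using y ab(1) by simp
   hence "y \<in> K" unfolding K_def by blast
   thus False using that by simp
  qed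
 qed (auto intro: not_supp)
 have cl: "loc_int UNIV f" by (rule loc_int_continuous[OF test_continuous[OF f]])
 have convT: "conv f s \<in> tf X"
  by (rule test_funsI[OF conv_smooth(1)[OF cl s(1)] K Kconv])
 thus "conv f s \<in> tf X" .
 show "supp (conv f s) <= {x - y |x y. x \<in> supp f & y \<in> supp m}"
  using supp_subset[OF compact_imp_closed[OF K(1)] Kconv] by (simp add: K_def)
 obtain C r where C: "C \<ge> 0" "!!f. f \<in> tf X ==> supp f <= K ==> cmod (u f) <= C * sn K r f"
  using distributions_bound[OF u K] by blast
 obtain M where M: "M > 0" "!!vs y. length vs <= r + 1 ==> (!!v. v \<in> set vs ==> norm v <= 1) ==> cmod (DL vs s y) <= M"
  using DL_bounded_all[OF s(1), of "r + 1"] by blast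
 obtain Lf where Lf: "Lf \<ge> 0" "!!x y. cmod (f x - f y) <= Lf * norm (x - y)" using test_lipschitz[OF f] by blast
 obtain Mf where Mf: "Mf > 0" "!!x. cmod (f x) <= Mf" using DL_bounded[OF f, of "[]"] by auto
 obtain Lg where Lg: "Lg \<ge> 0" "!!x y. cmod (f x * ?g x - f y * ?g y) <= Lg * norm (x - y)" using test_lipschitz[OF fg] by blast
 obtain B where B: "supp f <= cbox (- B) B"
  using f bounded_subset_cbox_symmetric[of "supp f"] compact_imp_bounded by (auto simp: tf_iff)
 let ?V = "measure lborel (cbox (- B) B)"
 define D where "D = C * ((Lf * M + Mf * M) * ?V) + Lg * ?V"
 \<comment> \<open>Two errors, both linear in the mesh \<open>d\<close>: that of the Riemann sum for
   the integral on the right, and that of the sum \<open>S\<close> of translated kernels as an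
   approximation of \<open>conv f s\<close> in the seminorm that controls \<open>u\<close>.\<close>
 have key: "cmod (u (conv f s) - (LI x. f x * ?g x)) <= D * d" if d: "d > 0" for d
 proof -
  obtain p where p: "p tagged_division_of cbox (- B) B" "(%x. ball x d) fine p"
   using fine_division_exists[of "%x. ball x d" "- B" B] d by (auto simp: gauge_def)
  have fin: "finite p" using p(1) by (rule tagged_division_of_finite)
  define S where "S = (%y. \<Sum>z\<in>p. (cr (measure lborel (snd z)) * f (fst z)) * s (y - fst z))"
  have tt: "(%y. f x * s (y - x)) \<in> tf X" for x
  proof (rule test_funsI[OF _ K])
   show "smooth_on UNIV (%y. f x * s (y - x))"
    using smooth_on_compose_affine[OF open_UNIV test_smooth[OF s(1)], of "- x" 1] by (auto intro!: smooth_on_cmult)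
   show "f x * s (y - x) = 0" if "y \<notin> K" for y
    using inK[of x y] that not_supp[of x f] by auto
  qed
  have tz: "(%y. cr (measure lborel (snd z)) * f (fst z) * s (y - fst z)) \<in> tf X" for z
   using test_cmult[OF tt[of "fst z"], of "cr (measure lborel (snd z))"] by (simp add: mult.assoc)
  have ST: "S \<in> tf X" unfolding S_def by (intro test_sum tz)
  have SK: "S y = 0" if "y \<notin> K" for y
   unfolding S_def using inK that not_supp[of _ f] by (intro sum.neutral) auto
  have uz: "u (%y. cr (measure lborel (snd z)) * f (fst z) * s (y - fst z)) = measure lborel (snd z) *\<^sub>R (f (fst z) * ?g (fst z))" for z
  proof (cases "fst z \<in> supp f")
   case True
   have "(%y. s (y - fst z)) = (%y. m (fst z - y))" using ev by auto
   moreover have "(%y. m (fst z - y)) \<in> tf X" using sub[OF True] by (intro trans_test m)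
   ultimately show ?thesis
    using distributions_cmult[OF u, of "%y. s (y - fst z)" "cr (measure lborel (snd z)) * f (fst z)"]
    by (simp add: scaleR_conv_of_real[where 'a=complex])
  qed (simp add: not_supp distributions_0[OF u])
  have "u S = (\<Sum>(x, k)\<in>p. measure lborel k *\<^sub>R (f x * ?g x))"
   unfolding S_def by (subst distributions_sum[OF u]) (simp_all only: tz uz case_prod_unfold)
  moreover have "cmod ((LI x. f x * ?g x) - (\<Sum>(x, k)\<in>p. measure lborel k *\<^sub>R (f x * ?g x))) <= Lg * d * ?V"
   using B not_supp[of _ f] by (intro riemann_sum_error[OF test_continuous[OF fg] _ Lg(2,1) p]) auto
  ultimately have 1: "cmod (u S - (LI x. f x * ?g x)) <= Lg * d * ?V"
   by (simp add: norm_minus_commute)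
  have "sn K r (%y. conv f s y - S y) <= (Lf * M + Mf * M) * d * ?V"
  proof (rule sn_le)
   show "0 <= (Lf * M + Mf * M) * d * ?V" using Lf M Mf d by simp
   fix al :: "nat ^ 'a" and y assume a: "mi_size al <= r"
   let ?s = "DL (mvecs al) s"
   have "DL (mvecs al) (%y. s (y - x)) y = ?s (y - x)" for x
    using DL_compose_affine[OF open_UNIV test_smooth[OF s(1)], of "- x" 1 y "mvecs al"] by simp
   moreover have smx: "smooth_on UNIV (%y. s (y - x))" for x
    using smooth_on_compose_affine[OF open_UNIV test_smooth[OF s(1)], of "- x" 1] by simp
   ultimately have "DL (mvecs al) S y = (\<Sum>z\<in>p. cr (measure lborel (snd z)) * f (fst z) * ?s (y - fst z))"
    unfolding S_def by (subst DL_sum[OF open_UNIV test_smooth[OF tz] UNIV_I]) (simp add: DL_cmult[OF open_UNIV smx UNIV_I])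
   hence DS: "DL (mvecs al) S y = (\<Sum>(x, k)\<in>p. measure lborel k *\<^sub>R (f x * ?s (y - x)))"
    by (simp add: case_prod_unfold scaleR_conv_of_real[where 'a=complex] mult.assoc)
   have "multi_deriv al (%y. conv f s y - S y) y = (LI x. f x * ?s (y - x)) - (\<Sum>(x, k)\<in>p. measure lborel k *\<^sub>R (f x * ?s (y - x)))"
    unfolding multi_deriv_DL DL_diff[OF open_UNIV test_smooth[OF convT] test_smooth[OF ST] UNIV_I] DS conv_smooth(2)[OF cl s(1)]
    by (simp only: conv_def)
   also have "cmod ... <= (Lf * M + Mf * M) * d * ?V"
   proof (rule riemann_sum_error[OF _ _ _ _ p])
    show "continuous_on UNIV (%x. f x * ?s (y - x))"
     by (intro continuous_intros test_continuous[OF f] continuous_on_compose2[OF test_continuous[OF test_DL[OF s(1)], of UNIV]]) auto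
    show "f x * ?s (y - x) = 0" if "x \<notin> cbox (- B) B" for x
     using B that not_supp[of x f] by auto
    show "0 <= Lf * M + Mf * M" using Lf M Mf by simp
    fix x x' :: "real ^ 'a"
    have mv: "length (mvecs al) <= r" "!!v. v \<in> set (mvecs al) ==> norm v <= 1"
     using a norm_mvecs[of _ al] by (auto simp: length_mvecs)
    have s1: "cmod (?s z) <= M" for z using M(2)[of "mvecs al" z] mv by auto
    define v where "v = (1 / norm (x' - x)) *\<^sub>R (x' - x)"
    have v: "norm v <= 1" "y - x = (y - x') + norm (x - x') *\<^sub>R v" by (auto simp: v_def norm_minus_commute)
    have "cmod (?s ((y - x') + norm (x - x') *\<^sub>R v) - ?s (y - x')) <= M * \<bar>norm (x - x')\<bar>"
     using M(2)[of "v # mvecs al"] mv v by (intro line_bound test_smooth[OF test_DL[OF s(1)]]) auto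
    hence s2: "cmod (?s (y - x) - ?s (y - x')) <= M * norm (x - x')" by (simp add: v(2))
    have "f x * ?s (y - x) - f x' * ?s (y - x') = (f x - f x') * ?s (y - x) + f x' * (?s (y - x) - ?s (y - x'))"
     by (simp add: algebra_simps)
    also have "cmod ... <= (Lf * norm (x - x')) * M + Mf * (M * norm (x - x'))"
     using norm_triangle_le[OF add_mono] Lf s1 s2 Mf
     by (intro norm_triangle_le add_mono) (auto simp: norm_mult intro!: mult_mono)
    finally show "cmod (f x * ?s (y - x) - f x' * ?s (y - x')) <= (Lf * M + Mf * M) * norm (x - x')"
     by (simp add: algebra_simps)
   qed
   finally show "cmod (multi_deriv al (%y. conv f s y - S y) y) <= (Lf * M + Mf * M) * d * ?V" .
  qed
  from mult_left_mono[OF this C(1)]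
  have le: "C * sn K r (%y. conv f s y - S y) <= C * ((Lf * M + Mf * M) * d * ?V)" .
  have "supp (%y. conv f s y - S y) <= K"
   using SK Kconv by (intro supp_subset compact_imp_closed K) auto
  from order_trans[OF C(2)[OF test_diff[OF convT ST] this] le]
  have "cmod (u (%y. conv f s y - S y)) <= C * ((Lf * M + Mf * M) * d * ?V)" .
  hence 2: "cmod (u (conv f s) - u S) <= C * ((Lf * M + Mf * M) * d * ?V)"
   using distributions_diff[OF u convT ST] by simp
  have "cmod (u (conv f s) - (LI x. f x * ?g x)) <= cmod (u (conv f s) - u S) + cmod (u S - (LI x. f x * ?g x))"
   using norm_triangle_ineq[of "u (conv f s) - u S" "u S - (LI x. f x * ?g x)"] by simp
  also have "... <= D * d" using 1 2 by (simp add: D_def algebra_simps)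
  finally show ?thesis .
 qed
 have "cmod (u (conv f s) - (LI x. f x * ?g x)) <= 0"
 proof (rule field_le_epsilon)
  fix e :: real assume e: "e > 0"
  have "D \<ge> 0" unfolding D_def using C Lf M Mf Lg by simp
  hence "D * (e / (D + 1)) <= e" using e by (simp add: field_simps)
  moreover have "e / (D + 1) > 0" using e \<open>D \<ge> 0\<close> by simp
  ultimately show "cmod (u (conv f s) - (LI x. f x * ?g x)) <= 0 + e" using key[of "e / (D + 1)"] by simp
 qed
 thus "u (conv f s) = (LI x. f x * ?g x)" by simp
qed

section \<open>Distributions and their supports\<close>

lemma lborel_integral_reflect:
 fixes g :: "real ^ 'd::finite => 'b::{banach, second_countable_topology}"
 assumes "g \<in> borel_measurable borel"
 shows "(LI y. g (x - y)) = (LI y. g y)"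
 using lborel_integral_scale(1)[OF assms, of "-1" x] by simp

text \<open>The indicator of the \<open>2 * e\<close>-neighbourhood \<open>A\<close> of
  \<open>K\<close>, mollified at scale \<open>e\<close>: it is 1 within distance \<open>e\<close> of
  \<open>K\<close> and 0 beyond \<open>3 * e\<close>, which stays below the lower bound
  \<open>d = 4 * e\<close> for the distance from \<open>K\<close> to the complement of
  \<open>U\<close>.\<close>

lemma cutoff_exists:
 fixes K U :: "(real ^ 'd::finite) set"
 assumes K: "compact K" and U: "open U" "K <= U"
 obtains h V where "h \<in> tf U" "open V" "K <= V" "V <= U" "!!x. x \<in> V ==> h x = 1"
proof -
 obtain d where d: "d > 0" "!!x y. x \<in> K ==> y \<in> - U ==> d <= dist x y"
 proof -
  have "K \<inter> - U = {}" using U by auto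
  thus ?thesis using separate_compact_closed[OF K, of "- U"] U(1) that by (auto simp: closed_Compl)
 qed
 define e where "e = d / 4"
 have e: "e > 0" using d by (simp add: e_def)
 define A where "A = {a + b |a b. a \<in> K & b \<in> cball 0 (2 * e)}"
 have A: "compact A" unfolding A_def by (intro compact_sums K compact_cball)
 define B where "B = {a + b |a b. a \<in> A & b \<in> cball 0 e}"
 have B: "compact B" unfolding B_def by (intro compact_sums A compact_cball)
 define f where "f = (%x. indicator A x *\<^sub>R (1::complex))"
 have "integrable lborel f" unfolding f_def by (rule borel_integrable_compact[OF A continuous_on_const])
 hence f: "loc_int UNIV f" by (rule loc_int_integrable)
 define h where "h = conv f (moll e)"
 have BU: "B <= U"
 proof
  fix x assume "x \<in> B"
  then obtain a b c where x: "x = a + b + c" "a \<in> K" "norm b <= 2 * e" "norm c <= e"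
   unfolding A_def B_def by auto
  have "dist a x = norm (b + c)" using norm_minus_cancel[of "b + c"] by (simp add: x dist_norm add.assoc)
  also have "... <= norm b + norm c" by (rule norm_triangle_ineq)
  also have "... < d" using x e by (simp add: e_def)
  finally show "x \<in> U" using d(2)[OF x(2), of x] by force
 qed
 have chi: "h \<in> tf U"
 proof (rule test_funsI[OF _ B BU])
  show "smooth_on UNIV h" unfolding h_def by (rule conv_smooth(1)[OF f moll_test[OF e]])
  show "h x = 0" if "x \<notin> B" for x
   unfolding h_def
  proof (rule conv_eq_0[of A _ "cball 0 e"])
   show "moll e y = 0" if "y \<notin> cball 0 e" for y :: "real ^ 'd" using that by (intro moll_eq_0[OF e]) auto
  qed (use that in \<open>auto simp: f_def B_def\<close>)
 qed
 define V where "V = (\<Union>x\<in>K. ball x e)"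
 have one: "h x = 1" if "x \<in> V" for x
 proof -
  obtain z where z: "z \<in> K" "dist z x < e" using \<open>x \<in> V\<close> by (auto simp: V_def)
  have "f y * moll e (x - y) = moll e (x - y)" for y
  proof (cases "norm (x - y) <= e")
   case True
   have "y = z + (y - z)" by simp
   moreover have "norm (y - z) <= 2 * e"
    using norm_triangle_ineq[of "y - x" "x - z"] True z(2) by (simp add: dist_norm norm_minus_commute)
   ultimately have "y \<in> A" unfolding A_def using z(1) by (metis (mono_tags, lifting) mem_Collect_eq mem_cball_0)
   thus ?thesis by (simp add: f_def)
  next
   case False
   thus ?thesis using moll_eq_0[OF e, of "x - y"] by simp
  qed
  hence "(%y. f y * moll e (x - y)) = (%y. moll e (x - y))" by (rule ext)
  hence "h x = (LI y. moll e (x - y))" by (simp only: h_def conv_def)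
  also have "... = (LI y. moll e (y :: real ^ 'd))"
   by (intro lborel_integral_reflect cont_bm test_continuous[OF moll_test[OF e]])
  finally show ?thesis using integral_moll[OF e, where 'd = 'd] by simp
 qed
 have "x \<in> U" if "x \<in> V" for x
  using chi one[OF that] not_supp[of x h] by (auto simp: tf_iff)
 thus ?thesis using that[of h V] chi one e by (force simp: V_def)
qed

subsection \<open>Supports\<close>

definition vanishes :: "((real ^ 'd::finite => complex) => complex) => (real ^ 'd) set => bool"
 where "vanishes u U \<longleftrightarrow> (\<forall>f\<in>tf U. u f = 0)"

lemma dsupp_vanishes: "dsupp X u = X - \<Union>{U. open U & U <= X & vanishes u U}"
 by (simp add: dist_support_def vanishes_def)

lemma dsupp_subsetI:
 "(!!x. x \<in> X ==> x \<notin> L ==> \<exists>U. open U & x \<in> U & U <= X & vanishes u U) ==> dsupp X u <= L"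
 unfolding dsupp_vanishes by blast

lemma not_in_dist_support:
 "x \<in> X ==> x \<notin> dsupp X u ==> \<exists>U. open U & x \<in> U & U <= X & vanishes u U"
 unfolding dsupp_vanishes by blast

lemma dsupp_subset: "dsupp X u <= X"
 by (auto simp: dist_support_def)

text \<open>A partition of unity with two members: the part of the support outside \<open>V\<close>
  is compact and contained in \<open>U\<close>.\<close>

lemma vanishes_Un:
 assumes u: "u \<in> distributions X" and U: "open U" "U <= X" "vanishes u U" and V: "open V" "V <= X" "vanishes u V"
 shows "vanishes u (U \<union> V)"
 unfolding vanishes_def
proof
 fix f assume f: "f \<in> tf (U \<union> V)"
 have "compact (supp f - V)" using f V(1) by (auto simp: tf_iff compact_diff)
 moreover have "supp f - V <= U" using f by (auto simp: tf_iff)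
 ultimately obtain h W where h: "h \<in> tf U" "open W" "supp f - V <= W" "W <= U" "!!x. x \<in> W ==> h x = 1"
  using cutoff_exists[OF _ U(1)] by metis
 have 1: "(%x. f x * h x) \<in> tf U"
  using test_mult[OF U(1) smooth_on_subset[OF test_smooth[OF f]] h(1)] by auto
 have 2: "(%x. f x - f x * h x) \<in> tf V"
 proof (rule test_funsI[of _ "supp f - W"])
  show "smooth_on UNIV (%x. f x - f x * h x)"
   by (intro smooth_on_diff open_UNIV test_smooth[OF f] test_smooth[OF 1])
  show "compact (supp f - W)" using f h(2) by (auto simp: tf_iff compact_diff)
  show "supp f - W <= V" using h(3) by auto
  show "f x - f x * h x = 0" if "x \<notin> supp f - W" for x
   using that h(5)[of x] not_supp[of x f] by auto
 qed
 have "u f = u (%x. f x * h x + (f x - f x * h x))" by simp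
 also have "... = u (%x. f x * h x) + u (%x. f x - f x * h x)"
  using tf_mono[OF 1 U(2)] tf_mono[OF 2 V(2)] by (rule distributions_add[OF u])
 finally show "u f = 0" using U(3) V(3) 1 2 by (simp add: vanishes_def)
qed

lemma vanishes_Union:
 assumes u: "u \<in> distributions X" and "finite \<U>" "!!U. U \<in> \<U> ==> open U & U <= X & vanishes u U"
 shows "vanishes u (\<Union>\<U>)"
 using assms(2,3)
proof (induction \<U> rule: finite_induct)
 case empty
 have "f = (%x. 0)" if "f \<in> tf {}" for f :: "real^'a => complex"
  using that not_supp[of _ f] by (auto simp: tf_iff)
 thus ?case using distributions_0[OF u] by (auto simp: vanishes_def)
next
 case (insert U \<U>)
 have "vanishes u (U \<union> \<Union>\<U>)"
  using insert by (intro vanishes_Un[OF u]) auto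
 thus ?case by simp
qed

text \<open>By compactness finitely many open sets on which \<open>u\<close> vanishes cover the
  support of \<open>f\<close>, and \<open>vanishes_Union\<close> applies.\<close>

lemma dsupp_eq_0:
 assumes u: "u \<in> distributions X" and f: "f \<in> tf X" "supp f \<inter> dsupp X u = {}"
 shows "u f = 0"
proof -
 let ?F = "{U. open U & U <= X & vanishes u U}"
 have "supp f <= \<Union>?F" using f by (auto simp: tf_iff dsupp_vanishes)
 obtain \<V> where \<V>: "\<V> <= ?F" "finite \<V>" "supp f <= \<Union>\<V>"
 proof -
  have "compact (supp f)" using f(1) by (simp add: tf_iff)
  thus ?thesis
   using \<open>supp f <= \<Union>?F\<close> that by (elim compactE) auto
 qed
 hence "vanishes u (\<Union>\<V>)" by (intro vanishes_Union[OF u]) auto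
 moreover have "f \<in> tf (\<Union>\<V>)" using f(1) \<V>(3) by (auto simp: tf_iff)
 ultimately show ?thesis by (simp add: vanishes_def)
qed

lemma sn_mono:
 assumes "smooth_on UNIV f" "compact K'" "K <= K'" "r <= r'"
 shows "sn K r f <= sn K' r' f"
proof (rule sn_le)
 show "0 <= sn K' r' f" using sn_nonneg[OF open_UNIV assms(2) _ assms(1)] by simp
 show "cmod (multi_deriv a f x) <= sn K' r' f" if "x \<in> K" "mi_size a <= r" for a x
  using that assms by (intro multi_deriv_le_seminorm[OF open_UNIV assms(2)]) auto
qed

text \<open>Arguments are multiplied by a cutoff that is 1 near the support of \<open>f\<close>: the
  product is a test function on \<open>Y\<close>, and a change away from the support does not affect
  the value of \<open>f\<close>.\<close>

lemma extend_distribution: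
 assumes Y: "open Y" and YZ: "Y <= Z" and f: "f \<in> cdist Y"
 obtains f' where "f' \<in> distributions Z" "!!g. g \<in> tf Y ==> f' g = f g"
  "!!g. g \<in> tf Z ==> supp g \<inter> dsupp Y f = {} ==> f' g = 0"
proof -
 let ?S = "dsupp Y f"
 have fd: "f \<in> distributions Y" and S: "compact ?S" using f by (auto simp: compact_distributions_def)
 obtain h V where h: "h \<in> tf Y" "open V" "?S <= V" "V <= Y" "!!x. x \<in> V ==> h x = 1"
  using cutoff_exists[OF S Y dsupp_subset] by metis
 have T: "(%x. g x * h x) \<in> tf Y" if "g \<in> tf Z" for g
  using test_mult[OF Y smooth_on_subset[OF test_smooth[OF that]] h(1)] by auto
 define f' where "f' = (\<lambda>g\<in>tf Z. f (%x. g x * h x))"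
 show ?thesis
 proof (rule that[of f'])
  show "f' \<in> distributions Z"
   unfolding distributions_def mem_Collect_eq
  proof (intro conjI ballI allI impI)
   show "f' \<in> extensional (tf Z)" by (simp add: f'_def)
   fix g assume g: "g \<in> tf Z"
   show "f' (%x. g x + q x) = f' g + f' q" if "q \<in> tf Z" for q
    using distributions_add[OF fd T[OF g] T[OF that]] g that by (simp add: f'_def test_add distrib_right)
   show "f' (%x. c * g x) = c * f' g" for c
    using distributions_cmult[OF fd T[OF g], of c] g by (simp add: f'_def test_cmult mult.assoc)
  next
   fix K assume K: "compact K & K <= Z"
   have sc: "compact (supp h)" "supp h <= Y" using h(1) by (auto simp: tf_iff)
   obtain C r where C: "C \<ge> 0" "!!g. g \<in> tf Y ==> supp g <= supp h ==> cmod (f g) <= C * sn (supp h) r g"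
    using distributions_bound[OF fd sc] by blast
   let ?N = "(2 * real CARD('a) ^ 2) ^ r"
   let ?B = "sn (supp h \<union> K) r h"
   have B: "0 <= ?B" using sn_nonneg[OF open_UNIV _ _ test_smooth[OF h(1)]] sc K by (simp add: compact_Un)
   show "\<exists>C r. \<forall>g\<in>tf Z. supp g <= K --> cmod (f' g) <= C * sn K r g"
   proof (rule exI[of _ "C * ?N * ?B"], rule exI[of _ r], intro ballI impI)
    fix g assume g: "g \<in> tf Z" "supp g <= K"
    have sm: "smooth_on UNIV g" using g(1) by (rule test_smooth)
    have "supp (%x. g x * h x) <= supp h"
     by (rule supp_subset) (auto simp: not_supp)
    hence "cmod (f (%x. g x * h x)) <= C * sn (supp h) r (%x. g x * h x)"
     using C(2)[OF T[OF g(1)]] by simp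
    also have "... <= C * sn (supp h \<union> K) r (%x. g x * h x)"
     using sc K by (intro mult_left_mono C(1) sn_mono test_smooth[OF T[OF g(1)]]) auto
    also have "... <= C * (?N * sn (supp h \<union> K) r g * ?B)"
     using sc K by (intro mult_left_mono C(1) sn_mult[OF open_UNIV] sm test_smooth[OF h(1)]) auto
    \<comment> \<open>Since \<open>g\<close> vanishes with all derivatives outside \<open>K\<close>,
      the larger compact set does not increase the seminorm.\<close>
    also have "sn (supp h \<union> K) r g <= sn K r g"
    proof (rule sn_le)
     show "0 <= sn K r g" using sn_nonneg[OF open_UNIV _ _ sm] K by simp
     show "cmod (multi_deriv al g x) <= sn K r g" if "mi_size al <= r" for al x
     proof (cases "x \<in> K")
      case True
      thus ?thesis using that K by (intro multi_deriv_le_seminorm[OF open_UNIV] sm) auto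
     next
      case False
      hence "DL (mvecs al) g x = 0" using g(2) by (intro DL_outside_support) auto
      thus ?thesis using \<open>0 <= sn K r g\<close> by (simp add: multi_deriv_DL)
     qed
    qed
    finally show "cmod (f' g) <= C * ?N * ?B * sn K r g"
     using C(1) B g(1) by (simp add: f'_def mult_left_mono mult_right_mono mult_ac)
   qed
  qed
  show "f' g = f g" if g: "g \<in> tf Y" for g
  proof -
   have 1: "(%x. g x - g x * h x) \<in> tf Y"
    using g T[OF tf_mono[OF g YZ]] by (rule test_diff)
   have "supp (%x. g x - g x * h x) <= - V"
    using h(2,5) by (intro supp_subset) auto
   hence "f (%x. g x - g x * h x) = 0"
    using h(3) by (intro dsupp_eq_0[OF fd 1]) auto
   thus ?thesis
    using distributions_diff[OF fd g T[OF tf_mono[OF g YZ]]] tf_mono[OF g YZ] by (simp add: f'_def)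
  qed
  show "f' g = 0" if g: "g \<in> tf Z" "supp g \<inter> ?S = {}" for g
  proof -
   have "supp (%x. g x * h x) <= supp g"
    by (rule supp_subset) (auto simp: not_supp)
   hence "f (%x. g x * h x) = 0" using g(2) by (intro dsupp_eq_0[OF fd T[OF g(1)]]) auto
   thus ?thesis using g(1) by (simp add: f'_def)
  qed
 qed
qed

subsection \<open>Differential operators\<close>

lemma diff_op_DL:
 "diff_op P f x = (\<Sum>a\<in>keys P. coef P a * (- \<i>) ^ mi_size a * DL (mvecs a) f x)"
 by (simp add: diff_op_def multi_deriv_DL)

lemma diff_op_cong: "open X ==> x \<in> X ==> (!!y. y \<in> X ==> f y = g y) ==> diff_op P f x = diff_op P g x"
 unfolding diff_op_DL using DL_cong[of X x f g] by simp

lemma diff_op_add: "open X ==> smooth_on X f ==> smooth_on X g ==> x \<in> X ==> diff_op P (%x. f x + g x) x = diff_op P f x + diff_op P g x"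
 unfolding diff_op_DL by (simp add: DL_add distrib_left sum.distrib)

lemma diff_op_diff: "open X ==> smooth_on X f ==> smooth_on X g ==> x \<in> X ==> diff_op P (%x. f x - g x) x = diff_op P f x - diff_op P g x"
 unfolding diff_op_DL by (simp add: DL_diff right_diff_distrib sum_subtractf)

lemma diff_op_cmult: "open X ==> smooth_on X f ==> x \<in> X ==> diff_op P (%x. c * f x) x = c * diff_op P f x"
 unfolding diff_op_DL by (simp add: DL_cmult sum_distrib_left mult.left_commute)

lemma test_diff_op: "f \<in> tf X ==> diff_op P f \<in> tf X"
 unfolding diff_op_DL[abs_def] by (intro test_sum test_cmult test_DL)

lemma diff_op_outside_support: "x \<notin> supp f ==> diff_op P f x = 0"
 by (simp add: diff_op_DL DL_outside_support)

lemma supp_diff_op: "supp (diff_op P f) <= supp f"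
 by (rule supp_subset) (auto intro: diff_op_outside_support)

lemma lookup_mpoly_reflect: "coef (rfl P) a = (-1) ^ mi_size a * coef P a"
 by (auto simp: mpoly_reflect_def lookup_mapp in_keys_iff when_def)

lemma mpoly_reflect_reflect [simp]: "rfl (rfl P) = P"
 by (rule poly_mapping_eqI) (simp add: lookup_mpoly_reflect power_mult_distrib[symmetric] mult.assoc[symmetric])

lemma diff_op_reflect_DL:
 "diff_op (rfl P) f x = (\<Sum>a\<in>keys P. coef P a * (- \<i>) ^ mi_size a * ((-1) ^ mi_size a * DL (mvecs a) f x))"
 unfolding diff_op_DL keys_mpoly_reflect lookup_mpoly_reflect by (intro sum.cong) (auto simp: mult_ac)

lemma diff_op_reflect_arg:
 assumes "open X" "smooth_on X f" "a - y \<in> X"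
 shows "diff_op (rfl P) (%y. f (a - y)) y = diff_op P f (a - y)"
 unfolding diff_op_reflect_DL unfolding diff_op_DL
 using DL_compose_affine[OF assms(1,2), of a "-1" y] assms(3)
 by (intro sum.cong) (auto simp: length_mvecs power_mult_distrib[symmetric] mult.assoc[symmetric])

text \<open>Every derivative moved by parts costs a sign, and the signs
  \<open>(-1) ^ mi_size a\<close> are exactly the passage from \<open>P\<close> to the reflected
  polynomial.\<close>

lemma integral_diff_op:
 assumes X: "open X" and F: "smooth_on X F" and f: "f \<in> tf X"
 shows "(LI x. diff_op P F x * f x) = (LI x. F x * diff_op (rfl P) f x)"
proof -
 have i1: "integrable lborel (%x. DL vs F x * f x)" for vs
  by (rule test_integrable[OF test_mult[OF X smooth_on_DL[OF X F] f]])
 have i2: "integrable lborel (%x. F x * DL vs f x)" for vs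
  by (rule test_integrable[OF test_mult[OF X F test_DL[OF f]]])
 have "(LI x. diff_op P F x * f x) =
  (LI x. (\<Sum>a\<in>keys P. (coef P a * (- \<i>) ^ mi_size a) * (DL (mvecs a) F x * f x)))"
  by (simp add: diff_op_DL sum_distrib_right mult.assoc)
 also have "... = (\<Sum>a\<in>keys P. (coef P a * (- \<i>) ^ mi_size a) * (LI x. DL (mvecs a) F x * f x))"
  using i1 by (subst Bochner_Integration.integral_sum) auto
 also have "... = (\<Sum>a\<in>keys P. (coef P a * (- \<i>) ^ mi_size a) * ((-1) ^ mi_size a * (LI x. F x * DL (mvecs a) f x)))"
  by (simp only: integral_by_parts[OF X F f] length_mvecs)
 also have "... = (\<Sum>a\<in>keys P. (LI x. (coef P a * (- \<i>) ^ mi_size a * (-1) ^ mi_size a) * (F x * DL (mvecs a) f x)))"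
  by (intro sum.cong) (auto simp: mult.assoc)
 also have "... = (LI x. (\<Sum>a\<in>keys P. (coef P a * (- \<i>) ^ mi_size a * (-1) ^ mi_size a) * (F x * DL (mvecs a) f x)))"
  using i2 by (subst Bochner_Integration.integral_sum) auto
 also have "... = (LI x. F x * diff_op (rfl P) f x)"
  unfolding diff_op_reflect_DL by (simp add: sum_distrib_left mult_ac)
 finally show ?thesis .
qed

lemma ddo_eq:
 assumes u: "u \<in> distributions X" and f: "f \<in> tf X"
 shows "ddo X P u f = u (diff_op (rfl P) f)"
proof -
 have "u (diff_op (rfl P) f) = u (%x. \<Sum>a\<in>keys P. (coef P a * (- \<i>) ^ mi_size a * (-1) ^ mi_size a) * DL (mvecs a) f x)"
  unfolding diff_op_reflect_DL[abs_def] by (simp add: mult.assoc)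
 also have "... = (\<Sum>a\<in>keys P. u (%x. (coef P a * (- \<i>) ^ mi_size a * (-1) ^ mi_size a) * DL (mvecs a) f x))"
  by (intro distributions_sum[OF u] test_cmult test_DL f)
 also have "... = (\<Sum>a\<in>keys P. coef P a * (- \<i>) ^ mi_size a * (-1) ^ mi_size a * u (DL (mvecs a) f))"
  by (intro sum.cong refl distributions_cmult[OF u] test_DL f)
 finally show ?thesis
  using f by (simp add: dist_diff_op_def dist_multi_deriv_def multi_deriv_DL mult.assoc)
qed

lemma diff_op_mollify:
 assumes u: "u \<in> distributions X" and r: "r \<in> tf UNIV" and G: "open G" "!!x y. x \<in> G ==> y \<in> supp r ==> x - y \<in> X" and x: "x \<in> G"
 shows "diff_op P (%x. u (%y. r (x - y))) x = u (diff_op (rfl P) (%y. r (x - y)))"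
proof -
 have t: "(%y. DL vs r (x - y)) \<in> tf X" for vs
  using supp_DL[of vs r] G(2)[OF x] by (intro trans_test test_DL r) auto
 have "diff_op P (%x. u (%y. r (x - y))) x = (\<Sum>a\<in>keys P. coef P a * (- \<i>) ^ mi_size a * u (%y. DL (mvecs a) r (x - y)))"
  unfolding diff_op_DL by (simp add: mollify_smooth(2)[OF u r G x])
 also have "... = (\<Sum>a\<in>keys P. u (%y. coef P a * (- \<i>) ^ mi_size a * DL (mvecs a) r (x - y)))"
  by (intro sum.cong refl distributions_cmult[OF u t, symmetric])
 also have "... = u (%y. \<Sum>a\<in>keys P. coef P a * (- \<i>) ^ mi_size a * DL (mvecs a) r (x - y))"
  by (intro distributions_sum[OF u, symmetric] test_cmult t)
 also have "(%y. \<Sum>a\<in>keys P. coef P a * (- \<i>) ^ mi_size a * DL (mvecs a) r (x - y)) = diff_op (rfl P) (%y. r (x - y))"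
  using diff_op_reflect_arg[OF open_UNIV test_smooth[OF r]] by (simp add: diff_op_DL fun_eq_iff)
 finally show ?thesis .
qed

section \<open>The Fourier transform of test functions\<close>

text \<open>The kernel of the Fourier transform, which carries no normalising factor; the powers of
  \<open>2 * pi\<close> cancel in \<open>L2_estimate_of_FT\<close>.\<close>

definition osc :: "real ^ 'd::finite => real ^ 'd => complex"
 where "osc z x = exp (\<i> * cr (- (z \<bullet> x)))"

lemma cmod_osc [simp]: "cmod (osc z x) = 1"
 by (simp add: osc_def norm_exp_i_times)

lemma osc_add: "osc z (x + y) = osc z x * osc z y"
 by (simp add: osc_def inner_add_right exp_add[symmetric] distrib_left right_diff_distrib)

lemma osc_has_derivative:
 "(osc z has_derivative (%h. (- \<i> * cr (z \<bullet> h)) * osc z x)) (at x)"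
proof -
 have 1: "((%x. \<i> * cr (- (z \<bullet> x))) has_derivative (%h. \<i> * cr (- (z \<bullet> h)))) (at x)"
  by (auto intro!: derivative_eq_intros)
 have 2: "(exp has_derivative (*) (exp y)) (at y)" for y :: complex
  using DERIV_exp[of y] by (simp add: has_field_derivative_def)
 show ?thesis
  unfolding osc_def[abs_def] using has_derivative_compose[OF 1 2] by (simp add: mult.commute)
qed

lemma osc_continuous: "continuous_on S (osc z)"
 unfolding osc_def[abs_def] by (intro continuous_intros)

lemma osc_smooth: "smooth_on UNIV (osc z)"
proof -
 have "C_on k UNIV (%x. c * osc z x)" for k c
 proof (induction k arbitrary: c)
  case 0
  thus ?case by (auto intro!: continuous_intros osc_continuous)
 next
  case (Suc k)
  show ?case
  proof (rule C_on_SucI[where g = "%j x. (c * (- \<i> * cr (z \<bullet> ax j))) * osc z x"])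
   show "continuous_on UNIV (%x. c * osc z x)" by (intro continuous_intros osc_continuous)
   fix j :: 'a and x :: "real ^ 'a"
   have g: "((%t. x + t *\<^sub>R ax j) has_derivative (%t. t *\<^sub>R ax j)) (at (0::real))"
    by (auto intro!: derivative_eq_intros)
   have "((%t. osc z (x + t *\<^sub>R ax j)) has_derivative (%t. (- \<i> * cr (z \<bullet> (t *\<^sub>R ax j))) * osc z x)) (at 0)"
    using has_derivative_compose[OF g, of "osc z" "%h. (- \<i> * cr (z \<bullet> h)) * osc z x"] osc_has_derivative[of z x] by simp
   from has_derivative_mult_right[OF this, of c]
   show "((%t. c * osc z (x + t *\<^sub>R ax j)) has_vector_derivative (c * (- \<i> * cr (z \<bullet> ax j))) * osc z x) (at 0)"
    unfolding has_vector_derivative_def by (simp add: scaleR_conv_of_real[where 'a=complex] mult_ac)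
  next
   fix j :: 'a
   show "C_on k UNIV (%x. (c * (- \<i> * cr (z \<bullet> ax j))) * osc z x)" by (rule Suc)
  qed auto
 qed
 from this[where c = 1] show ?thesis by (simp add: smooth_on_def)
qed

lemma dd_osc: "dd v (osc z) x = (- \<i> * cr (z \<bullet> v)) * osc z x"
 by (rule has_derivative_imp_dd(2)[OF osc_has_derivative])

definition FT :: "(real ^ 'd::finite => complex) => real ^ 'd => complex"
 where "FT g z = (LI x. osc z x * g x)"

lemma FT_integrable: "g \<in> tf UNIV ==> integrable lborel (%x. osc z x * g x)"
 using test_integrable[OF test_mult[OF open_UNIV osc_smooth]] .

lemma FT_dd:
 assumes g: "g \<in> tf UNIV"
 shows "FT (dd v g) z = \<i> * cr (z \<bullet> v) * FT g z"
proof -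
 have "(LI x. (- \<i> * cr (z \<bullet> v)) * (osc z x * g x)) = - FT (dd v g) z"
  using integral_by_parts_dd[OF open_UNIV osc_smooth g, of v z] by (simp add: FT_def dd_osc mult.assoc)
 thus ?thesis by (simp add: FT_def)
qed

lemma FT_DL: "g \<in> tf UNIV ==> FT (DL vs g) z = (\<Prod>v\<leftarrow>vs. \<i> * cr (z \<bullet> v)) * FT g z"
proof (induction vs)
 case (Cons v vs)
 thus ?case using FT_dd[OF test_DL[OF Cons.prems, of vs]] by (simp add: mult.assoc)
qed auto

lemma FT_cmult: "FT (%x. c * g x) z = c * FT g z"
 by (simp add: FT_def mult.left_commute)

lemma FT_sum: "(!!i. i \<in> I ==> g i \<in> tf UNIV) ==> FT (%x. \<Sum>i\<in>I. g i x) z = (\<Sum>i\<in>I. FT (g i) z)"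
 unfolding FT_def sum_distrib_left using FT_integrable by (intro Bochner_Integration.integral_sum) auto

lemma FT_diff: "g \<in> tf UNIV ==> h \<in> tf UNIV ==> FT (%x. g x - h x) z = FT g z - FT h z"
 unfolding FT_def right_diff_distrib by (intro Bochner_Integration.integral_diff FT_integrable)

text \<open>With the exponential regarded as a regular distribution, \<open>mollify_pairing\<close>
  plays the part of Fubini's theorem.\<close>

lemma FT_conv:
 assumes g: "g \<in> tf UNIV" and h: "h \<in> tf UNIV"
 shows "FT (conv g h) t = FT g t * FT h t"
proof -
 let ?u = "reg UNIV (osc t)"
 have u: "?u \<in> distributions UNIV" by (rule reg_distribution[OF loc_int_continuous[OF osc_continuous]])
 have r: "(%z. h (- z)) \<in> tf UNIV" using test_compose_affine(1)[OF h, of "-1" 0] by simp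
 have hm: "h \<in> borel_measurable borel" "osc t \<in> borel_measurable borel"
  using test_continuous[OF h] by (auto intro: cont_bm osc_continuous)
 have inner: "?u (%y. h (- (x - y))) = osc t x * FT h t" for x
 proof -
  have "(%y. h (- (x - y))) \<in> tf UNIV" using test_compose_affine(1)[OF h, of 1 "- x"] by simp
  hence "?u (%y. h (- (x - y))) = (LI y. osc t y * h (- (x - y)))" by (simp add: reg_def)
  also have "... = (LI y. osc t (x + y) * h (- (x - (x + y))))"
   using hm by (intro lborel_integral_translate[symmetric]) simp
  also have "... = (LI y. osc t x * (osc t y * h y))" by (simp add: osc_add mult.assoc)
  finally show ?thesis by (simp add: FT_def)
 qed
 have ct: "conv g h \<in> tf UNIV"
  using mollify_pairing(1)[OF u open_UNIV r h _ g] by simp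
 have "FT (conv g h) t = ?u (conv g h)" using ct by (simp add: FT_def reg_def)
 also have "... = (LI x. g x * ?u (%y. h (- (x - y))))"
  using mollify_pairing(2)[OF u open_UNIV r h _ g] by simp
 also have "... = (LI x. (osc t x * g x) * FT h t)" unfolding inner by (simp add: mult_ac)
 finally show ?thesis by (simp add: FT_def)
qed

subsection \<open>The Gaussian\<close>

lemma Basis_vec_eq: "(Basis :: (real ^ 'd) set) = (%j. ax j) ` UNIV"
 by (auto simp: Basis_vec_def)

text \<open>Lebesgue measure on the vector type is the image of the product measure over
  \<open>Basis\<close>, and the basis vectors are indexed by the coordinates.\<close>

lemma lborel_prod_cart:
 fixes f :: "'d::finite => real => 'b::{real_normed_field, banach, second_countable_topology}"
 assumes f: "!!j. integrable lborel (f j)"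
 shows "integrable lborel (%x::real^'d. \<Prod>j\<in>UNIV. f j (x $ j))"
  and "(LI x. (\<Prod>j\<in>UNIV. f j (x $ j))) = (\<Prod>j\<in>UNIV. integral\<^sup>L lborel (f j))"
proof -
 interpret product_sigma_finite "%_::real^'d. lborel :: real measure" by standard
 define T where "T = (%g. \<Sum>b\<in>(Basis :: (real^'d) set). g b *\<^sub>R b)"
 have Tm: "T \<in> measurable (\<Pi>\<^sub>M b\<in>Basis. lborel) borel" unfolding T_def by measurable
 have lb: "(lborel :: (real^'d) measure) = distr (\<Pi>\<^sub>M b\<in>Basis. lborel) borel T"
  unfolding T_def by (rule lborel_eq)
 define idx where "idx = inv (%j::'d. axis j (1::real))"
 have inj: "inj (%j::'d. axis j (1::real))" by (auto simp: inj_def axis_eq_axis)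
 have idx: "idx (ax j) = j" for j unfolding idx_def using inv_f_f[OF inj] .
 have Tn: "T g $ j = g (ax j)" for g j
 proof -
  have "T g \<bullet> ax j = g (ax j)"
   unfolding T_def by (rule inner_sum_left_Basis) (auto simp: Basis_vec_eq)
  thus ?thesis by (simp add: inner_axis)
 qed
 have FT': "(\<Prod>j\<in>UNIV. f j (T g $ j)) = (\<Prod>b\<in>Basis. f (idx b) (g b))" for g
  unfolding Basis_vec_eq prod.reindex[OF inj] by (simp add: Tn idx)
 have meas: "(%x::real^'d. \<Prod>j\<in>UNIV. f j (x $ j)) \<in> borel_measurable borel"
 proof (intro borel_measurable_prod)
  fix j
  have "f j \<in> borel_measurable borel" using borel_measurable_integrable[OF f, of j] by simp
  thus "(%x::real^'d. f j (x $ j)) \<in> borel_measurable borel"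
   using measurable_compose[of "%x::real^'d. x $ j" borel borel "f j" borel] by simp
 qed
 have i: "integrable (\<Pi>\<^sub>M b\<in>Basis. lborel) (%g. \<Prod>b\<in>Basis. f (idx b) (g b))"
  by (rule product_integrable_prod) (auto intro: f)
 show "integrable lborel (%x::real^'d. \<Prod>j\<in>UNIV. f j (x $ j))"
  unfolding lb using integrable_distr_eq[OF Tm meas] i by (simp add: FT')
 have "(LI x. (\<Prod>j\<in>UNIV. f j (x $ j))) = (\<integral>g. (\<Prod>b\<in>Basis. f (idx b) (g b)) \<partial>(\<Pi>\<^sub>M b\<in>Basis. lborel))"
  unfolding lb using integral_distr[OF Tm meas] by (simp add: FT')
 also have "... = (\<Prod>b\<in>Basis. integral\<^sup>L lborel (f (idx b)))"
  by (rule product_integral_prod) (auto intro: f)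
 also have "... = (\<Prod>j\<in>UNIV. integral\<^sup>L lborel (f j))"
  unfolding Basis_vec_eq prod.reindex[OF inj] by (simp add: idx)
 finally show "(LI x. (\<Prod>j\<in>UNIV. f j (x $ j))) = (\<Prod>j\<in>UNIV. integral\<^sup>L lborel (f j))" .
qed

definition gauss :: "real ^ 'd::finite => real"
 where "gauss x = (\<Prod>j\<in>UNIV. std_normal_density (x $ j))"

lemma gauss_pos: "gauss x > 0"
 unfolding gauss_def by (intro prod_pos) (simp add: normal_density_pos)

lemma integrable_std_normal_density: "integrable lborel std_normal_density"
 using integrable_std_normal_moment[of 0] by simp

lemma integral_std_normal_density: "integral\<^sup>L lborel std_normal_density = 1"
 using integral_std_normal_moment_even[of 0] by simp

lemma gauss_integrable: "integrable lborel (gauss :: real ^ 'd::finite => real)"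
 unfolding gauss_def[abs_def] by (rule lborel_prod_cart(1)) (rule integrable_std_normal_density)

lemma gauss_integral: "integral\<^sup>L lborel (gauss :: real ^ 'd::finite => real) = 1"
 unfolding gauss_def[abs_def] using lborel_prod_cart(2)[of "%_::'d. std_normal_density"]
 by (simp add: integrable_std_normal_density integral_std_normal_density)

text \<open>In each coordinate this is the characteristic function of the standard normal
  distribution, which is the density again up to the factor \<open>sqrt (2 * pi)\<close>.\<close>

lemma FT_gauss: "(LI z. osc z x * cr (gauss z)) = cr (sqrt (2 * pi) ^ CARD('d) * gauss (x :: real ^ 'd::finite))"
proof -
 define f where "f = (%j t. iexp (- (x $ j) * t) * cr (std_normal_density t))"
 have cm: "cmod (f j t) = std_normal_density t" for j t
  by (simp add: f_def norm_mult norm_exp_i_times[of "- (x $ j) * t", simplified])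
 have fi: "integrable lborel (f j)" for j
 proof (rule Bochner_Integration.integrable_bound[OF integrable_std_normal_density])
  show "f j \<in> borel_measurable lborel" unfolding f_def by measurable
  show "AE t in lborel. norm (f j t) <= norm (std_normal_density t)" by (simp add: cm)
 qed
 have fI: "integral\<^sup>L lborel (f j) = cr (sqrt (2 * pi) * std_normal_density (x $ j))" for j
 proof -
  have "cr (exp (- ((- (x $ j))\<^sup>2) / 2)) = char std_normal_distribution (- (x $ j))"
   by (simp only: char_std_normal_distribution)
  also have "... = (LI t. std_normal_density t *\<^sub>R iexp (- (x $ j) * t))"
   unfolding char_def by (subst integral_density) (auto simp: normal_density_nonneg)
  also have "... = integral\<^sup>L lborel (f j)"
   by (simp add: f_def scaleR_conv_of_real mult.commute)
  finally show ?thesis by (simp add: std_normal_density_def)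
 qed
 have "osc z x * cr (gauss z) = (\<Prod>j\<in>UNIV. f j (z $ j))" for z
  by (simp add: f_def osc_def gauss_def prod.distrib exp_sum[symmetric] inner_vec_def sum_negf sum_distrib_left mult.commute)
 hence "(LI z. osc z x * cr (gauss z)) = (\<Prod>j\<in>UNIV. integral\<^sup>L lborel (f j))"
  using lborel_prod_cart(2)[of f] fi by simp
 thus ?thesis by (simp add: fI gauss_def prod.distrib)
qed

lemma gauss_measurable [measurable]: "gauss \<in> borel_measurable borel"
 using borel_measurable_integrable[OF gauss_integrable] by simp

text \<open>The Gaussian makes the double integral absolutely convergent, so Fubini's theorem moves
  the transform from \<open>B\<close> to \<open>gauss\<close>.\<close>

lemma FT_gauss_pairing:
 assumes B: "B \<in> tf UNIV"
 shows "integrable lborel (%z. FT B z * cr (gauss z))"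
  and "(LI z. FT B z * cr (gauss z)) = (LI x. B (x :: real ^ 'd::finite) * cr (sqrt (2 * pi) ^ CARD('d) * gauss x))"
proof -
 let ?F = "%(z, x). osc z x * B x * cr (gauss z)"
 have Bm [measurable]: "B \<in> borel_measurable borel" using test_continuous[OF B] by (rule cont_bm)
 have om: "(%(z, x). osc z x) \<in> borel_measurable (lborel \<Otimes>\<^sub>M lborel)"
  unfolding osc_def lborel_prod by (simp add: split_def) (intro cont_bm continuous_intros)
 have m: "?F \<in> borel_measurable (lborel \<Otimes>\<^sub>M lborel)"
 proof -
  have [measurable]: "(%p. osc (fst p) (snd p)) \<in> borel_measurable (lborel \<Otimes>\<^sub>M lborel)"
   using om by (simp add: split_def)
  have [measurable]: "B \<in> borel_measurable lborel" "(%z. cr (gauss z)) \<in> borel_measurable lborel" by simp_all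
  show ?thesis unfolding split_def by measurable
 qed
 have int: "integrable (lborel \<Otimes>\<^sub>M lborel) ?F"
 proof (rule lborel_pair.Fubini_integrable[OF m])
  have "(LI x. norm (?F (z, x))) = gauss z * (LI x. cmod (B x))" for z
   using gauss_pos[of z] by (simp add: norm_mult mult.commute)
  moreover have "integrable lborel (%z. gauss z * (LI x. cmod (B x)))"
   by (intro integrable_mult_left gauss_integrable)
  ultimately show "integrable lborel (%z. LI x. norm (?F (z, x)))" by simp
  show "AE z in lborel. integrable lborel (%x. ?F (z, x))"
   using FT_integrable[OF B] by simp
 qed
 have 1: "(LI x. osc z x * B x * cr (gauss z)) = FT B z * cr (gauss z)" for z
  by (simp add: FT_def)
 show "integrable lborel (%z. FT B z * cr (gauss z))"
  using lborel_pair.integrable_fst'[OF int] unfolding 1 split .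
 have 2: "(LI z. osc z x * B x * cr (gauss z)) = B x * cr (sqrt (2 * pi) ^ CARD('d) * gauss x)" for x
 proof -
  have "(LI z. osc z x * B x * cr (gauss z)) = (LI z. B x * (osc z x * cr (gauss z)))" by (simp add: mult_ac)
  thus ?thesis using FT_gauss[of x] by simp
 qed
 have "(LI x. (LI z. osc z x * B x * cr (gauss z))) = (LI z. (LI x. osc z x * B x * cr (gauss z)))"
  by (rule lborel_pair.Fubini_integral) (use int in \<open>simp add: split_def\<close>)
 thus "(LI z. FT B z * cr (gauss z)) = (LI x. B x * cr (sqrt (2 * pi) ^ CARD('d) * gauss x))"
  unfolding 1 2 by (rule sym)
qed

subsection \<open>Plancherel\<close>

text \<open>The transform of this function is the squared modulus of that of \<open>g\<close>, and
  its value at 0 is the squared L2 norm of \<open>g\<close>; Plancherel's identity for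
  \<open>g\<close> thus becomes Fourier inversion at 0.\<close>

definition autocorr :: "(real ^ 'd::finite => complex) => real ^ 'd => complex"
 where "autocorr g = conv g (%z. cnj (g (- z)))"

lemma autocorr:
 assumes g: "g \<in> tf UNIV"
 shows "autocorr g \<in> tf UNIV" "FT (autocorr g) y = cr ((cmod (FT g y))\<^sup>2)"
  "autocorr g 0 = cr (LI x. (cmod (g x))\<^sup>2)"
proof -
 have h: "(%z. cnj (g (- z))) \<in> tf UNIV"
  using test_cnj[OF test_compose_affine(1)[OF g, of "-1" 0]] by simp
 show "autocorr g \<in> tf UNIV"
  unfolding autocorr_def using loc_int_continuous[OF test_continuous[OF g]] h g
  by (intro conv_test[of _ _ "supp g"]) (auto simp: tf_iff not_supp)
 have "FT (%z. cnj (g (- z))) y = (LI x. osc y (0 - x) * cnj (g (- (0 - x))))"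
  unfolding FT_def
  by (intro lborel_integral_reflect[symmetric] cont_bm continuous_intros osc_continuous
   continuous_on_compose2[OF test_continuous[OF g, of UNIV]]) auto
 also have "... = (LI x. cnj (osc y x * g x))"
  by (simp add: osc_def exp_cnj)
 also have "... = cnj (FT g y)" unfolding FT_def by (rule integral_bounded_linear[OF bounded_linear_cnj FT_integrable[OF g]])
 finally show "FT (autocorr g) y = cr ((cmod (FT g y))\<^sup>2)"
  unfolding autocorr_def FT_conv[OF g h] by (simp only: complex_norm_square)
 have "autocorr g 0 = (LI x. cr ((cmod (g x))\<^sup>2))"
  unfolding autocorr_def conv_def by (simp only: complex_norm_square diff_0 minus_minus)
 thus "autocorr g 0 = cr (LI x. (cmod (g x))\<^sup>2)"
  by (simp only: integral_complex_of_real)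
qed

lemma FT_scale:
 assumes "B \<in> tf UNIV" "s > 0"
 shows "FT (%x. B (s *\<^sub>R x)) z = cr ((1 / s) ^ CARD('d)) * FT B ((1 / s) *\<^sub>R z :: real ^ 'd::finite)"
proof -
 have m: "(%x. osc ((1 / s) *\<^sub>R z) x * B x) \<in> borel_measurable borel"
  using test_continuous[OF assms(1)] by (intro cont_bm continuous_intros osc_continuous) auto
 have "FT B ((1 / s) *\<^sub>R z) = \<bar>s\<bar> ^ DIM(real^'d) *\<^sub>R (LI x. osc ((1 / s) *\<^sub>R z) (0 + s *\<^sub>R x) * B (0 + s *\<^sub>R x))"
  unfolding FT_def using assms(2) m by (intro lborel_integral_scale) auto
 also have "... = cr (s ^ CARD('d)) * FT (%x. B (s *\<^sub>R x)) z"
  using assms(2) by (simp add: FT_def osc_def scaleR_conv_of_real[where 'a=complex])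
 finally show ?thesis using assms(2) by (simp add: power_divide)
qed

text \<open>Plancherel's identity, reached as a limit of Gaussian means so that no decay of the transform is needed.\<close>

lemma plancherel_limit:
 fixes g :: "real ^ 'd::finite => complex"
 assumes g: "g \<in> tf UNIV"
 shows "integrable lborel (%z. (cmod (FT g (real (Suc n) *\<^sub>R z)))\<^sup>2 * gauss z)"
  and "(%n. real (Suc n) ^ CARD('d) * (LI z. (cmod (FT g (real (Suc n) *\<^sub>R z)))\<^sup>2 * gauss z))
   \<longlonglongrightarrow> sqrt (2 * pi) ^ CARD('d) * (LI x. (cmod (g x))\<^sup>2)"
proof -
 let ?A = "autocorr g" and ?k = "sqrt (2 * pi) ^ CARD('d)"
 \<comment> \<open>Dilating \<open>autocorr g\<close> by \<open>s n\<close> dilates its transform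
   the other way; as \<open>s n\<close> tends to 0 the values under the Gaussian integral tend to
   \<open>autocorr g 0\<close>.\<close>
 define s where "s = (%n. 1 / real (Suc n))"
 have s: "s n > 0" for n by (simp add: s_def)
 have sT: "(%x. ?A (s n *\<^sub>R x)) \<in> tf UNIV" for n
  using test_compose_affine(1)[OF autocorr(1)[OF g], of "s n" 0] s[of n] by simp
 have F: "FT (%x. ?A (s n *\<^sub>R x)) z * cr (gauss z) = cr (real (Suc n) ^ CARD('d) * ((cmod (FT g (real (Suc n) *\<^sub>R z)))\<^sup>2 * gauss z))" for n z
  using FT_scale[OF autocorr(1)[OF g] s, of n z] by (simp add: autocorr(2)[OF g] s_def mult.assoc)
 have "integrable lborel (%z. cr (real (Suc n) ^ CARD('d) * ((cmod (FT g (real (Suc n) *\<^sub>R z)))\<^sup>2 * gauss z)))" for n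
  using FT_gauss_pairing(1)[OF sT, of n] unfolding F .
 hence "integrable lborel (%z. real (Suc n) ^ CARD('d) * ((cmod (FT g (real (Suc n) *\<^sub>R z)))\<^sup>2 * gauss z))" for n
  by (simp only: complex_of_real_integrable_eq)
 from integrable_mult_right[OF this, of "1 / real (Suc n) ^ CARD('d)" n]
 show "integrable lborel (%z. (cmod (FT g (real (Suc n) *\<^sub>R z)))\<^sup>2 * gauss z)"
  by (simp add: mult.assoc[symmetric] del: of_nat_Suc)
 have eq: "cr (real (Suc n) ^ CARD('d) * (LI z. (cmod (FT g (real (Suc n) *\<^sub>R z)))\<^sup>2 * gauss z))
   = (LI x. ?A (s n *\<^sub>R x) * cr (?k * gauss x))" for n
 proof -
  have "cr (real (Suc n) ^ CARD('d) * (LI z. (cmod (FT g (real (Suc n) *\<^sub>R z)))\<^sup>2 * gauss z))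
    = cr (LI z. real (Suc n) ^ CARD('d) * ((cmod (FT g (real (Suc n) *\<^sub>R z)))\<^sup>2 * gauss z))"
   by simp
  also have "... = (LI z. cr (real (Suc n) ^ CARD('d) * ((cmod (FT g (real (Suc n) *\<^sub>R z)))\<^sup>2 * gauss z)))"
   by (rule integral_complex_of_real[symmetric])
  also have "... = (LI x. ?A (s n *\<^sub>R x) * cr (?k * gauss x))"
   unfolding F[symmetric] by (rule FT_gauss_pairing(2)[OF sT])
  finally show ?thesis .
 qed
 obtain M where M: "M > 0" "!!y. cmod (?A y) <= M" using DL_bounded[OF autocorr(1)[OF g], of "[]"] by auto
 have Am [measurable]: "?A \<in> borel_measurable borel"
  using test_continuous[OF autocorr(1)[OF g]] by (rule cont_bm)
 have "(%n. LI x. ?A (s n *\<^sub>R x) * cr (?k * gauss x)) \<longlonglongrightarrow> (LI x. ?A 0 * cr (?k * gauss (x :: real ^ 'd)))"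
 proof (rule integral_dominated_convergence[where w = "%x. M * (?k * gauss x)"])
  show "integrable lborel (%x::real^'d. M * (?k * gauss x))" by (intro integrable_mult_right gauss_integrable)
  show "AE x in lborel. (%n. ?A (s n *\<^sub>R x) * cr (?k * gauss x)) \<longlonglongrightarrow> ?A 0 * cr (?k * gauss x)"
  proof (rule AE_I2)
   fix x :: "real ^ 'd"
   have "(%n. s n *\<^sub>R x) \<longlonglongrightarrow> 0 *\<^sub>R x"
    unfolding s_def by (intro tendsto_intros LIMSEQ_Suc[OF lim_1_over_n])
   moreover have "isCont ?A 0" using test_continuous[OF autocorr(1)[OF g], of UNIV] by (simp add: continuous_on_eq_continuous_at)
   ultimately have "(%n. ?A (s n *\<^sub>R x)) \<longlonglongrightarrow> ?A 0" using isCont_tendsto_compose by fastforce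
   thus "(%n. ?A (s n *\<^sub>R x) * cr (?k * gauss x)) \<longlonglongrightarrow> ?A 0 * cr (?k * gauss x)"
    by (rule tendsto_mult_right)
  qed
  show "AE x in lborel. norm (?A (s n *\<^sub>R x) * cr (?k * gauss x)) <= M * (?k * gauss x)" for n
  proof (rule AE_I2)
   fix x :: "real ^ 'd"
   have "\<bar>?k * gauss x\<bar> = ?k * gauss x" using gauss_pos[of x] by simp
   hence "norm (?A (s n *\<^sub>R x) * cr (?k * gauss x)) = cmod (?A (s n *\<^sub>R x)) * (?k * gauss x)"
    by (simp only: norm_mult norm_of_real)
   thus "norm (?A (s n *\<^sub>R x) * cr (?k * gauss x)) <= M * (?k * gauss x)"
    using M(2)[of "s n *\<^sub>R x"] gauss_pos[of x] by (simp add: mult_right_mono)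
  qed
 qed measurable
 also have "(LI x. ?A 0 * cr (?k * gauss (x :: real ^ 'd))) = ?A 0 * cr ?k"
 proof -
  have "(LI x. ?A 0 * cr (?k * gauss (x :: real ^ 'd))) = ?A 0 * (LI x. cr (?k * gauss (x :: real ^ 'd)))"
   by simp
  also have "(LI x. cr (?k * gauss (x :: real ^ 'd))) = cr (LI x. ?k * gauss (x :: real ^ 'd))"
   by (rule integral_complex_of_real)
  finally show ?thesis by (simp add: gauss_integral)
 qed
 also have "... = cr (?k * (LI x. (cmod (g x))\<^sup>2))"
  by (simp add: autocorr(3)[OF g])
 finally have "(%n. cr (real (Suc n) ^ CARD('d) * (LI z. (cmod (FT g (real (Suc n) *\<^sub>R z)))\<^sup>2 * gauss z)))
   \<longlonglongrightarrow> cr (?k * (LI x. (cmod (g x))\<^sup>2))"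
  unfolding eq .
 thus "(%n. real (Suc n) ^ CARD('d) * (LI z. (cmod (FT g (real (Suc n) *\<^sub>R z)))\<^sup>2 * gauss z)) \<longlonglongrightarrow> ?k * (LI x. (cmod (g x))\<^sup>2)"
  by (simp only: tendsto_of_real_iff)
qed

text \<open>The pointwise inequality is integrated against the Gaussian at dilated arguments and
  carried to the limit by \<open>plancherel_limit\<close>.\<close>

lemma L2_estimate_of_FT:
 assumes f: "f \<in> tf UNIV" and q: "q \<in> tf UNIV" "h \<in> tf UNIV" and "C \<ge> 0"
  and le: "!!z. (cmod (FT f z))\<^sup>2 <= C * ((cmod (FT q z))\<^sup>2 + (cmod (FT h z))\<^sup>2)"
 shows "(LI x. (cmod (f x))\<^sup>2) <= C * ((LI x. (cmod (q x))\<^sup>2) + (LI x. (cmod (h (x :: real ^ 'd::finite)))\<^sup>2))"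
proof -
 let ?I = "%g n. LI z. (cmod (FT g (real (Suc n) *\<^sub>R z)))\<^sup>2 * gauss (z :: real ^ 'd)"
 let ?k = "sqrt (2 * pi) ^ CARD('d)"
 have "?I f n <= C * (?I q n + ?I h n)" for n
 proof -
  have "?I f n <= (LI z. C * ((cmod (FT q (real (Suc n) *\<^sub>R z)))\<^sup>2 * gauss z + (cmod (FT h (real (Suc n) *\<^sub>R z)))\<^sup>2 * gauss (z :: real ^ 'd)))"
  proof (rule lint_mono)
   show "integrable lborel (%z. (cmod (FT f (real (Suc n) *\<^sub>R z)))\<^sup>2 * gauss z)" by (rule plancherel_limit(1)[OF f])
   show "integrable lborel (%z. C * ((cmod (FT q (real (Suc n) *\<^sub>R z)))\<^sup>2 * gauss z + (cmod (FT h (real (Suc n) *\<^sub>R z)))\<^sup>2 * gauss (z :: real ^ 'd)))"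
    by (intro integrable_mult_right Bochner_Integration.integrable_add plancherel_limit(1) q)
   fix z :: "real ^ 'd"
   show "(cmod (FT f (real (Suc n) *\<^sub>R z)))\<^sup>2 * gauss z <= C * ((cmod (FT q (real (Suc n) *\<^sub>R z)))\<^sup>2 * gauss z + (cmod (FT h (real (Suc n) *\<^sub>R z)))\<^sup>2 * gauss z)"
    using mult_right_mono[OF le[of "real (Suc n) *\<^sub>R z"], of "gauss z"] gauss_pos[of z] by (simp only: distrib_right mult.assoc less_imp_le)
  qed
  also have "... = C * (?I q n + ?I h n)"
   using plancherel_limit(1)[OF q(1), of n] plancherel_limit(1)[OF q(2), of n] by simp
  finally show ?thesis .
 qed
 hence "real (Suc n) ^ CARD('d) * ?I f n <= C * (real (Suc n) ^ CARD('d) * ?I q n + real (Suc n) ^ CARD('d) * ?I h n)" for n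
  using mult_left_mono[of "?I f n" "C * (?I q n + ?I h n)" "real (Suc n) ^ CARD('d)"] by (simp only: distrib_left mult.left_commute[of C] zero_le_power of_nat_0_le_iff)
 hence "?k * (LI x. (cmod (f x))\<^sup>2) <= C * (?k * (LI x. (cmod (q x))\<^sup>2) + ?k * (LI x. (cmod (h x))\<^sup>2))"
  by (intro LIMSEQ_le[OF plancherel_limit(2)[OF f] tendsto_mult_left[OF tendsto_add[OF plancherel_limit(2)[OF q(1)] plancherel_limit(2)[OF q(2)]]]]) auto
 hence "?k * (LI x. (cmod (f x))\<^sup>2) <= ?k * (C * ((LI x. (cmod (q x))\<^sup>2) + (LI x. (cmod (h x))\<^sup>2)))"
  by (simp only: distrib_left mult.left_commute)
 thus ?thesis by (simp only: mult_le_cancel_left_pos zero_less_power real_sqrt_gt_zero pi_gt_zero zero_less_numeral mult_pos_pos)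
qed

lemma L2_zero_imp_zero:
 assumes "continuous_on UNIV f" "integrable lborel (%x. (cmod (f x))\<^sup>2)" "(LI x. (cmod (f x))\<^sup>2) <= 0"
 shows "f (x :: real ^ 'd::finite) = 0"
proof -
 have "(LI x. (cmod (f x))\<^sup>2) = 0" using assms(3) by (simp add: antisym)
 hence "AE x in lborel. (cmod (f x))\<^sup>2 = 0"
  using integral_nonneg_eq_0_iff_AE[OF assms(2)] by simp
 hence "AE x in lborel. x \<in> UNIV --> f x = 0" by (rule eventually_mono) simp
 thus ?thesis using AE_zero_continuous[OF open_UNIV assms(1) _ UNIV_I] by blast
qed

lemma test_L2_integrable: "f \<in> tf X ==> integrable lborel (%x. (cmod (f x))\<^sup>2)"
 by (rule integrable_compact_support[of _ "supp f"])
  (auto intro!: continuous_intros test_continuous simp: tf_iff not_supp)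

lemma FT_inj:
 assumes "f \<in> tf UNIV" "!!z. FT f z = 0"
 shows "f x = 0"
proof (rule L2_zero_imp_zero)
 show "(LI x. (cmod (f x))\<^sup>2) <= 0"
  using L2_estimate_of_FT[OF assms(1) test_zero test_zero, of 0] assms(2) by simp
qed (use assms(1) in \<open>auto intro: test_continuous test_L2_integrable\<close>)

section \<open>Ellipticity along a subspace\<close>

lemma prod_mvecs: "(\<Prod>v\<leftarrow>mvecs a. h v) = (\<Prod>j\<in>UNIV. h (ax j) ^ (a $ j))" for h :: "real ^ 'd::finite => 'b::comm_monoid_mult"
proof -
 have *: "prod_list (map h (concat (map (%j. replicate (a $ j) (ax j)) cs))) = (\<Prod>j\<leftarrow>cs. h (ax j) ^ (a $ j))" for cs
  by (induction cs) (simp_all add: prod_list_replicate)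
 have "(\<Prod>v\<leftarrow>mvecs a. h v) = (\<Prod>j\<in>set coords. h (ax j) ^ (a $ j))"
  unfolding mvecs_def * by (rule prod.distinct_set_conv_list[OF coords(1), symmetric])
 thus ?thesis by (simp add: coords(2))
qed

lemma prod_list_scale: "(\<Prod>v\<leftarrow>vs. c * h v) = c ^ length vs * (\<Prod>v\<leftarrow>vs. h v)" for c :: "'b::comm_monoid_mult"
 by (induction vs) (auto simp: mult_ac)

text \<open>The powers of \<open>- \<i>\<close> in the definition of \<open>P(D)\<close> cancel the
  powers of \<open>\<i>\<close> produced by \<open>FT_DL\<close>.\<close>

lemma FT_diff_op:
 assumes f: "f \<in> tf UNIV"
 shows "FT (diff_op P f) z = mpoly_eval P z * FT f z"
proof -
 have *: "(- \<i>) ^ mi_size a * (\<Prod>v\<leftarrow>mvecs a. \<i> * cr (z \<bullet> v)) = (\<Prod>j\<in>UNIV. cr (z $ j) ^ (a $ j))" for a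
 proof -
  have "(\<Prod>v\<leftarrow>mvecs a. \<i> * cr (z \<bullet> v)) = \<i> ^ mi_size a * (\<Prod>j\<in>UNIV. cr (z $ j) ^ (a $ j))"
   unfolding prod_list_scale length_mvecs prod_mvecs by (simp add: inner_axis)
  thus ?thesis by (simp add: mult.assoc[symmetric] power_mult_distrib[symmetric])
 qed
 have "FT (diff_op P f) z = (\<Sum>a\<in>keys P. FT (%x. coef P a * (- \<i>) ^ mi_size a * DL (mvecs a) f x) z)"
  unfolding diff_op_DL[abs_def] by (intro FT_sum test_cmult test_DL f)
 also have "... = (\<Sum>a\<in>keys P. coef P a * ((- \<i>) ^ mi_size a * (\<Prod>v\<leftarrow>mvecs a. \<i> * cr (z \<bullet> v))) * FT f z)"
  unfolding FT_cmult FT_DL[OF f] by (simp add: mult.assoc)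
 finally show ?thesis
  unfolding * by (simp add: mpoly_eval_def sum_distrib_right)
qed

subsection \<open>Orthogonal projections\<close>

context
 fixes W :: "(real ^ 'd::finite) set"
 assumes W: "subspace W"
begin

abbreviation "\<pi> \<equiv> orth_proj W"

lemma orth_proj_mem: "\<pi> x \<in> W"
 and orth_proj_orth: "w \<in> W ==> (x - \<pi> x) \<bullet> w = 0"
 using orth_proj[OF W, of x] by (auto simp: orthogonal_def)

lemma orth_proj_eqI:
 assumes "y \<in> W" "!!w. w \<in> W ==> (x - y) \<bullet> w = 0"
 shows "\<pi> x = y"
proof -
 have m: "\<pi> x - y \<in> W" using orth_proj_mem assms(1) W by (simp add: subspace_diff)
 have "(x - y) \<bullet> (\<pi> x - y) - (x - \<pi> x) \<bullet> (\<pi> x - y) = 0" using orth_proj_orth[OF m] assms(2)[OF m] by simp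
 hence "(\<pi> x - y) \<bullet> (\<pi> x - y) = 0" by (simp flip: inner_diff_left)
 thus ?thesis by simp
qed

lemma orth_proj_add: "\<pi> (x + y) = \<pi> x + \<pi> y"
proof (rule orth_proj_eqI)
 show "\<pi> x + \<pi> y \<in> W" using W orth_proj_mem by (simp add: subspace_add)
 show "(x + y - (\<pi> x + \<pi> y)) \<bullet> w = 0" if "w \<in> W" for w
 proof -
  have "(x + y - (\<pi> x + \<pi> y)) \<bullet> w = (x - \<pi> x) \<bullet> w + (y - \<pi> y) \<bullet> w"
   by (simp add: inner_add_left inner_diff_left)
  thus ?thesis using orth_proj_orth[OF that, of x] orth_proj_orth[OF that, of y] by simp
 qed
qed

lemma orth_proj_scale: "\<pi> (c *\<^sub>R x) = c *\<^sub>R \<pi> x"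
proof (rule orth_proj_eqI)
 show "c *\<^sub>R \<pi> x \<in> W" using W orth_proj_mem by (simp add: subspace_scale)
 show "(c *\<^sub>R x - c *\<^sub>R \<pi> x) \<bullet> w = 0" if "w \<in> W" for w
  using orth_proj_orth[OF that, of x] by (simp flip: scaleR_diff_right)
qed

lemma orth_proj_linear: "linear \<pi>"
 by (intro linearI orth_proj_add orth_proj_scale)

lemma orth_proj_minus: "\<pi> (- x) = - \<pi> x"
 using orth_proj_scale[of "-1" x] by simp

lemma orth_proj_diff: "\<pi> (x - y) = \<pi> x - \<pi> y"
 using orth_proj_add[of x "- y"] by (simp add: orth_proj_minus)

lemma orth_proj_id: "w \<in> W ==> \<pi> w = w"
 by (rule orth_proj_eqI) auto

lemma inner_orth_proj: "w \<in> W ==> \<pi> x \<bullet> w = x \<bullet> w"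
 using orth_proj_orth[of w x] by (simp add: inner_diff_left)

lemma orth_proj_adjoint: "x \<bullet> \<pi> y = \<pi> x \<bullet> y"
 using inner_orth_proj[OF orth_proj_mem, of x y] inner_orth_proj[OF orth_proj_mem, of y x] by (simp add: inner_commute)

lemma norm_orth_proj: "norm (\<pi> x) <= norm x"
proof (cases "\<pi> x = 0")
 case False
 have "norm (\<pi> x) ^ 2 = \<pi> x \<bullet> \<pi> x" by (simp add: power2_norm_eq_inner)
 also have "... = x \<bullet> \<pi> x" by (rule inner_orth_proj[OF orth_proj_mem])
 also have "... <= norm x * norm (\<pi> x)" by (rule norm_cauchy_schwarz)
 finally show ?thesis using False by (simp add: power2_eq_square)
qed auto

lemma norm_orth_compl: "norm (x - \<pi> x) <= norm x"
proof -
 have "(norm x)\<^sup>2 = (norm (x - \<pi> x + \<pi> x))\<^sup>2" by simp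
 also have "... = (norm (x - \<pi> x))\<^sup>2 + (norm (\<pi> x))\<^sup>2"
  using orth_proj_orth[OF orth_proj_mem, of x x] by (simp only: power2_norm_eq_inner inner_add_left inner_add_right inner_commute)
 finally have "(norm (x - \<pi> x))\<^sup>2 <= (norm x)\<^sup>2" by simp
 thus ?thesis by (rule power2_le_imp_le) simp
qed

lemma orth_proj_continuous: "continuous_on S \<pi>"
 by (rule linear_continuous_on) (simp add: linear_conv_bounded_linear[symmetric] orth_proj_linear)

end

lemma mpoly_eval_bound:
 "cmod (\<Prod>j\<in>UNIV. cr (h $ j) ^ (a $ j)) <= norm (h :: real ^ 'd::finite) ^ mi_size a"
proof -
 have "cmod (\<Prod>j\<in>UNIV. cr (h $ j) ^ (a $ j)) = (\<Prod>j\<in>UNIV. \<bar>h $ j\<bar> ^ (a $ j))"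
  by (simp add: prod_norm[symmetric] norm_power)
 also have "... <= (\<Prod>j\<in>UNIV. norm h ^ (a $ j))"
  by (intro prod_mono) (auto intro: power_mono component_le_norm_cart)
 finally show ?thesis by (simp add: power_sum mi_size_def)
qed

lemma lookup_principal_part:
 "coef (principal_part P) a = (if mi_size a = deg P then coef P a else 0)"
 by (auto simp: principal_part_def lookup_mapp in_keys_iff when_def)

lemma mpoly_eval_superset:
 assumes "finite S" "keys P <= S"
 shows "mpoly_eval P z = (\<Sum>a\<in>S. coef P a * (\<Prod>j\<in>UNIV. cr (z $ j) ^ (a $ j)))"
 unfolding mpoly_eval_def using assms by (intro sum.mono_neutral_left) (auto simp: in_keys_iff)

lemma keys_principal_part: "keys (principal_part P) <= keys P"
 by (auto simp: in_keys_iff lookup_principal_part split: if_splits)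

lemma principal_part_homogeneous:
 "mpoly_eval (principal_part P) (c *\<^sub>R z) = cr c ^ deg P * mpoly_eval (principal_part P) z"
proof -
 have "(\<Prod>j\<in>UNIV. cr ((c *\<^sub>R z) $ j) ^ (a $ j)) = cr c ^ mi_size a * (\<Prod>j\<in>UNIV. cr (z $ j) ^ (a $ j))" for a
  by (simp add: power_mult_distrib prod.distrib power_sum mi_size_def)
 thus ?thesis
  unfolding mpoly_eval_superset[OF finite_keys keys_principal_part] sum_distrib_left
  by (intro sum.cong) (auto simp: lookup_principal_part)
qed

lemma deg_ge: "a \<in> keys P ==> mi_size a <= deg P"
 unfolding mpoly_degree_def by (intro Max_ge) auto

lemma mpoly_eval_continuous: "continuous_on S (mpoly_eval P)"
 unfolding mpoly_eval_def by (intro continuous_intros)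

context
 fixes P :: "'d::finite mpoly" and W :: "(real ^ 'd) set"
 assumes W: "subspace W" and act: "acts_along P W" and ell: "elliptic_on P W"
begin

abbreviation "prj \<equiv> orth_proj W"

text \<open>On \<open>W\<close> the principal part is bounded below by homogeneity and compactness
  of the unit sphere of \<open>W\<close>, and lower order terms are absorbed for large arguments.
  For general \<open>z\<close> the symbol depends on \<open>prj z\<close> only.\<close>

lemma elliptic_symbol_estimate:
 obtains C where "C > 0" "!!z k. k <= deg P ==> norm (prj z) ^ k <= C * (1 + cmod (mpoly_eval P z))"
proof -
 let ?m = "deg P" and ?p = "mpoly_eval (principal_part P)"
 define A where "A = (\<Sum>a\<in>keys P. cmod (coef P a))"
 have A: "A \<ge> 0" unfolding A_def by (rule sum_nonneg) auto
 have lower: "cmod (mpoly_eval P h - ?p h) <= A * norm h ^ (?m - 1)" if "norm h \<ge> 1" for h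
 proof -
  have "mpoly_eval P h - ?p h = (\<Sum>a\<in>keys P. (if mi_size a = ?m then 0 else coef P a) * (\<Prod>j\<in>UNIV. cr (h $ j) ^ (a $ j)))"
   unfolding mpoly_eval_superset[OF finite_keys keys_principal_part] unfolding mpoly_eval_def sum_subtractf[symmetric]
   by (intro sum.cong) (auto simp: lookup_principal_part)
  also have "cmod ... <= (\<Sum>a\<in>keys P. cmod (coef P a) * norm h ^ (?m - 1))"
  proof (rule sum_norm_le)
   fix a assume a: "a \<in> keys P"
   show "cmod ((if mi_size a = ?m then 0 else coef P a) * (\<Prod>j\<in>UNIV. cr (h $ j) ^ (a $ j))) <= cmod (coef P a) * norm h ^ (?m - 1)"
   proof (cases "mi_size a = ?m")
    case False
    hence "mi_size a <= ?m - 1" using deg_ge[OF a] by simp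
    hence "norm h ^ mi_size a <= norm h ^ (?m - 1)" using that by (rule power_increasing)
    hence "cmod (\<Prod>j\<in>UNIV. cr (h $ j) ^ (a $ j)) <= norm h ^ (?m - 1)"
     using mpoly_eval_bound[of h a] by linarith
    thus ?thesis using False by (simp add: norm_mult mult_left_mono)
   qed simp
  qed
  finally show ?thesis by (simp add: A_def sum_distrib_right)
 qed
 \<comment> \<open>The origin is exempted: in degree 0 its zeroth power is 1, and ellipticity says
   nothing about the origin.\<close>
 obtain c where c: "c > 0" "!!h. h \<in> W ==> c * norm h ^ ?m <= cmod (?p h) \<or> h = 0"
 proof -
  let ?S = "W \<inter> sphere 0 1"
  show ?thesis
  proof (cases "?S = {}")
   case True
   have "h = 0" if "h \<in> W" for h
   proof (rule ccontr)
    assume "h ~= 0"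
    hence "(1 / norm h) *\<^sub>R h \<in> ?S" using that W by (simp add: subspace_scale)
    thus False using True by auto
   qed
   thus ?thesis using that[of 1] by auto
  next
   case False
   have "compact ?S" using closed_subspace[OF W] by (intro closed_Int_compact compact_sphere)
   then obtain h0 where h0: "h0 \<in> ?S" "!!h. h \<in> ?S ==> cmod (?p h0) <= cmod (?p h)"
   proof -
    have "continuous_on ?S (%h. cmod (?p h))" by (intro continuous_intros mpoly_eval_continuous)
    from continuous_attains_inf[OF \<open>compact ?S\<close> False this] show ?thesis using that by blast
   qed
   have pos: "cmod (?p h0) > 0" using ell h0(1) unfolding elliptic_on_def by force
   have "cmod (?p h0) * norm h ^ ?m <= cmod (?p h)" if "h \<in> W" "h ~= 0" for h
   proof -
    have "(1 / norm h) *\<^sub>R h \<in> ?S" using that W by (simp add: subspace_scale)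
    hence "cmod (?p h0) <= cmod (?p ((1 / norm h) *\<^sub>R h))" by (rule h0(2))
    also have "... = (1 / norm h) ^ ?m * cmod (?p h)"
     unfolding principal_part_homogeneous norm_mult norm_power norm_of_real by simp
    finally show ?thesis using that(2) by (simp add: power_divide field_simps)
   qed
   thus ?thesis using that[of "cmod (?p h0)"] pos by blast
  qed
 qed
 \<comment> \<open>Beyond this radius, in positive degree, the lower order terms amount to at most
   half of the lower bound for the principal part.\<close>
 define r where "r = max 1 (2 * A / c)"
 have r: "r \<ge> 1" by (simp add: r_def)
 define C where "C = 1 + r ^ ?m + 2 / c"
 have C: "C \<ge> 1 + r ^ ?m" "C \<ge> 1 + 2 / c" using c(1) r by (auto simp: C_def)
 have "norm h ^ ?m <= r ^ ?m + (2 / c) * cmod (mpoly_eval P h)" if h: "h \<in> W" for h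
 proof (cases "norm h <= r")
  case True
  hence "norm h ^ ?m <= r ^ ?m" by (intro power_mono) auto
  thus ?thesis using c(1) by (simp add: add_increasing2)
 next
  case False
  hence n1: "norm h \<ge> 1" "norm h > 2 * A / c" and n0: "h ~= 0" using r by (auto simp: r_def)
  show ?thesis
  proof (cases "?m = 0")
   case True
   thus ?thesis using c(1) r by simp
  next
   case m: False
   have "c * norm h ^ ?m <= cmod (?p h)" using c(2)[OF h] n0 by auto
   also have "... <= cmod (mpoly_eval P h) + cmod (mpoly_eval P h - ?p h)"
    using norm_triangle_ineq4[of "mpoly_eval P h" "mpoly_eval P h - ?p h"] by simp
   also have "... <= cmod (mpoly_eval P h) + A * norm h ^ (?m - 1)" using lower[OF n1(1)] by simp
   also have "A * norm h ^ (?m - 1) <= (c / 2 * norm h) * norm h ^ (?m - 1)"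
    using n1(2) c(1) by (intro mult_right_mono) (auto simp: field_simps)
   also have "(c / 2 * norm h) * norm h ^ (?m - 1) = c / 2 * norm h ^ ?m"
    using m by (cases ?m) auto
   finally have "c / 2 * norm h ^ ?m <= cmod (mpoly_eval P h)" by simp
   hence "norm h ^ ?m <= (2 / c) * cmod (mpoly_eval P h)" using c(1) by (simp add: field_simps)
   moreover have "0 <= r ^ ?m" using r by simp
   ultimately show ?thesis by linarith
  qed
 qed
 hence m: "norm (prj z) ^ ?m <= r ^ ?m + (2 / c) * cmod (mpoly_eval P z)" for z
  using orth_proj_mem[OF W, of z] act unfolding acts_along_def by metis
 have "norm (prj z) ^ k <= C * (1 + cmod (mpoly_eval P z))" if "k <= ?m" for z k
 proof -
  have "norm (prj z) ^ k <= 1 + norm (prj z) ^ ?m"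
  proof (cases "norm (prj z) <= 1")
   case True
   hence "norm (prj z) ^ k <= 1" by (simp add: power_le_one)
   thus ?thesis by (simp add: add_increasing2)
  next
   case False
   hence "norm (prj z) ^ k <= norm (prj z) ^ ?m" using that by (intro power_increasing) auto
   thus ?thesis by simp
  qed
  also have "... <= (1 + r ^ ?m) * 1 + (2 / c) * cmod (mpoly_eval P z)" using m[of z] by simp
  also have "... <= C * 1 + C * cmod (mpoly_eval P z)"
   using C by (intro add_mono mult_right_mono) auto
  finally show ?thesis by (simp add: distrib_left)
 qed
 moreover have "C > 0" using C(1) r by (smt (verit) zero_le_power)
 ultimately show ?thesis using that by blast
qed

text \<open>On the Fourier side a derivative along a vector of \<open>W\<close> of norm at most 1 is
  multiplication by a factor of modulus at most \<open>norm (prj z)\<close>; for up to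
  \<open>deg P\<close> factors the symbol estimate applies.\<close>

lemma elliptic_estimate:
 obtains C where "C > 0" "!!f ws. f \<in> tf UNIV ==> length ws <= deg P ==> (!!w. w \<in> set ws ==> w \<in> W & norm w <= 1) ==>
   (LI x. (cmod (DL ws f x))\<^sup>2) <= C * ((LI x. (cmod (diff_op P f x))\<^sup>2) + (LI x. (cmod (f x))\<^sup>2))"
proof -
 obtain C where C: "C > 0" "!!z k. k <= deg P ==> norm (prj z) ^ k <= C * (1 + cmod (mpoly_eval P z))"
  using elliptic_symbol_estimate by blast
 show ?thesis
 proof (rule that[of "2 * C\<^sup>2"])
  show "0 < 2 * C\<^sup>2" using C(1) by simp
  fix f :: "real ^ 'd => complex" and ws
  assume f: "f \<in> tf UNIV" and ws: "length ws <= deg P" "!!w. w \<in> set ws ==> w \<in> W & norm w <= 1"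
  show "(LI x. (cmod (DL ws f x))\<^sup>2) <= 2 * C\<^sup>2 * ((LI x. (cmod (diff_op P f x))\<^sup>2) + (LI x. (cmod (f x))\<^sup>2))"
  proof (rule L2_estimate_of_FT)
   fix z :: "real ^ 'd"
   have "cmod (\<Prod>w\<leftarrow>ws. \<i> * cr (z \<bullet> w)) <= norm (prj z) ^ length ws"
    using ws(2)
   proof (induction ws)
    case (Cons w ws)
    have w: "w \<in> W" "norm w <= 1" using Cons.prems by auto
    have "\<bar>z \<bullet> w\<bar> = \<bar>prj z \<bullet> w\<bar>" using inner_orth_proj[OF W w(1), of z] by simp
    also have "... <= norm (prj z) * norm w" by (rule Cauchy_Schwarz_ineq2)
    also have "... <= norm (prj z) * 1" using w(2) by (intro mult_left_mono) auto
    finally have "\<bar>z \<bullet> w\<bar> <= norm (prj z)" by simp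
    thus ?case using Cons by (auto simp: norm_mult intro!: mult_mono)
   qed simp
   also have "... <= C * (1 + cmod (mpoly_eval P z))" by (rule C(2)[OF ws(1)])
   finally have "(cmod (\<Prod>w\<leftarrow>ws. \<i> * cr (z \<bullet> w)))\<^sup>2 <= (C * (1 + cmod (mpoly_eval P z)))\<^sup>2"
    by (intro power_mono) auto
   also have "... <= 2 * C\<^sup>2 * ((cmod (mpoly_eval P z))\<^sup>2 + 1)"
   proof -
    have "(1 + cmod (mpoly_eval P z))\<^sup>2 <= 2 * ((cmod (mpoly_eval P z))\<^sup>2 + 1)"
     using sum_squares_bound[of 1 "cmod (mpoly_eval P z)"] by (simp add: power2_eq_square algebra_simps)
    thus ?thesis unfolding power_mult_distrib using mult_left_mono[of "(1 + cmod (mpoly_eval P z))\<^sup>2" "2 * ((cmod (mpoly_eval P z))\<^sup>2 + 1)" "C\<^sup>2"] by (auto simp: algebra_simps)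
   qed
   finally have "(cmod (\<Prod>w\<leftarrow>ws. \<i> * cr (z \<bullet> w)))\<^sup>2 * (cmod (FT f z))\<^sup>2 <= 2 * C\<^sup>2 * ((cmod (mpoly_eval P z))\<^sup>2 + 1) * (cmod (FT f z))\<^sup>2"
    by (intro mult_right_mono) auto
   thus "(cmod (FT (DL ws f) z))\<^sup>2 <= 2 * C\<^sup>2 * ((cmod (FT (diff_op P f) z))\<^sup>2 + (cmod (FT f z))\<^sup>2)"
    unfolding FT_DL[OF f] FT_diff_op[OF f] norm_mult power_mult_distrib by (simp only: distrib_right mult.assoc mult_1 distrib_left)
  qed (use f in \<open>auto intro: test_DL test_diff_op\<close>)
 qed
qed

text \<open>All derivatives may be taken along the projected axes, hence along \<open>W\<close>. For
  test functions both sides have the same Fourier transform because the symbol does not change under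
  \<open>prj\<close>; a cutoff extends this to functions that are smooth near
  \<open>x\<close>.\<close>

lemma diff_op_along:
 assumes X: "open X" and f: "smooth_on X f" and x: "x \<in> X"
 shows "diff_op P f x = (\<Sum>a\<in>keys P. coef P a * (- \<i>) ^ mi_size a * DL (map prj (mvecs a)) f x)"
proof -
 let ?D = "%g x. \<Sum>a\<in>keys P. coef P a * (- \<i>) ^ mi_size a * DL (map prj (mvecs a)) g x"
 have test: "diff_op P g y = ?D g y" if g: "g \<in> tf UNIV" for g y
 proof -
  have T: "?D g \<in> tf UNIV" by (intro test_sum test_cmult test_DL g)
  have "FT (?D g) z = FT (diff_op P g) z" for z
  proof -
   have *: "(- \<i>) ^ mi_size a * (\<Prod>v\<leftarrow>map prj (mvecs a). \<i> * cr (z \<bullet> v)) = (\<Prod>j\<in>UNIV. cr (prj z $ j) ^ (a $ j))" for a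
   proof -
    have "(\<Prod>v\<leftarrow>map prj (mvecs a). \<i> * cr (z \<bullet> v)) = (\<Prod>v\<leftarrow>mvecs a. \<i> * cr (prj z \<bullet> v))"
     by (simp add: comp_def orth_proj_adjoint[OF W])
    also have "... = \<i> ^ mi_size a * (\<Prod>j\<in>UNIV. cr (prj z $ j) ^ (a $ j))"
     unfolding prod_list_scale length_mvecs prod_mvecs by (simp add: inner_axis)
    finally show ?thesis by (simp add: mult.assoc[symmetric] power_mult_distrib[symmetric])
   qed
   have "FT (?D g) z = (\<Sum>a\<in>keys P. FT (%x. coef P a * (- \<i>) ^ mi_size a * DL (map prj (mvecs a)) g x) z)"
    by (intro FT_sum test_cmult test_DL g)
   also have "... = (\<Sum>a\<in>keys P. coef P a * ((- \<i>) ^ mi_size a * (\<Prod>v\<leftarrow>map prj (mvecs a). \<i> * cr (z \<bullet> v))) * FT g z)"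
    unfolding FT_cmult FT_DL[OF g] by (simp add: mult.assoc)
   also have "... = mpoly_eval P (prj z) * FT g z"
    unfolding * by (simp add: mpoly_eval_def sum_distrib_right)
   also have "mpoly_eval P (prj z) = mpoly_eval P z" using act by (simp add: acts_along_def)
   finally show ?thesis by (simp add: FT_diff_op[OF g])
  qed
  hence "FT (%x. diff_op P g x - ?D g x) z = 0" for z
   by (simp add: FT_diff[OF test_diff_op[OF g] T])
  from FT_inj[OF test_diff[OF test_diff_op[OF g] T] this, of y] show ?thesis by simp
 qed
 obtain h V where h: "h \<in> tf X" "open V" "{x} <= V" "V <= X" "!!x. x \<in> V ==> h x = 1"
  using cutoff_exists[of "{x}" X] X x by (metis compact_sing empty_subsetI insert_subset)
 have T: "(%x. f x * h x) \<in> tf UNIV" using tf_UNIV[OF test_mult[OF X f h(1)]] .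
 have eq: "f y = f y * h y" if "y \<in> V" for y using h(5)[OF that] by simp
 have xV: "x \<in> V" using h(3) by simp
 have "diff_op P f x = diff_op P (%x. f x * h x) x" by (rule diff_op_cong[OF h(2) xV eq])
 also have "... = ?D (%x. f x * h x) x" by (rule test[OF T])
 also have "... = ?D f x"
  using DL_cong[OF h(2) xV eq] by simp
 finally show ?thesis .
qed

end

section \<open>Unique continuation along the subspace\<close>

lemma dd_invariant:
 assumes f: "smooth_on UNIV f" and inv: "!!x t. f (x + t *\<^sub>R w) = f x"
 shows "dd w f x = 0"
proof -
 have "((%t. f (x + t *\<^sub>R w)) has_vector_derivative dd w f (x + 0 *\<^sub>R w)) (at 0)"
  by (rule smooth_line_derivative[OF open_UNIV f UNIV_I])
 hence "((%t::real. f x) has_vector_derivative dd w f x) (at 0)" by (simp add: inv)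
 thus ?thesis using has_vector_derivative_const vector_derivative_unique_at by blast
qed

lemma DL_translate: "smooth_on UNIV f ==> DL vs (%x. f (a + x)) x = DL vs f (a + x)"
 using DL_compose_affine[OF open_UNIV, of f a 1 x vs] by simp

lemma DL_invariant:
 assumes f: "smooth_on UNIV f" and inv: "!!x w. w \<in> W ==> f (x + w) = f x" and W: "subspace W"
  and ws: "ws ~= []" "set ws <= W"
 shows "DL ws f x = 0"
proof (cases ws)
 case (Cons w vs)
 have "DL vs f (x + t *\<^sub>R w) = DL vs f x" for x t
 proof -
  have "t *\<^sub>R w \<in> W" using ws W by (simp add: Cons subspace_scale)
  from inv[OF this] have "f (t *\<^sub>R w + x) = f x" for x by (simp add: add.commute)
  hence "(%x. f (t *\<^sub>R w + x)) = f" by (rule ext)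
  thus ?thesis using DL_translate[OF f, of vs "t *\<^sub>R w" x] by (simp add: add.commute)
 qed
 thus ?thesis unfolding Cons DL_Cons by (intro dd_invariant smooth_on_DL open_UNIV f)
qed (use ws in auto)

lemma splits_last:
 "\<exists>rest. splits vs = rest @ [([], vs)] & (\<forall>(a, b)\<in>set rest. a ~= [])"
proof (induction vs)
 case (Cons v vs)
 then obtain rest where r: "splits vs = rest @ [([], vs)]" "\<forall>(a, b)\<in>set rest. a ~= []" by blast
 have "splits (v # vs) = (map (%(a, b). (v # a, b)) (splits vs) @ map (%(a, b). (a, v # b)) rest) @ [([], v # vs)]"
  by (simp add: r(1))
 moreover have "\<forall>(a, b)\<in>set (map (%(a, b). (v # a, b)) (splits vs) @ map (%(a, b). (a, v # b)) rest). a ~= []"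
  using r(2) by auto
 ultimately show ?case by blast
qed auto

text \<open>The Leibniz terms in which at least one derivative falls on the first factor; the last
  entry of \<open>splits\<close> is the only one in which none does.\<close>

definition rsplits :: "'a list => ('a list \<times> 'a list) list"
 where "rsplits vs = butlast (splits vs)"

lemma rsplits: "splits vs = rsplits vs @ [([], vs)]" "(a, b) \<in> set (rsplits vs) ==> a ~= []"
 using splits_last[of vs] by (auto simp: rsplits_def)

lemma rsplitsD: "(a, b) \<in> set (rsplits vs) ==> length a + length b = length vs & set a <= set vs & set b <= set vs & a ~= []"
 using splitsD[of a b vs] rsplits(1)[of vs] rsplits(2)[of a b vs] by auto

lemma loc_int_indicator: "open S ==> loc_int UNIV (%x. indicator S x *\<^sub>R (1::complex))"
 unfolding loc_int_def
proof (intro allI impI)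
 fix K :: "(real^'a) set" assume S: "open S" and K: "compact K & K <= UNIV"
 have "integrable lborel (%x. indicator S x *\<^sub>R (indicator K x *\<^sub>R (1::complex)))"
  using S K by (intro integrable_mult_indicator borel_integrable_compact continuous_on_const) auto
 thus "integrable lborel (%x. indicator K x *\<^sub>R indicator S x *\<^sub>R (1::complex))"
  by (simp add: mult.commute)
qed

text \<open>A cutoff for possibly unbounded sets, with bounds for its derivatives in terms of the
  scale \<open>e\<close> alone, which \<open>cutoff_exists\<close> does not provide.\<close>

definition smear :: "(real ^ 'd::finite) set => real => real ^ 'd => complex"
 where "smear S e = conv (%x. indicator S x *\<^sub>R 1) (moll e)"

context
 fixes S :: "(real ^ 'd::finite) set" and e :: real
 assumes S: "open S" and e: "e > 0"
begin

lemma smear_smooth: "smooth_on UNIV (smear S e)"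
 unfolding smear_def by (rule conv_smooth(1)[OF loc_int_indicator[OF S] moll_test[OF e]])

lemma smear_one: "(!!y. norm y < e ==> x - y \<in> S) ==> smear S e x = 1"
proof -
 assume *: "!!y. norm y < e ==> x - y \<in> S"
 have "(indicator S y *\<^sub>R 1) * moll e (x - y) = moll e (x - y)" for y
  using *[of "x - y"] moll_eq_0[OF e, of "x - y"] by (cases "norm (x - y) < e") auto
 hence "smear S e x = (LI y. moll e (x - y))" by (simp only: smear_def conv_def)
 also have "... = integral\<^sup>L lborel (moll e :: real ^ 'd => complex)"
  by (intro lborel_integral_reflect cont_bm test_continuous[OF moll_test[OF e]])
 finally show "smear S e x = 1" by (simp add: integral_moll[OF e])
qed

lemma smear_zero: "(!!y. norm y < e ==> x - y \<notin> S) ==> smear S e x = 0"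
proof -
 assume *: "!!y. norm y < e ==> x - y \<notin> S"
 have "(indicator S y *\<^sub>R 1) * moll e (x - y) = 0" for y
  using *[of "x - y"] moll_eq_0[OF e, of "x - y"] by (cases "norm (x - y) < e") auto
 thus "smear S e x = 0" by (simp only: smear_def conv_def integral_zero)
qed

lemma smear_translate:
 assumes "!!x. x + w \<in> S \<longleftrightarrow> x \<in> S"
 shows "smear S e (x + w) = smear S e x"
proof -
 have m: "(%y. (indicator S y *\<^sub>R 1) * moll e (x + w - y)) \<in> borel_measurable (borel :: (real^'d) measure)"
  using S by (intro borel_measurable_times borel_measurable_scaleR borel_measurable_indicator cont_bm
    continuous_on_compose2[OF test_continuous[OF moll_test[OF e], of UNIV]] continuous_intros) auto
 have "smear S e (x + w) = (LI y. (indicator S (w + y) *\<^sub>R 1) * moll e (x + w - (w + y)))"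
  unfolding smear_def conv_def by (rule lborel_integral_translate[OF m, symmetric])
 also have "... = smear S e x"
 proof -
  have "(indicator S (w + y) *\<^sub>R 1) * moll e (x + w - (w + y)) = (indicator S y *\<^sub>R 1) * moll e (x - y)" for y
  proof -
   have "x + w - (w + y) = x - y" by simp
   moreover have "indicator S (w + y) = (indicator S y :: real)"
    using assms[of y] by (simp add: indicator_def add.commute)
   ultimately show ?thesis by simp
  qed
  thus ?thesis unfolding smear_def conv_def by (intro Bochner_Integration.integral_cong refl)
 qed
 finally show ?thesis .
qed

end

text \<open>The derivatives fall on the mollifier, whose rescaling yields a factor
  \<open>1 / e\<close> for each of them; the indicator is at most 1, so \<open>C\<close> does not
  depend on \<open>S\<close>.\<close>

lemma smear_DL_bound:
 obtains C where "C > 0" "!!S e ws (x :: real ^ 'd::finite). open S ==> e > 0 ==> length ws <= m ==> (!!w. w \<in> set ws ==> norm w <= 1) ==>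
  cmod (DL ws (smear S e) x) <= C * (1 / e) ^ length ws"
proof -
 obtain M where M: "M > 0" "!!vs (y :: real ^ 'd). length vs <= m ==> (!!v. v \<in> set vs ==> norm v <= 1) ==> cmod (DL vs bump y) <= M"
  using DL_bounded_all[OF bump_test, of m] by blast
 let ?I = "integral\<^sup>L lborel (%x::real^'d. Re (bump x))"
 let ?V = "measure lborel (cball (0::real^'d) 1)"
 have I: "?I > 0" by (rule bump_integral_pos)
 have "cmod (DL ws (smear S e) x) <= (M * ?V / ?I + 1) * (1 / e) ^ length ws"
  if S: "open S" and e: "e > 0" and ws: "length ws <= m" "!!w. w \<in> set ws ==> norm w <= 1" for S e ws and x :: "real ^ 'd"
 proof -
  let ?s = "DL ws (moll e) :: real ^ 'd => complex"
  let ?k = "length ws"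
  have s: "?s \<in> tf UNIV" by (rule test_DL[OF moll_test[OF e]])
  have si: "integrable lborel (%y. cmod (?s y))" using test_integrable[OF s] by simp
  have tr: "(%y. ?s (x - y)) \<in> tf UNIV" by (rule test_reflect_translate(1)[OF s])
  have "DL ws (smear S e) x = conv (%x. indicator S x *\<^sub>R 1) ?s x"
   unfolding smear_def by (rule conv_smooth(2)[OF loc_int_indicator[OF S] moll_test[OF e]])
  also have "cmod ... <= (LI y. cmod ((indicator S y *\<^sub>R 1) * ?s (x - y)))"
   unfolding conv_def by (rule integral_norm_bound)
  also have "... <= (LI y. cmod (?s (x - y)))"
  proof (rule lint_mono)
   show "integrable lborel (%y. cmod ((indicator S y *\<^sub>R 1) * ?s (x - y)))"
    by (intro integrable_norm loc_int_test(1)[OF loc_int_indicator[OF S] tr])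
   show "integrable lborel (%y. cmod (?s (x - y)))" using test_integrable[OF tr] by simp
  qed (auto simp: indicator_def)
  also have "... = (LI y. cmod (?s y))"
   using test_continuous[OF s] by (intro lborel_integral_reflect[of "%y. cmod (?s y)"] cont_bm continuous_on_norm) auto
  also have "... = e ^ CARD('d) * (LI y. cmod (?s (0 + e *\<^sub>R y)))"
   using lborel_integral_scale(1)[of "%y. cmod (?s y)" e 0] e test_continuous[OF s, of UNIV]
   by (simp add: cont_bm continuous_on_norm)
  also have "(LI y. cmod (?s (0 + e *\<^sub>R y))) <= (LI y. indicator (cball 0 1) (y :: real ^ 'd) *\<^sub>R (moll_const TYPE('d) e * (1 / e) ^ ?k * M))"
  proof (rule lint_mono)
   show "integrable lborel (%y. cmod (?s (0 + e *\<^sub>R y)))"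
    using si lborel_integral_scale(2)[of "%y. cmod (?s y)" e 0] e test_continuous[OF s, of UNIV]
    by (simp add: cont_bm continuous_on_norm)
   show "integrable lborel (%y::real^'d. indicator (cball 0 1) y *\<^sub>R (moll_const TYPE('d) e * (1 / e) ^ ?k * M))"
    by (intro borel_integrable_compact continuous_on_const) simp
   fix y :: "real ^ 'd"
   have k0: "moll_const TYPE('d) e > 0" by (rule moll_const_pos[OF e])
   have "?s (e *\<^sub>R y) = cr (moll_const TYPE('d) e) * (cr (1 / e) ^ ?k * DL ws bump ((1 / e) *\<^sub>R (e *\<^sub>R y)))"
   proof -
    have "?s (e *\<^sub>R y) = DL ws (%x. cr (moll_const TYPE('d) e) * bump (0 + (1 / e) *\<^sub>R x)) (e *\<^sub>R y)"
     by (simp add: moll_def[abs_def])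
    also have "... = cr (moll_const TYPE('d) e) * DL ws (%x. bump (0 + (1 / e) *\<^sub>R x)) (e *\<^sub>R y)"
     using smooth_on_compose_affine[OF open_UNIV bump_smooth, of 0 "1 / e"] by (intro DL_cmult[OF open_UNIV]) auto
    also have "DL ws (%x. bump (0 + (1 / e) *\<^sub>R x)) (e *\<^sub>R y) = cr (1 / e) ^ ?k * DL ws bump (0 + (1 / e) *\<^sub>R (e *\<^sub>R y))"
     by (rule DL_compose_affine[OF open_UNIV bump_smooth UNIV_I])
    finally show ?thesis by simp
   qed
   hence "cmod (?s (e *\<^sub>R y)) = moll_const TYPE('d) e * (1 / e) ^ ?k * cmod (DL ws bump y)"
    using k0 e by (simp add: norm_mult norm_power norm_divide power_divide)
   also have "... <= moll_const TYPE('d) e * (1 / e) ^ ?k * M"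
    using k0 e M(2)[OF ws] by (intro mult_left_mono) auto
   finally have 1: "cmod (?s (e *\<^sub>R y)) <= moll_const TYPE('d) e * (1 / e) ^ ?k * M" .
   have "?s (e *\<^sub>R y) = 0" if "y \<notin> cball 0 1"
   proof (rule DL_outside_support)
    have "e *\<^sub>R y \<notin> cball 0 e" using that e by (simp add: field_simps)
    thus "e *\<^sub>R y \<notin> supp (moll e)" using moll_support[OF e, where 'a = 'd] by blast
   qed
   with 1 show "cmod (?s (0 + e *\<^sub>R y)) <= indicator (cball 0 1) y *\<^sub>R (moll_const TYPE('d) e * (1 / e) ^ ?k * M)"
    by (auto simp: indicator_def)
  qed
  also have "(LI y. indicator (cball 0 1) (y :: real ^ 'd) *\<^sub>R (moll_const TYPE('d) e * (1 / e) ^ ?k * M)) = ?V * (moll_const TYPE('d) e * (1 / e) ^ ?k * M)"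
   by simp
  also have "e ^ CARD('d) * (?V * (moll_const TYPE('d) e * (1 / e) ^ ?k * M)) = (M * ?V / ?I) * (1 / e) ^ ?k"
   using e by (simp add: moll_const_def field_simps)
  also have "... <= (M * ?V / ?I + 1) * (1 / e) ^ ?k"
   using e by (intro mult_right_mono) auto
  finally show ?thesis using e by (simp add: mult_left_mono)
 qed
 moreover have "M * ?V / ?I + 1 > 0" using M(1) I by (smt (verit) divide_nonneg_pos measure_nonneg mult_nonneg_nonneg)
 ultimately show ?thesis using that by blast
qed

lemma test_mult_left: "smooth_on UNIV F ==> f \<in> tf UNIV ==> (%x. F x * f x) \<in> tf UNIV"
 by (rule test_mult[OF open_UNIV])

definition nsq :: "(real ^ 'd::finite) set => (real ^ 'd => complex) => real"
 where "nsq S f = (LI x. indicator S x *\<^sub>R (cmod (f x))\<^sup>2)"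

lemma nsq_integrable:
 assumes "f \<in> tf UNIV" "open S"
 shows "integrable lborel (%x. indicator S x *\<^sub>R (cmod (f x))\<^sup>2)"
 using assms by (intro integrable_mult_indicator test_L2_integrable) auto

lemma nsq_mono: "f \<in> tf UNIV ==> open S ==> open T ==> S <= T ==> nsq S f <= nsq T f"
 unfolding nsq_def by (intro lint_mono nsq_integrable) (auto simp: indicator_def)

lemma nsq_le: "f \<in> tf UNIV ==> open S ==> nsq S f <= (LI x. (cmod (f x))\<^sup>2)"
 unfolding nsq_def by (intro lint_mono nsq_integrable test_L2_integrable) (auto simp: indicator_def)

lemma nsq_nonneg: "0 <= nsq S f"
 unfolding nsq_def by (intro Bochner_Integration.integral_nonneg) auto

lemma nsq_cong: "(!!x. x \<in> S ==> f x = g x) ==> nsq S f = nsq S g"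
 unfolding nsq_def by (intro Bochner_Integration.integral_cong) (auto simp: indicator_def)

lemma cmod_sum_squares: "(cmod (\<Sum>i\<in>I. f i))\<^sup>2 <= real (card I) * (\<Sum>i\<in>I. (cmod (f i))\<^sup>2)"
proof (cases "finite I")
 case True
 have "(cmod (\<Sum>i\<in>I. f i))\<^sup>2 <= (\<Sum>i\<in>I. cmod (f i))\<^sup>2" by (intro power_mono norm_sum) auto
 also have "... = (\<Sum>i\<in>I. cmod (f i) * 1)\<^sup>2" by simp
 also have "... <= (\<Sum>i\<in>I. (cmod (f i))\<^sup>2) * (\<Sum>i\<in>I. 1\<^sup>2)" by (rule Cauchy_Schwarz_ineq_sum)
 finally show ?thesis by (simp add: mult.commute)
qed simp

lemma diff_op_DL_commute:
 assumes "open X" "smooth_on X f" "x \<in> X"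
 shows "diff_op P (DL ws f) x = DL ws (diff_op P f) x"
proof -
 have "DL (mvecs a) (DL ws f) x = DL ws (DL (mvecs a) f) x" for a
  unfolding DL_append[symmetric] by (rule DL_perm[OF assms(1) _ assms(2,3)]) simp
 moreover have "DL ws (diff_op P f) x = (\<Sum>a\<in>keys P. coef P a * (- \<i>) ^ mi_size a * DL ws (DL (mvecs a) f) x)"
  unfolding diff_op_DL[abs_def]
  by (subst DL_sum[OF assms(1) smooth_on_cmult[OF assms(1) smooth_on_DL[OF assms(1,2)]] assms(3)])
   (simp only: DL_cmult[OF assms(1) smooth_on_DL[OF assms(1,2)] assms(3)])
 ultimately show ?thesis by (simp add: diff_op_DL)
qed

section \<open>Interior L2 estimates on cylinders whose axis is orthogonal to
  \<open>W\<close>\<close>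

context
 fixes P :: "'d::finite mpoly" and W :: "(real ^ 'd) set"
 assumes W: "subspace W" and act: "acts_along P W" and ell: "elliptic_on P W"
begin

abbreviation "pr \<equiv> orth_proj W"

text \<open>Unbounded across \<open>W\<close>, so that a smoothed indicator has to fall off along
  \<open>W\<close> only; integrability comes from the compact support of the functions
  considered.\<close>

definition cyl :: "real ^ 'd => real => (real ^ 'd) set"
 where "cyl a s = {x. norm (pr (x - a)) < s}"

lemma open_cyl: "open (cyl a s)"
proof -
 have "continuous_on UNIV (%x. norm (pr (x - a)))"
  by (intro continuous_intros continuous_on_compose2[OF orth_proj_continuous[OF W, of UNIV]]) auto
 hence "open {x. norm (pr (x - a)) < s}" by (intro open_Collect_less continuous_on_const)
 thus ?thesis by (simp add: cyl_def)
qed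

lemma cyl_mono: "s <= t ==> cyl a s <= cyl a t"
 by (auto simp: cyl_def)

text \<open>Cutting off in the directions of \<open>W\<close> only costs a factor of order \<open>1 / d\<close> per derivative, when passing to a cylinder thinner by \<open>d\<close>.\<close>

lemma cyl_step:
 obtains K where "K \<ge> 1"
  "!!a v R s de D ws. v \<in> tf UNIV ==> (!!x. x \<in> cyl a R ==> diff_op P v x = 0) ==> 0 < de ==> de <= 1 ==> s <= R ==>
   (!!ws'. length ws' < deg P ==> set ws' <= W ==> (\<forall>w\<in>set ws'. norm w <= 1) ==> de ^ (2 * length ws') * nsq (cyl a s) (DL ws' v) <= D) ==>
   0 < deg P ==>
   length ws = deg P ==> set ws <= W ==> (\<forall>w\<in>set ws. norm w <= 1) ==>
   de ^ (2 * deg P) * nsq (cyl a (s - de)) (DL ws v) <= K * D"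
proof -
 let ?m = "deg P"
 obtain C1 where C1: "C1 > 0" "!!f ws. f \<in> tf UNIV ==> length ws <= ?m ==> (!!w. w \<in> set ws ==> w \<in> W & norm w <= 1) ==>
   (LI x. (cmod (DL ws f x))\<^sup>2) <= C1 * ((LI x. (cmod (diff_op P f x))\<^sup>2) + (LI x. (cmod (f x))\<^sup>2))"
  using elliptic_estimate[OF W act ell] by blast
 obtain C2 where C2: "C2 > 0" "!!S e ws (x :: real ^ 'd). open S ==> e > 0 ==> length ws <= ?m ==> (!!w. w \<in> set ws ==> norm w <= 1) ==>
  cmod (DL ws (smear S e) x) <= C2 * (1 / e) ^ length ws"
  using smear_DL_bound by blast
 define C3 where "C3 = (C2 * 4 ^ ?m + 1)\<^sup>2"
 \<comment> \<open>Indices of the commutator terms: a monomial of \<open>P\<close> together with a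
   Leibniz term in which the cutoff is differentiated at least once.\<close>
 define J where "J = (SIGMA al:keys P. {..<length (rsplits (map pr (mvecs al)))})"
 have J: "finite J" unfolding J_def by (intro finite_SigmaI) auto
 define A where "A = (%j. fst (rsplits (map pr (mvecs (fst j))) ! snd j))"
 define B where "B = (%j. snd (rsplits (map pr (mvecs (fst j))) ! snd j))"
 define c where "c = (%j :: (nat ^ 'd) \<times> nat. coef P (fst j) * (- \<i>) ^ mi_size (fst j))"
 have AB: "length (A j) + length (B j) <= ?m" "A j ~= []" "set (A j) <= W" "set (B j) <= W" "\<forall>w\<in>set (A j). norm w <= 1" "\<forall>w\<in>set (B j). norm w <= 1"
  if j: "j \<in> J" for j
 proof -
  obtain al k where jk: "j = (al, k)" "al \<in> keys P" "k < length (rsplits (map pr (mvecs al)))" using j unfolding J_def by auto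
  have "(A j, B j) \<in> set (rsplits (map pr (mvecs al)))" using jk by (simp add: A_def B_def)
  hence r: "length (A j) + length (B j) = length (map pr (mvecs al))" "set (A j) <= set (map pr (mvecs al))" "set (B j) <= set (map pr (mvecs al))" "A j ~= []"
   using rsplitsD by blast+
  show "length (A j) + length (B j) <= ?m" using r(1) deg_ge[OF jk(2)] by (simp add: length_mvecs)
  have v: "w \<in> W & norm w <= 1" if w: "w \<in> set (map pr (mvecs al))" for w
  proof -
   obtain z where z: "w = pr z" "z \<in> set (mvecs al)" using w by auto
   hence "norm w <= 1" using norm_orth_proj[OF W, of z] norm_mvecs[OF z(2)] by simp
   thus ?thesis using orth_proj_mem[OF W, of z] z(1) by simp
  qed
  show "set (A j) <= W" "set (B j) <= W" "\<forall>w\<in>set (A j). norm w <= 1" "\<forall>w\<in>set (B j). norm w <= 1" "A j ~= []"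
   using r v by auto
 qed
 \<comment> \<open>Collects the constants of the estimates \<open>I1\<close> and \<open>I2\<close>
   below; the summand 1 makes \<open>K\<close> at least 1, so that its powers are
   increasing.\<close>
 define K where "K = 1 + C1 * (real (card J) * (\<Sum>j\<in>J. (cmod (c j))\<^sup>2) * C3 + C3)"
 have C3: "C3 \<ge> 0" by (simp add: C3_def)
 have K1: "K \<ge> 1" unfolding K_def using C1(1) C3 by (simp add: sum_nonneg)
 show ?thesis
 proof (rule that[OF K1])
  fix a v R s de D ws
  assume v: "v \<in> tf UNIV" and Pv: "!!x. x \<in> cyl a R ==> diff_op P v x = 0" and de: "0 < de" "de <= 1" and sR: "s <= R"
   and D: "!!ws'. length ws' < ?m ==> set ws' <= W ==> (\<forall>w\<in>set ws'. norm w <= 1) ==> de ^ (2 * length ws') * nsq (cyl a s) (DL ws' v) <= D"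
   and m: "0 < ?m" and ws: "length ws = ?m" "set ws <= W" "\<forall>w\<in>set ws. norm w <= 1"
  \<comment> \<open>A quarter of the margin: the cutoff \<open>h\<close> is 1 on the cylinder of
    radius \<open>s - de\<close> and vanishes beyond radius \<open>s - e\<close>.\<close>
  define e where "e = de / 4"
  have e: "e > 0" using de by (simp add: e_def)
  define h where "h = smear (cyl a (s - 2 * e)) e"
  have hs: "smooth_on UNIV h" unfolding h_def by (rule smear_smooth[OF open_cyl e])
  have hb: "cmod (DL ws' h x) <= C2 * 4 ^ ?m * (1 / de) ^ length ws'" if "length ws' <= ?m" "\<forall>w\<in>set ws'. norm w <= 1" for ws' x
  proof -
   have "cmod (DL ws' h x) <= C2 * (1 / e) ^ length ws'"
    unfolding h_def using that by (intro C2(2) open_cyl e) auto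
   also have "(1 / e) ^ length ws' = 4 ^ length ws' * (1 / de) ^ length ws'" by (simp add: e_def power_divide)
   also have "... <= 4 ^ ?m * (1 / de) ^ length ws'" using that(1) de by (intro mult_right_mono power_increasing) auto
   finally show ?thesis using C2(1) by (simp add: mult.assoc)
  qed
  have pry: "norm (pr y) <= norm y" for y by (rule norm_orth_proj[OF W])
  have h1: "h x = 1" if "x \<in> cyl a (s - de)" for x
   unfolding h_def
  proof (rule smear_one[OF open_cyl e])
   fix y :: "real ^ 'd" assume y: "norm y < e"
   have "pr (x - y - a) = pr (x - a) - pr y" by (simp add: orth_proj_diff[OF W])
   hence "norm (pr (x - y - a)) <= norm (pr (x - a)) + norm (pr y)" by (simp add: norm_triangle_ineq4)
   also have "... < s - 2 * e" using that y pry[of y] de(1) by (simp add: cyl_def e_def)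
   finally show "x - y \<in> cyl a (s - 2 * e)" by (simp add: cyl_def)
  qed
  define Z where "Z = {x :: real ^ 'd. norm (pr (x - a)) <= s - e}"
  have Zc: "closed Z"
  proof -
   have "continuous_on UNIV (%x. norm (pr (x - a)))"
    by (intro continuous_intros continuous_on_compose2[OF orth_proj_continuous[OF W, of UNIV]]) auto
   thus ?thesis unfolding Z_def by (intro closed_Collect_le continuous_on_const)
  qed
  have ZR: "x \<in> cyl a s" if "x \<in> Z" for x using that e by (auto simp: Z_def cyl_def)
  have h0: "h x = 0" if "x \<notin> Z" for x
   unfolding h_def
  proof (rule smear_zero[OF open_cyl e])
   fix y :: "real ^ 'd" assume y: "norm y < e"
   have "pr (x - a) = pr (x - y - a) + pr y" by (simp add: orth_proj_diff[OF W])
   hence "norm (pr (x - a)) <= norm (pr (x - y - a)) + norm (pr y)" by (simp add: norm_triangle_ineq)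
   thus "x - y \<notin> cyl a (s - 2 * e)" using that y pry[of y] by (auto simp: cyl_def Z_def)
  qed
  define f where "f = (%x. h x * v x)"
  have f: "f \<in> tf UNIV" unfolding f_def by (rule test_mult_left[OF hs v])
  have vs: "smooth_on UNIV v" using v by (rule test_smooth)
  have D0: "nsq (cyl a s) (DL b v) <= D * (1 / de) ^ (2 * length b)" if "length b < ?m" "set b <= W" "\<forall>w\<in>set b. norm w <= 1" for b
   using D[OF that] de by (simp add: power_divide pos_le_divide_eq mult.commute)
  \<comment> \<open>Since \<open>P(D) v = 0\<close> on the cylinder, only the commutator with the
    cutoff survives.\<close>
  have Pf: "diff_op P f x = (\<Sum>j\<in>J. c j * (DL (A j) h x * DL (B j) v x))" if x: "x \<in> cyl a s" for x
  proof -
   have "x \<in> cyl a R" using x cyl_mono[OF sR] by auto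
   hence 0: "(\<Sum>al\<in>keys P. coef P al * (- \<i>) ^ mi_size al * DL (map pr (mvecs al)) v x) = 0"
    using Pv diff_op_along[OF W act ell open_UNIV vs UNIV_I, of x] by simp
   have "DL (map pr (mvecs al)) f x = (\<Sum>k<length (rsplits (map pr (mvecs al))). DL (A (al, k)) h x * DL (B (al, k)) v x) + h x * DL (map pr (mvecs al)) v x" for al
   proof -
    have "DL (map pr (mvecs al)) f x = (\<Sum>(a, b)\<leftarrow>splits (map pr (mvecs al)). DL a h x * DL b v x)"
     unfolding f_def by (rule DL_mult[OF open_UNIV hs vs UNIV_I])
    also have "... = (\<Sum>p\<leftarrow>rsplits (map pr (mvecs al)). DL (fst p) h x * DL (snd p) v x) + h x * DL (map pr (mvecs al)) v x"
     unfolding rsplits(1) by (simp add: case_prod_unfold)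
    finally show ?thesis by (simp add: sum_list_sum_nth atLeast0LessThan A_def B_def)
   qed
   hence "diff_op P f x = (\<Sum>al\<in>keys P. (\<Sum>k<length (rsplits (map pr (mvecs al))). c (al, k) * (DL (A (al, k)) h x * DL (B (al, k)) v x)))
     + h x * (\<Sum>al\<in>keys P. coef P al * (- \<i>) ^ mi_size al * DL (map pr (mvecs al)) v x)"
    unfolding diff_op_along[OF W act ell open_UNIV test_smooth[OF f] UNIV_I]
    by (simp add: c_def distrib_left sum.distrib sum_distrib_left mult_ac)
   also have "... = (\<Sum>j\<in>J. c j * (DL (A j) h x * DL (B j) v x))"
    unfolding 0 J_def by (subst sum.Sigma) (auto simp: case_prod_unfold)
   finally show ?thesis .
  qed
  have dep: "(1 / de) ^ k <= (1 / de) ^ l" if "k <= l" for k l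
   using de that by (intro power_increasing) auto
  have bound: "(cmod (diff_op P f x))\<^sup>2 <= (\<Sum>j\<in>J. real (card J) * (cmod (c j))\<^sup>2 * C3 * (1 / de) ^ (2 * (?m - length (B j))) * (indicator (cyl a s) x *\<^sub>R (cmod (DL (B j) v x))\<^sup>2))" for x
  proof (cases "x \<in> cyl a s")
   case True
   have "(cmod (diff_op P f x))\<^sup>2 <= real (card J) * (\<Sum>j\<in>J. (cmod (c j * (DL (A j) h x * DL (B j) v x)))\<^sup>2)"
    unfolding Pf[OF True] by (rule cmod_sum_squares)
   also have "... <= real (card J) * (\<Sum>j\<in>J. (cmod (c j))\<^sup>2 * C3 * (1 / de) ^ (2 * (?m - length (B j))) * (cmod (DL (B j) v x))\<^sup>2)"
   proof (intro mult_left_mono sum_mono)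
    fix j assume j: "j \<in> J"
    have "cmod (DL (A j) h x) <= C2 * 4 ^ ?m * (1 / de) ^ length (A j)"
     using AB[OF j] by (intro hb) auto
    also have "... <= (C2 * 4 ^ ?m + 1) * (1 / de) ^ (?m - length (B j))"
     using AB(1)[OF j] C2(1) de by (intro mult_mono dep) auto
    finally have "(cmod (DL (A j) h x))\<^sup>2 <= ((C2 * 4 ^ ?m + 1) * (1 / de) ^ (?m - length (B j)))\<^sup>2"
     by (intro power_mono) auto
    also have "... = C3 * (1 / de) ^ (2 * (?m - length (B j)))"
     by (simp only: C3_def power_mult_distrib power_mult[symmetric] mult.commute[of 2])
    finally have "(cmod (c j))\<^sup>2 * (cmod (DL (A j) h x))\<^sup>2 * (cmod (DL (B j) v x))\<^sup>2 <= (cmod (c j))\<^sup>2 * (C3 * (1 / de) ^ (2 * (?m - length (B j)))) * (cmod (DL (B j) v x))\<^sup>2"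
     by (intro mult_right_mono mult_left_mono) auto
    thus "(cmod (c j * (DL (A j) h x * DL (B j) v x)))\<^sup>2 <= (cmod (c j))\<^sup>2 * C3 * (1 / de) ^ (2 * (?m - length (B j))) * (cmod (DL (B j) v x))\<^sup>2"
     by (simp only: norm_mult power_mult_distrib mult.assoc)
   qed simp
   finally show ?thesis using True by (simp add: sum_distrib_left mult.assoc)
  next
   case False
   hence "x \<notin> Z" using ZR by blast
   hence "diff_op P f x = 0"
    unfolding diff_op_DL using DL_eq_0_outside[OF Zc, of f x] h0 by (simp add: f_def)
   thus ?thesis using False by simp
  qed
  \<comment> \<open>At least one derivative falls on \<open>h\<close>, so \<open>v\<close> is
    differentiated fewer than \<open>deg P\<close> times and the hypothesis \<open>D\<close>
    applies.\<close>
  have nB: "length (B j) < ?m" if "j \<in> J" for j using AB(1,2)[OF that] by (cases "A j") auto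
  have I1: "(LI x. (cmod (diff_op P f x))\<^sup>2) <= (real (card J) * (\<Sum>j\<in>J. (cmod (c j))\<^sup>2) * C3) * ((1 / de) ^ (2 * ?m) * D)"
  proof -
   have iB: "integrable lborel (%x. indicator (cyl a s) x *\<^sub>R (cmod (DL (B j) v x))\<^sup>2)" for j
    by (rule nsq_integrable[OF test_DL[OF v] open_cyl])
   have "(LI x. (cmod (diff_op P f x))\<^sup>2) <= (LI x. (\<Sum>j\<in>J. real (card J) * (cmod (c j))\<^sup>2 * C3 * (1 / de) ^ (2 * (?m - length (B j))) * (indicator (cyl a s) x *\<^sub>R (cmod (DL (B j) v x))\<^sup>2)))"
    using bound iB by (intro lint_mono test_L2_integrable[OF test_diff_op[OF f]] Bochner_Integration.integrable_sum integrable_mult_right) auto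
   also have "... = (\<Sum>j\<in>J. real (card J) * (cmod (c j))\<^sup>2 * C3 * (1 / de) ^ (2 * (?m - length (B j))) * nsq (cyl a s) (DL (B j) v))"
    unfolding nsq_def using iB by (subst Bochner_Integration.integral_sum) (auto intro!: integrable_mult_right)
   also have "... <= (\<Sum>j\<in>J. real (card J) * (cmod (c j))\<^sup>2 * C3 * ((1 / de) ^ (2 * ?m) * D))"
   proof (rule sum_mono)
    fix j assume j: "j \<in> J"
    have "(1 / de) ^ (2 * (?m - length (B j))) * nsq (cyl a s) (DL (B j) v) <= (1 / de) ^ (2 * (?m - length (B j))) * (D * (1 / de) ^ (2 * length (B j)))"
     using AB[OF j] nB[OF j] de by (intro mult_left_mono D0) auto
    also have "... = (1 / de) ^ (2 * (?m - length (B j)) + 2 * length (B j)) * D"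
     by (simp only: power_add mult_ac)
    also have "2 * (?m - length (B j)) + 2 * length (B j) = 2 * ?m" using nB[OF j] by simp
    finally have "(real (card J) * (cmod (c j))\<^sup>2 * C3) * ((1 / de) ^ (2 * (?m - length (B j))) * nsq (cyl a s) (DL (B j) v)) <= (real (card J) * (cmod (c j))\<^sup>2 * C3) * ((1 / de) ^ (2 * ?m) * D)"
     using C3 by (intro mult_left_mono) auto
    thus "real (card J) * (cmod (c j))\<^sup>2 * C3 * (1 / de) ^ (2 * (?m - length (B j))) * nsq (cyl a s) (DL (B j) v) <= real (card J) * (cmod (c j))\<^sup>2 * C3 * ((1 / de) ^ (2 * ?m) * D)"
     by (simp only: mult.assoc)
   qed
   finally show ?thesis by (simp only: sum_distrib_left sum_distrib_right mult_ac)
  qed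
  have I2: "(LI x. (cmod (f x))\<^sup>2) <= C3 * ((1 / de) ^ (2 * ?m) * D)"
  proof -
   have le: "(cmod (f x))\<^sup>2 <= C3 * (indicator (cyl a s) x *\<^sub>R (cmod (v x))\<^sup>2)" for x
   proof (cases "x \<in> cyl a s")
    case True
    have "cmod (h x) <= C2 * 4 ^ ?m + 1" using hb[of "[]" x] by simp
    hence "(cmod (h x))\<^sup>2 <= C3" unfolding C3_def by (intro power_mono) auto
    hence "(cmod (h x))\<^sup>2 * (cmod (v x))\<^sup>2 <= C3 * (cmod (v x))\<^sup>2" by (intro mult_right_mono) auto
    thus ?thesis using True by (simp add: f_def norm_mult power_mult_distrib)
   next
    case False
    hence "h x = 0" using h0 ZR by blast
    thus ?thesis using False by (simp add: f_def)
   qed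
   have "(LI x. (cmod (f x))\<^sup>2) <= (LI x. C3 * (indicator (cyl a s) x *\<^sub>R (cmod (v x))\<^sup>2))"
    using le by (intro lint_mono test_L2_integrable[OF f] integrable_mult_right nsq_integrable[OF v open_cyl]) auto
   also have "... = C3 * nsq (cyl a s) (DL [] v)" by (simp add: nsq_def)
   also have "... <= C3 * (D * (1 / de) ^ (2 * length ([] :: (real^'d) list)))" using C3 m by (intro mult_left_mono D0) auto
   also have "... <= C3 * ((1 / de) ^ (2 * ?m) * D)"
   proof -
    have "0 <= de ^ 0 * nsq (cyl a s) (DL [] v)" using nsq_nonneg by simp
    also have "... <= D" using D[of "[]"] m by simp
    finally have "D \<ge> 0" .
    thus ?thesis using C3 dep[of 0 "2 * ?m"] by (intro mult_left_mono) (auto simp: mult_le_cancel_right1)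
   qed
   finally show ?thesis .
  qed
  have "nsq (cyl a (s - de)) (DL ws v) = nsq (cyl a (s - de)) (DL ws f)"
  proof (rule nsq_cong)
   fix x assume x: "x \<in> cyl a (s - de)"
   show "DL ws v x = DL ws f x"
    by (rule DL_cong[OF open_cyl x]) (simp add: f_def h1)
  qed
  also have "... <= (LI x. (cmod (DL ws f x))\<^sup>2)" by (rule nsq_le[OF test_DL[OF f] open_cyl])
  also have "... <= C1 * ((LI x. (cmod (diff_op P f x))\<^sup>2) + (LI x. (cmod (f x))\<^sup>2))"
   using ws by (intro C1(2) f) auto
  also have "... <= C1 * ((real (card J) * (\<Sum>j\<in>J. (cmod (c j))\<^sup>2) * C3) * ((1 / de) ^ (2 * ?m) * D) + C3 * ((1 / de) ^ (2 * ?m) * D))"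
   using C1(1) I1 I2 by (intro mult_left_mono add_mono) auto
  also have "... = (K - 1) * ((1 / de) ^ (2 * ?m) * D)" by (simp add: K_def algebra_simps)
  finally have "de ^ (2 * ?m) * nsq (cyl a (s - de)) (DL ws v) <= de ^ (2 * ?m) * ((K - 1) * ((1 / de) ^ (2 * ?m) * D))"
   using de by (intro mult_left_mono) auto
  also have "... = (K - 1) * D" using de by (simp add: power_divide)
  also have "... <= K * D"
  proof -
   have "0 <= de ^ 0 * nsq (cyl a s) (DL [] v)" using nsq_nonneg by simp
   also have "... <= D" using D[of "[]"] m by simp
   finally show ?thesis by (intro mult_right_mono) auto
  qed
  finally show "de ^ (2 * ?m) * nsq (cyl a (s - de)) (DL ws v) <= K * D" .
 qed
qed

end

context
 fixes P :: "'d::finite mpoly" and W :: "(real ^ 'd) set"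
 assumes W: "subspace W" and act: "acts_along P W" and ell: "elliptic_on P W"
begin

abbreviation "pj \<equiv> orth_proj W"
abbreviation "cy \<equiv> cyl W"

text \<open>Induction on the order \<open>n\<close>, each step losing a factor \<open>K\<close> and
  a margin \<open>de\<close>. Derivatives of \<open>v\<close> are again solutions on the cylinder,
  so \<open>cyl_step\<close> is applied after the inner \<open>n - deg P\<close> derivatives have
  been taken; the lower orders it asks for are covered by the induction hypothesis.\<close>

lemma cyl_iterate:
 assumes m: "0 < deg P"
 obtains K where "K \<ge> 1"
  "!!a v R de D n ws. v \<in> tf UNIV ==> (!!x. x \<in> cy a R ==> diff_op P v x = 0) ==> 0 < de ==> de <= 1 ==>
   (!!ws'. length ws' < deg P ==> (\<forall>w\<in>set ws'. norm w <= 1) ==> (LI x. (cmod (DL ws' v x))\<^sup>2) <= D) ==>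
   length ws = n ==> set ws <= W ==> (\<forall>w\<in>set ws. norm w <= 1) ==>
   de ^ (2 * n) * nsq (cy a (R - real n * de)) (DL ws v) <= K ^ n * D"
proof -
 let ?m = "deg P"
 obtain K where K: "K \<ge> 1"
  "!!a v R s de D ws. v \<in> tf UNIV ==> (!!x. x \<in> cy a R ==> diff_op P v x = 0) ==> 0 < de ==> de <= 1 ==> s <= R ==>
   (!!ws'. length ws' < ?m ==> set ws' <= W ==> (\<forall>w\<in>set ws'. norm w <= 1) ==> de ^ (2 * length ws') * nsq (cy a s) (DL ws' v) <= D) ==>
   0 < ?m ==> length ws = ?m ==> set ws <= W ==> (\<forall>w\<in>set ws. norm w <= 1) ==>
   de ^ (2 * ?m) * nsq (cy a (s - de)) (DL ws v) <= K * D"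
  using cyl_step[OF W act ell] by blast
 note oc = open_cyl[OF W act ell]
 have "de ^ (2 * n) * nsq (cy a (R - real n * de)) (DL ws v) <= K ^ n * D"
  if v: "v \<in> tf UNIV" and Pv: "!!x. x \<in> cy a R ==> diff_op P v x = 0" and de: "0 < de" "de <= 1" and
   D: "!!ws'. length ws' < ?m ==> (\<forall>w\<in>set ws'. norm w <= 1) ==> (LI x. (cmod (DL ws' v x))\<^sup>2) <= D" and
   ws: "length ws = n" "set ws <= W" "\<forall>w\<in>set ws. norm w <= 1" for a v R de D n ws
  using ws
 proof (induction n arbitrary: ws rule: less_induct)
  case (less n)
  have "0 <= (LI x. (cmod (DL [] v x))\<^sup>2)" by (intro Bochner_Integration.integral_nonneg) auto
  also have "... <= D" using m by (intro D) auto
  finally have D0: "D \<ge> 0" .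
  show ?case
  proof (cases "n < ?m")
   case True
   have "de ^ (2 * n) * nsq (cy a (R - real n * de)) (DL ws v) <= 1 * nsq (cy a (R - real n * de)) (DL ws v)"
    using de by (intro mult_right_mono nsq_nonneg power_le_one) auto
   also have "... <= (LI x. (cmod (DL ws v x))\<^sup>2)" using nsq_le[OF test_DL[OF v] oc] by simp
   also have "... <= D" using less.prems True by (intro D) auto
   also have "... <= K ^ n * D" using D0 K(1) by (simp add: mult_le_cancel_right1)
   finally show ?thesis .
  next
   case False
   define ws1 where "ws1 = take ?m ws"
   define ws2 where "ws2 = drop ?m ws"
   have wsd: "ws = ws1 @ ws2" by (simp add: ws1_def ws2_def)
   have l1: "length ws1 = ?m" "length ws2 = n - ?m" using less.prems False by (auto simp: ws1_def ws2_def)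
   have s12: "set ws1 <= W" "\<forall>w\<in>set ws1. norm w <= 1" "set ws2 <= W" "\<forall>w\<in>set ws2. norm w <= 1"
    using less.prems by (auto simp: wsd)
   define s where "s = R - real (n - 1) * de"
   have sR: "s <= R" using de by (simp add: s_def)
   \<comment> \<open>Renormalises the induction hypothesis: the weight
     \<open>de ^ (2 * (n - deg P))\<close> that belongs to the inner derivatives is divided
     out.\<close>
   define D' where "D' = K ^ (n - 1) * D * (1 / de) ^ (2 * (n - ?m))"
   have PV: "diff_op P (DL ws2 v) x = 0" if "x \<in> cy a R" for x
   proof -
    have "diff_op P (DL ws2 v) x = DL ws2 (diff_op P v) x"
     by (rule diff_op_DL_commute[OF open_UNIV test_smooth[OF v] UNIV_I])
    also have "... = DL ws2 (%x. 0) x" using Pv by (intro DL_cong[OF oc that])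
    finally show ?thesis using DL_0[OF open_UNIV] by simp
   qed
   have "de ^ (2 * ?m) * nsq (cy a (s - de)) (DL ws1 (DL ws2 v)) <= K * D'"
   proof (rule K(2)[OF test_DL[OF v] PV de sR _ m l1(1) s12(1,2)])
    fix ws' assume ws': "length ws' < ?m" "set ws' <= W" "\<forall>w\<in>set ws'. norm w <= 1"
    define n' where "n' = length ws' + (n - ?m)"
    have n': "n' < n" "n' <= n - 1" using ws'(1) False by (auto simp: n'_def)
    have "de ^ (2 * n') * nsq (cy a (R - real n' * de)) (DL (ws' @ ws2) v) <= K ^ n' * D"
     using ws' s12 l1 by (intro less.IH[OF n'(1)]) (auto simp: n'_def)
    also have "... <= K ^ (n - 1) * D"
     using K(1) n'(2) D0 by (intro mult_right_mono power_increasing) auto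
    finally have 1: "de ^ (2 * n') * nsq (cy a (R - real n' * de)) (DL ws' (DL ws2 v)) <= K ^ (n - 1) * D"
     by (simp add: DL_append)
    have "s <= R - real n' * de"
     unfolding s_def using n'(2) de by (intro diff_left_mono mult_right_mono) auto
    hence "nsq (cy a s) (DL ws' (DL ws2 v)) <= nsq (cy a (R - real n' * de)) (DL ws' (DL ws2 v))"
     by (intro nsq_mono test_DL v oc cyl_mono[OF W act ell])
    hence "de ^ (2 * n') * nsq (cy a s) (DL ws' (DL ws2 v)) <= K ^ (n - 1) * D"
     using 1 de mult_left_mono[of "nsq (cy a s) (DL ws' (DL ws2 v))" _ "de ^ (2 * n')"] by (smt (verit) zero_le_power)
    hence "(de ^ (2 * n') * nsq (cy a s) (DL ws' (DL ws2 v))) * (1 / de) ^ (2 * (n - ?m)) <= D'"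
     unfolding D'_def using de by (intro mult_right_mono) auto
    moreover have "de ^ (2 * n') * (1 / de) ^ (2 * (n - ?m)) = de ^ (2 * length ws')"
     using de by (simp add: n'_def distrib_left power_add power_divide)
    ultimately show "de ^ (2 * length ws') * nsq (cy a s) (DL ws' (DL ws2 v)) <= D'"
     by (metis mult.commute mult.left_commute)
   qed
   hence "de ^ (2 * (n - ?m)) * (de ^ (2 * ?m) * nsq (cy a (s - de)) (DL ws v)) <= de ^ (2 * (n - ?m)) * (K * D')"
    using de by (intro mult_left_mono) (auto simp: wsd DL_append)
   also have "... = K * K ^ (n - 1) * D" using de by (simp add: D'_def power_divide)
   also have "K * K ^ (n - 1) = K ^ n" using False m by (cases n) auto
   finally have "de ^ (2 * (n - ?m)) * (de ^ (2 * ?m) * nsq (cy a (s - de)) (DL ws v)) <= K ^ n * D" .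
   moreover have "s - de = R - real n * de" using False m by (cases n) (auto simp: s_def algebra_simps)
   moreover have "de ^ (2 * (n - ?m)) * (de ^ (2 * ?m) * q) = de ^ (2 * n) * q" for q
   proof -
    have "2 * n = 2 * (n - ?m) + 2 * ?m" using False by simp
    thus ?thesis by (metis power_add mult.assoc)
   qed
   ultimately show ?thesis by simp
  qed
 qed
 thus ?thesis using that K(1) by blast
qed

text \<open>Taylor's formula with integral remainder along the ray; only the remainder is left
  because the coefficients at 0 vanish.\<close>

lemma scalar_Taylor_bound:
 fixes \<Phi> :: "real ^ 'd => complex"
 assumes \<Phi>: "smooth_on UNIV \<Phi>" and t: "0 <= t" and n: "n > 0"
  and z: "!!k. k < n ==> DL (replicate k w) \<Phi> 0 = 0"
  and B: "!!s. 0 <= s ==> s <= t ==> cmod (DL (replicate n w) \<Phi> (s *\<^sub>R w)) <= B"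
 shows "cmod (\<Phi> (t *\<^sub>R w)) <= t ^ n / fact (n - 1) * B"
proof -
 have B0: "0 <= B" using B[of 0] t norm_ge_zero order_trans by blast
 let ?Df = "%k s. DL (replicate k w) \<Phi> (s *\<^sub>R w)"
 have "((%x. ((t - x) ^ (n - 1) / fact (n - 1)) *\<^sub>R ?Df n x) has_integral \<Phi> (t *\<^sub>R w) - (\<Sum>i<n. ((t - 0) ^ i / fact i) *\<^sub>R ?Df i 0)) {0..t}"
 proof (rule Taylor_has_integral[OF n, where Df = ?Df and f = "%t. \<Phi> (t *\<^sub>R w)"])
  show "(?Df k has_vector_derivative ?Df (Suc k) s) (at s within {0..t})" for k s
   using smooth_line_derivative[OF open_UNIV smooth_on_DL[OF open_UNIV \<Phi>, of "replicate k w"], of 0 s w] by simp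
 qed (use t in auto)
 hence "((%x. ((t - x) ^ (n - 1) / fact (n - 1)) *\<^sub>R ?Df n x) has_integral \<Phi> (t *\<^sub>R w)) (cbox 0 t)"
  using z by (simp add: cbox_interval)
 from has_integral_bound[OF _ this, of "t ^ (n - 1) / fact (n - 1) * B"]
 have "cmod (\<Phi> (t *\<^sub>R w)) <= t ^ (n - 1) / fact (n - 1) * B * measure lborel (cbox 0 t)"
 proof -
  have "norm (((t - x) ^ (n - 1) / fact (n - 1)) *\<^sub>R ?Df n x) <= t ^ (n - 1) / fact (n - 1) * B" if "x \<in> cbox 0 t" for x
  proof -
   have x: "0 <= x" "x <= t" using that by (auto simp: cbox_interval)
   have "\<bar>t - x\<bar> ^ (n - 1) <= t ^ (n - 1)" using x by (intro power_mono) auto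
   hence "\<bar>t - x\<bar> ^ (n - 1) / fact (n - 1) <= t ^ (n - 1) / fact (n - 1)" by (intro divide_right_mono) auto
   thus ?thesis
    using B[OF x] t B0 unfolding norm_scaleR by (intro mult_mono) (auto simp: power_abs)
  qed
  thus ?thesis
   using has_integral_bound[OF _ \<open>((%x. ((t - x) ^ (n - 1) / fact (n - 1)) *\<^sub>R ?Df n x) has_integral \<Phi> (t *\<^sub>R w)) (cbox 0 t)\<close>, of "t ^ (n - 1) / fact (n - 1) * B"] t B0 by simp
 qed
 also have "... = t ^ n / fact (n - 1) * B"
  using t n by (cases n) (auto simp: cbox_interval)
 finally show ?thesis .
qed

text \<open>Iterating the previous estimate on \<open>n\<close> nested cylinders bounds derivatives of order \<open>n\<close> along \<open>W\<close> by \<open>(c n)^n\<close>. So the function is real analytic along \<open>W\<close>, and vanishes if its Taylor series does.\<close>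

lemma uc_cyl:
 assumes m: "0 < deg P"
 obtains th where "0 < th" "th <= 1 / 4"
  "!!v a R r h. v \<in> tf UNIV ==> 0 < R ==> R <= 1 ==> (!!x. x \<in> cy a R ==> diff_op P v x = 0) ==>
   r <= R / 4 ==> (!!x. x \<in> cy a r ==> v x = 0) ==> h \<in> W ==> norm h <= th * R ==> (!!x. x \<in> cy a r ==> v (h + x) = 0)"
proof -
 let ?m = "deg P"
 obtain K where K: "K \<ge> 1"
  "!!a v R de D n ws. v \<in> tf UNIV ==> (!!x. x \<in> cy a R ==> diff_op P v x = 0) ==> 0 < de ==> de <= 1 ==>
   (!!ws'. length ws' < ?m ==> (\<forall>w\<in>set ws'. norm w <= 1) ==> (LI x. (cmod (DL ws' v x))\<^sup>2) <= D) ==>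
   length ws = n ==> set ws <= W ==> (\<forall>w\<in>set ws. norm w <= 1) ==>
   de ^ (2 * n) * nsq (cy a (R - real n * de)) (DL ws v) <= K ^ n * D"
  using cyl_iterate[OF m] by blast
 note oc = open_cyl[OF W act ell]
 \<comment> \<open>Chosen so that \<open>2 * K * th * exp 1 = 1 / 2\<close>, the ratio of the
   geometric decay obtained at the end. It depends on \<open>P\<close> and \<open>W\<close>
   only.\<close>
 define th where "th = 1 / (4 * K * exp 1)"
 have e1: "exp (1::real) \<ge> 1" by simp
 have th: "th > 0" "th <= 1 / 4" "2 * K * th * exp 1 = 1 / 2"
  using K(1) mult_mono[OF K(1) e1] by (auto simp: th_def field_simps)
 show ?thesis
 proof (rule that[OF th(1,2)])
  fix v a R r h x1
  assume v: "v \<in> tf UNIV" and R: "0 < R" "R <= 1" and Pv: "!!x. x \<in> cy a R ==> diff_op P v x = 0"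
   and r: "r <= R / 4" and v0: "!!x. x \<in> cy a r ==> v x = 0" and h: "h \<in> W" "norm h <= th * R" and x1: "x1 \<in> cy a r"
  define t where "t = norm h"
  define w0 where "w0 = (1 / norm h) *\<^sub>R h"
  have w0: "w0 \<in> W" "norm w0 <= 1" "t *\<^sub>R w0 = h" using h W by (auto simp: w0_def t_def subspace_scale)
  have "th * R <= 1 / 4 * R" using th(2) R by (intro mult_right_mono) auto
  hence t: "0 <= t" "t <= th * R" "t <= R / 4"
   using h by (auto simp: t_def)
  obtain M where M: "M > 0" "!!ws y. length ws <= ?m ==> (!!w. w \<in> set ws ==> norm w <= 1) ==> cmod (DL ws v y) <= M"
   using DL_bounded_all[OF v, of ?m] by blast
  have sc: "compact (supp v)" using v by (simp add: tf_iff)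
  define D where "D = M\<^sup>2 * measure lborel (supp v)"
  have D: "(LI x. (cmod (DL ws' v x))\<^sup>2) <= D" if "length ws' < ?m" "\<forall>w\<in>set ws'. norm w <= 1" for ws'
  proof -
   have "(LI x. (cmod (DL ws' v x))\<^sup>2) <= (LI x. indicator (supp v) x *\<^sub>R M\<^sup>2)"
   proof (rule lint_mono)
    show "integrable lborel (%x. indicator (supp v) x *\<^sub>R M\<^sup>2)" using sc by (intro borel_integrable_compact continuous_on_const)
    show "(cmod (DL ws' v x))\<^sup>2 <= indicator (supp v) x *\<^sub>R M\<^sup>2" for x
     using M(2)[of ws' x] that DL_outside_support[of x v ws'] by (cases "x \<in> supp v") (auto intro: power_mono)
   qed (rule test_L2_integrable[OF test_DL[OF v]])
   also have "... = D" by (simp add: D_def mult.commute)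
   finally show ?thesis .
  qed
  have D0: "D \<ge> 0" by (simp add: D_def)
  \<comment> \<open>\<open>D + 1\<close> is positive and its square dominates \<open>D\<close>, so
    the bound for squared norms can be written as a square.\<close>
  define E where "E = D + 1"
  have E: "E > 0" "D <= E\<^sup>2" using D0 by (auto simp: E_def power2_eq_square algebra_simps)
  \<comment> \<open>The estimates are in mean square, so the translate of \<open>v\<close> is tested
    against \<open>w\<close>: the scalar function \<open>\<Phi>\<close> inherits the vanishing
    Taylor coefficients and the growth of the derivatives.\<close>
  have zero: "(LI x. w x * v (h + x)) = 0" if w: "w \<in> tf (cy a r)" for w
  proof -
   have wU: "w \<in> tf UNIV" using w by (rule tf_UNIV)
   define w' where "w' = (%x. w (- x))"
   have w': "w' \<in> tf UNIV" unfolding w'_def using test_compose_affine(1)[OF wU, of "-1" 0] by simp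
   define \<Phi> where "\<Phi> = conv w' v"
   have cl: "loc_int UNIV w'" by (rule loc_int_continuous[OF test_continuous[OF w']])
   have \<Phi>s: "smooth_on UNIV \<Phi>" unfolding \<Phi>_def by (rule conv_smooth(1)[OF cl v])
   have D\<Phi>: "DL ws \<Phi> y = (LI x. w x * DL ws v (y + x))" for ws y
   proof -
    have "DL ws \<Phi> y = (LI x. w' x * DL ws v (y - x))" unfolding \<Phi>_def conv_smooth(2)[OF cl v] conv_def ..
    also have "... = (LI x. w' (0 - x) * DL ws v (y - (0 - x)))"
     by (intro lborel_integral_reflect[of "%x. w' x * DL ws v (y - x)", symmetric] cont_bm continuous_intros
       test_continuous[OF w'] continuous_on_compose2[OF test_continuous[OF test_DL[OF v], where S = UNIV]]) auto
    finally show ?thesis by (simp add: w'_def)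
   qed
   have z0: "DL ws \<Phi> 0 = 0" for ws
   proof -
    have "w x * DL ws v (0 + x) = 0" for x
    proof (cases "x \<in> cy a r")
     case True
     have "DL ws v x = DL ws (%x. 0) x" by (rule DL_cong[OF oc True]) (rule v0)
     also have "... = 0" by (rule DL_0[OF open_UNIV])
     finally show ?thesis by simp
    next
     case False
     thus ?thesis using w not_supp[of x w] by (auto simp: tf_iff)
    qed
    hence "(%x. w x * DL ws v (0 + x)) = (%x. 0)" by (rule ext)
    thus ?thesis unfolding D\<Phi> by (simp only: integral_zero)
   qed
   define I where "I = (LI x. (cmod (w x))\<^sup>2)"
   have I: "I \<ge> 0" unfolding I_def by (intro Bochner_Integration.integral_nonneg) auto
   \<comment> \<open>The margin \<open>R / (2 * n)\<close> spends half of the radius in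
     \<open>n\<close> steps, which is the source of the factor \<open>n ^ n\<close> typical of
     analytic functions.\<close>
   have bound: "cmod (DL (replicate n w0) \<Phi> (t' *\<^sub>R w0)) <= (2 * K * real n / R) ^ n * (E * (I + 1))"
    if n: "n > 0" and t': "0 <= t'" "t' <= t" for n t'
   proof -
    let ?g = "DL (replicate n w0) v"
    have g: "?g \<in> tf UNIV" by (rule test_DL[OF v])
    define de where "de = R / (2 * real n)"
    have de: "0 < de" "de <= 1" using R n by (auto simp: de_def field_simps)
    have "R - real n * de = R / 2" using n by (simp add: de_def)
    moreover have "de ^ (2 * n) * nsq (cy a (R - real n * de)) ?g <= K ^ n * D"
     using w0 by (intro K(2)[OF v Pv de D]) auto
    ultimately have "nsq (cy a (R / 2)) ?g <= K ^ n * D * (1 / de) ^ (2 * n)"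
     using de by (simp add: power_divide pos_le_divide_eq mult.commute)
    also have "... <= (K ^ n)\<^sup>2 * E\<^sup>2 * (1 / de) ^ (2 * n)"
     using E D0 de K(1) by (intro mult_right_mono mult_mono self_le_power one_le_power) auto
    also have "... = ((2 * K * real n / R) ^ n * E)\<^sup>2"
    proof -
     have "(2 * K * real n / R) = K * (1 / de)" using R n by (simp add: de_def)
     thus ?thesis by (simp only: power_mult_distrib power_mult[symmetric] mult_ac)
    qed
    finally have nb: "nsq (cy a (R / 2)) ?g <= ((2 * K * real n / R) ^ n * E)\<^sup>2" .
    let ?b = "(2 * K * real n / R) ^ n * E"
    have b: "?b > 0" using K(1) R n E by simp
    let ?f = "%x. indicator (cy a (R / 2)) x *\<^sub>R (cmod (?g x))\<^sup>2"
    have fi: "integrable lborel ?f" by (rule nsq_integrable[OF g oc])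
    have fm: "?f \<in> borel_measurable borel" using borel_measurable_integrable[OF fi] by simp
    have fi': "integrable lborel (%x. ?f (t' *\<^sub>R w0 + x))"
     using fi lborel_integral_scale(2)[OF fm, of 1 "t' *\<^sub>R w0"] by simp
    have "cmod (DL (replicate n w0) \<Phi> (t' *\<^sub>R w0)) <= (LI x. cmod (w x * ?g (t' *\<^sub>R w0 + x)))"
     unfolding D\<Phi> by (rule integral_norm_bound)
    \<comment> \<open>A weighted inequality between products and squares, with weight
      \<open>?b\<close>: after integration both halves are multiples of \<open>?b\<close>.\<close>
    also have "... <= (LI x. ?b * (cmod (w x))\<^sup>2 + (1 / ?b) * ?f (t' *\<^sub>R w0 + x))"
    proof (rule lint_mono)
     have "(%x. ?g (t' *\<^sub>R w0 + x)) \<in> tf UNIV"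
      using test_compose_affine(1)[OF g, of 1 "t' *\<^sub>R w0"] by simp
     hence "(%x. ?g (t' *\<^sub>R w0 + x) * w x) \<in> tf UNIV"
      by (rule test_mult_left[OF test_smooth wU])
     from test_integrable[OF this] show "integrable lborel (%x. cmod (w x * ?g (t' *\<^sub>R w0 + x)))"
      by (simp add: mult.commute)
     show "integrable lborel (%x. ?b * (cmod (w x))\<^sup>2 + (1 / ?b) * ?f (t' *\<^sub>R w0 + x))"
      by (intro Bochner_Integration.integrable_add integrable_mult_right test_L2_integrable[OF wU] fi')
     fix x
     show "cmod (w x * ?g (t' *\<^sub>R w0 + x)) <= ?b * (cmod (w x))\<^sup>2 + (1 / ?b) * ?f (t' *\<^sub>R w0 + x)"
     proof (cases "x \<in> cy a r")
      case True
      have "pj (t' *\<^sub>R w0 + x - a) = pj (x - a) + t' *\<^sub>R w0"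
       using orth_proj_add[OF W, of "x - a" "t' *\<^sub>R w0"] orth_proj_id[OF W subspace_scale[OF W w0(1)]] by (simp add: algebra_simps)
      hence "norm (pj (t' *\<^sub>R w0 + x - a)) <= norm (pj (x - a)) + norm (t' *\<^sub>R w0)" by (simp only: norm_triangle_ineq)
      also have "norm (t' *\<^sub>R w0) <= t * 1" unfolding norm_scaleR using t' w0(2) by (intro mult_mono) auto
      finally have "t' *\<^sub>R w0 + x \<in> cy a (R / 2)" using True r t(3) by (simp add: cyl_def[OF W act ell])
      hence f: "?f (t' *\<^sub>R w0 + x) = (cmod (?g (t' *\<^sub>R w0 + x)))\<^sup>2" by simp
      have "p * q <= be * p\<^sup>2 + (1 / be) * q\<^sup>2" if "be > 0" for p q be :: real
      proof -
       have "0 <= (be * p - q)\<^sup>2" by simp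
       hence "2 * (be * (p * q)) <= be\<^sup>2 * p\<^sup>2 + q\<^sup>2" by (simp add: power2_diff power_mult_distrib)
       moreover have "0 <= be\<^sup>2 * p\<^sup>2 + q\<^sup>2" by simp
       ultimately have "be * (p * q) <= be\<^sup>2 * p\<^sup>2 + q\<^sup>2" by linarith
       also have "... = be * (be * p\<^sup>2 + (1 / be) * q\<^sup>2)" using that by (simp add: distrib_left power2_eq_square)
       finally show ?thesis using that by simp
      qed
      from this[OF b] show ?thesis unfolding f norm_mult .
     next
      case False
      hence "w x = 0" using w not_supp[of x w] by (auto simp: tf_iff)
      thus ?thesis using b by simp
     qed
    qed
    also have "... = ?b * I + (1 / ?b) * (LI x. ?f (t' *\<^sub>R w0 + x))"
     unfolding I_def using fi' test_L2_integrable[OF wU] by (subst Bochner_Integration.integral_add) (auto intro!: integrable_mult_right simp del: times_divide_eq_left)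
    also have "(LI x. ?f (t' *\<^sub>R w0 + x)) = nsq (cy a (R / 2)) ?g"
     unfolding nsq_def by (rule lborel_integral_translate[OF fm])
    also have "?b * I + (1 / ?b) * nsq (cy a (R / 2)) ?g <= ?b * I + (1 / ?b) * ?b\<^sup>2"
     using nb b by (intro add_left_mono mult_left_mono) auto
    also have "... = (2 * K * real n / R) ^ n * (E * (I + 1))"
    proof -
     have "be * I + (1 / be) * be\<^sup>2 = be * (I + 1)" if "be > 0" for be :: real
      using that by (simp add: power2_eq_square algebra_simps)
     from this[OF b] show ?thesis by (simp only: mult.assoc)
    qed
    finally show ?thesis .
   qed
   have "cmod (\<Phi> h) <= (E * (I + 1)) * (real n * (1 / 2) ^ n)" if n: "n > 0" for n
   proof -
    have "cmod (\<Phi> (t *\<^sub>R w0)) <= t ^ n / fact (n - 1) * ((2 * K * real n / R) ^ n * (E * (I + 1)))"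
     by (rule scalar_Taylor_bound[OF \<Phi>s t(1) n z0 bound[OF n]])
    also have "... <= (th * R) ^ n / fact (n - 1) * ((2 * K * real n / R) ^ n * (E * (I + 1)))"
     using t K(1) R E I by (intro mult_right_mono divide_right_mono power_mono) auto
    also have "... = (E * (I + 1)) * ((2 * K * th) ^ n * (real n ^ n / fact (n - 1)))"
     using R by (simp add: power_mult_distrib power_divide mult_ac)
    also have "real n ^ n / fact (n - 1) = real n * (real n ^ n / fact n)"
     using n by (simp add: fact_reduce)
    also have "(E * (I + 1)) * ((2 * K * th) ^ n * (real n * (real n ^ n / fact n))) <= (E * (I + 1)) * ((2 * K * th) ^ n * (real n * exp (real n)))"
     using E I K(1) th(1) power_div_fact_le_exp[of "real n" n] by (intro mult_left_mono) auto
    also have "exp (real n) = exp 1 ^ n" using exp_of_nat_mult[of n 1] by simp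
    also have "(2 * K * th) ^ n * (real n * exp 1 ^ n) = real n * (2 * K * th * exp 1) ^ n"
     by (simp only: power_mult_distrib mult_ac)
    finally show ?thesis unfolding th(3) w0(3) .
   qed
   moreover have "(%n. (E * (I + 1)) * (real n * (1 / 2) ^ n)) \<longlonglongrightarrow> (E * (I + 1)) * 0"
    by (intro tendsto_mult_left powser_times_n_limit_0) auto
   ultimately have "cmod (\<Phi> h) <= (E * (I + 1)) * 0"
    by (intro LIMSEQ_le_const) (auto intro!: exI[of _ 1])
   hence "\<Phi> h = 0" by simp
   thus ?thesis using D\<Phi>[of "[]" h] by simp
  qed
  \<comment> \<open>Testing with the conjugate of the cut off translate produces an L2 norm equal to
    zero, hence the pointwise statement at \<open>x1\<close>.\<close>
  obtain k V where k: "k \<in> tf (cy a r)" "{x1} <= V" "!!x. x \<in> V ==> k x = 1"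
   using cutoff_exists[of "{x1}" "cy a r"] oc x1 by (metis compact_sing empty_subsetI insert_subset)
  let ?f = "%x. v (h + x)"
  have f: "?f \<in> tf UNIV" using test_compose_affine(1)[OF v, of 1 h] by simp
  have kf: "(%x. ?f x * k x) \<in> tf UNIV" by (rule test_mult_left[OF test_smooth[OF f] tf_UNIV[OF k(1)]])
  have "(%x. cnj (?f x * k x) * k x) \<in> tf (cy a r)"
   using test_mult[OF oc smooth_on_subset[OF test_smooth[OF test_cnj[OF kf]]] k(1)] by auto
  from zero[OF this] have "(LI x. cr ((cmod (?f x * k x))\<^sup>2)) = 0"
   by (simp only: complex_norm_square mult_ac)
  hence "(LI x. (cmod (?f x * k x))\<^sup>2) = 0" by (simp only: integral_complex_of_real of_real_eq_0_iff)
  hence "?f x1 * k x1 = 0"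
   using L2_zero_imp_zero[OF test_continuous[OF kf] test_L2_integrable[OF kf], of x1] by simp
  thus "v (h + x1) = 0" using k by simp
 qed
qed

section \<open>From infinite cylinders to bounded tubes\<close>

lemma DL_mult_invariant:
 assumes g: "smooth_on UNIV g" "!!x w. w \<in> W ==> g (x + w) = g x" and u: "smooth_on UNIV u" and ws: "set ws <= W"
 shows "DL ws (%x. g x * u x) x = g x * DL ws u x"
proof -
 have 0: "DL a g x * DL b u x = 0" if "(a, b) \<in> set (rsplits ws)" for a b
  using DL_invariant[OF g W, of a x] rsplitsD[OF that] ws by auto
 have "DL ws (%x. g x * u x) x = (\<Sum>(a, b)\<leftarrow>rsplits ws. DL a g x * DL b u x) + g x * DL ws u x"
  using DL_mult[OF open_UNIV g(1) u UNIV_I, of ws x] unfolding rsplits(1) by simp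
 also have "(\<Sum>(a, b)\<leftarrow>rsplits ws. DL a g x * DL b u x) = (\<Sum>(a, b)\<leftarrow>rsplits ws. 0)"
  using 0 by (intro arg_cong[where f = sum_list] map_cong) auto
 also have "... = 0" by (simp add: case_prod_unfold)
 finally show ?thesis by simp
qed

definition tube :: "real ^ 'd => real => real => (real ^ 'd) set"
 where "tube a s q = {x. norm (pj (x - a)) < s & norm ((x - a) - pj (x - a)) < q}"

text \<open>A cutoff \<open>g\<close> across \<open>W\<close> that is constant along
  \<open>W\<close> commutes with \<open>P(D)\<close>, so \<open>g * u\<close> satisfies on the whole
  cylinder what \<open>u\<close> satisfies on the tube, and \<open>uc_cyl\<close> applies.\<close>

lemma uc_tube:
 obtains t where "0 < t" "t <= 1 / 4"
  "!!u a R r q h x. u \<in> tf UNIV ==> 0 < R ==> R <= 1 ==> (!!x. x \<in> tube a R q ==> diff_op P u x = 0) ==>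
   0 < r ==> r <= R / 4 ==> (!!x. x \<in> tube a r q ==> u x = 0) ==> h \<in> W ==> norm h <= t * R ==> x \<in> tube a r q ==> u (h + x) = 0"
proof (cases "deg P = 0")
 case True
 show ?thesis
 proof (rule that[of "1 / 4"])
  fix u a R r q h x
  assume u: "u \<in> tf UNIV" and R: "0 < R" "R <= 1" and Pu: "!!x. x \<in> tube a R q ==> diff_op P u x = 0"
   and r: "r <= R / 4" and u0: "!!x. x \<in> tube a r q ==> u x = 0" and h: "h \<in> W" "norm h <= 1 / 4 * R" and x: "x \<in> tube a r q"
  show "u (h + x) = 0"
  proof (cases "h = 0")
   case True
   thus ?thesis using u0[OF x] by simp
  next
   case False
   \<comment> \<open>In degree 0 ellipticity at \<open>h\<close> makes \<open>P\<close> a nonzero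
     constant, so \<open>u\<close> vanishes wherever \<open>P(D) u\<close> does.\<close>
   have deg: "mi_size al = 0" if "al \<in> keys P" for al
    using deg_ge[OF that] True by simp
   have a0: "al $ j = 0" if "al \<in> keys P" for al j
    using deg[OF that] by (simp add: mi_size_def)
   have mv: "mvecs al = []" if "al \<in> keys P" for al
    using length_mvecs[of al] deg[OF that] by simp
   have "mpoly_eval (principal_part P) h ~= 0" using ell h(1) False by (simp add: elliptic_on_def)
   hence c: "(\<Sum>al\<in>keys P. coef P al) ~= 0"
    unfolding mpoly_eval_superset[OF finite_keys keys_principal_part] using True deg a0
    by (simp add: lookup_principal_part)
   have d: "diff_op P u y = (\<Sum>al\<in>keys P. coef P al) * u y" for y
    unfolding diff_op_DL sum_distrib_right using deg mv by (intro sum.cong) auto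
   have ph: "pj (h + x - a) = pj (x - a) + h"
    using orth_proj_add[OF W, of "x - a" h] orth_proj_id[OF W h(1)] by (simp add: algebra_simps)
   have "h + x \<in> tube a R q"
   proof -
    have "norm (pj (h + x - a)) <= norm (pj (x - a)) + norm h" unfolding ph by (rule norm_triangle_ineq)
    moreover have "norm (h + x - a - pj (h + x - a)) = norm (x - a - pj (x - a))"
     unfolding ph by (rule arg_cong[where f = norm]) simp
    ultimately show ?thesis using x r h(2) R unfolding tube_def mem_Collect_eq by linarith
   qed
   from Pu[OF this] show ?thesis using c d by simp
  qed
 qed auto
next
 case False
 hence m: "0 < deg P" by simp
 show ?thesis
 proof (rule uc_cyl[OF m])
 fix t0 assume t: "0 < t0" "t0 <= 1 / 4"
  "!!v a R r h. v \<in> tf UNIV ==> 0 < R ==> R <= 1 ==> (!!x. x \<in> cy a R ==> diff_op P v x = 0) ==>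
   r <= R / 4 ==> (!!x. x \<in> cy a r ==> v x = 0) ==> h \<in> W ==> norm h <= t0 * R ==> (!!x. x \<in> cy a r ==> v (h + x) = 0)"
 show ?thesis
 proof (rule that[OF t(1,2)])
  fix u a R r q h x1
  assume u: "u \<in> tf UNIV" and R: "0 < R" "R <= 1" and Pu: "!!x. x \<in> tube a R q ==> diff_op P u x = 0"
   and r: "r <= R / 4" and u0: "!!x. x \<in> tube a r q ==> u x = 0" and h: "h \<in> W" "norm h <= t0 * R" and x1: "x1 \<in> tube a r q"
  let ?n = "%x. norm ((x - a) - pj (x - a))"
  \<comment> \<open>A quarter of the transversal distance of \<open>x1\<close> to the boundary of
    the tube; it makes \<open>g\<close> equal to 1 at \<open>h + x1\<close> and 0 from transversal
    distance \<open>q\<close> on.\<close>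
  define e where "e = (q - ?n x1) / 4"
  have e: "e > 0" using x1 by (simp add: e_def tube_def)
  define S where "S = {x. ?n x < q - 2 * e}"
  have S: "open S"
  proof -
   have "continuous_on UNIV ?n"
    by (intro continuous_intros continuous_on_compose2[OF orth_proj_continuous[OF W, of UNIV]]) auto
   thus ?thesis unfolding S_def by (intro open_Collect_less continuous_on_const)
  qed
  define g where "g = smear S e"
  have gs: "smooth_on UNIV g" unfolding g_def by (rule smear_smooth[OF S e])
  have nW: "?n (x + w) = ?n x" if "w \<in> W" for x w
  proof -
   have "pj (x + w - a) = pj (x - a) + w"
    using orth_proj_add[OF W, of "x - a" w] orth_proj_id[OF W that] by (simp add: algebra_simps)
   hence "(x + w - a) - pj (x + w - a) = (x - a) - pj (x - a)" by (simp only: add_diff_eq) simp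
   thus ?thesis by (simp only:)
  qed
  have gW: "g (x + w) = g x" if "w \<in> W" for x w
   unfolding g_def by (rule smear_translate[OF S e]) (simp add: S_def nW[OF that])
  have n3: "?n x <= ?n (x - y) + norm y" "?n (x - y) <= ?n x + norm y" for x y
  proof -
   have eq: "(x - y - a) - pj (x - y - a) = ((x - a) - pj (x - a)) - (y - pj y)"
    using orth_proj_diff[OF W, of "x - a" y] by (simp add: algebra_simps)
   show "?n (x - y) <= ?n x + norm y"
    unfolding eq using norm_triangle_ineq4[of "(x - a) - pj (x - a)" "y - pj y"] norm_orth_compl[OF W, of y] by linarith
   show "?n x <= ?n (x - y) + norm y"
    unfolding eq using norm_triangle_ineq2[of "(x - a) - pj (x - a)" "y - pj y"] norm_orth_compl[OF W, of y] by linarith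
  qed
  have g0: "g x = 0" if "?n x \<ge> q" for x
   unfolding g_def
  proof (rule smear_zero[OF S e])
   fix y :: "real ^ 'd" assume "norm y < e"
   thus "x - y \<notin> S" using n3(1)[of x y] that e by (simp add: S_def)
  qed
  have g1: "g (h + x1) = 1"
   unfolding g_def
  proof (rule smear_one[OF S e])
   fix y :: "real ^ 'd" assume "norm y < e"
   moreover have "?n (h + x1) = ?n x1" using nW[OF h(1), of x1] by (simp only: add.commute[of h])
   ultimately show "h + x1 - y \<in> S"
    using n3(2)[of "h + x1" y] e unfolding S_def e_def mem_Collect_eq by argo
  qed
  define v where "v = (%x. g x * u x)"
  have v: "v \<in> tf UNIV" unfolding v_def by (rule test_mult_left[OF gs u])
  have us: "smooth_on UNIV u" using u by (rule test_smooth)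
  have Pv: "diff_op P v x = g x * diff_op P u x" for x
  proof -
   have "DL (map pj (mvecs al)) v x = g x * DL (map pj (mvecs al)) u x" for al
    unfolding v_def by (rule DL_mult_invariant[OF gs gW us]) (auto intro: orth_proj_mem[OF W])
   thus ?thesis
    unfolding diff_op_along[OF W act ell open_UNIV test_smooth[OF v] UNIV_I] diff_op_along[OF W act ell open_UNIV us UNIV_I]
    by (simp add: sum_distrib_left mult_ac)
  qed
  have "v (h + x1) = 0"
  proof (rule t(3)[OF v R _ r _ h])
   show "x1 \<in> cy a r" using x1 by (simp add: tube_def cyl_def[OF W act ell])
   show "diff_op P v x = 0" if "x \<in> cy a R" for x
    using that Pu[of x] g0[of x] unfolding Pv by (cases "?n x < q") (auto simp: tube_def cyl_def[OF W act ell])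
   show "v x = 0" if "x \<in> cy a r" for x
    using that u0[of x] g0[of x] unfolding v_def by (cases "?n x < q") (auto simp: tube_def cyl_def[OF W act ell])
  qed
  thus "u (h + x1) = 0" using g1 by (simp add: v_def)
 qed
 qed
qed

end

section \<open>The support of a distribution with given image\<close>

lemma compact_enlargement:
 fixes K X :: "(real ^ 'd::finite) set"
 assumes "compact K" "open X" "K <= X"
 obtains d K' where "d > 0" "compact K'" "K' <= X" "!!x y. x \<in> K ==> norm y <= d ==> x - y \<in> K'" "K <= K'"
proof -
 obtain d where d: "d > 0" "(\<Union>x\<in>K. cball x d) <= X"
  using compact_subset_open_imp_cball_epsilon_subset[OF assms] by metis
 let ?K = "{x - y |x y. x \<in> K & y \<in> cball 0 d}"
 show ?thesis
 proof (rule that[OF d(1), of ?K])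
  show "compact ?K" by (rule compact_difference_set[OF assms(1) compact_cball])
  show "?K <= X"
  proof clarify
   fix x y :: "real ^ 'd" assume x: "x \<in> K" and "y \<in> cball 0 d"
   hence "x - y \<in> (\<Union>x\<in>K. cball x d)" by (intro UN_I[OF x]) (simp add: dist_norm)
   from subsetD[OF d(2) this] show "x - y \<in> X" .
  qed
  show "K <= ?K"
  proof
   fix x assume "x \<in> K"
   thus "x \<in> ?K" using d(1) by (intro CollectI exI[of _ x] exI[of _ 0]) simp
  qed
  show "x - y \<in> ?K" if "x \<in> K" "norm y <= d" for x y using that by (intro CollectI exI[of _ x] exI[of _ y]) simp
 qed
qed

text \<open>The error is uniform over all \<open>f\<close> supported in \<open>K\<close> with a
  common bound \<open>M\<close> for their derivatives; the strong topology demands this uniformity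
  over bounded sets.\<close>

lemma mollify_approx:
 assumes u: "u \<in> distributions X" and X: "open X" and K: "compact K" "K <= X"
 obtains C d r where "C \<ge> 0" "d > 0"
  "!!f e M. f \<in> tf X ==> supp f <= K ==> 0 < e ==> e <= d ==>
   (!!vs y. length vs <= r + 1 ==> (!!v. v \<in> set vs ==> norm v <= 1) ==> cmod (DL vs f y) <= M) ==>
   cmod ((LI x. f x * u (%y. moll e (x - y))) - u f) <= C * (M * e)"
proof -
 obtain d K' where d: "d > 0" and K': "compact K'" "K' <= X" "!!x y. x \<in> K ==> norm y <= d ==> x - y \<in> K'" "K <= K'"
  using compact_enlargement[OF K(1) X K(2)] by blast
 obtain C r where C: "C \<ge> 0" "!!f. f \<in> tf X ==> supp f <= K' ==> cmod (u f) <= C * sn K' r f"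
  using distributions_bound[OF u K'(1,2)] by blast
 show ?thesis
 proof (rule that[OF C(1) d])
  fix f e M
  assume f: "f \<in> tf X" "supp f <= K" and e: "0 < e" "e <= d"
   and M: "!!vs y. length vs <= r + 1 ==> (!!v. v \<in> set vs ==> norm v <= 1) ==> cmod (DL vs f y) <= M"
  have M0: "0 <= M" by (rule order_trans[OF norm_ge_zero M[of "[]" undefined]]) auto
  note fU = tf_UNIV[OF f(1)]
  have s: "x - y \<in> K'" if "x \<in> supp f" "y \<in> supp (moll e)" for x y
   using that f(2) moll_support[OF e(1)] e by (intro K'(3)) auto
  have s': "x - y \<in> X" if "x \<in> supp f" "y \<in> supp (moll e)" for x y using s[OF that] K'(2) by blast
  have mp: "conv f (moll e) \<in> tf X" "u (conv f (moll e)) = (LI x. f x * u (%y. moll e (x - y)))"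
   "supp (conv f (moll e)) <= {x - y |x y. x \<in> supp f & y \<in> supp (moll e)}"
   by (rule mollify_pairing[OF u X moll_test[OF e(1)] moll_test[OF e(1)] moll_even fU], erule (1) s')+
  have "cmod (u (%x. conv f (moll e) x - f x)) <= C * sn K' r (%x. conv f (moll e) x - f x)"
  proof (rule C(2)[OF test_diff[OF mp(1) f(1)]])
   have "conv f (moll e) x - f x = 0" if "x \<notin> K'" for x
   proof -
    have "x \<notin> supp (conv f (moll e))" using mp(3) s that by blast
    moreover have "x \<notin> supp f" using f(2) K'(4) that by blast
    ultimately show ?thesis by (simp add: not_supp)
   qed
   thus "supp (%x. conv f (moll e) x - f x) <= K'"
    by (intro supp_subset compact_imp_closed K')
  qed
  also have "... <= C * (M * e)"
  proof (intro mult_left_mono C(1) sn_le)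
   fix al :: "nat ^ 'a" and x :: "real ^ 'a" assume "mi_size al <= r"
   thus "cmod (multi_deriv al (%x. conv f (moll e) x - f x) x) <= M * e"
    unfolding multi_deriv_DL DL_diff[OF open_UNIV test_smooth[OF mp(1)] test_smooth[OF f(1)] UNIV_I]
    by (intro conv_moll_DL_approx[OF fU e(1) _ _ M]) (auto simp: length_mvecs norm_mvecs)
  qed (use M0 e in auto)
  finally show "cmod ((LI x. f x * u (%y. moll e (x - y))) - u f) <= C * (M * e)"
   unfolding distributions_diff[OF u mp(1) f(1)] mp(2) .
 qed
qed

lemma mollify_tendsto:
 assumes u: "u \<in> distributions X" and X: "open X" and f: "f \<in> tf X"
 shows "((%e. LI x. f x * u (%y. moll e (x - y))) \<longlongrightarrow> u f) (at_right 0)"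
proof -
 have K: "compact (supp f)" "supp f <= X" using f by (auto simp: tf_iff)
 obtain C d r where C: "C \<ge> 0" "d > 0"
  "!!f' e M. f' \<in> tf X ==> supp f' <= supp f ==> 0 < e ==> e <= d ==>
   (!!vs y. length vs <= r + 1 ==> (!!v. v \<in> set vs ==> norm v <= 1) ==> cmod (DL vs f' y) <= M) ==>
   cmod ((LI x. f' x * u (%y. moll e (x - y))) - u f') <= C * (M * e)"
  using mollify_approx[OF u X K] by blast
 obtain M where M: "M > 0" "!!vs y. length vs <= r + 1 ==> (!!v. v \<in> set vs ==> norm v <= 1) ==> cmod (DL vs f y) <= M"
  using DL_bounded_all[OF tf_UNIV[OF f], of "r + 1"] by blast
 have 0: "((%e::real. C * (M * e)) \<longlongrightarrow> 0) (at_right 0)" by (auto intro!: tendsto_eq_intros)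
 have "eventually (%e. norm ((LI x. f x * u (%y. moll e (x - y))) - u f) <= C * (M * e)) (at_right 0)"
  using eventually_at_right_less[of 0] eventually_at_right_real[OF C(2)] 
 proof eventually_elim
  case (elim e)
  show ?case
  proof (rule C(3)[OF f order_refl])
   show "cmod (DL vs f y) <= M" if "length vs <= r + 1" "!!v. v \<in> set vs ==> norm v <= 1" for vs y using that by (rule M(2))
  qed (use elim in auto)
 qed
 from Lim_null_comparison[OF this 0] show ?thesis by (rule LIM_zero_cancel)
qed

lemma sn_diff_op:
 assumes K: "compact K"
 obtains C where "C \<ge> 0" "!!f. smooth_on UNIV f ==> sn K r (diff_op P f) <= C * sn K (r + deg P) f"
proof -
 define C where "C = (\<Sum>al\<in>keys P. cmod (coef P al) * real CARD('a) ^ (r + deg P))"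
 show ?thesis
 proof (rule that[of C])
  fix f :: "real ^ 'a => complex" assume f: "smooth_on UNIV f"
  let ?s = "sn K (r + deg P) f"
  have s0: "0 <= ?s" by (rule sn_nonneg[OF open_UNIV K subset_UNIV f])
  show "sn K r (diff_op P f) <= C * ?s"
  proof (rule sn_le)
   fix b :: "nat ^ 'a" and x assume x: "x \<in> K" and b: "mi_size b <= r"
   have "cmod (DL (mvecs al @ mvecs b) f x) <= real CARD('a) ^ (r + deg P) * ?s" if al: "al \<in> keys P" for al
   proof -
    have l: "length (mvecs al @ mvecs b) <= r + deg P" using b deg_ge[OF al] by (simp add: length_mvecs)
    have "cmod (DL (mvecs al @ mvecs b) f x) <= real CARD('a) ^ length (mvecs al @ mvecs b) * ?s"
     using l by (intro DL_le_seminorm[OF open_UNIV K subset_UNIV f x]) (auto simp: norm_mvecs)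
    also have "... <= real CARD('a) ^ (r + deg P) * ?s"
     using l s0 by (intro mult_right_mono power_increasing) auto
    finally show ?thesis .
   qed
   hence "cmod (diff_op P (DL (mvecs b) f) x) <= (\<Sum>al\<in>keys P. cmod (coef P al) * (real CARD('a) ^ (r + deg P) * ?s))"
    unfolding diff_op_DL by (intro sum_norm_le) (auto simp: norm_mult norm_power DL_append intro!: mult_left_mono)
   also have "... = C * ?s" by (simp add: C_def sum_distrib_right mult.assoc)
   finally show "cmod (multi_deriv b (diff_op P f) x) <= C * ?s"
    unfolding multi_deriv_DL diff_op_DL_commute[OF open_UNIV f UNIV_I] .
  qed (use s0 in \<open>auto simp: C_def intro!: mult_nonneg_nonneg sum_nonneg\<close>)
 qed (auto simp: C_def intro!: sum_nonneg)
qed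

lemma ddo_distribution:
 assumes u: "u \<in> distributions X"
 shows "ddo X P u \<in> distributions X"
proof -
 let ?Q = "rfl P"
 have "\<exists>C r. \<forall>f\<in>tf X. supp f <= K --> cmod (ddo X P u f) <= C * sn K r f"
  if K: "compact K" "K <= X" for K
 proof -
  obtain C r where C: "C \<ge> 0" "!!f. f \<in> tf X ==> supp f <= K ==> cmod (u f) <= C * sn K r f"
   using distributions_bound[OF u K] by blast
  obtain C' where C': "!!f. smooth_on UNIV f ==> sn K r (diff_op ?Q f) <= C' * sn K (r + deg ?Q) f"
   using sn_diff_op[OF K(1), of r ?Q] by blast
  have "cmod (ddo X P u f) <= (C * C') * sn K (r + deg ?Q) f" if f: "f \<in> tf X" "supp f <= K" for f
  proof -
   have "cmod (ddo X P u f) <= C * sn K r (diff_op ?Q f)"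
    unfolding ddo_eq[OF u f(1)] using supp_diff_op[of ?Q f] f(2) by (intro C(2) test_diff_op f(1)) blast
   also have "... <= C * (C' * sn K (r + deg ?Q) f)"
    by (intro mult_left_mono C' C(1) test_smooth[OF f(1)])
   finally show ?thesis by (simp add: mult.assoc)
  qed
  thus ?thesis by blast
 qed
 moreover have "ddo X P u (%x. f x + g x) = ddo X P u f + ddo X P u g" if "f \<in> tf X" "g \<in> tf X" for f g
 proof -
  have "diff_op ?Q (%x. f x + g x) = (%x. diff_op ?Q f x + diff_op ?Q g x)"
   by (rule ext, rule diff_op_add[OF open_UNIV test_smooth[OF that(1)] test_smooth[OF that(2)] UNIV_I])
  thus ?thesis
   using distributions_add[OF u test_diff_op[OF that(1)] test_diff_op[OF that(2)]] that by (simp add: ddo_eq[OF u] test_add)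
 qed
 moreover have "ddo X P u (%x. c * f x) = c * ddo X P u f" if "f \<in> tf X" for f c
 proof -
  have "diff_op ?Q (%x. c * f x) = (%x. c * diff_op ?Q f x)"
   by (rule ext, rule diff_op_cmult[OF open_UNIV test_smooth[OF that] UNIV_I])
  thus ?thesis
   using distributions_cmult[OF u test_diff_op[OF that]] that by (simp add: ddo_eq[OF u] test_cmult)
 qed
 ultimately show ?thesis unfolding distributions_def by (auto simp: dist_diff_op_def)
qed

section \<open>The reflected polynomial and the propagation of zeros along paths\<close>

lemma deg_reflect: "deg (rfl P) = deg P"
 by (simp add: mpoly_degree_def keys_mpoly_reflect)

lemma elliptic_on_reflect:
 assumes "subspace W" "elliptic_on P W"
 shows "elliptic_on (rfl P) W"
 unfolding elliptic_on_def
proof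
 fix z assume z: "z \<in> W - {0}"
 have "principal_part (rfl P) = rfl (principal_part P)"
  by (rule poly_mapping_eqI) (simp add: lookup_principal_part lookup_mpoly_reflect deg_reflect)
 thus "mpoly_eval (principal_part (rfl P)) z ~= 0"
  using assms z by (simp add: mpoly_eval_reflect elliptic_on_def subspace_neg)
qed

lemma acts_along_reflect:
 "subspace W ==> acts_along P W ==> acts_along (rfl P) W"
 unfolding acts_along_def mpoly_eval_reflect by (metis orth_proj_minus)

text \<open>The path is followed by tubes of fixed size, and \<open>uc_tube\<close> carries the
  zeros from one to the next, starting at the end point outside \<open>L\<close>. The margin
  \<open>m\<close> is chosen before \<open>u\<close>, so it serves all mollifications of a
  distribution.\<close>

lemma zero_propagation:
 fixes g :: "real => real ^ 'd::finite"
 assumes W: "subspace W" and act: "acts_along P W" and ell: "elliptic_on P W"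
  and g: "path g" "!!s t. s \<in> {0..1} ==> t \<in> {0..1} ==> g s - g t \<in> W"
  and K: "compact K" "path_image g \<inter> K = {}" and L: "compact L" "pathfinish g \<notin> L"
 obtains m where "m > 0" "!!u y. u \<in> tf UNIV ==> (!!y. (!!k. k \<in> K ==> m <= dist y k) ==> diff_op P u y = 0) ==>
   (!!y. (!!k. k \<in> L ==> m <= dist y k) ==> u y = 0) ==> dist (pathstart g) y < m ==> u y = 0"
proof -
 obtain th where th: "0 < th" "th <= 1 / 4"
  "!!u a R r q h x. u \<in> tf UNIV ==> 0 < R ==> R <= 1 ==> (!!x. x \<in> tube W a R q ==> diff_op P u x = 0) ==>
   0 < r ==> r <= R / 4 ==> (!!x. x \<in> tube W a r q ==> u x = 0) ==> h \<in> W ==> norm h <= th * R ==> x \<in> tube W a r q ==> u (h + x) = 0"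
  using uc_tube[OF W act ell] by blast
 obtain d1 where d1: "d1 > 0" "!!x k. x \<in> path_image g ==> k \<in> K ==> d1 <= dist x k"
  using separate_compact_closed[OF compact_path_image[OF g(1)] compact_imp_closed[OF K(1)] K(2)] by blast
 obtain d2 where d2: "d2 > 0" "!!k. k \<in> L ==> d2 <= dist (pathfinish g) k"
  using separate_point_closed[OF compact_imp_closed[OF L(1)] L(2)] by blast
 define d where "d = min 1 (min d1 d2)"
 have d: "d > 0" "d <= 1" "d <= d1" "d <= d2" using d1 d2 by (auto simp: d_def)
 \<comment> \<open>Small enough that the tubes of radii \<open>R\<close> and \<open>r\<close> around
   points of the path keep distance at least \<open>r\<close> from \<open>K\<close>, and the tube at
   the end point from \<open>L\<close>.\<close>
 define R where "R = d / 4"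
 define r where "r = R / 4"
 have R: "0 < R" "R <= 1" "0 < r" "r <= R / 4" "R + r < d / 2" "r + r < d / 2" "r <= d / 2" using d by (auto simp: R_def r_def)
 have tub: "dist a y < s + r" if "y \<in> tube W a s r" for a y s
  using that norm_triangle_ineq[of "orth_proj W (y - a)" "(y - a) - orth_proj W (y - a)"]
  by (simp add: tube_def[OF W act ell] dist_norm norm_minus_commute)
 have tub2: "y \<in> tube W a r r" if "dist a y < r" for a y
  using that norm_orth_proj[OF W, of "y - a"] norm_orth_compl[OF W, of "y - a"]
  by (simp add: tube_def[OF W act ell] dist_norm norm_minus_commute)
 have "uniformly_continuous_on {0..1} g"
  using g(1) by (intro compact_uniformly_continuous) (auto simp: path_def)
 then obtain de where de: "de > 0" "!!s t. s \<in> {0..1} ==> t \<in> {0..1} ==> dist t s < de ==> dist (g t) (g s) < th * R"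
  unfolding uniformly_continuous_on_def using mult_pos_pos[OF th(1) R(1)] by metis
 show ?thesis
 proof (rule that[OF R(3)])
  fix u y
  assume u: "u \<in> tf UNIV" and PK: "!!y. (!!k. k \<in> K ==> r <= dist y k) ==> diff_op P u y = 0"
   and uL: "!!y. (!!k. k \<in> L ==> r <= dist y k) ==> u y = 0" and y: "dist (pathstart g) y < r"
  \<comment> \<open>Induction on the number \<open>n\<close> of parameter steps of length
    \<open>de / 2\<close> back from the end of the path; by uniform continuity each moves the centre
    by less than \<open>th * R\<close>.\<close>
  have "\<forall>x\<in>tube W (g t) r r. u x = 0" if "t \<in> {0..1}" "1 - real n * (de / 2) <= t" for n t
   using that
  proof (induction n arbitrary: t)
   case 0
   hence t: "g t = pathfinish g" by (simp add: pathfinish_def)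
   show ?case
   proof
    fix x assume "x \<in> tube W (g t) r r"
    from tub[OF this] have x: "dist (pathfinish g) x < r + r" by (simp add: t)
    show "u x = 0"
    proof (rule uL)
     fix k assume "k \<in> L"
     thus "r <= dist x k" using d2(2)[of k] x R d dist_triangle[of "pathfinish g" k x] by linarith
    qed
   qed
  next
   case (Suc n)
   define s where "s = min 1 (t + de / 2)"
   have s: "s \<in> {0..1}" "1 - real n * (de / 2) <= s" "dist t s < de"
    using Suc.prems de(1) by (auto simp: s_def dist_real_def algebra_simps add_divide_distrib)
   have h: "g t - g s \<in> W" "norm (g t - g s) <= th * R"
    using g(2)[OF Suc.prems(1) s(1)] de(2)[OF s(1) Suc.prems(1) s(3)] by (auto simp: dist_norm)
   show ?case
   proof
    fix x assume x: "x \<in> tube W (g t) r r"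
    have "u ((g t - g s) + (x - (g t - g s))) = 0"
    proof (rule th(3)[OF u R(1,2) _ R(3,4) _ h])
     show "diff_op P u z = 0" if "z \<in> tube W (g s) R r" for z
     proof (rule PK)
      fix k assume "k \<in> K"
      moreover have "g s \<in> path_image g" using s(1) by (simp add: path_image_def)
      ultimately show "r <= dist z k"
       using d1(2)[of "g s" k] tub[OF that] R d dist_triangle[of "g s" k z] by linarith
     qed
     show "u z = 0" if "z \<in> tube W (g s) r r" for z using Suc.IH[OF s(1,2)] that by blast
     show "x - (g t - g s) \<in> tube W (g s) r r" using x by (simp add: tube_def[OF W act ell])
    qed
    thus "u x = 0" by simp
   qed
  qed
  note all = this
  obtain n where "1 / (de / 2) <= real n" using real_arch_simple by blast
  hence "1 - real n * (de / 2) <= 0" using de(1) by (simp add: pos_divide_le_eq)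
  hence "\<forall>x\<in>tube W (g 0) r r. u x = 0" by (intro all) auto
  thus "u y = 0" using tub2[of "g 0" y] y by (simp add: pathstart_def)
 qed
qed

text \<open>\<open>f\<close> is extended by zero to the whole space and mollified. On the
  mollifications zeros propagate to a ball of fixed radius around the start of the path; letting the
  scale tend to 0 shows that \<open>f\<close> vanishes there.\<close>

lemma support_avoids_path:
 assumes W: "subspace W" and act: "acts_along P W" and ell: "elliptic_on P W" and X: "open X"
  and f: "f \<in> cdist X" and K: "compact K" "dsupp X (ddo X (rfl P) f) <= K"
  and L: "compact L" "L <= X" "dsupp X f <= L"
  and g: "path g" "!!s t. s \<in> {0..1} ==> t \<in> {0..1} ==> g s - g t \<in> W" "path_image g \<inter> K = {}" "pathfinish g \<notin> L"
 shows "pathstart g \<notin> dsupp X f"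
proof
 let ?Q = "rfl P"
 define x where "x = pathstart g"
 assume "pathstart g \<in> dsupp X f"
 hence xs: "x \<in> dsupp X f" "x \<in> X" using dsupp_subset by (auto simp: x_def)
 have fX: "f \<in> distributions X" using f by (simp add: compact_distributions_def)
 obtain f' where f': "f' \<in> distributions UNIV" "!!p. p \<in> tf X ==> f' p = f p"
  "!!p. p \<in> tf UNIV ==> supp p \<inter> dsupp X f = {} ==> f' p = 0"
  using extend_distribution[OF X subset_UNIV f] by blast
 obtain h V where h: "h \<in> tf X" "open V" "L <= V" "V <= X" "!!x. x \<in> V ==> h x = 1"
  using cutoff_exists[OF L(1) X L(2)] by blast
 \<comment> \<open>\<open>p\<close> is split by the cutoff \<open>h\<close>: for \<open>p1\<close>,
   a test function on \<open>X\<close>, the hypothesis on the image of \<open>f\<close> applies, and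
   the rest stays away from the support of \<open>f\<close>.\<close>
 have key: "f' (diff_op P p) = 0" if p: "p \<in> tf UNIV" "supp p \<inter> K = {}" for p
 proof -
  define p1 where "p1 = (%x. p x * h x)"
  define q where "q = (%x. p x - p1 x)"
  have p1: "p1 \<in> tf X"
   unfolding p1_def by (rule test_mult[OF X smooth_on_subset[OF test_smooth[OF p(1)] subset_UNIV] h(1)])
  have q: "q \<in> tf UNIV" unfolding q_def by (rule test_diff[OF p(1) tf_UNIV[OF p1]])
  have "supp q <= - V" using h(2,5) by (intro supp_subset) (auto simp: q_def p1_def)
  hence "supp (diff_op P q) \<inter> dsupp X f = {}"
   using supp_diff_op[of P q] h(3) L(3) by blast
  hence 1: "f' (diff_op P q) = 0" by (intro f'(3) test_diff_op q)
  have "supp p1 <= supp p"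
   by (rule supp_subset[OF closed_fun_support]) (simp add: p1_def not_supp)
  hence "supp p1 \<inter> dsupp X (ddo X ?Q f) = {}" using p(2) K(2) by blast
  from dsupp_eq_0[OF ddo_distribution[OF fX] p1 this] have "f (diff_op P p1) = 0"
   unfolding ddo_eq[OF fX p1] by simp
  hence 2: "f' (diff_op P p1) = 0" using f'(2)[OF test_diff_op[OF p1]] by simp
  have "diff_op P p = (%x. diff_op P p1 x + diff_op P q x)"
  proof
   fix x
   have "diff_op P p x = diff_op P (%x. p1 x + q x) x" by (simp add: q_def)
   also have "... = diff_op P p1 x + diff_op P q x"
    by (rule diff_op_add[OF open_UNIV test_smooth[OF p1] test_smooth[OF q] UNIV_I])
   finally show "diff_op P p x = diff_op P p1 x + diff_op P q x" .
  qed
  hence "f' (diff_op P p) = f' (diff_op P p1) + f' (diff_op P q)"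
   using distributions_add[OF f'(1) test_diff_op[OF tf_UNIV[OF p1]] test_diff_op[OF q]] by simp
  thus ?thesis using 1 2 by simp
 qed
 define u where "u = (%e x. f' (%y. moll e (x - y)))"
 have msupp: "supp (%y. moll e (x - y)) <= cball x e" if "e > 0" for e and x :: "real ^ 'a"
  using test_reflect_translate(2)[OF moll_test[OF that], of x] moll_support[OF that]
   unfolding subset_iff mem_Collect_eq mem_cball dist_norm by (metis diff_0 norm_minus_cancel)
 have uL: "u e y = 0" if "e > 0" "!!k. k \<in> L ==> e < dist y k" for e y
  unfolding u_def
 proof (rule f'(3)[OF trans_test[OF moll_test[OF that(1)] UNIV_I]])
  show "supp (%y'. moll e (y - y')) \<inter> dsupp X f = {}"
   using msupp[OF that(1), of y] that(2) L(3) by fastforce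
 qed
 have u: "u e \<in> tf UNIV" if e: "e > 0" for e
 proof (rule test_funsI)
  show "smooth_on UNIV (u e)" unfolding u_def by (rule mollify_smooth(1)[OF f'(1) moll_test[OF e] open_UNIV UNIV_I])
  show "compact {x - y |x y. x \<in> L & y \<in> cball 0 e}" by (rule compact_difference_set[OF L(1) compact_cball])
  fix x assume x: "x \<notin> {x - y |x y. x \<in> L & y \<in> cball 0 e}"
  show "u e x = 0"
  proof (rule uL[OF e])
   fix k assume k: "k \<in> L"
   show "e < dist x k"
   proof (rule ccontr)
    assume "\<not> e < dist x k"
    hence "k - x \<in> cball 0 e" by (simp add: dist_norm norm_minus_commute)
    hence "x \<in> {x - y |x y. x \<in> L & y \<in> cball 0 e}" using k by (intro CollectI exI[of _ k] exI[of _ "k - x"]) simp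
    thus False using x by contradiction
   qed
  qed
 qed simp
 have uK: "diff_op ?Q (u e) y = 0" if "e > 0" "!!k. k \<in> K ==> e < dist y k" for e y
 proof -
  have "diff_op ?Q (u e) y = f' (diff_op P (%y'. moll e (y - y')))"
   unfolding u_def diff_op_mollify[OF f'(1) moll_test[OF that(1)] open_UNIV UNIV_I UNIV_I] by simp
  also have "... = 0"
   using msupp[OF that(1), of y] that(2)
   by (intro key trans_test[OF moll_test[OF that(1)] UNIV_I]) fastforce
  finally show ?thesis .
 qed
 obtain r where r: "r > 0" "!!u y. u \<in> tf UNIV ==> (!!y. (!!k. k \<in> K ==> r <= dist y k) ==> diff_op ?Q u y = 0) ==>
   (!!y. (!!k. k \<in> L ==> r <= dist y k) ==> u y = 0) ==> dist (pathstart g) y < r ==> u y = 0"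
  using zero_propagation[OF W acts_along_reflect[OF W act] elliptic_on_reflect[OF W ell] g(1) _ K(1) g(3) L(1) g(4)] g(2) by blast
 have u0: "u e y = 0" if "0 < e" "e < r" "dist x y < r" for e y
 proof (rule r(2)[OF u[OF that(1)]])
  show "diff_op ?Q (u e) y = 0" if "!!k. k \<in> K ==> r <= dist y k" for y
   using that \<open>0 < e\<close> \<open>e < r\<close> by (intro uK) force+
  show "u e y = 0" if "!!k. k \<in> L ==> r <= dist y k" for y
   using that \<open>0 < e\<close> \<open>e < r\<close> by (intro uL) force+
 qed (use that in \<open>simp add: x_def\<close>)
 have "vanishes f (ball x r \<inter> X)"
  unfolding vanishes_def
 proof
  fix p assume p: "p \<in> tf (ball x r \<inter> X)"
  have pU: "p \<in> tf UNIV" and pX: "p \<in> tf X" using p by (auto simp: tf_iff)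
  have "eventually (%e. (LI y. p y * u e y) = 0) (at_right 0)"
   using eventually_at_right_less[of 0] eventually_at_right_real[OF r(1)]
  proof eventually_elim
   case (elim e)
   have "p y * u e y = 0" for y
    using u0[of e y] elim p not_supp[of y p] by (cases "dist x y < r") (auto simp: tf_iff subset_iff)
   hence "(%y. p y * u e y) = (%y. 0)" by (rule ext)
   thus ?case by simp
  qed
  hence "((%e. LI y. p y * u e y) \<longlongrightarrow> 0) (at_right 0)" by (rule tendsto_eventually)
  moreover have "((%e. LI y. p y * u e y) \<longlongrightarrow> f' p) (at_right 0)"
   unfolding u_def by (rule mollify_tendsto[OF f'(1) open_UNIV pU])
  ultimately have "f' p = 0" by (intro tendsto_unique[OF trivial_limit_at_right_real])
  thus "f p = 0" using f'(2)[OF pX] by simp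
 qed
 hence "\<exists>U. open U & U <= X & vanishes f U & x \<in> U"
  using r(1) X xs(2) by (intro exI[of _ "ball x r \<inter> X"]) auto
 hence "x \<notin> dsupp X f" unfolding dsupp_vanishes by blast
 thus False using xs(1) by contradiction
qed

text \<open>With \<open>M\<close> given by the convexity of \<open>X\<close>, the set \<open>L\<close> consists of the points of \<open>M\<close> from which every path in \<open>x + W\<close> that leaves \<open>M\<close> meets \<open>K\<close>.\<close>

lemma support_hull:
 assumes W: "subspace W" and act: "acts_along P W" and ell: "elliptic_on P W"
  and X: "open X" and Y: "open Y" "Y <= X" and conv: "P_convex_for_supports P X"
  and comp: "\<not> (\<exists>x C. C \<in> components ((UNIV - Y) \<inter> (%w. x + w) ` W) & compact C & C <= X)"
  and K: "compact K" "K <= Y"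
 obtains L where "compact L" "L <= Y" "!!f. f \<in> cdist X ==>
  dsupp X (ddo X (rfl P) f) <= K ==> dsupp X f <= L"
proof -
 obtain M where M: "compact M" "M <= X" "!!f. f \<in> cdist X ==>
  dsupp X (ddo X (rfl P) f) <= K ==> dsupp X f <= M"
  using conv K Y unfolding P_convex_for_supports_def by (metis subset_trans)
 let ?T = "%x. (%w. x + w) ` W - K"
 define G where "G = {x. \<exists>y. y \<notin> M & path_component (?T x) x y}"
 \<comment> \<open>A path from \<open>x\<close> is translated as a whole by a small vector: it then
   lies in the parallel affine space, still avoids the compact \<open>K\<close> and still ends
   outside the compact \<open>M\<close>.\<close>
 have "open G"
 proof (rule openI)
  fix x assume "x \<in> G"
  then obtain g y where g: "path g" "path_image g <= ?T x" "pathstart g = x" "pathfinish g = y" "y \<notin> M"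
   unfolding G_def path_component_def by blast
  obtain d1 where d1: "d1 > 0" "!!z k. z \<in> path_image g ==> k \<in> K ==> d1 <= dist z k"
   using separate_compact_closed[OF compact_path_image[OF g(1)] compact_imp_closed[OF K(1)]] g(2) by blast
  obtain d2 where d2: "d2 > 0" "!!k. k \<in> M ==> d2 <= dist y k"
   using separate_point_closed[OF compact_imp_closed[OF M(1)] g(5)] by blast
  show "\<exists>e>0. ball x e <= G"
  proof (intro exI[of _ "min d1 d2"] conjI subsetI)
   fix x' assume x': "x' \<in> ball x (min d1 d2)"
   define v where "v = x' - x"
   have v: "norm v < d1" "norm v < d2" using x' by (auto simp: v_def dist_norm norm_minus_commute)
   have nv: "dist z (v + z) = norm v" for z by (simp add: dist_norm)
   have "y + v \<notin> M" using d2(2)[of "v + y"] v nv[of y] by (auto simp: add.commute)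
   moreover have "path_component (?T x') x' (y + v)"
    unfolding path_component_def
   proof (intro exI[of _ "(%z. v + z) \<circ> g"] conjI)
    show "path ((%z. v + z) \<circ> g)" using g(1) by (simp add: path_translation_eq)
    show "path_image ((%z. v + z) \<circ> g) <= ?T x'"
    proof
     fix z' assume "z' \<in> path_image ((%z. v + z) \<circ> g)"
     then obtain z where z: "z \<in> path_image g" "z' = v + z" by (auto simp: path_image_translation)
     then obtain w where "w \<in> W" "z = x + w" using g(2) by blast
     hence "z' \<in> (%w. x' + w) ` W" using z by (intro image_eqI[of _ _ w]) (auto simp: v_def)
     moreover have "z' \<notin> K" using d1(2)[OF z(1), of z'] v nv[of z] z(2) by auto
     ultimately show "z' \<in> ?T x'" by simp
    qed
   qed (use g in \<open>auto simp: pathstart_def pathfinish_def v_def\<close>)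
   ultimately show "x' \<in> G" unfolding G_def by blast
  qed (use d1 d2 in auto)
 qed
 define L where "L = M - G"
 have Lc: "compact L" unfolding L_def by (rule compact_diff[OF M(1) \<open>open G\<close>])
 have "L <= Y"
 proof (rule ccontr)
  \<comment> \<open>The component of the slice of the complement of \<open>Y\<close> through a point
    of \<open>L\<close> outside \<open>Y\<close> would be trapped in \<open>M\<close>, hence be a
    compact component inside \<open>X\<close>, which the hypothesis excludes.\<close>
  assume "\<not> L <= Y"
  then obtain x where x: "x \<in> M" "x \<notin> G" "x \<notin> Y" unfolding L_def by blast
  let ?A = "(%w. x + w) ` W"
  let ?S = "(UNIV - Y) \<inter> ?A"
  have xA: "x \<in> ?A" using subspace_0[OF W] by (intro image_eqI[of _ _ 0]) auto
  define C where "C = connected_component_set ?S x"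
  have CS: "C \<in> components ?S" unfolding C_def components_def using x(3) xA by blast
  have "closed ?S" using Y(1) closed_subspace[OF W] by (intro closed_Int closed_translation) (auto simp: Compl_eq_Diff_UNIV[symmetric])
  hence Ccl: "closed C" using CS closed_components by blast
  \<comment> \<open>A relatively open subset of an affine space is locally path connected, so its
    components are path components and the connected set \<open>C\<close> can be compared with
    \<open>G\<close>.\<close>
  have lp: "locally path_connected (?T x)"
  proof (rule locally_open_subset)
   show "locally path_connected ?A"
    by (intro convex_imp_locally_path_connected convex_translation subspace_imp_convex[OF W])
   show "openin (top_of_set ?A) (?T x)"
    using openin_open_Int[of "- K" ?A] compact_imp_closed[OF K(1)] by (simp add: Diff_eq open_Compl)
  qed
  have "C <= M"
  proof
   fix y assume "y \<in> C"
   hence "connected_component ?S x y" by (simp add: C_def)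
   hence "connected_component (?T x) x y" using K(2) by (auto elim!: connected_component_of_subset)
   hence "path_component (?T x) x y" using path_component_eq_connected_component[OF lp] by simp
   thus "y \<in> M" using x(2) unfolding G_def by blast
  qed
  hence "compact C" "C <= X" using Ccl M compact_Int_closed[OF M(1) Ccl] by (auto simp: inf_absorb2)
  thus False using comp CS by blast
 qed
 moreover have "dsupp X f <= L" if f: "f \<in> cdist X" "dsupp X (ddo X (rfl P) f) <= K" for f
 proof
  fix x assume x: "x \<in> dsupp X f"
  have "x \<notin> G"
  proof
   assume "x \<in> G"
   then obtain g y where g: "path g" "path_image g <= ?T x" "pathstart g = x" "pathfinish g = y" "y \<notin> M"
    unfolding G_def path_component_def by blast
   have "g s - g t \<in> W" if st: "s \<in> {0..1}" "t \<in> {0..1}" for s t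
   proof -
    have "g s \<in> (%w. x + w) ` W" "g t \<in> (%w. x + w) ` W"
     using subsetD[OF g(2), of "g s"] subsetD[OF g(2), of "g t"] st by (auto simp: path_image_def)
    thus ?thesis using subspace_diff[OF W] by auto
   qed
   hence "pathstart g \<notin> dsupp X f"
    using g by (intro support_avoids_path[OF W act ell X f(1) K(1) f(2) M(1,2) M(3)[OF f]]) auto
   thus False using x g(3) by simp
  qed
  thus "x \<in> L" using M(3)[OF f] x by (auto simp: L_def)
 qed
 ultimately show ?thesis using that Lc by blast
qed

section \<open>Convexity for supports of the smaller set\<close>

lemma compact_dist_supportI:
 assumes X: "open X" and C: "compact C" "C <= X" "dsupp X u <= C"
 shows "compact (dsupp X u)"
proof -
 have "open (\<Union>{U. open U & U <= X & (\<forall>f\<in>tf U. u f = 0)})" by (intro open_Union) auto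
 hence "compact (C - \<Union>{U. open U & U <= X & (\<forall>f\<in>tf U. u f = 0)})" by (rule compact_diff[OF C(1)])
 moreover have "C - \<Union>{U. open U & U <= X & (\<forall>f\<in>tf U. u f = 0)} = dsupp X u"
  using C(2,3) unfolding dist_support_def by blast
 ultimately show ?thesis by simp
qed

text \<open>Extension by zero from \<open>Y\<close> to \<open>X\<close> enlarges neither the support
  of \<open>f\<close> nor the bound \<open>K\<close> for that of its image, so the hull for
  distributions on \<open>X\<close> also confines those on \<open>Y\<close>.\<close>

lemma P_convex_subset:
 assumes X: "open X" and Y: "open Y" "Y <= X"
  and hull: "!!K. compact K ==> K <= Y ==> \<exists>L. compact L & L <= Y & (\<forall>f\<in>cdist X.
   dsupp X (ddo X (rfl P) f) <= K --> dsupp X f <= L)"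
 shows "P_convex_for_supports P Y"
 unfolding P_convex_for_supports_def
proof (intro allI impI)
 let ?Q = "rfl P"
 fix K assume K: "compact K & K <= Y"
 then obtain L where L: "compact L" "L <= Y" "!!f. f \<in> cdist X ==>
   dsupp X (ddo X ?Q f) <= K ==> dsupp X f <= L"
  using hull[of K] by metis
 have "dsupp Y f <= L" if f: "f \<in> cdist Y" "dsupp Y (ddo Y ?Q f) <= K" for f
 proof -
  have fY: "f \<in> distributions Y" "compact (dsupp Y f)" using f(1) by (auto simp: compact_distributions_def)
  obtain g where g: "g \<in> distributions X" "!!h. h \<in> tf Y ==> g h = f h"
   "!!h. h \<in> tf X ==> supp h \<inter> dsupp Y f = {} ==> g h = 0"
   using extend_distribution[OF Y f(1)] by blast
  let ?V = "X - dsupp Y f"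
  have V: "open ?V" using X fY(2) by (intro open_Diff compact_imp_closed)
  have gV: "g h = 0" if "h \<in> tf ?V" for h
   using that by (intro g(3)) (auto simp: tf_iff)
  have sub: "dsupp X g <= dsupp Y f"
   by (rule dsupp_subsetI) (use V gV in \<open>auto simp: vanishes_def intro!: exI[of _ ?V]\<close>)
  have gc: "g \<in> cdist X"
   unfolding compact_distributions_def
   using g(1) compact_dist_supportI[OF X fY(2) _ sub] dsupp_subset[of Y f] Y(2) by blast
  have "dsupp X (ddo X ?Q g) <= K"
  proof (rule dsupp_subsetI)
   fix x assume x: "x \<in> X" "x \<notin> K"
   show "\<exists>U. open U & x \<in> U & U <= X & vanishes (ddo X ?Q g) U"
   \<comment> \<open>Off the support of \<open>f\<close> the extension vanishes; on the support the
     point lies in \<open>Y\<close>, where \<open>g\<close> agrees with \<open>f\<close> on test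
     functions.\<close>
   proof (cases "x \<in> dsupp Y f")
    case False
    have "ddo X ?Q g h = 0" if "h \<in> tf ?V" for h
    proof -
     have "h \<in> tf X" using that by (rule tf_mono) blast
     thus ?thesis unfolding ddo_eq[OF g(1) \<open>h \<in> tf X\<close>] by (simp add: gV test_diff_op that)
    qed
    thus ?thesis using V x False by (intro exI[of _ ?V]) (auto simp: vanishes_def)
   next
    case True
    hence xY: "x \<in> Y" using dsupp_subset[of Y f] by blast
    obtain U where U: "open U" "x \<in> U" "U <= Y" "vanishes (ddo Y ?Q f) U"
     using not_in_dist_support[OF xY] f(2) x(2) by blast
    have "ddo X ?Q g h = 0" if h: "h \<in> tf U" for h
    proof -
     have hY: "h \<in> tf Y" and hX: "h \<in> tf X" using h U(3) Y(2) by (auto simp: tf_iff)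
     have "ddo X ?Q g h = f (diff_op P h)"
      unfolding ddo_eq[OF g(1) hX] using g(2)[OF test_diff_op[OF hY]] by simp
     also have "... = ddo Y ?Q f h" unfolding ddo_eq[OF fY(1) hY] by simp
     also have "... = 0" using U(4) h by (simp add: vanishes_def)
     finally show ?thesis .
    qed
    thus ?thesis using U Y(2) by (intro exI[of _ U]) (auto simp: vanishes_def)
   qed
  qed
  from L(3)[OF gc this] have gL: "dsupp X g <= L" .
  show ?thesis
  proof (rule dsupp_subsetI)
   fix x assume x: "x \<in> Y" "x \<notin> L"
   then obtain U where U: "open U" "x \<in> U" "U <= X" "vanishes g U"
    using not_in_dist_support[of x X g] gL Y(2) by blast
   have "f h = 0" if "h \<in> tf (U \<inter> Y)" for h
   proof -
    have "h \<in> tf U" "h \<in> tf Y" using that by (auto simp: tf_iff)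
    thus ?thesis using g(2)[of h] U(4) by (simp add: vanishes_def)
   qed
   thus "\<exists>U. open U & x \<in> U & U <= Y & vanishes f U"
    using U(1,2) x(1) Y(1) by (intro exI[of _ "U \<inter> Y"]) (auto simp: vanishes_def)
  qed
 qed
 thus "\<exists>L. compact L & L <= Y & (\<forall>f\<in>cdist Y. dsupp Y (ddo Y ?Q f) <= K --> dsupp Y f <= L)"
  using L(1,2) by blast
qed

section \<open>Square integrable functions\<close>

text \<open>Functions, not classes modulo null sets: limits are determined up to null sets only, and
  pointwise conclusions are drawn for continuous functions through
  \<open>L2_zero_imp_zero\<close>.\<close>

definition L2 :: "(real ^ 'd::finite => complex) set"
 where "L2 = {f. f \<in> borel_measurable borel & integrable lborel (%x. (cmod (f x))\<^sup>2)}"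

definition nrm2 :: "(real ^ 'd::finite => complex) => real"
 where "nrm2 f = (LI x. (cmod (f x))\<^sup>2)"

definition inn :: "(real ^ 'd::finite => complex) => (real ^ 'd => complex) => complex"
 where "inn f g = (LI x. f x * cnj (g x))"

lemma L2_measurable: "f \<in> L2 ==> f \<in> borel_measurable borel"
 and L2_integrable: "f \<in> L2 ==> integrable lborel (%x. (cmod (f x))\<^sup>2)"
 by (auto simp: L2_def)

lemma nrm2_nonneg [simp]: "0 <= nrm2 f"
 by (simp add: nrm2_def)

lemma test_L2: "f \<in> tf X ==> f \<in> L2"
 unfolding L2_def using test_continuous test_L2_integrable by (auto intro: cont_bm)

lemma L2_prod_integrable:
 assumes f: "f \<in> L2" and g: "g \<in> L2"
 shows "integrable lborel (%x. cmod (f x) * cmod (g x))" "integrable lborel (%x. f x * g x)"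
proof -
 have m [measurable]: "f \<in> borel_measurable borel" "g \<in> borel_measurable borel" using f g by (auto simp: L2_def)
 have i: "integrable lborel (%x. (cmod (f x))\<^sup>2 + (cmod (g x))\<^sup>2)"
  using f g by (auto simp: L2_def)
 have "cmod (f x) * cmod (g x) <= (cmod (f x))\<^sup>2 + (cmod (g x))\<^sup>2" for x
  using sum_squares_bound[of "cmod (f x)" "cmod (g x)"] mult_nonneg_nonneg[OF norm_ge_zero norm_ge_zero, of "f x" "g x"]
  by linarith
 thus "integrable lborel (%x. cmod (f x) * cmod (g x))" "integrable lborel (%x. f x * g x)"
  by (auto intro!: Bochner_Integration.integrable_bound[OF i] simp: norm_mult)
qed

lemma L2_cnj: "f \<in> L2 ==> (%x. cnj (f x)) \<in> L2"
 using measurable_compose[OF _ cont_bm[OF continuous_on_cnj[OF continuous_on_id]], of f borel]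
 by (auto simp: L2_def)

lemma L2_cmult: "f \<in> L2 ==> (%x. c * f x) \<in> L2"
 by (auto simp: L2_def norm_mult power_mult_distrib)

lemma L2_add:
 assumes f: "f \<in> L2" and g: "g \<in> L2"
 shows "(%x. f x + g x) \<in> L2"
proof -
 have m [measurable]: "f \<in> borel_measurable borel" "g \<in> borel_measurable borel" using f g by (auto simp: L2_def)
 have i: "integrable lborel (%x. 2 * (cmod (f x))\<^sup>2 + 2 * (cmod (g x))\<^sup>2)"
  using f g by (auto simp: L2_def)
 have "(cmod (f x + g x))\<^sup>2 <= 2 * (cmod (f x))\<^sup>2 + 2 * (cmod (g x))\<^sup>2" for x
  using power_mono[OF norm_triangle_ineq[of "f x" "g x"] norm_ge_zero, of 2] sum_squares_bound[of "cmod (f x)" "cmod (g x)"]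
  by (simp add: power2_sum)
 hence "integrable lborel (%x. (cmod (f x + g x))\<^sup>2)"
  by (intro Bochner_Integration.integrable_bound[OF i]) auto
 thus ?thesis by (simp add: L2_def)
qed

lemma L2_diff: "f \<in> L2 ==> g \<in> L2 ==> (%x. f x - g x) \<in> L2"
 using L2_add[of f "%x. - 1 * g x"] L2_cmult[of g "- 1"] by simp

lemma L2_indicator:
 assumes "f \<in> L2" "closed S"
 shows "(%x. indicator S x *\<^sub>R f x) \<in> L2"
proof -
 have m [measurable]: "f \<in> borel_measurable borel" "S \<in> sets borel" using assms by (auto simp: L2_def)
 have "integrable lborel (%x. (cmod (indicator S x *\<^sub>R f x))\<^sup>2)"
  by (rule Bochner_Integration.integrable_bound[OF L2_integrable[OF assms(1)]]) (auto simp: indicator_def)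
 thus ?thesis by (simp add: L2_def)
qed

context
 fixes f g :: "real ^ 'd::finite => complex"
 assumes f: "f \<in> L2" and g: "g \<in> L2"
begin

lemma inn_integrable: "integrable lborel (%x. f x * cnj (g x))"
 by (rule L2_prod_integrable(2)[OF f L2_cnj[OF g]])

lemma nrm2_add: "nrm2 (%x. f x + g x) = nrm2 f + 2 * Re (inn f g) + nrm2 g"
proof -
 define B where "B x = Re (f x * cnj (g x))" for x
 have B: "integrable lborel B" "(LI x. B x) = Re (inn f g)"
  unfolding B_def[abs_def] inn_def by (rule integrable_Re[OF inn_integrable], rule integral_Re[OF inn_integrable])
 have "(cmod (f x + g x))\<^sup>2 = (cmod (f x))\<^sup>2 + 2 * B x + (cmod (g x))\<^sup>2" for x
  unfolding cmod_power2 B_def by (simp add: power2_eq_square algebra_simps)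
 thus ?thesis
  unfolding nrm2_def B(2)[symmetric] using L2_integrable[OF f] L2_integrable[OF g] B(1) by simp
qed

text \<open>Nonnegativity of a quadratic polynomial in \<open>t\<close>. The moduli stand inside the
  integral because \<open>L2_complete\<close> requires L1 bounds.\<close>

lemma Cauchy_Schwarz_abs: "(LI x. cmod (f x) * cmod (g x))\<^sup>2 <= nrm2 f * nrm2 g"
proof -
 let ?I = "LI x. cmod (f x) * cmod (g x)"
 have q: "0 <= nrm2 f + 2 * t * ?I + t\<^sup>2 * nrm2 g" for t
 proof -
  have "0 <= (LI x. (cmod (f x) + t * cmod (g x))\<^sup>2)" by (rule Bochner_Integration.integral_nonneg) simp
  also have "... = (LI x. (cmod (f x))\<^sup>2 + 2 * t * (cmod (f x) * cmod (g x)) + t\<^sup>2 * (cmod (g x))\<^sup>2)"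
   by (simp add: power2_sum power_mult_distrib mult_ac add_ac)
  also have "... = nrm2 f + 2 * t * ?I + t\<^sup>2 * nrm2 g"
   unfolding nrm2_def using L2_integrable[OF f] L2_integrable[OF g] L2_prod_integrable(1)[OF f g] by simp
  finally show ?thesis .
 qed
 show ?thesis
 proof (cases "nrm2 g = 0")
  case True
  have "?I = 0"
  proof (rule ccontr)
   assume "?I ~= 0"
   thus False using q[of "- (nrm2 f + 1) / (2 * ?I)"] True by (simp add: field_simps)
  qed
  thus ?thesis by (simp add: mult_nonneg_nonneg)
 next
  case False
  hence g0: "nrm2 g > 0" using nrm2_nonneg[of g] by linarith
  hence "0 <= nrm2 f - ?I\<^sup>2 / nrm2 g"
   using q[of "- ?I / nrm2 g"] by (simp add: power2_eq_square field_simps)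
  thus ?thesis using g0 by (simp add: field_simps)
 qed
qed

lemma Cauchy_Schwarz: "(cmod (inn f g))\<^sup>2 <= nrm2 f * nrm2 g"
proof -
 have "cmod (inn f g) <= (LI x. cmod (f x) * cmod (g x))"
  unfolding inn_def using integral_norm_bound[of lborel "%x. f x * cnj (g x)"] by (simp add: norm_mult)
 hence "(cmod (inn f g))\<^sup>2 <= (LI x. cmod (f x) * cmod (g x))\<^sup>2" by (intro power_mono) auto
 thus ?thesis using Cauchy_Schwarz_abs by linarith
qed

end

lemma nrm2_cmult: "nrm2 (%x. c * f x) = (cmod c)\<^sup>2 * nrm2 f"
 by (simp add: nrm2_def norm_mult power_mult_distrib)

lemma inn_cmult: "inn (%x. c * f x) g = c * inn f g" "inn f (%x. c * g x) = cnj c * inn f g"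
 by (simp_all add: inn_def mult_ac)

lemma inn_add: "f \<in> L2 ==> g \<in> L2 ==> h \<in> L2 ==> inn (%x. f x + g x) h = inn f h + inn g h"
 using inn_integrable[of f h] inn_integrable[of g h] by (simp add: inn_def distrib_right)

lemma inn_diff: "f \<in> L2 ==> g \<in> L2 ==> h \<in> L2 ==> inn (%x. f x - g x) h = inn f h - inn g h"
 using inn_integrable[of f h] inn_integrable[of g h] by (simp add: inn_def left_diff_distrib)

lemma inn_commute: "inn g f = cnj (inn f g)"
 by (simp add: inn_def mult.commute flip: Bochner_Integration.integral_cnj)

lemma inn_self: "inn f f = cr (nrm2 f)"
 unfolding inn_def nrm2_def by (subst integral_complex_of_real[symmetric]) (simp only: complex_norm_square)

lemma nrm2_diff: "f \<in> L2 ==> g \<in> L2 ==> nrm2 (%x. f x - g x) = nrm2 f - 2 * Re (inn f g) + nrm2 g"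
 using nrm2_add[of f "%x. - 1 * g x", OF _ L2_cmult[of g "- 1"]] unfolding inn_cmult nrm2_cmult by simp

lemma nrm2_add_le: "f \<in> L2 ==> g \<in> L2 ==> nrm2 (%x. f x + g x) <= 2 * nrm2 f + 2 * nrm2 g"
 using nrm2_add[of f g] nrm2_diff[of f g] nrm2_nonneg[of "%x. f x - g x"] by linarith

text \<open>Multiplication by the square root of \<open>gauss\<close>, an L2 function without zeros,
  turns L2 Cauchy sequences into L1 Cauchy sequences, which have subsequences converging almost
  everywhere. Fatou's lemma then gives L2 convergence to that limit.\<close>

lemma L2_complete:
 fixes f :: "nat => real ^ 'd::finite => complex"
 assumes f: "!!n. f n \<in> L2" and C: "!!ep. ep > 0 ==> \<exists>N. \<forall>m\<ge>N. \<forall>n\<ge>N. nrm2 (%x. f m x - f n x) < ep"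
 obtains g where "g \<in> L2" "(%n. nrm2 (%x. f n x - g x)) \<longlonglongrightarrow> 0"
proof -
 have fm [measurable]: "f n \<in> borel_measurable borel" for n using f[of n] by (rule L2_measurable)
 define w :: "real ^ 'd => complex" where "w x = cr (sqrt (gauss x))" for x
 have w2: "(cmod (w x))\<^sup>2 = gauss x" for x using gauss_pos[of x] by (simp add: w_def)
 have "w \<in> borel_measurable borel" unfolding w_def[abs_def] by measurable
 hence wL: "w \<in> L2" unfolding L2_def mem_Collect_eq w2 using gauss_integrable by simp
 have w1: "nrm2 w = 1" unfolding nrm2_def w2 by (rule gauss_integral)
 have "\<exists>N. \<forall>i\<ge>N. \<forall>j\<ge>N. (LI x. norm (f i x * w x - f j x * w x)) < e" if e: "e > 0" for e
 proof -
  obtain N where N: "\<forall>m\<ge>N. \<forall>n\<ge>N. nrm2 (%x. f m x - f n x) < e\<^sup>2" using C[OF zero_less_power[OF e, of 2]] by blast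
  have "(LI x. norm (f i x * w x - f j x * w x)) < e" if "i \<ge> N" "j \<ge> N" for i j
  proof -
   have "(LI x. norm (f i x * w x - f j x * w x))\<^sup>2 <= nrm2 (%x. f i x - f j x) * nrm2 w"
    using Cauchy_Schwarz_abs[OF L2_diff[OF f[of i] f[of j]] wL] by (simp add: norm_mult[symmetric] left_diff_distrib)
   also have "... < e\<^sup>2" using N that w1 by simp
   finally show ?thesis using \<open>e > 0\<close> by (simp add: power_less_imp_less_base)
  qed
  thus ?thesis by blast
 qed
 then obtain r where r: "strict_mono r" "AE x in lborel. Cauchy (%i. f (r i) x * w x)"
  using cauchy_L1_AE_cauchy_subseq[of lborel "%n x. f n x * w x"] L2_prod_integrable(2)[OF f wL] by blast
 have w0: "w x ~= 0" for x using gauss_pos[of x] by (simp add: w_def)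
 have cv: "AE x in lborel. convergent (%i. f (r i) x)"
  using r(2)
 proof eventually_elim
  case (elim x)
  hence "convergent (%i. f (r i) x * w x * (1 / w x))"
   by (rule convergent_mult[OF _ convergent_const, OF Cauchy_convergent])
  moreover have "f (r i) x * w x * (1 / w x) = f (r i) x" for i using w0[of x] by simp
  ultimately show ?case by (simp only:)
 qed
 define g where "g x = lim (%i. f (r i) x)" for x
 have gm [measurable]: "g \<in> borel_measurable borel" unfolding g_def[abs_def] by measurable
 have gl: "AE x in lborel. (%i. f (r i) x) \<longlonglongrightarrow> g x"
  using cv by eventually_elim (simp add: g_def convergent_LIMSEQ_iff)
 have est: "integrable lborel (%x. (cmod (f m x - g x))\<^sup>2) & nrm2 (%x. f m x - g x) <= ep"
  if "ep > 0" "\<forall>n\<ge>m. nrm2 (%x. f m x - f n x) < ep" for m ep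
 proof -
  have "(\<integral>\<^sup>+x. ennreal ((cmod (f m x - g x))\<^sup>2) \<partial>lborel) = (\<integral>\<^sup>+x. liminf (%i. ennreal ((cmod (f m x - f (r i) x))\<^sup>2)) \<partial>lborel)"
  proof (rule nn_integral_cong_AE, use gl in eventually_elim)
   case (elim x)
   have "(%i. ennreal ((cmod (f m x - f (r i) x))\<^sup>2)) \<longlonglongrightarrow> ennreal ((cmod (f m x - g x))\<^sup>2)"
    by (intro tendsto_intros elim)
   from lim_imp_Liminf[OF trivial_limit_sequentially this] show ?case by (rule sym)
  qed
  also have "... <= liminf (%i. \<integral>\<^sup>+x. ennreal ((cmod (f m x - f (r i) x))\<^sup>2) \<partial>lborel)"
   by (rule nn_integral_liminf) measurable
  also have "... <= ennreal ep"
  proof (rule Liminf_le)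
   show "eventually (%i. (\<integral>\<^sup>+x. ennreal ((cmod (f m x - f (r i) x))\<^sup>2) \<partial>lborel) <= ennreal ep) sequentially"
   proof (rule eventually_sequentiallyI)
    fix i assume "m <= i"
    hence "r i \<ge> m" using seq_suble[OF r(1), of i] by simp
    hence "nrm2 (%x. f m x - f (r i) x) <= ep" using that(2) less_imp_le by blast
    thus "(\<integral>\<^sup>+x. ennreal ((cmod (f m x - f (r i) x))\<^sup>2) \<partial>lborel) <= ennreal ep"
     unfolding nrm2_def using L2_integrable[OF L2_diff[OF f[of m] f[of "r i"]]]
     by (subst nn_integral_eq_integral) (auto intro: ennreal_leI)
   qed
  qed simp
  finally have le: "(\<integral>\<^sup>+x. ennreal ((cmod (f m x - g x))\<^sup>2) \<partial>lborel) <= ennreal ep" .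
  hence i: "integrable lborel (%x. (cmod (f m x - g x))\<^sup>2)"
   by (intro integrableI_nonneg) (auto simp: less_top[symmetric] top_unique)
  moreover have "ennreal (nrm2 (%x. f m x - g x)) <= ennreal ep"
   using le unfolding nrm2_def by (subst (asm) nn_integral_eq_integral[OF i]) auto
  ultimately show ?thesis using that(1) by simp
 qed
 obtain N where N: "\<forall>m\<ge>N. \<forall>n\<ge>N. nrm2 (%x. f m x - f n x) < 1" using C[of 1] by auto
 have "integrable lborel (%x. (cmod (f N x - g x))\<^sup>2)" using est[of 1 N] N by auto
 hence "(%x. f N x - g x) \<in> L2" by (simp add: L2_def)
 from L2_diff[OF f[of N] this] have "g \<in> L2" by simp
 moreover have "(%n. nrm2 (%x. f n x - g x)) \<longlonglongrightarrow> 0"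
 proof (rule LIMSEQ_I)
  fix e :: real assume e: "e > 0"
  obtain N where N: "\<forall>m\<ge>N. \<forall>n\<ge>N. nrm2 (%x. f m x - f n x) < e / 2" using C[of "e / 2"] e by auto
  have "norm (nrm2 (%x. f n x - g x) - 0) < e" if "n \<ge> N" for n
  proof -
   have "\<forall>k\<ge>n. nrm2 (%x. f n x - f k x) < e / 2" using N that by (meson le_trans)
   hence "nrm2 (%x. f n x - g x) <= e / 2" using est[of "e / 2" n] e by simp
   thus ?thesis using e by simp
  qed
  thus "\<exists>N. \<forall>n\<ge>N. norm (nrm2 (%x. f n x - g x) - 0) < e" by blast
 qed
 ultimately show ?thesis by (rule that)
qed

lemma inn_tendsto:
 assumes f: "!!n. f n \<in> L2" and g: "g \<in> L2" and h: "h \<in> L2" and l: "(%n. nrm2 (%x. f n x - g x)) \<longlonglongrightarrow> 0"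
 shows "(%n. inn (f n) h) \<longlonglongrightarrow> inn g h"
proof (rule LIM_zero_cancel)
 define q where "q n = nrm2 (%x. f n x - g x)" for n
 have "(%n. sqrt (q n * nrm2 h)) \<longlonglongrightarrow> sqrt (0 * nrm2 h)"
  using l unfolding q_def[symmetric] by (intro tendsto_real_sqrt tendsto_mult_right)
 hence q: "(%n. sqrt (q n * nrm2 h)) \<longlonglongrightarrow> 0" by simp
 have "norm (inn (f n) h - inn g h) <= sqrt (q n * nrm2 h)" for n
  unfolding inn_diff[OF f g h, symmetric] q_def
  by (rule real_le_rsqrt[OF Cauchy_Schwarz[OF L2_diff[OF f g] h]])
 thus "(%n. inn (f n) h - inn g h) \<longlonglongrightarrow> 0" by (rule Lim_null_comparison[OF always_eventually[OF allI] q])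
qed

text \<open>A form of the projection theorem. The residuals \<open>y\<close> of a minimising
  sequence converge to some \<open>q\<close> orthogonal to \<open>A\<close>; by \<open>sep\<close>
  it is orthogonal to \<open>a\<close> as well, hence to every residual and to itself, so the
  residuals tend to zero.\<close>

lemma L2_separation:
 fixes A :: "(real ^ 'd::finite => complex) set"
 assumes A: "A <= L2" "A ~= {}" "!!f g. f \<in> A ==> g \<in> A ==> (%x. f x + g x) \<in> A" "!!c f. f \<in> A ==> (%x. c * f x) \<in> A"
  and a: "a \<in> L2" and sep: "!!q. q \<in> L2 ==> (!!f. f \<in> A ==> inn f q = 0) ==> inn a q = 0" and e: "e > 0"
 obtains f where "f \<in> A" "nrm2 (%x. a x - f x) < e"
proof -
 define d where "d = (INF f\<in>A. nrm2 (%x. a x - f x))"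
 have bb: "bdd_below ((%f. nrm2 (%x. a x - f x)) ` A)" by (intro bdd_belowI[of _ 0]) auto
 have d: "d <= nrm2 (%x. a x - f x)" if "f \<in> A" for f unfolding d_def by (rule cINF_lower[OF bb that])
 have "\<exists>f\<in>A. nrm2 (%x. a x - f x) < d + 1 / real (Suc n)" for n
  using cINF_less_iff[OF A(2) bb, of "d + 1 / real (Suc n)"] by (simp add: d_def)
 then obtain u where u: "!!n. u n \<in> A" "!!n. nrm2 (%x. a x - u n x) < d + 1 / real (Suc n)" by metis
 have uL: "u n \<in> L2" for n using u(1) A(1) by blast
 define y where "y n = (%x. a x - u n x)" for n
 have yL: "y n \<in> L2" for n unfolding y_def by (rule L2_diff[OF a uL])
 \<comment> \<open>Parallelogram law: the midpoint of two elements of \<open>A\<close> cannot beat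
   the infimum \<open>d\<close>.\<close>
 have par: "nrm2 (%x. y m x - y n x) <= 2 / real (Suc m) + 2 / real (Suc n)" for m n
 proof -
  have "(%x. (1 / 2) * (u m x + u n x)) \<in> A" by (intro A(3,4) u)
  from d[OF this] have "d <= nrm2 (%x. (1 / 2) * (y m x + y n x))"
   by (simp add: y_def field_simps)
  also have "... = (1 / 4) * nrm2 (%x. y m x + y n x)" by (subst nrm2_cmult) (simp add: power2_eq_square)
  finally have "4 * d <= nrm2 (%x. y m x + y n x)" by simp
  thus ?thesis
   using nrm2_add[OF yL yL, of m n] nrm2_diff[OF yL yL, of m n] u(2)[of m] u(2)[of n] by (simp add: y_def)
 qed
 have inv0: "(%n. 1 / real (Suc n)) \<longlonglongrightarrow> 0" using lim_inverse_n' LIMSEQ_Suc by blast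
 have "\<exists>N. \<forall>m\<ge>N. \<forall>n\<ge>N. nrm2 (%x. y m x - y n x) < ep" if ep: "ep > 0" for ep
 proof -
  obtain N where N: "1 / real (Suc N) < ep / 4" using nat_approx_posE[of "ep / 4"] ep by auto
  have "nrm2 (%x. y m x - y n x) < ep" if "m \<ge> N" "n \<ge> N" for m n
  proof -
   have "1 / real (Suc m) <= 1 / real (Suc N)" "1 / real (Suc n) <= 1 / real (Suc N)" using that by (auto intro!: divide_left_mono)
   thus ?thesis using par[of m n] N by simp
  qed
  thus ?thesis by blast
 qed
 then obtain q where q: "q \<in> L2" "(%n. nrm2 (%x. y n x - q x)) \<longlonglongrightarrow> 0"
  using L2_complete[of y, OF yL] by blast
 have orth: "inn f q = 0" if f: "f \<in> A" for f
 proof -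
  have fL: "f \<in> L2" using f A(1) by blast
  \<comment> \<open>Variation of \<open>u n\<close> in the direction \<open>f\<close> with
    coefficient \<open>inn (y n) f / (nrm2 f + 1)\<close>; the 1 keeps the denominator positive when
    \<open>f\<close> has norm zero.\<close>
  have le: "(cmod (inn (y n) f))\<^sup>2 <= (nrm2 f + 1) * (1 / real (Suc n))" for n
  proof -
   let ?s = "1 / (nrm2 f + 1)" and ?I = "inn (y n) f"
   define c where "c = cr ?s * ?I"
   have f1: "0 < nrm2 f + 1" using nrm2_nonneg[of f] by linarith
   have s: "0 < ?s" "?s * nrm2 f <= 1" using f1 by (auto simp: pos_divide_le_eq)
   have "(%x. u n x + c * f x) \<in> A" by (intro A(3,4) u f)
   from d[OF this] have "d <= nrm2 (%x. y n x - c * f x)" by (simp add: y_def diff_diff_add)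
   also have "... = nrm2 (y n) - 2 * Re (cnj c * ?I) + (cmod c)\<^sup>2 * nrm2 f"
    unfolding nrm2_diff[OF yL L2_cmult[OF fL]] inn_cmult nrm2_cmult ..
   also have "Re (cnj c * ?I) = ?s * (cmod ?I)\<^sup>2"
    unfolding c_def cmod_power2 by (simp add: power2_eq_square algebra_simps add_divide_distrib)
   also have "(cmod c)\<^sup>2 = ?s * ?s * (cmod ?I)\<^sup>2" unfolding c_def norm_mult norm_of_real using s(1) by (simp only: power_mult_distrib power2_eq_square abs_of_pos mult_ac)
   also have "?s * ?s * (cmod ?I)\<^sup>2 * nrm2 f = (?s * (cmod ?I)\<^sup>2) * (?s * nrm2 f)" by simp
   also have "... <= (?s * (cmod ?I)\<^sup>2) * 1" using s by (intro mult_left_mono) auto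
   finally have "?s * (cmod ?I)\<^sup>2 <= 1 / real (Suc n)" using u(2)[of n] by (simp add: y_def)
   thus ?thesis using nrm2_nonneg[of f] by (simp add: field_simps add_pos_nonneg)
  qed
  have "(%n. (cmod (inn (y n) f))\<^sup>2) \<longlonglongrightarrow> 0"
  proof (rule Lim_null_comparison)
   show "(%n. (nrm2 f + 1) * (1 / real (Suc n))) \<longlonglongrightarrow> 0" using tendsto_mult_left[OF inv0, of "nrm2 f + 1"] by simp
   show "eventually (%n. norm ((cmod (inn (y n) f))\<^sup>2) <= (nrm2 f + 1) * (1 / real (Suc n))) sequentially"
    using le by (intro always_eventually allI) (simp only: real_norm_def abs_power2)
  qed
  moreover have "(%n. (cmod (inn (y n) f))\<^sup>2) \<longlonglongrightarrow> (cmod (inn q f))\<^sup>2" by (intro tendsto_intros inn_tendsto yL q fL)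
  ultimately have "(cmod (inn q f))\<^sup>2 = 0" by (rule LIMSEQ_unique[symmetric])
  thus ?thesis by (subst inn_commute) simp
 qed
 have "inn (y n) q = 0" for n
  unfolding y_def using inn_diff[OF a uL q(1)] orth[OF u(1)] sep[OF q(1) orth] by simp
 moreover have "(%n. inn (y n) q) \<longlonglongrightarrow> inn q q" by (intro inn_tendsto yL q)
 ultimately have "nrm2 q = 0" using LIMSEQ_unique[OF tendsto_const, of 0 "inn q q"] by (simp add: inn_self)
 hence yq: "nrm2 (y n) <= 2 * nrm2 (%x. y n x - q x)" for n
  using nrm2_add_le[OF L2_diff[OF yL q(1)] q(1), of n] by simp
 have "eventually (%n. nrm2 (%x. y n x - q x) < e / 2) sequentially"
  using q(2) e by (intro order_tendstoD) auto
 then obtain n where n: "nrm2 (%x. y n x - q x) < e / 2" by (auto simp: eventually_sequentially)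
 have "nrm2 (y n) < e" using yq[of n] n by simp
 thus ?thesis using that[OF u(1), of n] by (simp add: y_def)
qed

section \<open>The coercivity estimate\<close>

text \<open>Constant coefficient operators as formal sums of products of directional derivatives.\<close>

definition opL :: "(complex \<times> (real ^ 'd::finite) list) list => (real ^ 'd => complex) => real ^ 'd => complex"
 where "opL T f x = (\<Sum>(c, vs)\<leftarrow>T. c * DL vs f x)"

fun dels :: "'a list => ('a \<times> 'a list) list" where
 "dels [] = []"
| "dels (v # vs) = (v, vs) # map (%(u, us). (u, v # us)) (dels vs)"

text \<open>The commutator of the operator with multiplication by \<open>x \<mapsto> w \<bullet> x\<close>.\<close>

definition ad :: "real ^ 'd::finite => (complex \<times> (real ^ 'd) list) list => (complex \<times> (real ^ 'd) list) list"
 where "ad w T = concat (map (%(c, vs). map (%(v, us). (c * cr (w \<bullet> v), us)) (dels vs)) T)"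

text \<open>The formal adjoint for \<open>inn\<close>. The lists are not reversed because
  derivatives of smooth functions commute.\<close>

definition adj :: "(complex \<times> (real ^ 'd::finite) list) list => (complex \<times> (real ^ 'd) list) list"
 where "adj T = map (%(c, vs). (cnj c * (-1) ^ length vs, vs)) T"

lemma opL_simps: "opL [] f = (%x. 0)" "opL ((c, vs) # T) f = (%x. c * DL vs f x + opL T f x)"
 "opL (S @ T) f = (%x. opL S f x + opL T f x)"
 by (auto simp: opL_def)

lemma adj_adj: "adj (adj T) = T"
 by (auto simp: adj_def comp_def case_prod_unfold power_mult_distrib[symmetric] intro!: map_idI)

lemma opL_smooth: "smooth_on UNIV f ==> smooth_on UNIV (opL T f)"
 by (induction T) (auto simp: opL_simps intro!: smooth_on_const smooth_on_add smooth_on_cmult smooth_on_DL)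

lemma opL_test: "f \<in> tf X ==> opL T f \<in> tf X"
 by (induction T) (auto simp: opL_simps intro!: test_add test_cmult test_DL)

lemma opL_support: "x \<notin> supp f ==> opL T f x = 0"
 by (induction T) (auto simp: opL_simps DL_outside_support)

lemma opL_add: "smooth_on UNIV f ==> smooth_on UNIV g ==> opL T (%x. f x + g x) = (%x. opL T f x + opL T g x)"
 by (induction T) (auto simp: opL_simps DL_add[OF open_UNIV] distrib_left)

lemma opL_cmult: "smooth_on UNIV f ==> opL T (%x. c * f x) = (%x. c * opL T f x)"
 by (induction T) (auto simp: opL_simps DL_cmult[OF open_UNIV] algebra_simps)

lemma opL_0: "opL T (%x. 0) = (%x. 0)"
 by (induction T) (auto simp: opL_simps DL_0[OF open_UNIV])

lemma opL_DL_commute: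
 assumes f: "smooth_on UNIV f"
 shows "opL T (DL ws f) = DL ws (opL T f)"
proof (induction T)
 case Nil
 show ?case by (rule ext) (simp add: opL_simps DL_0[OF open_UNIV])
next
 case (Cons a T)
 obtain c vs where a: "a = (c, vs)" by force
 have "DL vs (DL ws f) x = DL ws (DL vs f) x" for x
  using DL_perm[OF open_UNIV _ f UNIV_I, of "vs @ ws" "ws @ vs"] by (simp add: DL_append)
 thus ?case
  using f by (intro ext) (simp add: a opL_simps Cons DL_add[OF open_UNIV smooth_on_cmult[OF open_UNIV smooth_on_DL[OF open_UNIV f]] opL_smooth[OF f]]
   DL_cmult[OF open_UNIV smooth_on_DL[OF open_UNIV f]])
qed

lemma opL_commute:
 assumes f: "smooth_on UNIV f"
 shows "opL S (opL T f) = opL T (opL S f)"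
proof (induction T)
 case Nil
 show ?case by (simp add: opL_simps opL_0)
next
 case (Cons a T)
 obtain c vs where a: "a = (c, vs)" by force
 note sm = smooth_on_DL[OF open_UNIV f]
 show ?case
  unfolding a opL_simps opL_add[OF smooth_on_cmult[OF open_UNIV sm] opL_smooth[OF f]] opL_cmult[OF sm] opL_DL_commute[OF f] Cons ..
qed

lemma dd_sum_list:
 assumes "!!i. i \<in> set xs ==> smooth_on UNIV (f i)"
 shows "dd v (%x. \<Sum>i\<leftarrow>xs. f i x) x = (\<Sum>i\<leftarrow>xs. dd v (f i) x)" "smooth_on UNIV (%x. \<Sum>i\<leftarrow>xs. f i x)"
 using assms by (induction xs) (auto simp: dd_add[OF open_UNIV] dd_const[OF open_UNIV] intro!: smooth_on_const smooth_on_add)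

abbreviation lin :: "real ^ 'd::finite => (real ^ 'd => complex) => real ^ 'd => complex"
 where "lin w f \<equiv> %x. cr (w \<bullet> x) * f x"

lemma lin_smooth: "smooth_on UNIV f ==> smooth_on UNIV (lin w f)"
 using smooth_on_mult[OF open_UNIV smooth_on_affine[of UNIV w 0]] by simp

lemma DL_lin:
 assumes f: "smooth_on UNIV f"
 shows "DL vs (lin w f) = (%x. cr (w \<bullet> x) * DL vs f x + (\<Sum>(v, us)\<leftarrow>dels vs. cr (w \<bullet> v) * DL us f x))"
proof (induction vs)
 case (Cons v vs)
 let ?g = "%p x. cr (w \<bullet> fst p) * DL (snd p) f x"
 note s = smooth_on_DL[OF open_UNIV f]
 have g: "smooth_on UNIV (?g p)" for p by (intro smooth_on_cmult open_UNIV s)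
 have "dd v (lin w (DL vs f)) x = cr (w \<bullet> v) * DL vs f x + cr (w \<bullet> x) * dd v (DL vs f) x" for x
  using dd_mult[OF open_UNIV smooth_on_affine[of UNIV w 0] s UNIV_I, of v vs x] dd_affine[OF open_UNIV, of v w 0 x] by simp
 moreover have "dd v (?g p) x = cr (w \<bullet> fst p) * dd v (DL (snd p) f) x" for p x
  by (rule dd_cmult[OF open_UNIV s UNIV_I])
 moreover have "dd v (%x. \<Sum>p\<leftarrow>dels vs. ?g p x) x = (\<Sum>p\<leftarrow>dels vs. dd v (?g p) x)" for x by (rule dd_sum_list(1)) (rule g)
 moreover have sl: "smooth_on UNIV (%x. \<Sum>p\<leftarrow>dels vs. ?g p x)" by (rule dd_sum_list(2)) (rule g)
 ultimately have "dd v (%x. cr (w \<bullet> x) * DL vs f x + (\<Sum>p\<leftarrow>dels vs. ?g p x)) x =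
   cr (w \<bullet> x) * dd v (DL vs f) x + cr (w \<bullet> v) * DL vs f x + (\<Sum>p\<leftarrow>dels vs. cr (w \<bullet> fst p) * dd v (DL (snd p) f) x)" for x
  unfolding dd_add[OF open_UNIV lin_smooth[OF s] sl UNIV_I] by simp
 thus ?case
  by (simp add: Cons case_prod_unfold comp_def add.assoc)
qed simp

lemma opL_lin:
 assumes f: "smooth_on UNIV f"
 shows "opL T (lin w f) = (%x. cr (w \<bullet> x) * opL T f x + opL (ad w T) f x)"
proof (induction T)
 case (Cons a T)
 obtain c vs where a: "a = (c, vs)" by force
 have "opL (map (%(v, us). (c * cr (w \<bullet> v), us)) xs) f x = c * (\<Sum>(v, us)\<leftarrow>xs. cr (w \<bullet> v) * DL us f x)" for xs x
  by (induction xs) (auto simp: opL_simps algebra_simps)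
 hence "opL (ad w (a # T)) f x = c * (\<Sum>(v, us)\<leftarrow>dels vs. cr (w \<bullet> v) * DL us f x) + opL (ad w T) f x" for x
  by (simp add: a ad_def opL_simps)
 thus ?case
  unfolding opL_simps(2)[of c vs T, folded a] Cons DL_lin[OF f] by (intro ext) (simp add: algebra_simps)
qed (simp add: opL_simps ad_def)

lemma length_dels: "(v, us) \<in> set (dels vs) ==> length vs = Suc (length us)"
 by (induction vs arbitrary: us) auto

text \<open>A commutator removes one derivative and with it one of the signs of the adjoint.\<close>

lemma opL_ad_adj: "opL (ad w (adj T)) f x = - opL (adj (ad w T)) f x"
proof (induction T)
 case (Cons a T)
 obtain c vs where a: "a = (c, vs)" by force
 have *: "opL (map (%(v, us). (cnj c * (- 1) ^ length vs * cr (w \<bullet> v), us)) xs) f x =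
   - opL (adj (map (%(v, us). (c * cr (w \<bullet> v), us)) xs)) f x" if "set xs <= set (dels vs)" for xs
  using that
 proof (induction xs)
  case (Cons p xs)
  obtain v us where p: "p = (v, us)" by force
  have "length vs = Suc (length us)" using Cons.prems length_dels[of v us vs] by (simp add: p)
  thus ?case using Cons by (simp add: p opL_simps adj_def)
 qed (simp add: opL_simps adj_def)
 show ?case using *[OF order_refl] Cons by (simp add: a adj_def ad_def opL_simps)
qed (simp add: opL_simps adj_def ad_def)

lemma inn_add_right: "f \<in> L2 ==> g \<in> L2 ==> h \<in> L2 ==> inn h (%x. f x + g x) = inn h f + inn h g"
 using inn_add[of f g h] inn_commute[of h] by (metis complex_cnj_add)

lemma inn_DL:
 assumes f: "f \<in> tf UNIV" and g: "g \<in> tf UNIV"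
 shows "inn (DL vs f) g = (-1) ^ length vs * inn f (DL vs g)"
 unfolding inn_def integral_by_parts[OF open_UNIV test_smooth[OF f] test_cnj[OF g]]
 by (simp only: DL_cnj[OF open_UNIV test_smooth[OF g] UNIV_I])

lemma inn_adj:
 assumes f: "f \<in> tf UNIV" and g: "g \<in> tf UNIV"
 shows "inn (opL T f) g = inn f (opL (adj T) g)"
proof (induction T)
 case Nil
 show ?case by (simp add: opL_simps adj_def inn_def)
next
 case (Cons a T)
 obtain c vs where a: "a = (c, vs)" by force
 note L = test_L2[OF f] test_L2[OF g] test_L2[OF test_DL[OF f]] test_L2[OF test_DL[OF g]] test_L2[OF opL_test[OF f]] test_L2[OF opL_test[OF g]]
 have "inn (opL (a # T) f) g = c * inn (DL vs f) g + inn (opL T f) g"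
  unfolding a opL_simps by (simp add: inn_add L L2_cmult inn_cmult)
 also have "... = inn f (opL (adj (a # T)) g)"
  unfolding Cons inn_DL[OF f g] by (simp add: a adj_def opL_simps inn_add_right L L2_cmult inn_cmult)
 finally show ?case .
qed

text \<open>Constant coefficient operators commute with their adjoints, and a normal operator and
  its adjoint have equal norms on every vector.\<close>

lemma nrm2_adj:
 assumes f: "f \<in> tf UNIV"
 shows "nrm2 (opL (adj T) f) = nrm2 (opL T f)"
proof -
 have "inn (opL (adj T) f) (opL (adj T) f) = inn f (opL T (opL (adj T) f))"
  using inn_adj[OF f opL_test[OF f], of "adj T"] by (simp add: adj_adj)
 also have "... = inn f (opL (adj T) (opL T f))" by (simp only: opL_commute[OF test_smooth[OF f]])
 also have "... = inn (opL T f) (opL T f)" by (rule inn_adj[OF f opL_test[OF f], symmetric])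
 finally show ?thesis unfolding inn_self by simp
qed

abbreviation nrm :: "(real ^ 'd::finite => complex) => real" where "nrm f \<equiv> sqrt (nrm2 f)"

lemma Cauchy_Schwarz_nrm: "f \<in> L2 ==> g \<in> L2 ==> cmod (inn f g) <= nrm f * nrm g"
 unfolding real_sqrt_mult[symmetric] by (intro real_le_rsqrt Cauchy_Schwarz)

lemma nrm_lin_le:
 assumes f: "f \<in> tf UNIV" and b: "!!x. x \<in> supp f ==> \<bar>w \<bullet> x\<bar> <= b" "0 <= b"
 shows "lin w f \<in> tf UNIV" "nrm (lin w f) <= b * nrm f"
proof -
 show t: "lin w f \<in> tf UNIV"
  using test_mult_left[OF smooth_on_affine[of UNIV w 0] f] by simp
 have "nrm2 (lin w f) <= nrm2 (%x. cr b * f x)"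
  unfolding nrm2_def
 proof (rule lint_mono)
  fix x
  show "(cmod (cr (w \<bullet> x) * f x))\<^sup>2 <= (cmod (cr b * f x))\<^sup>2"
   using b not_supp[of x f] by (cases "x \<in> supp f") (auto simp: norm_mult intro!: power_mono mult_right_mono)
 qed (intro L2_integrable L2_cmult test_L2[OF f] test_L2[OF t])+
 also have "... = (b * nrm f)\<^sup>2" using nrm2_nonneg[of f] by (simp add: nrm2_cmult power_mult_distrib)
 finally show "nrm (lin w f) <= b * nrm f"
  using b(2) by (intro real_le_lsqrt) (auto intro: mult_nonneg_nonneg)
qed

text \<open>
 Hoermander's commutator argument for \<open>Tf\<close>, \<open>[T, w \<bullet> x]f\<close> and \<open>[[T, w \<bullet> x], w \<bullet> x]f\<close>. It uses that
 \<open>T\<close> is normal, having constant coefficients.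
\<close>

lemma commutator_estimate:
 assumes f: "f \<in> tf UNIV" and b: "!!x. x \<in> supp f ==> \<bar>w \<bullet> x\<bar> <= b" "0 <= b"
 shows "(nrm (opL (ad w T) f))\<^sup>2 <= nrm (opL T f) * (2 * b * nrm (opL (ad w T) f) + nrm (opL (ad w (ad w T)) f))"
proof -
 let ?T1 = "ad w T" and ?T2 = "ad w (ad w T)"
 note s = test_smooth[OF f]
 have sup: "\<bar>w \<bullet> x\<bar> <= b" if "x \<in> supp (opL S f)" for S x
  using supp_subset[OF closed_fun_support, of f "opL S f"] opL_support[of _ f S] that b(1) by blast
 note lin = nrm_lin_le[OF opL_test[OF f] sup b(2)]
 have linf: "lin w f \<in> tf UNIV" by (rule nrm_lin_le(1)[OF f b])
 note L = test_L2[OF opL_test[OF f]] test_L2[OF lin(1)] test_L2[OF opL_test[OF linf]]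
 have e1: "opL ?T1 f = (%x. opL T (lin w f) x - lin w (opL T f) x)"
  by (rule ext) (simp add: opL_lin[OF s])
 \<comment> \<open>One of the two commutators is written out, and adjoints are moved until each term
   contains \<open>opL T f\<close> or \<open>opL (adj T) f\<close>, whose norms agree by
   \<open>nrm2_adj\<close>.\<close>
 have "inn (opL ?T1 f) (opL ?T1 f) = inn (opL T (lin w f)) (opL ?T1 f) - inn (lin w (opL T f)) (opL ?T1 f)"
  by (subst e1) (rule inn_diff[OF L(3) L(2) L(1)])
 also have "inn (opL T (lin w f)) (opL ?T1 f) = inn (lin w f) (opL (adj T) (opL ?T1 f))"
  by (rule inn_adj[OF linf opL_test[OF f]])
 also have "... = inn (lin w f) (opL (adj (adj ?T1)) (opL (adj T) f))"
  unfolding adj_adj opL_commute[OF s, of "adj T"] ..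
 also have "... = inn (opL (adj ?T1) (lin w f)) (opL (adj T) f)"
  by (rule inn_adj[OF linf opL_test[OF f], symmetric])
 also have "opL (adj ?T1) (lin w f) = (%x. lin w (opL (adj ?T1) f) x - opL (adj ?T2) f x)"
  by (rule ext) (simp add: opL_lin[OF s] opL_ad_adj)
 also have "inn ... (opL (adj T) f) = inn (lin w (opL (adj ?T1) f)) (opL (adj T) f) - inn (opL (adj ?T2) f) (opL (adj T) f)"
  by (rule inn_diff[OF L(2) L(1) L(1)])
 finally have eq: "cr (nrm2 (opL ?T1 f)) = inn (lin w (opL (adj ?T1) f)) (opL (adj T) f) -
   inn (opL (adj ?T2) f) (opL (adj T) f) - inn (lin w (opL T f)) (opL ?T1 f)"
  unfolding inn_self .
 have "cmod (inn (lin w (opL (adj ?T1) f)) (opL (adj T) f)) <= nrm (lin w (opL (adj ?T1) f)) * nrm (opL (adj T) f)"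
  by (rule Cauchy_Schwarz_nrm[OF L(2) L(1)])
 also have "... <= (b * nrm (opL (adj ?T1) f)) * nrm (opL (adj T) f)" by (intro mult_right_mono lin(2)) auto
 finally have 1: "cmod (inn (lin w (opL (adj ?T1) f)) (opL (adj T) f)) <= b * nrm (opL ?T1 f) * nrm (opL T f)"
  unfolding nrm2_adj[OF f] .
 have "cmod (inn (lin w (opL T f)) (opL ?T1 f)) <= nrm (lin w (opL T f)) * nrm (opL ?T1 f)"
  by (rule Cauchy_Schwarz_nrm[OF L(2) L(1)])
 also have "... <= (b * nrm (opL T f)) * nrm (opL ?T1 f)" by (intro mult_right_mono lin(2)) auto
 finally have 2: "cmod (inn (lin w (opL T f)) (opL ?T1 f)) <= b * nrm (opL T f) * nrm (opL ?T1 f)" .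
 have 3: "cmod (inn (opL (adj ?T2) f) (opL (adj T) f)) <= nrm (opL ?T2 f) * nrm (opL T f)"
  using Cauchy_Schwarz_nrm[OF L(1) L(1), of "adj ?T2" "adj T"] unfolding nrm2_adj[OF f] .
 have "(nrm (opL ?T1 f))\<^sup>2 = cmod (cr (nrm2 (opL ?T1 f)))" by simp
 also have "... <= cmod (inn (lin w (opL (adj ?T1) f)) (opL (adj T) f)) + cmod (inn (opL (adj ?T2) f) (opL (adj T) f)) + cmod (inn (lin w (opL T f)) (opL ?T1 f))"
  unfolding eq by (intro order_trans[OF norm_triangle_ineq4] add_right_mono order_refl norm_triangle_ineq4)
 also have "... <= b * nrm (opL ?T1 f) * nrm (opL T f) + nrm (opL ?T2 f) * nrm (opL T f) + b * nrm (opL T f) * nrm (opL ?T1 f)"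
  using 1 2 3 by linarith
 finally show ?thesis by (simp add: algebra_simps)
qed

text \<open>The degree \<open>k\<close> part of the polynomial that arises when the derivative along
  \<open>v\<close> is replaced by the number \<open>w \<bullet> v\<close>.\<close>

definition lead :: "real ^ 'd::finite => nat => (complex \<times> (real ^ 'd) list) list => complex"
 where "lead w k T = (\<Sum>(c, vs)\<leftarrow>T. if length vs = k then c * (\<Prod>v\<leftarrow>vs. cr (w \<bullet> v)) else 0)"

lemma prod_dels: "(\<Sum>(v, us)\<leftarrow>dels vs. h v * (\<Prod>u\<leftarrow>us. h u)) = of_nat (length vs) * (\<Prod>v\<leftarrow>vs. h v)" for h :: "'a => complex"
proof (induction vs)
 case (Cons a vs)
 have "(\<Sum>p\<leftarrow>dels vs. h (fst p) * (h a * (\<Prod>u\<leftarrow>snd p. h u))) = h a * (\<Sum>p\<leftarrow>dels vs. h (fst p) * (\<Prod>u\<leftarrow>snd p. h u))"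
  by (simp add: sum_list_const_mult[symmetric] mult_ac)
 thus ?case using Cons by (simp add: case_prod_unfold comp_def algebra_simps)
qed simp

lemma lead_ad: "lead w k (ad w T) = of_nat (Suc k) * lead w (Suc k) T"
proof (induction T)
 case (Cons a T)
 obtain c vs where a: "a = (c, vs)" by force
 have *: "lead w k (map (%(v, us). (c * cr (w \<bullet> v), us)) xs) =
   (if length vs = Suc k then c * (\<Sum>(v, us)\<leftarrow>xs. cr (w \<bullet> v) * (\<Prod>u\<leftarrow>us. cr (w \<bullet> u))) else 0)"
  if "set xs <= set (dels vs)" for xs
  using that
 proof (induction xs)
  case (Cons p xs)
  obtain v us where p: "p = (v, us)" by force
  have "length vs = Suc (length us)" using Cons.prems length_dels[of v us vs] by (simp add: p)
  thus ?case using Cons by (auto simp: p lead_def algebra_simps)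
 qed (simp add: lead_def)
 have "lead w k (ad w (a # T)) = lead w k (map (%(v, us). (c * cr (w \<bullet> v), us)) (dels vs)) + lead w k (ad w T)"
  by (simp add: a ad_def lead_def)
 also have "lead w k (map (%(v, us). (c * cr (w \<bullet> v), us)) (dels vs)) =
   of_nat (Suc k) * (if length vs = Suc k then c * (\<Prod>v\<leftarrow>vs. cr (w \<bullet> v)) else 0)"
  unfolding *[OF order_refl] prod_dels by (simp add: mult_ac)
 finally show ?case unfolding Cons by (simp add: a lead_def distrib_left)
qed (simp add: lead_def ad_def)

text \<open>A commutator acts on the symbol as differentiation in direction \<open>w\<close>; by
  Euler's identity, \<open>k\<close> of them applied to the part of degree \<open>k\<close> produce
  the factor \<open>fact k\<close>.\<close>

lemma lead_ad_pow: "lead w 0 ((ad w ^^ k) T) = fact k * lead w k T"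
proof -
 have "lead w j ((ad w ^^ k) T) * fact j = fact (j + k) * lead w (j + k) T" for j
 proof (induction k arbitrary: j)
  case (Suc k)
  have "lead w j ((ad w ^^ Suc k) T) * fact j = lead w (Suc j) ((ad w ^^ k) T) * fact (Suc j)"
   by (simp add: lead_ad algebra_simps)
  thus ?case using Suc[of "Suc j"] by (simp add: mult.assoc)
 qed simp
 from this[of 0] show ?thesis by simp
qed

lemma ad_length: "(c, us) \<in> set (ad w T) ==> \<exists>c' vs. (c', vs) \<in> set T & length vs = Suc (length us)"
 unfolding ad_def using length_dels by fastforce

lemma ad_pow_length: "(c, us) \<in> set ((ad w ^^ k) T) ==> \<exists>c' vs. (c', vs) \<in> set T & length vs = k + length us"
proof (induction k arbitrary: c us)
 case (Suc k)
 then obtain c' vs where "(c', vs) \<in> set ((ad w ^^ k) T)" "length vs = Suc (length us)" using ad_length[of c us w "(ad w ^^ k) T"] by auto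
 with Suc.IH[of c' vs] show ?case by auto
qed auto

lemma opL_length_0:
 assumes "!!c vs. (c, vs) \<in> set T ==> vs = []"
 shows "opL T f x = lead w 0 T * f x"
 using assms
proof (induction T)
 case (Cons a T)
 obtain c where "a = (c, [])" using Cons.prems by (cases a) auto
 moreover have "opL T f x = lead w 0 T * f x" using Cons.prems by (intro Cons.IH) auto
 ultimately show ?case by (simp add: opL_simps lead_def distrib_right)
qed (simp add: opL_simps lead_def)

text \<open>After \<open>deg P\<close> commutators with \<open>w \<bullet> x\<close> only a constant
  is left, of modulus \<open>fact (deg P)\<close> times that of the principal part at
  \<open>w\<close>. Chaining \<open>commutator_estimate\<close> over the orders bounds it in terms
  of \<open>P(D) g\<close>.\<close>

lemma coercive:
 assumes w: "mpoly_eval (principal_part P) w ~= 0" and C: "compact C"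
 obtains c where "c > 0" "!!g. g \<in> tf UNIV ==> supp g <= C ==> nrm2 g <= c * nrm2 (diff_op P g)"
proof -
 let ?m = "deg P"
 obtain b where b: "!!x. x \<in> C ==> norm x <= b" using compact_imp_bounded[OF C] unfolding bounded_iff by blast
 define be where "be = norm w * \<bar>b\<bar>"
 have be: "\<bar>w \<bullet> x\<bar> <= be" if "x \<in> C" for x
  unfolding be_def using b[OF that] by (intro order_trans[OF Cauchy_Schwarz_ineq2] mult_left_mono) auto
 have be0: "0 <= be" by (simp add: be_def)
 obtain ks where ks: "set ks = keys P" "distinct ks" using finite_distinct_list[OF finite_keys[of P]] by metis
 define T where "T = map (%al. (coef P al * (- \<i>) ^ mi_size al, mvecs al)) ks"
 have TP: "opL T f = diff_op P f" for f
  by (rule ext) (simp add: opL_def diff_op_DL T_def comp_def sum_list_distinct_conv_sum_set[OF ks(2)] ks(1))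
 have leadT: "lead w ?m T = (- \<i>) ^ ?m * mpoly_eval (principal_part P) w"
 proof -
  have pm: "(\<Prod>v\<leftarrow>mvecs al. cr (w \<bullet> v)) = (\<Prod>j\<in>UNIV. cr (w \<bullet> ax j) ^ (al $ j))" for al
   by (rule prod_mvecs)
  have "lead w ?m T = (\<Sum>al\<in>keys P. if mi_size al = ?m then coef P al * (- \<i>) ^ mi_size al * (\<Prod>j\<in>UNIV. cr (w \<bullet> ax j) ^ (al $ j)) else 0)"
   by (simp add: lead_def T_def comp_def sum_list_distinct_conv_sum_set[OF ks(2)] ks(1) length_mvecs pm cong: if_cong)
  also have "... = (- \<i>) ^ ?m * mpoly_eval (principal_part P) w"
   unfolding mpoly_eval_superset[OF finite_keys keys_principal_part] sum_distrib_left
   by (intro sum.cong refl) (simp add: lookup_principal_part inner_axis)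
  finally show ?thesis .
 qed
 have len: "length vs <= ?m" if "(c, vs) \<in> set T" for c vs
  using that deg_ge by (auto simp: T_def ks length_mvecs)
 define ka where "ka = fact ?m * cmod (mpoly_eval (principal_part P) w)"
 define B where "B = (2 * be) ^ ?m * fact ?m"
 have ka: "ka > 0" using w by (simp add: ka_def)
 have est: "ka * nrm g <= B * nrm (diff_op P g)" if g: "g \<in> tf UNIV" "supp g <= C" for g
 proof -
  define a where "a k = nrm (opL ((ad w ^^ k) T) g)" for k
  have a0: "a k \<ge> 0" for k by (simp add: a_def)
  have rec: "(a (Suc k))\<^sup>2 <= a k * (2 * be * a (Suc k) + a (Suc (Suc k)))" for k
   using commutator_estimate[OF g(1) be be0, of "(ad w ^^ k) T"] g(2) unfolding a_def by auto
  have aS: "a (Suc ?m) = 0"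
  proof -
   have "(ad w ^^ Suc ?m) T = []"
   proof (rule ccontr)
    assume "(ad w ^^ Suc ?m) T ~= []"
    then obtain c us where "(c, us) \<in> set ((ad w ^^ Suc ?m) T)" by (metis list.set_intros(1) neq_Nil_conv surj_pair)
    from ad_pow_length[OF this] len show False by fastforce
   qed
   thus ?thesis by (simp add: a_def opL_simps nrm2_def)
  qed
  have am: "a ?m = ka * nrm g"
  proof -
   have "opL ((ad w ^^ ?m) T) g = (%x. lead w 0 ((ad w ^^ ?m) T) * g x)"
   proof (intro ext opL_length_0)
    fix c vs assume "(c, vs) \<in> set ((ad w ^^ ?m) T)"
    from ad_pow_length[OF this] len show "vs = []" by fastforce
   qed
   thus ?thesis
    unfolding a_def lead_ad_pow leadT by (simp add: nrm2_cmult norm_mult norm_power real_sqrt_mult ka_def)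
  qed
  \<comment> \<open>Induction downwards from the top order, where the next commutator is zero by
    \<open>aS\<close>; every level adds \<open>2 * be\<close> to the constant, giving
    \<open>2 * be * (deg P - k)\<close>.\<close>
  have step: "a (Suc k) <= 2 * be * real (Suc j) * a k" if "k + Suc j = ?m" for j k
   using that
  proof (induction j arbitrary: k)
   case 0
   hence "(a (Suc k))\<^sup>2 <= a k * (2 * be * a (Suc k))" using rec[of k] aS by simp
   hence "a (Suc k) * a (Suc k) <= (2 * be * a k) * a (Suc k)" by (simp add: power2_eq_square mult_ac)
   thus ?case using a0[of k] a0[of "Suc k"] be0 by (cases "a (Suc k) = 0") (auto simp: mult_le_cancel_right)
  next
   case (Suc j)
   hence "a (Suc (Suc k)) <= 2 * be * real (Suc j) * a (Suc k)" by simp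
   hence "a k * (2 * be * a (Suc k) + a (Suc (Suc k))) <= a k * (2 * be * a (Suc k) + 2 * be * real (Suc j) * a (Suc k))"
    using a0 by (intro mult_left_mono add_left_mono) auto
   also have "... = (2 * be * real (Suc (Suc j)) * a k) * a (Suc k)" by (simp add: algebra_simps)
   finally have "a (Suc k) * a (Suc k) <= (2 * be * real (Suc (Suc j)) * a k) * a (Suc k)"
    using rec[of k] by (simp add: power2_eq_square)
   thus ?case using a0[of k] a0[of "Suc k"] be0 by (cases "a (Suc k) = 0") (auto simp: mult_le_cancel_right)
  qed
  have "a ?m <= (2 * be) ^ j * fact j * a (?m - j)" if "j <= ?m" for j
   using that
  proof (induction j)
   case (Suc j)
   have "a (?m - j) <= 2 * be * real (Suc j) * a (?m - Suc j)" using step[of "?m - Suc j" j] Suc.prems by (simp add: Suc_diff_Suc)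
   hence "(2 * be) ^ j * fact j * a (?m - j) <= (2 * be) ^ j * fact j * (2 * be * real (Suc j) * a (?m - Suc j))"
    using be0 by (intro mult_left_mono) auto
   also have "... = (2 * be) ^ Suc j * fact (Suc j) * a (?m - Suc j)" by (simp add: algebra_simps)
   finally show ?case using Suc by linarith
  qed simp
  from this[of ?m] show ?thesis using am by (simp add: a_def TP B_def)
 qed
 show ?thesis
 proof (rule that[of "(B / ka)\<^sup>2 + 1"])
  fix g assume g: "g \<in> tf UNIV" "supp g <= C"
  have "nrm g <= (B / ka) * nrm (diff_op P g)" using est[OF g] ka by (simp add: field_simps)
  hence "(nrm g)\<^sup>2 <= ((B / ka) * nrm (diff_op P g))\<^sup>2" by (intro power_mono) auto
  hence "nrm2 g <= (B / ka)\<^sup>2 * nrm2 (diff_op P g)" unfolding power_mult_distrib by simp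
  also have "... <= ((B / ka)\<^sup>2 + 1) * nrm2 (diff_op P g)" by (intro mult_right_mono) auto
  finally show "nrm2 g <= ((B / ka)\<^sup>2 + 1) * nrm2 (diff_op P g)" .
 qed (simp add: add_nonneg_pos)
qed

section \<open>Approximation by solutions\<close>

lemma L2_loc_int:
 assumes f: "f \<in> L2"
 shows "loc_int X f"
 unfolding loc_int_def
proof (intro allI impI)
 fix K :: "(real ^ 'a) set" assume K: "compact K & K <= X"
 have "(%x. indicator K x *\<^sub>R (1 :: complex)) \<in> L2"
 proof -
  have "integrable lborel (%x. indicator K x *\<^sub>R (1 :: real))" using K by (intro borel_integrable_compact continuous_on_const) auto
  moreover have "(cmod (indicator K x *\<^sub>R 1))\<^sup>2 = indicator K x *\<^sub>R (1 :: real)" for x by (simp add: indicator_def)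
  moreover have "K \<in> sets borel" using K by (simp add: compact_imp_closed borel_closed)
  ultimately show ?thesis by (simp add: L2_def)
 qed
 moreover have "(%x. f x * (indicator K x *\<^sub>R 1)) = (%x. indicator K x *\<^sub>R f x)" by (auto simp: fun_eq_iff indicator_def)
 ultimately show "integrable lborel (%x. indicator K x *\<^sub>R f x)" using L2_prod_integrable(2)[OF f] by metis
qed

text \<open>Orthogonality is used twice: a function orthogonal to all weak solutions is a limit of images of test functions, by coercivity these test functions converge, and the support condition on the limit forces orthogonality to \<open>w\<close>.\<close>

lemma L2_approximation:
 assumes X: "open X" and C: "compact C" "C <= X" and U: "U <= C"
  and coer: "c > 0" "!!h. h \<in> tf UNIV ==> supp h <= C ==> nrm2 h <= c * nrm2 (diff_op (rfl P) h)"
  and K: "compact K" and L: "compact L" "K <= L"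
  and hull: "!!f. f \<in> cdist X ==> dsupp X (ddo X (rfl P) f) <= K ==> dsupp X f <= L"
  and V': "open V'" "L <= V'" and w: "w \<in> tf X" "!!x. x \<in> V' ==> diff_op P w x = 0" and ep: "ep > 0"
 obtains g where "g \<in> L2" "!!h. h \<in> tf U ==> (LI x. g x * diff_op (rfl P) h x) = 0"
  "nrm2 (%x. indicator K x *\<^sub>R (w x - g x)) < ep"
proof -
 let ?Q = "rfl P"
 let ?r = "%g x. indicator K x *\<^sub>R g x"
 have Kc: "closed K" using K by (rule compact_imp_closed)
 \<comment> \<open>Weak solutions on \<open>U\<close>, given as square integrable functions on the
   whole space; they are compared with \<open>w\<close> after restriction to
   \<open>K\<close>.\<close>
 define S where "S = {g \<in> L2. \<forall>h\<in>tf U. (LI x. g x * diff_op ?Q h x) = 0}"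
 have LQ: "diff_op ?Q h \<in> L2" if "h \<in> tf U" for h using test_L2[OF test_diff_op[OF that]] .
 have Sadd: "(%x. f x + g x) \<in> S" if f: "f \<in> S" and g: "g \<in> S" for f g
 proof -
  have "(LI x. (f x + g x) * diff_op ?Q h x) = 0" if "h \<in> tf U" for h
   using f g that L2_prod_integrable(2)[OF _ LQ[OF that], of f] L2_prod_integrable(2)[OF _ LQ[OF that], of g]
   by (simp add: S_def distrib_right)
  thus ?thesis using f g by (simp add: S_def L2_add)
 qed
 have Scm: "(%x. k * f x) \<in> S" if "f \<in> S" for k f
  using that by (simp add: S_def L2_cmult mult.assoc)
 have wL: "w \<in> L2" by (rule test_L2[OF w(1)])
 define a where "a = ?r w"
 have aL: "a \<in> L2" unfolding a_def by (rule L2_indicator[OF wL Kc])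
 have sep: "inn a q = 0" if q: "q \<in> L2" and qS: "!!f. f \<in> ?r ` S ==> inn f q = 0" for q
 proof -
  \<comment> \<open>The conjugation turns the Hermitian pairing with \<open>q\<close> over
    \<open>K\<close> into a bilinear one, the form in which distributions act.\<close>
  define b where "b = (%x. cnj (?r q x))"
  have bL: "b \<in> L2" unfolding b_def by (rule L2_cnj[OF L2_indicator[OF q Kc]])
  let ?A = "diff_op ?Q ` tf U"
  \<comment> \<open>What is orthogonal to all images of test functions is, up to conjugation, a weak
    solution and hence orthogonal to \<open>b\<close>; so \<open>L2_separation\<close> places
    \<open>b\<close> in the closure of these images.\<close>
  have bA: "inn b r = 0" if r: "r \<in> L2" "!!f. f \<in> ?A ==> inn f r = 0" for r
  proof -
   have "(LI x. cnj (r x) * diff_op ?Q h x) = 0" if "h \<in> tf U" for h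
    using r(2)[OF imageI[OF that]] by (simp add: inn_def mult.commute)
   hence "(%x. cnj (r x)) \<in> S" using L2_cnj[OF r(1)] by (simp add: S_def)
   hence "inn (?r (%x. cnj (r x))) q = 0" using qS by blast
   thus ?thesis by (simp add: inn_def b_def mult_ac)
  qed
  have "\<exists>h\<in>tf U. nrm2 (%x. b x - diff_op ?Q h x) < 1 / real (Suc n)" for n
  proof -
   obtain f where "f \<in> ?A" "nrm2 (%x. b x - f x) < 1 / real (Suc n)"
   proof (rule L2_separation[of ?A b "1 / real (Suc n)"])
    show "?A <= L2" using LQ by blast
    show "?A ~= {}" using test_zero by blast
    show "(%x. f x + g x) \<in> ?A" if fg: "f \<in> ?A" "g \<in> ?A" for f g
    proof -
     obtain h p where "h \<in> tf U" "p \<in> tf U" "f = diff_op ?Q h" "g = diff_op ?Q p" using fg by blast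
     thus ?thesis
      by (intro image_eqI[of _ _ "%x. h x + p x"] test_add ext)
        (auto simp: diff_op_add[OF open_UNIV test_smooth test_smooth UNIV_I])
    qed
    show "(%x. k * f x) \<in> ?A" if ff: "f \<in> ?A" for k f
    proof -
     obtain h where "h \<in> tf U" "f = diff_op ?Q h" using ff by blast
     thus ?thesis
      by (intro image_eqI[of _ _ "%x. k * h x"] test_cmult ext) (auto simp: diff_op_cmult[OF open_UNIV test_smooth UNIV_I])
    qed
   qed (use bL bA in auto)
   thus ?thesis by blast
  qed
  then obtain h where h: "!!n. h n \<in> tf U" "!!n. nrm2 (%x. b x - diff_op ?Q (h n) x) < 1 / real (Suc n)" by metis
  have hU: "h n \<in> tf UNIV" for n using tf_UNIV[OF h(1)] .
  have hC: "supp (h n) <= C" for n using h(1)[of n] U by (auto simp: tf_iff)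
  have h0: "h n x = 0" if "x \<notin> C" for n x using hC[of n] that not_supp by blast
  note hL = test_L2[OF hU] and QL = LQ[OF h(1)]
  have diff: "nrm2 (%x. h m x - h n x) <= c * (2 / real (Suc m) + 2 / real (Suc n))" for m n
  proof -
   have t: "(%x. h m x - h n x) \<in> tf UNIV" by (rule test_diff[OF hU hU])
   have "supp (%x. h m x - h n x) <= C"
    using hC h0 by (intro supp_subset compact_imp_closed C) simp
   from coer(2)[OF t this] have "nrm2 (%x. h m x - h n x) <= c * nrm2 (diff_op ?Q (%x. h m x - h n x))" .
   also have "diff_op ?Q (%x. h m x - h n x) = (%x. - (b x - diff_op ?Q (h m) x) + (b x - diff_op ?Q (h n) x))"
    by (rule ext) (simp add: diff_op_diff[OF open_UNIV test_smooth[OF hU] test_smooth[OF hU] UNIV_I])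
   also have "nrm2 ... <= 2 * nrm2 (%x. - (b x - diff_op ?Q (h m) x)) + 2 * nrm2 (%x. b x - diff_op ?Q (h n) x)"
    using L2_cmult[OF L2_diff[OF bL QL], of "-1"] by (intro nrm2_add_le L2_diff bL QL) simp
   also have "nrm2 (%x. - (b x - diff_op ?Q (h m) x)) = nrm2 (%x. b x - diff_op ?Q (h m) x)"
    by (simp add: nrm2_def norm_minus_commute)
   also have "2 * ... + 2 * nrm2 (%x. b x - diff_op ?Q (h n) x) <= 2 * (1 / real (Suc m)) + 2 * (1 / real (Suc n))"
    using h(2)[of m] h(2)[of n] by (intro add_mono mult_left_mono) auto
   finally show ?thesis using coer(1) by simp
  qed
  have "\<exists>N. \<forall>m\<ge>N. \<forall>n\<ge>N. nrm2 (%x. h m x - h n x) < e" if e: "e > 0" for e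
  proof -
   obtain N where N: "1 / real (Suc N) < e / (4 * c)" using nat_approx_posE[of "e / (4 * c)"] e coer(1) by auto
   have "nrm2 (%x. h m x - h n x) < e" if "m \<ge> N" "n \<ge> N" for m n
   proof -
    have "1 / real (Suc m) <= 1 / real (Suc N)" "1 / real (Suc n) <= 1 / real (Suc N)" using that by (auto intro!: divide_left_mono)
    hence "c * (2 / real (Suc m) + 2 / real (Suc n)) <= c * (4 * (1 / real (Suc N)))" using coer(1) by (intro mult_left_mono) auto
    also have "... < e" using N coer(1) by (simp add: field_simps)
    finally show ?thesis using diff[of m n] by simp
   qed
   thus ?thesis by blast
  qed
  then obtain f where f: "f \<in> L2" "(%n. nrm2 (%x. h n x - f x)) \<longlonglongrightarrow> 0" using L2_complete[of h, OF hL] by blast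
  have lim: "(%n. LI x. h n x * p x) \<longlonglongrightarrow> (LI x. f x * p x)" if "p \<in> tf X" for p
   using inn_tendsto[OF hL f(1) L2_cnj[OF test_L2[OF that]] f(2)] by (simp add: inn_def)
  have QF: "(LI x. f x * diff_op P p x) = (LI x. b x * p x)" if p: "p \<in> tf X" for p
  proof -
   have "(%n. nrm2 (%x. diff_op ?Q (h n) x - b x)) \<longlonglongrightarrow> 0"
   proof (rule Lim_null_comparison)
    show "(%n. 1 / real (Suc n)) \<longlonglongrightarrow> 0" using lim_inverse_n' LIMSEQ_Suc by blast
    show "eventually (%n. norm (nrm2 (%x. diff_op ?Q (h n) x - b x)) <= 1 / real (Suc n)) sequentially"
     using h(2) by (intro always_eventually allI) (simp add: nrm2_def norm_minus_commute less_imp_le)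
   qed
   from inn_tendsto[OF QL bL L2_cnj[OF test_L2[OF p]] this]
   have "(%n. LI x. diff_op ?Q (h n) x * p x) \<longlonglongrightarrow> (LI x. b x * p x)" by (simp add: inn_def)
   hence "(%n. LI x. h n x * diff_op P p x) \<longlonglongrightarrow> (LI x. b x * p x)"
    unfolding integral_diff_op[OF open_UNIV test_smooth[OF hU] tf_UNIV[OF p], of ?Q] by simp
   thus ?thesis using lim[OF test_diff_op[OF p], of P] LIMSEQ_unique by blast
  qed
  \<comment> \<open>The limit as a distribution: its support lies in \<open>C\<close> like those of
    all \<open>h n\<close>, its image is \<open>b\<close> with support in \<open>K\<close>, so
    \<open>hull\<close> confines it to \<open>L\<close>, near which \<open>P(D) w\<close>
    vanishes.\<close>
  define F where "F = reg X f"
  have FX: "F \<in> distributions X" unfolding F_def by (rule reg_distribution[OF L2_loc_int[OF f(1)]])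
  have Fv: "F p = (LI x. f x * p x)" if "p \<in> tf X" for p using that by (simp add: F_def reg_def)
  have sC: "dsupp X F <= C"
  proof (rule dsupp_subsetI)
   fix x assume x: "x \<in> X" "x \<notin> C"
   have "F p = 0" if p: "p \<in> tf (X - C)" for p
   proof -
    have pX: "p \<in> tf X" using p by (rule tf_mono) blast
    have "h n x * p x = 0" for n x
     using p hC[of n] not_supp[of x p] not_supp[of x "h n"] by (auto simp: tf_iff)
    hence "(LI x. h n x * p x) = 0" for n by (simp only: integral_zero)
    thus ?thesis using lim[OF pX] Fv[OF pX] by (simp add: LIMSEQ_const_iff)
   qed
   thus "\<exists>U. open U & x \<in> U & U <= X & vanishes F U"
    using x X compact_imp_closed[OF C(1)] by (intro exI[of _ "X - C"]) (auto simp: vanishes_def)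
  qed
  have Fc: "F \<in> cdist X"
   unfolding compact_distributions_def using FX compact_dist_supportI[OF X C sC] by blast
  have "dsupp X (ddo X ?Q F) <= K"
  proof (rule dsupp_subsetI)
   fix x assume x: "x \<in> X" "x \<notin> K"
   have "ddo X ?Q F p = 0" if p: "p \<in> tf (X - K)" for p
   proof -
    have pX: "p \<in> tf X" using p by (rule tf_mono) blast
    have "b x * p x = 0" for x
     using p not_supp[of x p] by (cases "x \<in> K") (auto simp: tf_iff b_def)
    hence "(LI x. b x * p x) = 0" by (simp only: integral_zero)
    thus ?thesis
     unfolding ddo_eq[OF FX pX] mpoly_reflect_reflect Fv[OF test_diff_op[OF pX]] QF[OF pX] .
   qed
   thus "\<exists>U. open U & x \<in> U & U <= X & vanishes (ddo X ?Q F) U"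
    using x X Kc by (intro exI[of _ "X - K"]) (auto simp: vanishes_def)
  qed
  from hull[OF Fc this] have sL: "dsupp X F <= L" .
  have "supp (diff_op P w) <= - V'" using V'(1) w(2) by (intro supp_subset) auto
  hence "F (diff_op P w) = 0" using sL V'(2) by (intro dsupp_eq_0[OF FX] test_diff_op w(1)) blast
  hence "(LI x. b x * w x) = 0" using Fv[OF test_diff_op[OF w(1)]] QF[OF w(1)] by simp
  thus ?thesis by (simp add: inn_def b_def a_def mult_ac)
 qed
 obtain f where f: "f \<in> ?r ` S" "nrm2 (%x. a x - f x) < ep"
 proof (rule L2_separation[of "?r ` S" a ep])
  show "?r ` S <= L2" using L2_indicator[OF _ Kc] by (auto simp: S_def)
  have "(%x. 0) \<in> S" by (simp add: S_def L2_def)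
  thus "?r ` S ~= {}" by blast
  show "(%x. f x + g x) \<in> ?r ` S" if fg: "f \<in> ?r ` S" "g \<in> ?r ` S" for f g
  proof -
   obtain f' g' where "f' \<in> S" "g' \<in> S" "f = ?r f'" "g = ?r g'" using fg by blast
   thus ?thesis using Sadd[of f' g'] by (intro image_eqI[of _ _ "%x. f' x + g' x"]) (auto simp: scaleR_add_right)
  qed
  show "(%x. k * f x) \<in> ?r ` S" if ff: "f \<in> ?r ` S" for k f
  proof -
   obtain f' where "f' \<in> S" "f = ?r f'" using ff by blast
   thus ?thesis using Scm[of f' k] by (intro image_eqI[of _ _ "%x. k * f' x"]) auto
  qed
 qed (use aL sep ep in auto)
 then obtain g where g: "g \<in> S" "f = ?r g" by blast
 have "(%x. a x - f x) = (%x. ?r (%x. w x - g x) x)" by (simp add: a_def g(2) scaleR_diff_right)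
 thus ?thesis using that[of g] g(1) f(2) by (simp add: S_def)
qed

text \<open>Mollifying the weak solution keeps the equation on a smaller neighbourhood of
  \<open>M\<close>, and Cauchy-Schwarz against derivatives of the mollifier turns mean square
  closeness on \<open>K\<close> into closeness of derivatives on \<open>K0\<close>.\<close>

lemma smooth_approximation:
 assumes X: "open X"
  and coer: "!!C. compact C ==> \<exists>c>0. \<forall>q\<in>tf UNIV. supp q <= C --> nrm2 q <= c * nrm2 (diff_op (rfl P) q)"
  and K: "compact K" and d: "d > 0" and near: "!!x y. x \<in> K0 ==> norm y <= d ==> x - y \<in> K"
  and L: "compact L" "K <= L"
  and hull: "!!f. f \<in> cdist X ==> dsupp X (ddo X (rfl P) f) <= K ==> dsupp X f <= L"
  and V: "open V" "L <= V" "V <= X" and v: "smooth_on V v" "!!x. x \<in> V ==> diff_op P v x = 0"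
  and M: "compact M" "M <= X" and ep: "ep > 0"
 obtains G N where "smooth_on UNIV G" "open N" "M <= N" "!!x. x \<in> N ==> diff_op P G x = 0"
  "sn K0 r (%x. G x - v x) < ep"
proof -
 let ?Q = "rfl P"
 obtain p V' where p: "p \<in> tf V" "open V'" "L <= V'" "V' <= V" "!!x. x \<in> V' ==> p x = 1"
  using cutoff_exists[OF L(1) V(1,2)] by blast
 define w where "w = (%x. v x * p x)"
 have wV: "w \<in> tf V" unfolding w_def by (rule test_mult[OF V(1) v(1) p(1)])
 note wU = tf_UNIV[OF wV]
 have wv: "w x = v x" if "x \<in> V'" for x using p(5)[OF that] by (simp add: w_def)
 have Pw: "diff_op P w x = 0" if "x \<in> V'" for x
  using diff_op_cong[OF p(2) that wv] v(2) p(4) that by auto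
 obtain d' C where C: "d' > 0" "compact C" "C <= X" "!!x y. x \<in> M ==> norm y <= d' ==> x - y \<in> C" "M <= C"
  using compact_enlargement[OF M(1) X M(2)] by blast
 \<comment> \<open>Weak solutions are sought on the \<open>d'\<close>-neighbourhood \<open>U\<close>
   of \<open>M\<close>; after mollification at a scale of at most \<open>d' / 2\<close> the equation
   holds on \<open>N\<close>.\<close>
 define U where "U = (\<Union>m\<in>M. ball m d')"
 define N where "N = (\<Union>m\<in>M. ball m (d' / 2))"
 have U: "U <= C"
 proof
  fix x assume "x \<in> U"
  then obtain m where m: "m \<in> M" "dist m x < d'" by (auto simp: U_def)
  thus "x \<in> C" using C(4)[OF m(1), of "m - x"] by (simp add: dist_norm)
 qed
 obtain c where c: "c > 0" "!!q. q \<in> tf UNIV ==> supp q <= C ==> nrm2 q <= c * nrm2 (diff_op ?Q q)"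
  using coer[OF C(2)] by blast
 obtain B where B: "B > 0" "!!vs y. length vs <= r + 1 ==> (!!v. v \<in> set vs ==> norm v <= 1) ==> cmod (DL vs w y) <= B"
  using DL_bounded_all[OF wU, of "r + 1"] by blast
 \<comment> \<open>The scale is fixed first, so that the mollified \<open>w\<close> is close to
   \<open>w\<close>; the mean square tolerance \<open>ep'\<close> is chosen afterwards and depends
   on the norms \<open>B2\<close> of the derivatives of the mollifier at this scale.\<close>
 define e where "e = min (min d (d' / 2)) (ep / (4 * B))"
 have e: "e > 0" "e <= d" "e <= d' / 2" "B * e <= ep / 4"
 proof -
  have "e <= ep / (4 * B)" by (simp add: e_def)
  from mult_left_mono[OF this, of B] show "B * e <= ep / 4" using B(1) by simp
 qed (use d C ep B in \<open>auto simp: e_def\<close>)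
 note mt = moll_test[OF e(1)]
 define B2 where "B2 = (\<Sum>al\<in>{al. mi_size al <= r}. nrm2 (DL (mvecs al) (moll e :: real ^ 'a => complex)))"
 have B20: "B2 \<ge> 0" by (simp add: B2_def sum_nonneg)
 have B2: "nrm2 (DL (mvecs al) (moll e :: real ^ 'a => complex)) <= B2" if "mi_size al <= r" for al :: "nat ^ 'a"
  unfolding B2_def using that finite_mi_size_le[where 'd = 'a, of r] by (intro member_le_sum) auto
 define ep' where "ep' = (ep / 4)\<^sup>2 / (B2 + 1)"
 have ep': "ep' > 0" "ep' * B2 <= (ep / 4)\<^sup>2"
  using ep B20 by (auto simp: ep'_def field_simps intro!: divide_pos_pos add_nonneg_pos)
 obtain g where g: "g \<in> L2" "!!q. q \<in> tf U ==> (LI x. g x * diff_op ?Q q x) = 0"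
  "nrm2 (%x. indicator K x *\<^sub>R (w x - g x)) < ep'"
  using L2_approximation[OF X C(2,3) U c K L hull p(2,3) tf_mono[OF wV V(3)] Pw ep'(1)] by blast
 define G where "G = conv g (moll e)"
 have gl: "loc_int UNIV g" by (rule L2_loc_int[OF g(1)])
 have wl: "loc_int UNIV w" by (rule L2_loc_int[OF test_L2[OF wU]])
 have Gs: "smooth_on UNIV G" unfolding G_def by (rule conv_smooth(1)[OF gl mt])
 have "diff_op P G x = 0" if x: "x \<in> N" for x
 proof -
  obtain m where m: "m \<in> M" "dist m x < d' / 2" using x by (auto simp: N_def)
  have "supp (%y. moll e (x - y)) <= U"
  proof
   fix y assume "y \<in> supp (%y. moll e (x - y))"
   hence "x - y \<in> cball 0 e" using test_reflect_translate(2)[OF mt, of x] moll_support[OF e(1)] by blast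
   hence "dist x y <= d' / 2" using e(3) by (simp add: dist_norm norm_minus_commute)
   hence "dist m y < d'" using m(2) dist_triangle[of m y x] by linarith
   thus "y \<in> U" using m(1) by (auto simp: U_def)
  qed
  hence t: "(%y. moll e (x - y)) \<in> tf U" using test_reflect_translate(1)[OF mt, of x] tf_support by blast
  have "G = (%x. reg UNIV g (%y. moll e (x - y)))" unfolding G_def by (rule ext) (rule reg_translate[OF mt, symmetric])
  hence "diff_op P G x = reg UNIV g (diff_op ?Q (%y. moll e (x - y)))"
   using diff_op_mollify[OF reg_distribution[OF gl] mt open_UNIV UNIV_I UNIV_I] by simp
  also have "... = (LI y. g y * diff_op ?Q (%y. moll e (x - y)) y)"
   using test_diff_op[OF tf_UNIV[OF t]] by (simp add: reg_def)
  also have "... = 0" by (rule g(2)[OF t])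
  finally show ?thesis .
 qed
 moreover have "sn K0 r (%x. G x - v x) <= ep / 2"
 proof (rule sn_le)
  fix al :: "nat ^ 'a" and x assume x: "x \<in> K0" and al: "mi_size al <= r"
  let ?D = "DL (mvecs al)"
  have xV: "x \<in> V'" using near[OF x, of 0] d L(2) p(3) by auto
  define t' where "t' = (%y. ?D (moll e) (x - y))"
  have t': "t' \<in> tf UNIV" unfolding t'_def by (rule test_reflect_translate(1)[OF test_DL[OF mt]])
  have t'0: "t' y = 0" if "y \<notin> K" for y
  proof -
   have "norm (x - y) > e" using near[OF x, of "x - y"] e(2) that by fastforce
   hence "x - y \<notin> supp (moll e)" using moll_support[OF e(1)] by fastforce
   thus ?thesis unfolding t'_def by (rule DL_outside_support)
  qed
  have t'n: "nrm2 t' <= B2"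
  proof -
   have m: "(%y. (cmod (?D (moll e :: real ^ 'a => complex) y))\<^sup>2) \<in> borel_measurable borel"
    by (intro cont_bm continuous_intros test_continuous[OF test_DL[OF mt]])
   have "nrm2 t' = nrm2 (?D (moll e))" unfolding nrm2_def t'_def by (rule lborel_integral_reflect[OF m])
   thus ?thesis using B2[OF al] by simp
  qed
  have cv: "?D (conv h (moll e)) x = (LI y. h y * t' y)" if "loc_int UNIV h" for h
   unfolding conv_smooth(2)[OF that mt] conv_def t'_def ..
  let ?k = "%x. indicator K x *\<^sub>R (w x - g x)"
  have kL: "?k \<in> L2" by (intro L2_indicator L2_diff test_L2[OF wU] g(1) compact_imp_closed K)
  have "?D (conv w (moll e)) x - ?D G x = (LI y. w y * t' y - g y * t' y)"
   unfolding G_def cv[OF gl] cv[OF wl]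
   by (intro Bochner_Integration.integral_diff[symmetric] L2_prod_integrable test_L2[OF wU] test_L2[OF t'] g(1))
  also have "... = inn ?k (%y. cnj (t' y))"
   unfolding inn_def
  proof (intro Bochner_Integration.integral_cong refl)
   show "w y * t' y - g y * t' y = ?k y * cnj (cnj (t' y))" for y
    using t'0[of y] by (cases "y \<in> K") (auto simp: left_diff_distrib)
  qed
  finally have eq: "?D (conv w (moll e)) x - ?D G x = inn ?k (%y. cnj (t' y))" .
  have "(cmod (inn ?k (%y. cnj (t' y))))\<^sup>2 <= nrm2 ?k * nrm2 t'"
   using Cauchy_Schwarz[OF kL L2_cnj[OF test_L2[OF t']]] by (simp add: nrm2_def)
  also have "... <= ep' * B2" using g(3) t'n ep'(1) by (intro mult_mono) auto
  also have "... <= (ep / 4)\<^sup>2" by (rule ep'(2))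
  finally have "(cmod (inn ?k (%y. cnj (t' y))))\<^sup>2 <= (ep / 4)\<^sup>2" .
  from power2_le_imp_le[OF this] have 1: "cmod (?D (conv w (moll e)) x - ?D G x) <= ep / 4"
   unfolding eq using ep by simp
  have "cmod (?D (conv w (moll e)) x - ?D w x) <= B * e"
   by (rule conv_moll_DL_approx[OF wU e(1) _ _ B(2)]) (use al in \<open>auto simp: length_mvecs norm_mvecs\<close>)
  hence 2: "cmod (?D (conv w (moll e)) x - ?D w x) <= ep / 4" using e(4) by linarith
  have "multi_deriv al (%x. G x - v x) x = ?D G x - ?D v x"
   unfolding multi_deriv_DL
   by (rule DL_diff[OF p(2) smooth_on_subset[OF Gs subset_UNIV] smooth_on_subset[OF v(1) p(4)] xV])
  also have "?D v x = ?D w x" by (rule DL_cong[OF p(2) xV wv, symmetric])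
  also have "?D G x - ?D w x = (?D (conv w (moll e)) x - ?D w x) - (?D (conv w (moll e)) x - ?D G x)" by simp
  finally have "cmod (multi_deriv al (%x. G x - v x) x) <= cmod (?D (conv w (moll e)) x - ?D w x) + cmod (?D (conv w (moll e)) x - ?D G x)"
   using norm_triangle_ineq4[of "?D (conv w (moll e)) x - ?D w x" "?D (conv w (moll e)) x - ?D G x"] by simp
  thus "cmod (multi_deriv al (%x. G x - v x) x) <= ep / 2" using 1 2 by linarith
 qed (use ep in simp)
 moreover have "open N" "M <= N" using C(1) by (auto simp: N_def)
 ultimately show ?thesis using that[OF Gs] ep by fastforce
qed

section \<open>Limits of sequences of solutions\<close>

lemma mvecs_axes: "\<exists>js. mvecs a = axes js & length js = mi_size a"
proof (intro exI conjI)
 show *: "mvecs a = axes (concat (map (%j. replicate (a $ j) j) coords))"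
  by (simp add: mvecs_def map_concat comp_def)
 show "length (concat (map (%j. replicate (a $ j) j) coords)) = mi_size a"
  using arg_cong[OF *, of length] by (simp add: length_mvecs)
qed

text \<open>The order \<open>r + n\<close> grows with \<open>n\<close>, so for a fixed derivative
  and a fixed \<open>C k\<close> all but finitely many increments are bounded by a geometric series;
  derivatives converge locally uniformly and the limit can be differentiated term by term.\<close>

lemma smooth_limit:
 fixes G :: "nat => real ^ 'd::finite => complex"
 assumes X: "open X" and C: "!!n. compact (C n)" "!!n. C n <= X" "!!m n. m <= n ==> C m <= C n" "!!x. x \<in> X ==> \<exists>n. x \<in> interior (C n)"
  and G: "!!n. smooth_on X (G n)" and de: "de > 0"
  and step: "!!n. sn (C n) (r + n) (%x. G (Suc n) x - G n x) <= de * (1 / 2) ^ (n + 2)"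
 obtains F where "smooth_on X F" "!!js x. x \<in> X ==> (%n. DL (axes js) (G n) x) \<longlonglongrightarrow> DL (axes js) F x"
  "!!js x. x \<in> C 0 ==> length js <= r ==> cmod (DL (axes js) F x - DL (axes js) (G 0) x) <= de / 2"
proof -
 define D where "D js n = DL (axes js) (G n)" for js n
 have Ds: "smooth_on X (D js n)" for js n unfolding D_def by (rule smooth_on_DL[OF X G])
 have one: "cmod (D js (Suc n) x - D js n x) <= de * (1 / 2) ^ (n + 2)"
  if x: "x \<in> C k" "k <= n" "length js <= r + n" for js n k x
 proof -
  have xn: "x \<in> C n" using C(3)[OF x(2)] x(1) by blast
  have "D js (Suc n) x - D js n x = DL (axes js) (%x. G (Suc n) x - G n x) x"
   unfolding D_def using C(2) xn by (intro DL_diff[OF X G G, symmetric]) blast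
  also have "cmod ... <= sn (C n) (r + n) (%x. G (Suc n) x - G n x)"
   by (rule DL_axes_le_seminorm[OF X C(1,2) smooth_on_diff[OF X G G] xn x(3)])
  finally show ?thesis using step[of n] by linarith
 qed
 have tele: "cmod (D js (n + p) x - D js n x) <= de * (1 / 2) ^ (n + 1) - de * (1 / 2) ^ (n + p + 1)"
  if x: "x \<in> C k" "k <= n" "length js <= r + n" for js n k x p
 proof (induction p)
  case (Suc p)
  have "cmod (D js (n + Suc p) x - D js n x) <= cmod (D js (Suc (n + p)) x - D js (n + p) x) + cmod (D js (n + p) x - D js n x)"
   using norm_triangle_ineq[of "D js (Suc (n + p)) x - D js (n + p) x" "D js (n + p) x - D js n x"] by simp
  also have "... <= de * (1 / 2) ^ (n + p + 2) + (de * (1 / 2) ^ (n + 1) - de * (1 / 2) ^ (n + p + 1))"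
   using one[OF x(1), of "n + p" js] x Suc by (intro add_mono) auto
  finally show ?case by simp
 qed simp
 have tele': "cmod (D js m x - D js n x) <= de * (1 / 2) ^ (n + 1)"
  if x: "x \<in> C k" "k <= n" "length js <= r + n" "n <= m" for js n k x m
 proof -
  have "0 <= de * (1 / 2) ^ (n + (m - n) + 1)" using de by simp
  thus ?thesis using tele[OF x(1-3), of "m - n"] x(4) by simp
 qed
 have small: "\<exists>N\<ge>M. de * (1 / 2) ^ (N + 1) < e" if "e > 0" for e M
 proof -
  have "(%n. (1 / 2 :: real) ^ (n + 1)) \<longlonglongrightarrow> 0" by (intro LIMSEQ_power_zero[THEN LIMSEQ_ignore_initial_segment]) simp
  from tendsto_mult_right_zero[OF this] have "(%n. de * (1 / 2) ^ (n + 1)) \<longlonglongrightarrow> 0" .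
  hence "eventually (%n. de * (1 / 2) ^ (n + 1) < e) sequentially" using that by (rule order_tendstoD(2))
  then obtain N where "!!n. n \<ge> N ==> de * (1 / 2) ^ (n + 1) < e" by (auto simp: eventually_sequentially)
  thus ?thesis by (intro exI[of _ "max M N"]) auto
 qed
 \<comment> \<open>Limits are formed for all lists at once; \<open>der\<close> below identifies
   \<open>H (j # js)\<close> as the partial derivative of \<open>H js\<close>.\<close>
 define H where "H js x = lim (%n. D js n x)" for js x
 have conv: "(%n. D js n x) \<longlonglongrightarrow> H js x" if x: "x \<in> C k" for js k x
 proof -
  have "Cauchy (%n. D js n x)"
  proof (rule CauchyI)
   fix e :: real assume "0 < e"
   hence "0 < e / 2" by simp
   from small[OF this] obtain N where N: "N \<ge> max k (length js)" "de * (1 / 2) ^ (N + 1) < e / 2" by blast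
   have "norm (D js m x - D js n x) < e" if "m \<ge> N" "n \<ge> N" for m n
   proof -
    have "cmod (D js m x - D js N x) < e / 2" "cmod (D js n x - D js N x) < e / 2"
     using tele'[OF x, of N js m] tele'[OF x, of N js n] N that by auto
    thus ?thesis using norm_triangle_ineq4[of "D js m x - D js N x" "D js n x - D js N x"] by simp
   qed
   thus "\<exists>N. \<forall>m\<ge>N. \<forall>n\<ge>N. norm (D js m x - D js n x) < e" by blast
  qed
  thus ?thesis unfolding H_def by (simp add: Cauchy_convergent_iff convergent_LIMSEQ_iff)
 qed
 have bound: "cmod (H js x - D js n x) <= de * (1 / 2) ^ (n + 1)" if x: "x \<in> C k" "k <= n" "length js <= r + n" for js n k x
 proof (rule LIMSEQ_le_const2)
  show "(%m. cmod (D js m x - D js n x)) \<longlonglongrightarrow> cmod (H js x - D js n x)" by (intro tendsto_intros conv[OF x(1)])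
  show "\<exists>N. \<forall>m\<ge>N. cmod (D js m x - D js n x) <= de * (1 / 2) ^ (n + 1)" using tele'[OF x] by blast
 qed
 have unif: "\<exists>N. \<forall>n\<ge>N. \<forall>x\<in>C k. cmod (D js n x - H js x) < e" if e: "e > 0" for e k js
 proof -
  obtain N where N: "N \<ge> max k (length js)" "de * (1 / 2) ^ (N + 1) < e" using small[OF e] by blast
  have "cmod (D js n x - H js x) < e" if "n \<ge> N" "x \<in> C k" for n x
  proof -
   have "de * (1 / 2) ^ (n + 1) <= de * (1 / 2) ^ (N + 1)" using that(1) de by (intro mult_left_mono power_decreasing) auto
   thus ?thesis using bound[OF that(2), of n js] N that(1) by (simp add: norm_minus_commute)
  qed
  thus ?thesis by blast
 qed
 have inX: "\<exists>d>0. \<exists>k. cball x d <= C k" if "x \<in> X" for x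
  using C(4)[OF that] mem_interior_cball by metis
 have cont: "continuous_on X (H js)" for js
 proof (rule continuous_at_imp_continuous_on, rule ballI)
  fix x assume "x \<in> X"
  then obtain k where k: "x \<in> interior (C k)" using C(4) by blast
  have "continuous_on (C k) (H js)"
  proof (rule uniform_limit_theorem)
   show "eventually (%n. continuous_on (C k) (D js n)) sequentially"
    using continuous_on_subset[OF smooth_on_imp_continuous[OF Ds] C(2)] by (intro always_eventually) blast
   show "uniform_limit (C k) (D js) (H js) sequentially"
   proof (rule uniform_limitI)
    fix e :: real assume "e > 0"
    from unif[OF this, of k js] show "eventually (%n. \<forall>x\<in>C k. dist (D js n x) (H js x) < e) sequentially"
     by (simp add: eventually_sequentially dist_norm)
   qed
  qed simp
  thus "isCont (H js) x" using k continuous_on_interior by blast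
 qed
 have der: "((%t. H js (x + t *\<^sub>R ax j)) has_vector_derivative H (j # js) x) (at 0)" if x: "x \<in> X" for x js j
 proof -
  obtain d k where dk: "d > 0" "cball x d <= C k" using inX[OF x] by blast
  have inC: "x + t *\<^sub>R ax j \<in> C k" if "t \<in> ball 0 d" for t :: real
  proof -
   have "x + t *\<^sub>R ax j \<in> cball x d" using that by (simp add: dist_norm norm_axis_1)
   thus ?thesis using dk(2) by blast
  qed
  have "\<exists>g. \<forall>t\<in>ball 0 d. (%n. D js n (x + t *\<^sub>R ax j)) \<longlonglongrightarrow> g t &
   (g has_derivative (%h. h *\<^sub>R H (j # js) (x + t *\<^sub>R ax j))) (at t within ball 0 d)"
  proof (rule has_derivative_sequence[OF convex_ball])
   show "((%t. D js n (x + t *\<^sub>R ax j)) has_derivative (%h. h *\<^sub>R D (j # js) n (x + t *\<^sub>R ax j))) (at t within ball 0 d)"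
    if "t \<in> ball 0 d" for n and t :: real
    using smooth_line_derivative[OF X Ds[of js n], of x t "ax j" "ball 0 d"] inC[OF that] C(2)
    unfolding has_vector_derivative_def by (auto simp: D_def)
   show "eventually (%n. \<forall>t\<in>ball 0 d. \<forall>h. norm (h *\<^sub>R D (j # js) n (x + t *\<^sub>R ax j) - h *\<^sub>R H (j # js) (x + t *\<^sub>R ax j)) <= e * norm h) sequentially"
    if e: "e > 0" for e :: real
   proof -
    obtain N where N: "\<forall>n\<ge>N. \<forall>x\<in>C k. cmod (D (j # js) n x - H (j # js) x) < e" using unif[OF e] by blast
    have "norm (h *\<^sub>R D (j # js) n y - h *\<^sub>R H (j # js) y) <= e * norm h" if "n \<ge> N" "y \<in> C k" for n y and h :: real
    proof -
     have "\<bar>h\<bar> * cmod (D (j # js) n y - H (j # js) y) <= \<bar>h\<bar> * e" using N that by (intro mult_left_mono) (auto intro: less_imp_le)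
     thus ?thesis by (simp add: scaleR_diff_right[symmetric] mult.commute)
    qed
    thus ?thesis using inC unfolding eventually_sequentially by blast
   qed
   show "(0::real) \<in> ball 0 d" using dk(1) by simp
   show "(%n. D js n (x + 0 *\<^sub>R ax j)) \<longlonglongrightarrow> H js x" using conv[OF inC[of 0], of js] dk(1) by simp
  qed
  then obtain g where g: "!!t. t \<in> ball 0 d ==> (%n. D js n (x + t *\<^sub>R ax j)) \<longlonglongrightarrow> g t"
   "!!t. t \<in> ball 0 d ==> (g has_derivative (%h. h *\<^sub>R H (j # js) (x + t *\<^sub>R ax j))) (at t within ball 0 d)" by blast
  have z: "(0::real) \<in> ball 0 d" using dk(1) by simp
  have "g t = H js (x + t *\<^sub>R ax j)" if "t \<in> ball 0 d" for t
   using LIMSEQ_unique[OF g(1)[OF that] conv[OF inC[OF that]]] .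
  from has_derivative_transform[OF z this[symmetric] g(2)[OF z]]
  have "((%t. H js (x + t *\<^sub>R ax j)) has_derivative (%h. h *\<^sub>R H (j # js) (x + 0 *\<^sub>R ax j))) (at 0 within ball 0 d)" .
  thus ?thesis
   unfolding has_vector_derivative_def at_within_open[OF z open_ball] by simp
 qed
 have "C_on k X (H js)" for k js
 proof (induction k arbitrary: js)
  case 0
  show ?case using cont by simp
 next
  case (Suc k)
  show ?case by (rule C_on_SucI[OF X cont der Suc])
 qed
 hence Fs: "smooth_on X (H [])" by (simp add: smooth_on_def)
 have DF: "DL (axes js) (H []) x = H js x" if "x \<in> X" for js x
  using that
 proof (induction js arbitrary: x)
  case (Cons j js)
  have "DL (axes (j # js)) (H []) x = dd (ax j) (H js) x"
   unfolding list.map DL_Cons by (rule dd_cong[OF X Cons.prems Cons.IH])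
  also have "... = H (j # js) x" unfolding dd_axis by (rule pd_eqI[OF der[OF Cons.prems]])
  finally show ?case .
 qed simp
 show ?thesis
 proof (rule that[OF Fs])
  fix js :: "'d list" and x
  show "(%n. DL (axes js) (G n) x) \<longlonglongrightarrow> DL (axes js) (H []) x" if x: "x \<in> X"
  proof -
   obtain k where "x \<in> C k" using C(4)[OF x] interior_subset by blast
   from conv[OF this] show ?thesis unfolding DF[OF x] D_def .
  qed
  show "cmod (DL (axes js) (H []) x - DL (axes js) (G 0) x) <= de / 2" if "x \<in> C 0" "length js <= r"
   using bound[of x 0 0 js] that C(2)[of 0] unfolding D_def by (subst DF) auto
 qed
qed

text \<open>A Mittag-Leffler argument along a compact exhaustion of \<open>X\<close>.\<close>

lemma kernel_approximation:
 assumes X: "open X" and Y: "open Y" "Y <= X"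
  and coer: "!!C. compact C ==> \<exists>c>0. \<forall>h\<in>tf UNIV. supp h <= C --> nrm2 h <= c * nrm2 (diff_op (rfl P) h)"
  and hull: "!!Z K. Z \<in> {X, Y} ==> compact K ==> K <= Z ==> \<exists>L. compact L & L <= Z & (\<forall>f\<in>cdist X.
   dsupp X (ddo X (rfl P) f) <= K --> dsupp X f <= L)"
  and K: "compact K" "K <= Y"
 shows "\<exists>L. compact L & K <= L & L <= Y & (\<forall>V v r e. open V --> L <= V --> V <= Y --> smooth_on V v --> (\<forall>x\<in>V. diff_op P v x = 0) --> e > 0 -->
  (\<exists>F. smooth_on X F & (\<forall>x\<in>X. diff_op P F x = 0) & sn K r (%x. F x - v x) < e))"
proof -
 define sol where "sol M G \<longleftrightarrow> smooth_on UNIV G & (\<exists>N. open N & M <= N & (\<forall>x\<in>N. diff_op P G x = 0))" for M G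
 \<comment> \<open>The compact set \<open>M\<close> is not fixed in advance, which allows
   approximations to be chained along an exhaustion of \<open>X\<close>.\<close>
 define apx where "apx K0 L \<longleftrightarrow> (\<forall>V v M r e. open V --> L <= V --> V <= X --> smooth_on V v --> (\<forall>x\<in>V. diff_op P v x = 0) -->
   compact M --> M <= X --> e > 0 --> (\<exists>G. sol M G & sn K0 r (%x. G x - v x) < e))" for K0 L
 have approx: "\<exists>L. compact L & L <= Z & apx K0 L"
  if Z: "Z \<in> {X, Y}" and K0: "compact K0" "K0 <= Z" for Z K0
 proof -
  have "open Z" using Z X Y by auto
  obtain d K where K: "d > 0" "compact K" "K <= Z" "!!x y. x \<in> K0 ==> norm y <= d ==> x - y \<in> K" "K0 <= K"
   using compact_enlargement[OF K0(1) \<open>open Z\<close> K0(2)] by blast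
  obtain L where L: "compact L" "L <= Z" "!!f. f \<in> cdist X ==>
   dsupp X (ddo X (rfl P) f) <= K ==> dsupp X f <= L"
   using hull[OF Z K(2,3)] by blast
  have "\<exists>G. sol M G & sn K0 r (%x. G x - v x) < e"
   if V: "open V" "L \<union> K <= V" "V <= X" and v: "smooth_on V v" "\<forall>x\<in>V. diff_op P v x = 0" and M: "compact M" "M <= X" and e: "e > 0"
   for V v M r and e :: real
  proof -
   have LK: "compact (L \<union> K)" "K <= L \<union> K" using L(1) K(2) by auto
   obtain G N where "smooth_on UNIV G" "open N" "M <= N" "!!x. x \<in> N ==> diff_op P G x = 0"
    "sn K0 r (%x. G x - v x) < e"
   proof (rule smooth_approximation[OF X coer K(2,1,4) LK _ V v(1) _ M e])
    show "dsupp X f <= L \<union> K" if "f \<in> cdist X" "dsupp X (ddo X (rfl P) f) <= K" for f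
     using L(3)[OF that] by blast
   qed (use v(2) in auto)
   thus ?thesis unfolding sol_def by blast
  qed
  hence "apx K0 (L \<union> K)" unfolding apx_def by blast
  thus ?thesis using L K by (intro exI[of _ "L \<union> K"]) auto
 qed
 obtain C where C: "!!n. compact (C n)" "!!n. C n <= X" "!!n. C n <= interior (C (Suc n))" "\<Union>(range C) = X"
  "!!K. compact K ==> K <= X ==> \<exists>N. \<forall>n\<ge>N. K <= C n"
  using open_Union_compact_subsets[OF X] by metis
 obtain N0 where N0: "!!n. n \<ge> N0 ==> K <= C n" using C(5)[of K] K Y(2) by blast
 \<comment> \<open>The exhaustion is shifted so that its first member contains \<open>K\<close>; the
   final bound of \<open>smooth_limit\<close> then holds on \<open>K\<close>.\<close>
 define C' where "C' n = C (N0 + n)" for n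
 have "\<exists>M. compact M & M <= X & apx (C' n) M" for n
  by (rule approx) (auto simp: C'_def C)
 then obtain M where M: "!!n. compact (M n)" "!!n. M n <= X" "!!n. apx (C' n) (M n)" by metis
 have MM: "compact (M n \<union> C' n)" "M n \<union> C' n <= X" for n using M(1,2) C(1,2) by (auto simp: C'_def)
 obtain L0 where L0: "compact L0" "L0 <= Y" "apx K L0" using approx[OF _ K] by blast
 have "\<exists>F. smooth_on X F & (\<forall>x\<in>X. diff_op P F x = 0) & sn K r (%x. F x - v x) < e"
  if V: "open V" "L0 \<union> K <= V" "V <= Y" and v: "smooth_on V v" "!!x. x \<in> V ==> diff_op P v x = 0" and e: "e > 0" for V v r and e :: real
 proof -
 have VX: "V <= X" and L0V: "L0 <= V" and KV: "K <= V" using V Y by auto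
 obtain G0 where G0: "sol (M 0 \<union> C' 0) G0" "sn K r (%x. G0 x - v x) < e / 2"
  using L0(3)[unfolded apx_def, rule_format, OF V(1) L0V VX v(1) v(2) MM[of 0], of "e / 2" r] e by auto
 \<comment> \<open>Each \<open>G n\<close> is a solution near \<open>M n\<close>, so the next one
   can be taken close to it on \<open>C' n\<close>; the tolerances are those expected by
   \<open>smooth_limit\<close> and add up to \<open>e / 2\<close>.\<close>
 have "\<exists>G. \<forall>n. (sol (M n \<union> C' n) (G n) & (n = 0 --> G n = G0)) & sn (C' n) (r + n) (%x. G (Suc n) x - G n x) < e * (1 / 2) ^ (n + 2)"
 proof (rule dependent_nat_choice)
  show "\<exists>g. sol (M 0 \<union> C' 0) g & (0 = 0 --> g = G0)" using G0(1) by blast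
  fix g n assume "sol (M n \<union> C' n) g & (n = 0 --> g = G0)"
  then obtain N where N: "smooth_on UNIV g" "open N" "M n \<union> C' n <= N" "\<forall>x\<in>N. diff_op P g x = 0" unfolding sol_def by blast
  have "\<exists>G. sol (M (Suc n) \<union> C' (Suc n)) G & sn (C' n) (r + n) (%x. G x - g x) < e * (1 / 2) ^ (n + 2)"
   by (rule M(3)[unfolded apx_def, rule_format, of "N \<inter> X"]) (use N X M(2) MM smooth_on_subset[OF N(1)] e in auto)
  thus "\<exists>y. (sol (M (Suc n) \<union> C' (Suc n)) y & (Suc n = 0 --> y = G0)) & sn (C' n) (r + n) (%x. y x - g x) < e * (1 / 2) ^ (n + 2)"
   by blast
 qed
 then obtain G where G: "!!n. sol (M n \<union> C' n) (G n)" "G 0 = G0" "!!n. sn (C' n) (r + n) (%x. G (Suc n) x - G n x) < e * (1 / 2) ^ (n + 2)"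
  by blast
 have Gs: "smooth_on X (G n)" for n using G(1)[of n] smooth_on_subset unfolding sol_def by blast
 have CS: "C n <= C (Suc n)" for n using C(3)[of n] interior_subset[of "C (Suc n)"] by (rule subset_trans)
 have mono: "C' m <= C' n" if "m <= n" for m n
  unfolding C'_def by (rule lift_Suc_mono_le[of C, OF CS]) (use that in simp)
 have cov: "\<exists>n. x \<in> interior (C' n)" if x: "x \<in> X" for x
 proof -
  obtain n where n: "x \<in> C n" using C(4) x by blast
  have "C n <= C (N0 + n)" by (rule lift_Suc_mono_le[of C, OF CS]) simp
  hence "x \<in> interior (C' (Suc n))" using C(3)[of "N0 + n"] n by (auto simp: C'_def)
  thus ?thesis by blast
 qed
 have C'X: "C' n <= X" "compact (C' n)" for n using C by (auto simp: C'_def)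
 obtain F where F: "smooth_on X F" "!!js x. x \<in> X ==> (%n. DL (axes js) (G n) x) \<longlonglongrightarrow> DL (axes js) F x"
  "!!js x. x \<in> C' 0 ==> length js <= r ==> cmod (DL (axes js) F x - DL (axes js) (G 0) x) <= e / 2"
  using smooth_limit[of X C' G e r, OF X C'X(2,1) mono cov Gs e less_imp_le[OF G(3)]] by blast
 have lim: "(%n. DL (mvecs al) (G n) x) \<longlonglongrightarrow> DL (mvecs al) F x" if "x \<in> X" for al x
  using mvecs_axes[of al] F(2)[OF that] by metis
 show ?thesis
 proof (intro exI[of _ F] conjI ballI F(1))
  fix x assume x: "x \<in> X"
  have "(%n. diff_op P (G n) x) \<longlonglongrightarrow> diff_op P F x" unfolding diff_op_DL by (intro tendsto_intros lim[OF x])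
  moreover have "eventually (%n. diff_op P (G n) x = 0) sequentially"
  proof -
   obtain n0 where n0: "x \<in> C' n0" using cov[OF x] interior_subset by blast
   have "diff_op P (G n) x = 0" if "n \<ge> n0" for n using G(1)[of n] mono[OF that] n0 unfolding sol_def by blast
   thus ?thesis by (auto simp: eventually_sequentially)
  qed
  ultimately show "diff_op P F x = 0" using tendsto_unique[OF trivial_limit_sequentially _ tendsto_eventually] by blast
 next
  have "sn K r (%x. F x - v x) <= e / 2 + sn K r (%x. G0 x - v x)"
  proof (rule sn_le)
   have sd: "smooth_on V (%x. G0 x - v x)" using smooth_on_diff[OF V(1) smooth_on_subset[OF Gs VX] v(1), of 0] G(2) by simp
   show "0 <= e / 2 + sn K r (%x. G0 x - v x)"
    using sn_nonneg[OF V(1) K(1) KV sd, of r] e by simp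
   fix al :: "nat ^ 'a" and x assume x: "x \<in> K" and al: "mi_size al <= r"
   obtain js where js: "mvecs al = axes js" "length js = mi_size al" using mvecs_axes by blast
   have xV: "x \<in> V" "x \<in> C' 0" using x KV N0[of N0] by (auto simp: C'_def)
   have G0s: "smooth_on V G0" using smooth_on_subset[OF Gs VX, of 0] G(2) by simp
   have "multi_deriv al (%x. F x - v x) x = DL (mvecs al) F x - DL (mvecs al) v x"
    unfolding multi_deriv_DL by (rule DL_diff[OF V(1) smooth_on_subset[OF F(1) VX] v(1) xV(1)])
   also have "... = (DL (mvecs al) F x - DL (mvecs al) G0 x) + multi_deriv al (%x. G0 x - v x) x"
    unfolding multi_deriv_DL DL_diff[OF V(1) G0s v(1) xV(1)] by simp
   also have "cmod ... <= e / 2 + sn K r (%x. G0 x - v x)"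
    using F(3)[OF xV(2), of js] multi_deriv_le_seminorm[OF V(1) K(1) KV sd x al] js al G(2)
    by (intro order_trans[OF norm_triangle_ineq] add_mono) auto
   finally show "cmod (multi_deriv al (%x. F x - v x) x) <= e / 2 + sn K r (%x. G0 x - v x)" .
  qed
  thus "sn K r (%x. F x - v x) < e" using G0(2) by linarith
 qed
qed
 moreover have "compact (L0 \<union> K)" "K <= L0 \<union> K" "L0 \<union> K <= Y" using L0 K by auto
 ultimately show ?thesis by (intro exI[of _ "L0 \<union> K"]) blast
qed

text \<open>If the principal part has a nonzero value, \<open>coercive\<close> applies. Otherwise
  ellipticity forces \<open>W\<close> to be trivial, so that \<open>P\<close> is constant as a
  function: a nonzero constant is coercive at once, and the constant 0 contradicts the convexity of
  the nonempty \<open>X\<close>.\<close>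

lemma coercive_on_compacts:
 fixes P :: "'d::finite mpoly"
 assumes W: "subspace W" and act: "acts_along P W" and ell: "elliptic_on P W"
  and X: "open X" "X ~= {}" "P_convex_for_supports P X" and C: "compact C"
 shows "\<exists>c>0. \<forall>g\<in>tf UNIV. supp g <= C --> nrm2 g <= c * nrm2 (diff_op (rfl P) g)"
proof (cases "\<exists>w. mpoly_eval (principal_part (rfl P)) w ~= 0")
 case True
 thus ?thesis using coercive[OF _ C] by metis
next
 case False
 hence W0: "W <= {0}" using elliptic_on_reflect[OF W ell] by (auto simp: elliptic_on_def)
 define c where "c = mpoly_eval P 0"
 have ev: "mpoly_eval P z' = c" for z'
 proof -
  have "orth_proj W z' = 0" using orth_proj_mem[OF W, of z'] W0 by blast
  thus ?thesis using act unfolding acts_along_def c_def by metis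
 qed
 have op: "diff_op R g x = c * g x" if R: "R = P \<or> R = rfl P" and g: "g \<in> tf UNIV" for R g x
 proof -
  have t: "(%x. diff_op R g x - c * g x) \<in> tf UNIV" by (intro test_diff test_diff_op test_cmult g)
  have "FT (%x. diff_op R g x - c * g x) z' = 0" for z'
   using R unfolding FT_diff[OF test_diff_op[OF g] test_cmult[OF g]] FT_diff_op[OF g] FT_cmult
   by (auto simp: ev mpoly_eval_reflect)
  from FT_inj[OF t this] show ?thesis by simp
 qed
 show ?thesis
 proof (cases "c = 0")
  case False
  have "nrm2 g <= 1 / (cmod c)\<^sup>2 * nrm2 (diff_op (rfl P) g)" if "g \<in> tf UNIV" for g
  proof -
   have "diff_op (rfl P) g = (%x. c * g x)" using op[OF _ that] by auto
   thus ?thesis using False by (simp add: nrm2_cmult)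
  qed
  thus ?thesis using False by (intro exI[of _ "1 / (cmod c)\<^sup>2"]) auto
 next
  case True
  \<comment> \<open>For \<open>P(D) = 0\<close> all images have empty support, so convexity with
    \<open>K = {}\<close> would confine every compact support to one \<open>L\<close>. A bump
    outside \<open>L\<close> refutes this; there is room for it because no nonempty open set is
    compact.\<close>
  obtain L where L: "compact L" "L <= X" "!!f. f \<in> cdist X ==>
    dsupp X (ddo X (rfl P) f) <= {} ==> dsupp X f <= L"
   using X(3) unfolding P_convex_for_supports_def by (metis compact_empty empty_subsetI)
  have "X ~= L"
  proof
   assume "X = L"
   hence "X = UNIV" using X(1,2) L(1) clopen[of X] compact_imp_closed by blast
   thus False using \<open>X = L\<close> L(1) compact_imp_bounded not_bounded_UNIV by blast
  qed
  then obtain x where x: "x \<in> X - L" using L(2) by blast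
  have oXL: "open (X - L)" using X(1) L(1) by (intro open_Diff compact_imp_closed)
  obtain h V where h: "h \<in> tf (X - L)" "{x} <= V" "!!x. x \<in> V ==> h x = 1"
   using cutoff_exists[of "{x}" "X - L"] oXL x by (metis compact_sing empty_subsetI insert_subset)
  have hX: "h \<in> tf X" using h(1) by (rule tf_mono) blast
  define f where "f = reg X h"
  have f: "f \<in> distributions X" unfolding f_def by (rule reg_distribution[OF L2_loc_int[OF test_L2[OF hX]]])
  have fv: "f g = (LI y. h y * g y)" if "g \<in> tf X" for g using that by (simp add: f_def reg_def)
  have cs: "compact (supp h)" "supp h <= X" using hX by (auto simp: tf_iff)
  have "dsupp X f <= supp h"
  proof (rule dsupp_subsetI)
   fix y assume y: "y \<in> X" "y \<notin> supp h"
   have "f g = 0" if g: "g \<in> tf (X - supp h)" for g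
   proof -
    have "h z * g z = 0" for z
     using g not_supp[of z h] not_supp[of z g] by (auto simp: tf_iff)
    hence "(LI z. h z * g z) = 0" by (simp only: integral_zero)
    thus ?thesis using fv[OF tf_mono[OF g Diff_subset]] by simp
   qed
   thus "\<exists>U. open U & y \<in> U & U <= X & vanishes f U"
    using y X(1) by (intro exI[of _ "X - supp h"]) (auto simp: vanishes_def)
  qed
  hence fc: "f \<in> cdist X"
   using f compact_dist_supportI[OF X(1) cs] by (simp add: compact_distributions_def)
  have "dsupp X (ddo X (rfl P) f) <= {}"
  proof (rule dsupp_subsetI)
   fix y assume y: "y \<in> X"
   have "ddo X (rfl P) f g = 0" if g: "g \<in> tf X" for g
   proof -
    have "diff_op P g = (%x. 0)" using op[of P g] tf_UNIV[OF g] True by auto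
    thus ?thesis unfolding ddo_eq[OF f g] by (simp add: distributions_0[OF f])
   qed
   thus "\<exists>U. open U & y \<in> U & U <= X & vanishes (ddo X (rfl P) f) U"
    using y X(1) by (intro exI[of _ X]) (auto simp: vanishes_def)
  qed
  from L(3)[OF fc this] have sL: "dsupp X f <= L" .
  have "supp (%x. cnj (h x)) <= supp h" by (rule supp_subset) (auto simp: not_supp)
  hence "f (%x. cnj (h x)) = 0"
   using sL h(1) by (intro dsupp_eq_0[OF f test_cnj[OF hX]]) (auto simp: tf_iff)
  hence "inn h h = 0" using fv[OF test_cnj[OF hX]] by (simp add: inn_def)
  hence "h x = 0"
   using L2_zero_imp_zero[OF test_continuous[OF hX] test_L2_integrable[OF hX], of x] unfolding inn_self nrm2_def by simp
  thus ?thesis using h(2,3) by auto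
 qed
qed

section \<open>Density in the function and distribution topologies\<close>

lemma sn_subset:
 assumes X: "open X" and K: "compact K'" "K' <= X" "K <= K'" "r <= r'" and f: "smooth_on X f"
 shows "sn K r f <= sn K' r' f"
proof (rule sn_le)
 show "cmod (multi_deriv a f x) <= sn K' r' f" if "x \<in> K" "mi_size a <= r" for a x
  using that K by (intro multi_deriv_le_seminorm[OF X K(1,2) f]) auto
qed (rule sn_nonneg[OF X K(1,2) f])

lemma sn_cmult:
 assumes X: "open X" and K: "compact K" "K <= X" and f: "smooth_on X f"
 shows "sn K r (%x. c * f x) = cmod c * sn K r f"
proof -
 have le: "sn K r (%x. a * g x) <= cmod a * sn K r g" if g: "smooth_on X g" for a g
 proof (rule sn_le)
  fix al :: "nat ^ 'a" and x assume x: "x \<in> K" and al: "mi_size al <= r"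
  have "multi_deriv al (%x. a * g x) x = a * multi_deriv al g x"
   unfolding multi_deriv_DL using x K by (intro DL_cmult[OF X g]) auto
  thus "cmod (multi_deriv al (%x. a * g x) x) <= cmod a * sn K r g"
   using multi_deriv_le_seminorm[OF X K g x al] by (simp add: norm_mult mult_left_mono)
 qed (simp add: sn_nonneg[OF X K g])
 show ?thesis
 proof (cases "c = 0")
  case False
  have "sn K r f <= cmod (1 / c) * sn K r (%x. c * f x)"
   using le[OF smooth_on_cmult[OF X f, of c], of "1 / c"] False by simp
  thus ?thesis using le[OF f, of c] False by (simp add: norm_divide field_simps)
 qed simp
qed

lemma smooth_kernelI:
 assumes X: "open X" and F: "smooth_on X F" "!!x. x \<in> X ==> diff_op P F x = 0"
 shows "restrict F X \<in> smooth_kernel P X"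
proof -
 have "smooth_on X (restrict F X)" using F(1) smooth_on_cong[OF X, of "restrict F X" F] by simp
 moreover have "diff_op P (restrict F X) x = 0" if "x \<in> X" for x
  using diff_op_cong[OF X that, of "restrict F X" F P] F(2)[OF that] by simp
 ultimately show ?thesis by (simp add: smooth_kernel_def smooth_funs_def smooth_on_def)
qed

lemma smooth_kernelD:
 "v \<in> smooth_kernel P X ==> smooth_on X v" "v \<in> smooth_kernel P X ==> x \<in> X ==> diff_op P v x = 0"
 "v \<in> smooth_kernel P X ==> v \<in> smooth_funs X"
 by (auto simp: smooth_kernel_def smooth_funs_def smooth_on_def)

text \<open>The topology is generated by balls around arbitrary centres; the triangle inequality
  recentres them at \<open>v\<close>, and a finite intersection is handled by the union of the
  compact sets and the larger order.\<close>

lemma smooth_topology_nbhd: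
 assumes Y: "open Y" and U: "openin (smooth_topology Y) U" and v: "v \<in> U"
 shows "\<exists>K r e. compact K & K <= Y & e > 0 & {g \<in> smooth_funs Y. sn K r (%x. g x - v x) < e} <= U & v \<in> smooth_funs Y"
proof -
 have sm: "smooth_on Y f" if "f \<in> smooth_funs Y" for f using that by (simp add: smooth_funs_def smooth_on_def)
 have "generate_topology_on {{g \<in> smooth_funs Y. sn K r (%x. g x - f x) < e} |f K r e.
    f \<in> smooth_funs Y & compact K & K <= Y & e > 0} U"
  using U by (simp add: smooth_topology_def openin_topology_generated_by_iff)
 thus ?thesis using v
 proof (induction arbitrary: v)
  case (Int A B)
  obtain K r e where A: "compact K" "K <= Y" "e > 0" "{g \<in> smooth_funs Y. sn K r (%x. g x - v x) < e} <= A" "v \<in> smooth_funs Y"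
   using Int.IH(1)[of v] Int.prems by auto
  obtain K' r' e' where B: "compact K'" "K' <= Y" "e' > 0" "{g \<in> smooth_funs Y. sn K' r' (%x. g x - v x) < e'} <= B"
   using Int.IH(2)[of v] Int.prems by auto
  have KK: "compact (K \<union> K')" "K \<union> K' <= Y" using A B by auto
  have "g \<in> A \<inter> B" if g: "g \<in> smooth_funs Y" "sn (K \<union> K') (max r r') (%x. g x - v x) < min e e'" for g
  proof -
   have s: "smooth_on Y (%x. g x - v x)" by (intro smooth_on_diff Y sm g A)
   have "sn K r (%x. g x - v x) < e" "sn K' r' (%x. g x - v x) < e'"
    using sn_subset[OF Y KK _ _ s, of K r "max r r'"] sn_subset[OF Y KK _ _ s, of K' r' "max r r'"] g(2) by auto
   thus ?thesis using A(4) B(4) g(1) by blast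
  qed
  thus ?case using KK A(3,5) B(3) by (intro exI[of _ "K \<union> K'"] exI[of _ "max r r'"] exI[of _ "min e e'"]) auto
 next
  case (Basis A)
  then obtain f K r e where A: "A = {g \<in> smooth_funs Y. sn K r (%x. g x - f x) < e}" "f \<in> smooth_funs Y" "compact K" "K <= Y" "e > 0"
   by blast
  have v: "v \<in> smooth_funs Y" "sn K r (%x. v x - f x) < e" using Basis.prems by (auto simp: A(1))
  have "g \<in> A" if g: "g \<in> smooth_funs Y" "sn K r (%x. g x - v x) < e - sn K r (%x. v x - f x)" for g
   using sn_triangle[OF Y A(3,4) smooth_on_diff[OF Y sm[OF g(1)] sm[OF v(1)]] smooth_on_diff[OF Y sm[OF v(1)] sm[OF A(2)]], of r] g
   by (simp add: A(1))
  thus ?case using A v by (intro exI[of _ K] exI[of _ r] exI[of _ "e - sn K r (%x. v x - f x)"]) auto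
 next
  case (UN \<U>)
  then obtain A where A: "A \<in> \<U>" "v \<in> A" by blast
  from UN.IH[OF this] A(1) show ?case by blast
 qed simp
qed

lemma smooth_dense_range:
 assumes X: "open X" and Y: "open Y" "Y <= X"
  and approx: "!!K v r ep. compact K ==> K <= Y ==> smooth_on Y v ==> (!!x. x \<in> Y ==> diff_op P v x = 0) ==> ep > 0 ==>
   \<exists>F. smooth_on X F & (\<forall>x\<in>X. diff_op P F x = 0) & sn K r (%x. F x - v x) < ep"
 shows "dense_range (smooth_kernel_topology P X) (smooth_kernel_topology P Y) (%f. restrict f Y)"
 unfolding dense_range_def topspace_smooth_kernel_topology
proof
 show sub: "(%f. restrict f Y) ` smooth_kernel P X <= smooth_kernel P Y"
 proof clarify
  fix f assume f: "f \<in> smooth_kernel P X"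
  show "restrict f Y \<in> smooth_kernel P Y"
   using smooth_kernelD[OF f] Y(2) smooth_on_subset by (intro smooth_kernelI[OF Y(1)]) auto
 qed
 show "smooth_kernel_topology P Y closure_of (%f. restrict f Y) ` smooth_kernel P X = smooth_kernel P Y"
 proof
  show "smooth_kernel_topology P Y closure_of (%f. restrict f Y) ` smooth_kernel P X <= smooth_kernel P Y"
   using closure_of_subset_topspace[of "smooth_kernel_topology P Y"] unfolding topspace_smooth_kernel_topology .
  show "smooth_kernel P Y <= smooth_kernel_topology P Y closure_of (%f. restrict f Y) ` smooth_kernel P X"
  proof
   fix v assume v: "v \<in> smooth_kernel P Y"
   have "\<exists>y\<in>(%f. restrict f Y) ` smooth_kernel P X. y \<in> T" if T: "v \<in> T" "openin (smooth_kernel_topology P Y) T" for T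
   proof -
    obtain U where U: "openin (smooth_topology Y) U" "T = U \<inter> smooth_kernel P Y"
     using T(2) by (auto simp: smooth_kernel_topology_def openin_subtopology)
    obtain K r e where K: "compact K" "K <= Y" "e > 0" "{g \<in> smooth_funs Y. sn K r (%x. g x - v x) < e} <= U"
     using smooth_topology_nbhd[OF Y(1) U(1), of v] T(1) U(2) by blast
    obtain F where F: "smooth_on X F" "\<forall>x\<in>X. diff_op P F x = 0" "sn K r (%x. F x - v x) < e"
     using approx[OF K(1,2) smooth_kernelD(1,2)[OF v] K(3)] by blast
    have FX: "restrict F X \<in> smooth_kernel P X" using F by (intro smooth_kernelI[OF X]) auto
    have eq: "restrict (restrict F X) Y = restrict F Y" using Y(2) by (auto simp: restrict_def fun_eq_iff)
    have FY: "restrict F Y \<in> smooth_kernel P Y" using sub FX unfolding eq[symmetric] by blast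
    have "sn K r (%x. restrict F Y x - v x) = sn K r (%x. F x - v x)"
     by (rule sn_cong[OF Y(1) K(2)]) simp
    hence "restrict F Y \<in> T" using F(3) K(4) smooth_kernelD(3)[OF FY] FY U(2) by auto
    thus ?thesis using FX eq by (metis imageI)
   qed
   thus "v \<in> smooth_kernel_topology P Y closure_of (%f. restrict f Y) ` smooth_kernel P X"
    using v by (auto simp: in_closure_of topspace_smooth_kernel_topology)
  qed
 qed
qed

text \<open>Otherwise there are points \<open>x n\<close> leaving every compact set at which members of \<open>B\<close> do not vanish, and a weighted sum of point evaluations is an unbounded seminorm.\<close>

lemma bounded_test_set_support:
 assumes Y: "open Y" and B: "bounded_test_set Y B"
 obtains K where "compact K" "K <= Y" "!!f. f \<in> B ==> supp f <= K"
proof (rule ccontr)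
 note main = that
 assume "\<not> thesis"
 hence no: "\<exists>f\<in>B. \<not> supp f <= K" if "compact K" "K <= Y" for K using main[OF that] by blast
 obtain C where C: "!!n. compact (C n)" "!!n. C n <= Y" "!!n. C n <= interior (C (Suc n))" "\<Union>(range C) = Y"
  "!!K. compact K ==> K <= Y ==> \<exists>N. \<forall>n\<ge>N. K <= C n"
  using open_Union_compact_subsets[OF Y] by metis
 have "\<exists>f x. f \<in> B & x \<notin> C n & f x ~= 0" for n
 proof -
  obtain f where f: "f \<in> B" "\<not> supp f <= C n" using no[OF C(1)[of n] C(2)[of n]] by blast
  have "\<exists>x. x \<notin> C n & f x ~= 0"
  proof (rule ccontr)
   assume "\<not> ?thesis"
   hence "supp f <= C n" by (intro supp_subset compact_imp_closed C) blast
   thus False using f(2) by contradiction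
  qed
  thus ?thesis using f(1) by blast
 qed
 then obtain f x where f: "!!n. f n \<in> B" "!!n. x n \<notin> C n" "!!n. f n (x n) ~= 0" by metis
 \<comment> \<open>Weights that make the summand of index \<open>n\<close> equal to \<open>n\<close>
   at \<open>f n\<close>.\<close>
 define c where "c n = real n / cmod (f n (x n))" for n
 have c0: "c n \<ge> 0" for n by (simp add: c_def)
 define p where "p g = suminf (%n. c n * cmod (g (x n)))" for g
 \<comment> \<open>The points leave every compact set, so on functions supported in \<open>K\<close>
   the series is a finite sum; this gives both its convergence and the continuity of
   \<open>p\<close>.\<close>
 have fin: "\<exists>N. \<forall>g. supp g <= K --> (\<forall>n. n \<notin> {..<N} --> c n * cmod (g (x n)) = 0)" if K: "compact K" "K <= Y" for K
 proof -
  obtain N where N: "!!n. n \<ge> N ==> K <= C n" using C(5)[OF K] by blast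
  have "g (x n) = 0" if "supp g <= K" "n \<notin> {..<N}" for g n
   using N[of n] that f(2)[of n] by (intro not_supp) auto
  thus ?thesis by auto
 qed
 have su: "summable (%n. c n * cmod (g (x n)))" if t: "g \<in> tf Y" for g
 proof -
  obtain N where "\<forall>n. n \<notin> {..<N} --> c n * cmod (g (x n)) = 0"
   using fin[of "supp g"] t unfolding tf_iff by blast
  thus ?thesis by (intro summable_finite[of "{..<N}"]) auto
 qed
 have "continuous_test_seminorm Y p"
  unfolding continuous_test_seminorm_def
 proof (intro conjI ballI allI impI)
  fix g s assume t: "g \<in> tf Y" "s \<in> tf Y"
  have "p (%x. g x + s x) <= suminf (%n. c n * cmod (g (x n)) + c n * cmod (s (x n)))"
   unfolding p_def
  proof (intro suminf_le su test_add t summable_add)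
   show "c n * cmod (g (x n) + s (x n)) <= c n * cmod (g (x n)) + c n * cmod (s (x n))" for n
    using mult_left_mono[OF norm_triangle_ineq c0] by (simp add: distrib_left)
  qed
  also have "... = p g + p s" unfolding p_def by (rule suminf_add[OF su su, symmetric]) (rule t)+
  finally show "p (%x. g x + s x) <= p g + p s" .
 next
  fix g k assume t: "g \<in> tf Y"
  show "p (%x. k * g x) = cmod k * p g"
   unfolding p_def using suminf_mult[OF su[OF t], of "cmod k"] by (simp add: norm_mult mult.left_commute)
 next
  fix K assume K: "compact K & K <= Y"
  obtain N where N: "!!g n. supp g <= K ==> n \<notin> {..<N} ==> c n * cmod (g (x n)) = 0" using fin K by metis
  have "p g <= (\<Sum>n<N. c n) * sn K 0 g" if t: "g \<in> tf Y" "supp g <= K" for g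
  proof -
   have "p g = (\<Sum>n<N. c n * cmod (g (x n)))" unfolding p_def by (rule suminf_finite) (use N[OF t(2)] in auto)
   also have "... <= (\<Sum>n<N. c n * sn K 0 g)"
    using K t by (intro sum_mono mult_left_mono test_le_seminorm[OF t(1)] c0) auto
   finally show ?thesis by (simp add: sum_distrib_right)
  qed
  thus "\<exists>C r. \<forall>f\<in>tf Y. supp f <= K --> p f <= C * sn K r f" by blast
 qed
 then obtain M where M: "!!g. g \<in> B ==> p g <= M" using B unfolding bounded_test_set_def by blast
 obtain n where n: "M < real n" using reals_Archimedean2 by blast
 have t: "f n \<in> tf Y" using f(1) B by (auto simp: bounded_test_set_def)
 have "real n = c n * cmod (f n (x n))" using f(3)[of n] by (simp add: c_def)
 also have "... = (\<Sum>i\<in>{n}. c i * cmod (f n (x i)))" by simp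
 also have "... <= p (f n)" unfolding p_def by (rule sum_le_suminf[OF su[OF t]]) (auto simp: c0)
 also have "... <= M" by (rule M[OF f(1)])
 finally show False using n by simp
qed

lemma continuous_test_seminorm_smooth:
 assumes Y: "open Y" and K: "compact K" "K <= Y"
 shows "continuous_test_seminorm Y (sn K r)"
 unfolding continuous_test_seminorm_def
proof (intro conjI ballI allI impI)
 fix f g assume t: "f \<in> tf Y" "g \<in> tf Y"
 show "sn K r (%x. f x + g x) <= sn K r f + sn K r g"
  by (rule sn_triangle[OF open_UNIV K(1) subset_UNIV test_smooth[OF t(1)] test_smooth[OF t(2)]])
next
 fix f c assume t: "f \<in> tf Y"
 show "sn K r (%x. c * f x) = cmod c * sn K r f"
  by (rule sn_cmult[OF open_UNIV K(1) subset_UNIV test_smooth[OF t]])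
next
 fix K' assume K': "compact K' & K' <= Y"
 have "sn K r f <= 1 * sn K' r f" if t: "f \<in> tf Y" "supp f <= K'" for f
 proof (rule sn_le)
  note s = test_smooth[OF t(1)]
  have 0: "0 <= sn K' r f" using K' by (intro sn_nonneg[OF open_UNIV _ subset_UNIV s]) auto
  thus "0 <= 1 * sn K' r f" by simp
  fix al :: "nat ^ 'a" and x assume "x \<in> K" and al: "mi_size al <= r"
  show "cmod (multi_deriv al f x) <= 1 * sn K' r f"
  proof (cases "x \<in> K'")
   case True
   thus ?thesis using multi_deriv_le_seminorm[OF open_UNIV _ subset_UNIV s True al] K' by simp
  next
   case False
   hence "multi_deriv al f x = 0" unfolding multi_deriv_DL using t(2) by (intro DL_outside_support) blast
   thus ?thesis using 0 by simp
  qed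
 qed
 thus "\<exists>C r'. \<forall>f\<in>tf Y. supp f <= K' --> sn K r f <= C * sn K' r' f" by blast
qed

text \<open>The modulus of the difference of two distributions is itself a continuous seminorm on
  test functions, hence bounded on \<open>B\<close>; only then is the supremum in
  \<open>strong_seminorm\<close> meaningful.\<close>

lemma strong_seminorm_bdd:
 assumes u: "u \<in> distributions Y" and v: "v \<in> distributions Y" and B: "bounded_test_set Y B"
 shows "bdd_above (insert 0 {cmod (v f - u f) |f. f \<in> B})"
proof -
 define p where "p f = cmod (v f - u f)" for f
 have "continuous_test_seminorm Y p"
  unfolding continuous_test_seminorm_def
 proof (intro conjI ballI allI impI)
  fix f g assume t: "f \<in> tf Y" "g \<in> tf Y"
  show "p (%x. f x + g x) <= p f + p g"
   unfolding p_def distributions_add[OF u t] distributions_add[OF v t] add_diff_add by (rule norm_triangle_ineq)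
  show "p (%x. c * f x) = cmod c * p f" for c
   unfolding p_def distributions_cmult[OF u t(1)] distributions_cmult[OF v t(1)] by (simp add: norm_mult right_diff_distrib[symmetric])
 next
  fix K assume K: "compact K & K <= Y"
  obtain C r where C: "C \<ge> 0" "!!f. f \<in> tf Y ==> supp f <= K ==> cmod (u f) <= C * sn K r f"
   using distributions_bound[OF u] K by blast
  obtain C' r' where C': "C' \<ge> 0" "!!f. f \<in> tf Y ==> supp f <= K ==> cmod (v f) <= C' * sn K r' f"
   using distributions_bound[OF v] K by blast
  have "p f <= (C + C') * sn K (max r r') f" if t: "f \<in> tf Y" "supp f <= K" for f
  proof -
   have m: "sn K r f <= sn K (max r r') f" "sn K r' f <= sn K (max r r') f"
    using K by (auto intro!: sn_mono[OF test_smooth[OF t(1)]])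
   have "p f <= cmod (v f) + cmod (u f)" unfolding p_def by (rule norm_triangle_ineq4)
   also have "... <= C' * sn K (max r r') f + C * sn K (max r r') f"
    using C(2)[OF t] C'(2)[OF t] mult_left_mono[OF m(1) C(1)] mult_left_mono[OF m(2) C'(1)] by linarith
   finally show ?thesis by (simp add: algebra_simps)
  qed
  thus "\<exists>C r. \<forall>f\<in>tf Y. supp f <= K --> p f <= C * sn K r f" by blast
 qed
 then obtain M where "\<forall>f\<in>B. p f <= M" using B unfolding bounded_test_set_def by blast
 thus ?thesis by (intro bdd_aboveI[of _ "max 0 M"]) (auto simp: p_def le_max_iff_disj)
qed

lemma strong_seminorm_le:
 "0 <= c ==> (!!f. f \<in> B ==> cmod (w f) <= c) ==> strong_seminorm B w <= c"
 unfolding strong_seminorm_def by (rule cSup_least) auto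

lemma le_strong_seminorm:
 assumes "u \<in> distributions Y" "v \<in> distributions Y" "bounded_test_set Y B"
 shows "f \<in> B ==> cmod (v f - u f) <= strong_seminorm B (%f. v f - u f)" "0 <= strong_seminorm B (%f. v f - u f)"
 unfolding strong_seminorm_def using strong_seminorm_bdd[OF assms] by (auto intro!: cSup_upper)

text \<open>Balls are recentred by the triangle inequality as for smooth functions; here an
  intersection is handled by the union of two bounded sets, which is bounded again.\<close>

lemma strong_topology_nbhd:
 assumes U: "openin (strong_topology Y) U" and v: "v \<in> U"
 shows "\<exists>B e. bounded_test_set Y B & e > 0 & {w \<in> distributions Y. strong_seminorm B (%f. w f - v f) < e} <= U & v \<in> distributions Y"
proof -
 have "generate_topology_on {{w \<in> distributions Y. strong_seminorm B (%f. w f - u f) < e} |u B e.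
    u \<in> distributions Y & bounded_test_set Y B & e > 0} U"
  using U by (simp add: strong_topology_def openin_topology_generated_by_iff)
 thus ?thesis using v
 proof (induction arbitrary: v)
  case (Int A A')
  obtain B e where A: "bounded_test_set Y B" "e > 0" "{w \<in> distributions Y. strong_seminorm B (%f. w f - v f) < e} <= A" "v \<in> distributions Y"
   using Int.IH(1) Int.prems by blast
  obtain B' e' where A': "bounded_test_set Y B'" "e' > 0" "{w \<in> distributions Y. strong_seminorm B' (%f. w f - v f) < e'} <= A'"
   using Int.IH(2) Int.prems by blast
  have BB: "bounded_test_set Y (B \<union> B')"
   unfolding bounded_test_set_def
  proof (intro conjI allI impI)
   show "B \<union> B' <= tf Y" using A(1) A'(1) by (auto simp: bounded_test_set_def)
   fix p assume "continuous_test_seminorm Y p"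
   then obtain M M' where "\<forall>f\<in>B. p f <= M" "\<forall>f\<in>B'. p f <= M'" using A(1) A'(1) unfolding bounded_test_set_def by blast
   thus "\<exists>M. \<forall>f\<in>B \<union> B'. p f <= M" by (intro exI[of _ "max M M'"]) (auto simp: le_max_iff_disj)
  qed
  have "w \<in> A \<inter> A'" if w: "w \<in> distributions Y" "strong_seminorm (B \<union> B') (%f. w f - v f) < min e e'" for w
  proof -
   have "strong_seminorm B (%f. w f - v f) <= strong_seminorm (B \<union> B') (%f. w f - v f)"
    "strong_seminorm B' (%f. w f - v f) <= strong_seminorm (B \<union> B') (%f. w f - v f)"
    by (intro strong_seminorm_le le_strong_seminorm[OF A(4) w(1) BB]; blast)+
   thus ?thesis using w A(3) A'(3) by auto
  qed
  thus ?case using BB A(2,4) A'(2) by (intro exI[of _ "B \<union> B'"] exI[of _ "min e e'"]) auto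
 next
  case (Basis A)
  then obtain u B e where A: "A = {w \<in> distributions Y. strong_seminorm B (%f. w f - u f) < e}" "u \<in> distributions Y" "bounded_test_set Y B" "e > 0"
   by blast
  have v: "v \<in> distributions Y" "strong_seminorm B (%f. v f - u f) < e" using Basis.prems by (auto simp: A(1))
  have "w \<in> A" if w: "w \<in> distributions Y" "strong_seminorm B (%f. w f - v f) < e - strong_seminorm B (%f. v f - u f)" for w
  proof -
   have "strong_seminorm B (%f. w f - u f) <= strong_seminorm B (%f. w f - v f) + strong_seminorm B (%f. v f - u f)"
   proof (rule strong_seminorm_le)
    show "0 <= strong_seminorm B (%f. w f - v f) + strong_seminorm B (%f. v f - u f)"
     by (intro add_nonneg_nonneg le_strong_seminorm(2)[OF _ _ A(3)] v w A(2))
    fix f assume f: "f \<in> B"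
    have "cmod (w f - u f) <= cmod (w f - v f) + cmod (v f - u f)" using norm_triangle_ineq[of "w f - v f" "v f - u f"] by simp
    thus "cmod (w f - u f) <= strong_seminorm B (%f. w f - v f) + strong_seminorm B (%f. v f - u f)"
     using le_strong_seminorm(1)[OF v(1) w(1) A(3) f] le_strong_seminorm(1)[OF A(2) v(1) A(3) f] by linarith
   qed
   thus ?thesis using w by (simp add: A(1))
  qed
  thus ?case using A v by (intro exI[of _ B] exI[of _ "e - strong_seminorm B (%f. v f - u f)"]) auto
 next
  case (UN \<U>)
  then obtain A where A: "A \<in> \<U>" "v \<in> A" by blast
  from UN.IH[OF this] A(1) show ?case by blast
 qed simp
qed

lemma restrict_distribution:
 assumes u: "u \<in> distributions X" and Y: "Y <= X"
 shows "restrict u (tf Y) \<in> distributions Y"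
proof -
 have sub: "f \<in> tf X" if "f \<in> tf Y" for f using that Y by (rule tf_mono)
 have "\<exists>C r. \<forall>f\<in>tf Y. supp f <= K --> cmod (restrict u (tf Y) f) <= C * sn K r f"
  if "compact K" "K <= Y" for K
 proof -
  have "K <= X" using that(2) Y by blast
  from distributions_bound[OF u that(1) this] show ?thesis using sub by (metis restrict_apply')
 qed
 thus ?thesis
  unfolding distributions_def by (auto simp: test_add test_cmult distributions_add[OF u] distributions_cmult[OF u] sub)
qed

lemma restrict_dist_kernel:
 assumes u: "u \<in> dist_kernel P X" and Y: "Y <= X"
 shows "restrict u (tf Y) \<in> dist_kernel P Y"
proof -
 have uX: "u \<in> distributions X" using u by (simp add: dist_kernel_def)
 have "ddo Y P (restrict u (tf Y)) f = 0" if f: "f \<in> tf Y" for f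
 proof -
  have fX: "f \<in> tf X" using f Y by (rule tf_mono)
  have "ddo Y P (restrict u (tf Y)) f = u (diff_op (rfl P) f)"
   unfolding ddo_eq[OF restrict_distribution[OF uX Y] f] using test_diff_op[OF f] by simp
  also have "... = ddo X P u f" by (rule ddo_eq[OF uX fX, symmetric])
  also have "... = 0" using u fX by (simp add: dist_kernel_def)
  finally show ?thesis .
 qed
 thus ?thesis using restrict_distribution[OF uX Y] by (simp add: dist_kernel_def)
qed

lemma reg_dist_kernel:
 assumes X: "open X" and F: "smooth_on X F" "!!x. x \<in> X ==> diff_op P F x = 0"
 shows "reg X F \<in> dist_kernel P X"
proof -
 have d: "reg X F \<in> distributions X" by (rule reg_distribution[OF loc_int_continuous[OF smooth_on_imp_continuous[OF F(1)]]])
 have "ddo X P (reg X F) f = 0" if f: "f \<in> tf X" for f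
 proof -
  have "diff_op P F x * f x = 0" for x
   using F(2)[of x] f not_supp[of x f] by (auto simp: tf_iff)
  hence "(LI x. diff_op P F x * f x) = 0" by (simp only: integral_zero)
  thus ?thesis
   unfolding ddo_eq[OF d f] integral_diff_op[OF X F(1) f] using test_diff_op[OF f] by (simp add: reg_def)
 qed
 thus ?thesis using d by (simp add: dist_kernel_def)
qed

text \<open>The members of \<open>B\<close> have supports in one compact \<open>K\<close> and common
  bounds for their derivatives. Hence \<open>u\<close> can be replaced on \<open>B\<close> by a
  mollification \<open>v\<close>, a smooth solution near \<open>L\<close>, with error
  \<open>ep / 2\<close>, and \<open>v\<close> by a solution on \<open>X\<close> with the same
  error.\<close>

lemma dist_kernel_approximation:
 assumes X: "open X" and Y: "open Y" "Y <= X"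
  and approx: "!!K. compact K ==> K <= Y ==> \<exists>L. compact L & K <= L & L <= Y & (\<forall>V v r ep. open V --> L <= V --> V <= Y --> smooth_on V v -->
   (\<forall>x\<in>V. diff_op P v x = 0) --> ep > 0 --> (\<exists>F. smooth_on X F & (\<forall>x\<in>X. diff_op P F x = 0) & sn K r (%x. F x - v x) < ep))"
  and u: "u \<in> dist_kernel P Y" and B: "bounded_test_set Y B" and ep: "ep > 0"
 obtains F where "smooth_on X F" "!!x. x \<in> X ==> diff_op P F x = 0" "!!f. f \<in> B ==> cmod (reg X F f - u f) <= ep"
proof -
 let ?Q = "rfl P"
 have uY: "u \<in> distributions Y" using u by (simp add: dist_kernel_def)
 have BY: "f \<in> tf Y" if "f \<in> B" for f using that B by (auto simp: bounded_test_set_def)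
 obtain K where K: "compact K" "K <= Y" "!!f. f \<in> B ==> supp f <= K"
  using bounded_test_set_support[OF Y(1) B] by blast
 obtain L where L: "compact L" "K <= L" "L <= Y" "!!V v r ep. open V ==> L <= V ==> V <= Y ==> smooth_on V v ==>
   (\<forall>x\<in>V. diff_op P v x = 0) ==> ep > 0 ==> \<exists>F. smooth_on X F & (\<forall>x\<in>X. diff_op P F x = 0) & sn K r (%x. F x - v x) < ep"
  using approx[OF K(1,2)] by blast
 obtain C d r where C: "C \<ge> 0" "d > 0"
  "!!f e M. f \<in> tf Y ==> supp f <= K ==> 0 < e ==> e <= d ==>
   (!!vs y. length vs <= r + 1 ==> (!!v. v \<in> set vs ==> norm v <= 1) ==> cmod (DL vs f y) <= M) ==>
   cmod ((LI x. f x * u (%y. moll e (x - y))) - u f) <= C * (M * e)"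
  using mollify_approx[OF uY Y(1) K(1,2)] by blast
 obtain M0 where M0: "!!f. f \<in> B ==> sn K (r + 1) f <= M0"
  using B continuous_test_seminorm_smooth[OF Y(1) K(1,2), of "r + 1"] unfolding bounded_test_set_def by blast
 define M where "M = real CARD('a) ^ (r + 1) * \<bar>M0\<bar> + 1"
 have M: "M > 0" by (simp add: M_def add_nonneg_pos)
 have DM: "cmod (DL vs f y) <= M" if f: "f \<in> B" and vs: "length vs <= r + 1" "!!v. v \<in> set vs ==> norm v <= 1" for f vs y
 proof (cases "y \<in> K")
  case True
  have "cmod (DL vs f y) <= real CARD('a) ^ length vs * sn K (r + 1) f"
   by (rule DL_le_seminorm[OF open_UNIV K(1) subset_UNIV test_smooth[OF BY[OF f]] True vs])
  also have "... <= real CARD('a) ^ (r + 1) * \<bar>M0\<bar>"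
   using M0[OF f] vs(1) sn_nonneg[OF open_UNIV K(1) subset_UNIV test_smooth[OF BY[OF f]]]
   by (intro mult_mono power_increasing) auto
  finally show ?thesis by (simp add: M_def)
 next
  case False
  hence "DL vs f y = 0" using K(3)[OF f] by (intro DL_outside_support) blast
  thus ?thesis using M by simp
 qed
 obtain d0 L' where d0: "d0 > 0" "compact L'" "L' <= Y" "!!x y. x \<in> L ==> norm y <= d0 ==> x - y \<in> L'" "L <= L'"
  using compact_enlargement[OF L(1) Y(1) L(3)] by blast
 \<comment> \<open>\<open>d\<close> is the range of \<open>mollify_approx\<close>,
   \<open>d0 / 2\<close> keeps the kernels inside \<open>Y\<close>, and the last term makes
   \<open>C * (M * e)\<close> at most \<open>ep / 2\<close>.\<close>
 define e where "e = min (min d (d0 / 2)) (ep / (2 * (C + 1) * M))"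
 have e: "0 < e" using C(1,2) d0(1) ep M by (auto simp: e_def)
 have ed: "e <= d" "e <= d0 / 2" unfolding e_def min.assoc by (rule min.cobounded1, rule order_trans[OF min.cobounded2 min.cobounded1])
 have eC: "C * (M * e) <= ep / 2"
 proof -
  have k: "2 * (C + 1) * M > 0" using C(1) M by simp
  have "e <= ep / (2 * (C + 1) * M)" unfolding e_def by (rule min.cobounded2)
  hence "e * (2 * (C + 1) * M) <= ep" using k by (simp only: pos_le_divide_eq)
  moreover have "0 <= M * e" using M e by simp
  ultimately show ?thesis by (simp add: algebra_simps)
 qed
 define V where "V = (\<Union>m\<in>L. ball m (d0 / 2))"
 have V: "open V" "L <= V" using d0(1) by (auto simp: V_def)
 have VY: "x - y \<in> Y" if x: "x \<in> V" and y: "norm y <= d0 / 2" for x y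
 proof -
  obtain m where m: "m \<in> L" "dist m x < d0 / 2" using x by (auto simp: V_def)
  have "norm (m - x + y) <= d0" using norm_triangle_ineq[of "m - x" y] m(2) y by (simp add: dist_norm)
  hence "m - (m - x + y) \<in> L'" by (rule d0(4)[OF m(1)])
  thus ?thesis using d0(3) by (auto simp: algebra_simps)
 qed
 have "V <= Y" using VY[of _ 0] d0(1) by auto
 have ms: "x - y \<in> Y" if "x \<in> V" "y \<in> supp (moll e)" for x y
  using that moll_support[OF e] ed(2) by (intro VY) fastforce+
 define v where "v = (%x. u (%y. moll e (x - y)))"
 have vs: "smooth_on V v" unfolding v_def by (rule mollify_smooth(1)[OF uY moll_test[OF e] V(1) ms])
 have Pv: "\<forall>x\<in>V. diff_op P v x = 0"
 proof
  fix x assume x: "x \<in> V"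
  have t: "(%y. moll e (x - y)) \<in> tf Y" using ms[OF x] by (intro trans_test moll_test e)
  have "diff_op P v x = ddo Y P u (%y. moll e (x - y))"
   unfolding v_def ddo_eq[OF uY t] by (rule diff_op_mollify[OF uY moll_test[OF e] V(1) ms x])
  thus "diff_op P v x = 0" using u t by (simp add: dist_kernel_def)
 qed
 \<comment> \<open>The pairing of \<open>F - v\<close> with \<open>f\<close> is at most the measure
   of \<open>K\<close> times the uniform error times \<open>M\<close>; the summand 1 avoids division
   by zero when \<open>K\<close> is a null set.\<close>
 define ep1 where "ep1 = ep / (2 * (measure lborel K + 1) * M)"
 have ep1: "ep1 > 0" using ep M by (auto simp: ep1_def intro!: divide_pos_pos mult_pos_pos add_nonneg_pos)
 obtain F where F: "smooth_on X F" "\<forall>x\<in>X. diff_op P F x = 0" "sn K 0 (%x. F x - v x) < ep1"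
  using L(4)[OF V \<open>V <= Y\<close> vs Pv ep1, of 0] by blast
 show ?thesis
 proof (rule that[OF F(1)])
  fix f assume f: "f \<in> B"
  have KV: "K <= V" using L(2) V(2) by blast
  have fX: "f \<in> tf X" using BY[OF f] Y(2) by (rule tf_mono)
  have fV: "f \<in> tf V" using BY[OF f] K(3)[OF f] KV by (auto simp: tf_iff)
  have FV: "smooth_on V F" using F(1) \<open>V <= Y\<close> Y(2) by (intro smooth_on_subset[OF F(1)]) blast
  note ds = smooth_on_diff[OF V(1) FV vs]
  have li: "loc_int V F" "loc_int V v" "loc_int V (%x. F x - v x)"
   by (intro loc_int_continuous smooth_on_imp_continuous FV vs ds)+
  have "cmod (LI x. (F x - v x) * f x) <= (LI x. cmod (indicator K x *\<^sub>R (F x - v x))) * M"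
   using DM[OF f, of "[]"] by (intro loc_int_test(2)[OF li(3) fV K(1) KV K(3)[OF f]]) auto
  also have "(LI x. cmod (indicator K x *\<^sub>R (F x - v x))) <= (LI x. indicator K x *\<^sub>R ep1)"
  proof (rule lint_mono)
   show "integrable lborel (%x. cmod (indicator K x *\<^sub>R (F x - v x)))"
    using li(3) K(1) KV by (intro integrable_norm) (auto simp: loc_int_def)
   show "integrable lborel (%x. indicator K x *\<^sub>R ep1)" by (intro borel_integrable_compact K continuous_on_const)
   fix x
   have "cmod (F x - v x) <= ep1" if "x \<in> K"
    using DL_axes_le_seminorm[OF V(1) K(1) KV ds that, of "[]" 0] F(3) by simp
   thus "cmod (indicator K x *\<^sub>R (F x - v x)) <= indicator K x *\<^sub>R ep1" by (cases "x \<in> K") auto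
  qed
  also have "(LI x. indicator K x *\<^sub>R ep1) * M = (measure lborel K * M) * ep1" by (simp add: mult_ac)
  also have "... <= ((measure lborel K + 1) * M) * ep1" using M ep1 by (intro mult_right_mono) auto
  also have "... = ep / 2"
  proof -
   have "(a * M) * (ep / (2 * a * M)) = ep / 2" if "a > 0" for a using that M by simp
   from this[of "measure lborel K + 1"] show ?thesis by (simp add: ep1_def add_nonneg_pos)
  qed
  finally have 1: "cmod (LI x. (F x - v x) * f x) <= ep / 2" using M by (simp add: mult_right_mono)
  have "cmod ((LI x. f x * v x) - u f) <= C * (M * e)"
   unfolding v_def by (rule C(3)[OF BY[OF f] K(3)[OF f] e ed(1)]) (rule DM[OF f])
  hence 2: "cmod ((LI x. v x * f x) - u f) <= ep / 2" using eC by (simp add: mult.commute)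
  have "reg X F f - u f = (LI x. (F x - v x) * f x) + ((LI x. v x * f x) - u f)"
   using loc_int_test(1)[OF li(1) fV] loc_int_test(1)[OF li(2) fV] fX by (simp add: reg_def left_diff_distrib)
  hence "cmod (reg X F f - u f) <= cmod (LI x. (F x - v x) * f x) + cmod ((LI x. v x * f x) - u f)"
   by (simp only: norm_triangle_ineq)
  thus "cmod (reg X F f - u f) <= ep" using 1 2 by linarith
 qed (use F(2) in blast)
qed

lemma dist_dense_range:
 assumes X: "open X" and Y: "open Y" "Y <= X"
  and approx: "!!K. compact K ==> K <= Y ==> \<exists>L. compact L & K <= L & L <= Y & (\<forall>V v r ep. open V --> L <= V --> V <= Y --> smooth_on V v -->
   (\<forall>x\<in>V. diff_op P v x = 0) --> ep > 0 --> (\<exists>F. smooth_on X F & (\<forall>x\<in>X. diff_op P F x = 0) & sn K r (%x. F x - v x) < ep))"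
 shows "dense_range (dist_kernel_topology P X) (dist_kernel_topology P Y) (%u. restrict u (tf Y))"
 unfolding dense_range_def topspace_dist_kernel_topology
proof
 let ?r = "%u. restrict u (tf Y)"
 show "?r ` dist_kernel P X <= dist_kernel P Y" using restrict_dist_kernel[OF _ Y(2)] by blast
 show "dist_kernel_topology P Y closure_of ?r ` dist_kernel P X = dist_kernel P Y"
 proof
  show "dist_kernel_topology P Y closure_of ?r ` dist_kernel P X <= dist_kernel P Y"
   using closure_of_subset_topspace[of "dist_kernel_topology P Y"] unfolding topspace_dist_kernel_topology .
  show "dist_kernel P Y <= dist_kernel_topology P Y closure_of ?r ` dist_kernel P X"
  proof
   fix u assume u: "u \<in> dist_kernel P Y"
   have "\<exists>y\<in>?r ` dist_kernel P X. y \<in> T" if T: "u \<in> T" "openin (dist_kernel_topology P Y) T" for T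
   proof -
    obtain U where U: "openin (strong_topology Y) U" "T = U \<inter> dist_kernel P Y"
     using T(2) by (auto simp: dist_kernel_topology_def openin_subtopology)
    obtain B e where B: "bounded_test_set Y B" "e > 0" "{w \<in> distributions Y. strong_seminorm B (%f. w f - u f) < e} <= U"
     using strong_topology_nbhd[OF U(1), of u] T(1) U(2) by blast
    have e2: "e / 2 > 0" using B(2) by simp
    obtain F where F: "smooth_on X F" "!!x. x \<in> X ==> diff_op P F x = 0" "!!f. f \<in> B ==> cmod (reg X F f - u f) <= e / 2"
     using dist_kernel_approximation[OF X Y approx u B(1) e2] by blast
    have k: "reg X F \<in> dist_kernel P X" by (rule reg_dist_kernel[OF X F(1,2)])
    have rk: "?r (reg X F) \<in> dist_kernel P Y" by (rule restrict_dist_kernel[OF k Y(2)])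
    have "strong_seminorm B (%f. ?r (reg X F) f - u f) <= e / 2"
    proof (rule strong_seminorm_le)
     fix f assume f: "f \<in> B"
     hence "f \<in> tf Y" using B(1) by (auto simp: bounded_test_set_def)
     thus "cmod (?r (reg X F) f - u f) <= e / 2" using F(3)[OF f] by simp
    qed (use B(2) in simp)
    hence "?r (reg X F) \<in> T" using B(2,3) rk U(2) by (auto simp: dist_kernel_def)
    thus ?thesis using k by blast
   qed
   thus "u \<in> dist_kernel_topology P Y closure_of ?r ` dist_kernel P X"
    using u by (auto simp: in_closure_of topspace_dist_kernel_topology)
  qed
 qed
qed

theorem theorem3p3:
  fixes P :: "'d::finite mpoly" and W X Y :: "(real ^ 'd) set"
  assumes "subspace W"
    and "acts_along P W"
    and "elliptic_on P W"
    and "open X" and "open Y" and "Y \<subseteq> X"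
    and "P_convex_for_supports P X"
    and "\<not> (\<exists>x C. C \<in> components ((UNIV - Y) \<inter> (\<lambda>w. x + w) ` W) \<and> compact C \<and> C \<subseteq> X)"
  shows "P_convex_for_supports P Y \<and>
    dense_range (smooth_kernel_topology P X) (smooth_kernel_topology P Y) (\<lambda>f. restrict f Y) \<and>
    dense_range (dist_kernel_topology P X) (dist_kernel_topology P Y) (\<lambda>u. restrict u (test_funs Y))"
proof -
 let ?Q = "rfl P"
 have hullY: "\<exists>L. compact L & L <= Y & (\<forall>f\<in>cdist X. dsupp X (ddo X ?Q f) <= K --> dsupp X f <= L)"
  if "compact K" "K <= Y" for K
  using support_hull[OF assms that] by metis
 \<comment> \<open>For \<open>Z = X\<close> this is the convexity hypothesis itself, for
   \<open>Z = Y\<close> it is \<open>support_hull\<close>.\<close>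
 have hull: "\<exists>L. compact L & L <= Z & (\<forall>f\<in>cdist X. dsupp X (ddo X ?Q f) <= K --> dsupp X f <= L)"
  if "Z \<in> {X, Y}" "compact K" "K <= Z" for Z K
  using that hullY[of K] assms(7) unfolding P_convex_for_supports_def by blast
 have approx: "\<exists>L. compact L & K <= L & L <= Y & (\<forall>V v r \<epsilon>. open V --> L <= V --> V <= Y --> smooth_on V v -->
   (\<forall>x\<in>V. diff_op P v x = 0) --> \<epsilon> > 0 --> (\<exists>F. smooth_on X F & (\<forall>x\<in>X. diff_op P F x = 0) & sn K r (%x. F x - v x) < \<epsilon>))"
  if K: "compact K" "K <= Y" for K
 \<comment> \<open>\<open>coercive_on_compacts\<close> asks for a nonempty \<open>X\<close>; if
   \<open>X\<close> is empty, so are \<open>Y\<close> and \<open>K\<close>.\<close>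
 proof (cases "X = {}")
  case True
  thus ?thesis using K assms(6) by (intro exI[of _ "{}"]) auto
 next
  case False
  note coer = coercive_on_compacts[OF assms(1-4) False assms(7)]
  show ?thesis by (rule kernel_approximation[OF assms(4-6) _ _ K]) (erule coer, erule (2) hull)
 qed
 have approxY: "\<exists>F. smooth_on X F & (\<forall>x\<in>X. diff_op P F x = 0) & sn K r (%x. F x - v x) < \<epsilon>"
  if "compact K" "K <= Y" "smooth_on Y v" "!!x. x \<in> Y ==> diff_op P v x = 0" "\<epsilon> > 0" for K v r and \<epsilon> :: real
  using approx[OF that(1,2)] that(3-5) assms(5) by blast
 show ?thesis
  using P_convex_subset[OF assms(4-6) hullY] smooth_dense_range[OF assms(4-6) approxY] dist_dense_range[OF assms(4-6) approx] by blast
qed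

end
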